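(* Let $k,d,q\ge1$ be integers, $0<R\le\infty$, and let $S_0,\dots,S_k\in\mathbb{C}[X_0,\dots,X_k]$ be homogeneous polynomials of degree $d$ with $$\det\left(\frac{\partial S_{\mu}}{\partial X_i}\right)_{0\leq \mu, i\leq k}\not\equiv 0 .$$ Let $\Lambda$ be the meromorphic partial projective connection on $\mathbb{P}^k$ induced by $S_0,\dots,S_k$ (see context). For each $j=1,\dots,q$, let $\sigma_j$ be an element of the linear system $|\{S_0,\dots,S_k\}|$ such that the divisor $(\sigma_j)$ is smooth and $\sum_{1\leq j\leq q}(\sigma_j)$ is a simple normal crossing divisor. Let $f=[f_0:f_1:\cdots:f_k]:\mathbb{D}_R\to\mathbb{P}^k$ be a non-constant holomorphic map with growth index $c_f<\infty$ such that its image is neither contained in the support of an element of the linear system $|\{S_0,\dots,S_k\}|$ nor contained in the polar locus of $\Lambda$. Then $$\left(q-\frac{k+1}{d}-\frac{1}{2d}(k-1)k(k+1)(d-1)\right)T_f(r, dH) \leq \sum_{1\leq j\leq q}N_k(r, f^*(\sigma_j))+S_f(r),$$ where $H$ is the hyperplane bundle on $\mathbb{P}^k$ and, for any $\epsilon>0$, $$S_f(r)=O(\log^+T_f(r) +\log^+r)+\frac{k^2(k+1)^2}{2}(1+\epsilon)(c_f+\epsilon)T_f(r)\ \ \|.$$ Here $\|$ means that the inequality (with this bound for $S_f(r)$) holds for all $r\in(0,R)$ outside a set $E\subset(0,R)$ with $\int_E\exp((c_f+\epsilon)T_f(r))\,dr<\infty$.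
   Context: $\mathbb{D}_R=\{z\in\mathbb{C}:|z|<R\}$, $\mathbb{D}_\infty=\mathbb{C}$. Characteristic functions: $T_f(r)=T_f(r,H)=\int_0^r\frac{dt}{t}\int_{|z|\le t}f^*\omega_{FS}$, where $\omega_{FS}$ is the Fubini–Study form, normalized so that $T_f(r)=\frac1{2\pi}\int_0^{2\pi}\log\|\tilde f(re^{i\theta})\|\,d\theta+O(1)$ for a reduced representation $\tilde f=(f_0,\dots,f_k)$ (holomorphic functions without common zeros) with $\|\tilde f\|=\max_i|f_i|$. For a line bundle $F$ with Chern form $c_1(F)$, $T_f(r,F)=\int_0^r\frac{dt}{t}\int_{|z|\le t}f^*c_1(F)$; $dH=H^{\otimes d}$, so $T_f(r,dH)=d\,T_f(r)+O(1)$. Growth index: $c_f:=\inf\{c>0\mid\int_0^R\exp(cT_f(r))\,dr=\infty\}$ (with $\inf\emptyset=\infty$). Truncated counting function: for an effective divisor $D$ on $\mathbb{P}^k$ with $f(\mathbb{D}_R)\not\subset\mathrm{supp}\,D$, let $n_k(t,f^*D)=\sum_{|z|<t}\min\{k,\mathrm{ord}_zf^*D\}$, $n_k(0,f^*D)=\lim_{t\to0}n_k(t,f^*D)$, and $$N_k(r,f^*D)=\int_0^r\frac{n_k(t,f^*D)-n_k(0,f^*D)}{t}\,dt+n_k(0,f^*D)\log r .$$ $f^*(\sigma_j)$ denotes the pullback of the divisor $(\sigma_j)$. Linear system $|\{S_0,\dots,S_k\}|$: its elements are the nonzero linear combinations $\alpha_0S_0+\dots+\alpha_kS_k$, $(\alpha_0,\dots,\alpha_k)\in\mathbb{C}^{k+1}\setminus\{0\}$,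 each with its divisor in $\mathbb{P}^k$; the support is the zero set. Meromorphic partial projective connection: relative to an affine open covering $\{U_j\}$ of a complex projective manifold $X$, it is a collection $\Lambda=\{(\Lambda_j,U_j)\}$ of meromorphic connections $\Lambda_j$ (on the tangent bundle over $U_j$) with $\Lambda_j-\Lambda_l=\alpha_{jl}\otimes \mathrm{Id}_{TX}+\mathrm{Id}_{TX}\otimes\beta_{jl}$ on $U_j\cap U_l$ for some meromorphic one-forms $\alpha_{jl},\beta_{jl}$ on $U_j\cap U_l$. Let $S_j'$ be the smallest subvariety of $X$ such that $\Lambda_j$ is holomorphic on $U_j\setminus S_j'$; the polar locus of $\Lambda$ is $\mathrm{supp}(\Lambda)_\infty:=\bigcup_j S_j'$. Connection induced by $S_0,\dots,S_k$: let $\widetilde\Lambda=d+\widetilde\Gamma$ be the meromorphic connection on $\mathbb{C}^{k+1}$ whose Christoffel symbols $\widetilde\Gamma^{\lambda}_{i,j}$ are the rational functions determined by $$\sum_{0\leq\lambda\leq k}\frac{\partial S_{\mu}}{\partial X_{\lambda}}\widetilde{\Gamma}_{i,j}^{\lambda}=\frac{\partial^2S_{\mu}}{\partial X_i\partial X_j}\qquad(0\le \mu,i,j\le k).$$ It induces a meromorphic partial projective connection $\Lambda=\{(\Lambda_j,U_j)\}_{0\le j\le k}$ on $\mathbb{P}^k$ with $U_j=\{X_j\ne 0\}$: identifying $U_j$ with the affine hyperplane $\{X_j=1\}\subset\mathbb{C}^{k+1}$ with coordinates $z_i$ $(i\neq j)$ and $z_j=1$, $\Lambda_j=d+\Gamma_j$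 is the projection of $\widetilde\Lambda|_{\{X_j=1\}}$ by the differential of $\mathbb{C}^{k+1}\setminus\{0\}\to\mathbb{P}^k$, that is, $(\Gamma_j)^{\lambda}_{a,b}(z)=\widetilde\Gamma^{\lambda}_{a,b}(z)-z_\lambda\widetilde\Gamma^{j}_{a,b}(z)$ for $a,b,\lambda\ne j$. *)

theory Defs
  imports
    "HOL-Complex_Analysis.Complex_Analysis"
    "HOL-Library.Poly_Mapping"
    "HOL-Computational_Algebra.Squarefree"
begin

section \<open>Polynomials in the homogeneous coordinates\<close>

text \<open>The finite index type \<open>'n\<close> enumerates the homogeneous coordinates \<open>X_0, ..., X_k\<close>, so the
  ambient projective space has dimension \<open>k = CARD('n) - 1\<close>. A polynomial is a finitely supported
  map from exponent vectors to coefficients; its ring structure is the one of the library.\<close>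

type_synonym 'n cpoly = "('n \<Rightarrow>\<^sub>0 nat) \<Rightarrow>\<^sub>0 complex"

definition eval_poly :: "'n::finite cpoly \<Rightarrow> complex ^ 'n \<Rightarrow> complex" where
  "eval_poly p x =
     (\<Sum>m\<in>Poly_Mapping.keys p. Poly_Mapping.lookup p m * (\<Prod>i\<in>UNIV. (x $ i) ^ Poly_Mapping.lookup m i))"

definition const_poly :: "complex \<Rightarrow> 'n cpoly" where
  "const_poly c = Poly_Mapping.single 0 c"

definition homogeneous :: "nat \<Rightarrow> 'n::finite cpoly \<Rightarrow> bool" where
  "homogeneous d p \<longleftrightarrow> (\<forall>m\<in>Poly_Mapping.keys p. (\<Sum>i\<in>UNIV. Poly_Mapping.lookup m i) = d)"

text \<open>The truncated subtraction of exponents is harmless: if \<open>X_i\<close> does not occur in the monomial,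
  then the coefficient of the corresponding summand is zero.\<close>

definition pdiff :: "'n \<Rightarrow> 'n cpoly \<Rightarrow> 'n cpoly" where
  "pdiff i p = (\<Sum>m\<in>Poly_Mapping.keys p.
     Poly_Mapping.single (m - Poly_Mapping.single i 1)
       (of_nat (Poly_Mapping.lookup m i) * Poly_Mapping.lookup p m))"

definition gradient :: "'n::finite cpoly \<Rightarrow> complex ^ 'n \<Rightarrow> complex ^ 'n" where
  "gradient p x = (\<chi> i. eval_poly (pdiff i p) x)"

definition jacobian_det :: "('n::finite \<Rightarrow> 'n cpoly) \<Rightarrow> 'n cpoly" where
  "jacobian_det S = det (\<chi> \<mu> i. pdiff i (S \<mu>))"


section \<open>Projective space, algebraic subsets, divisors\<close>

text \<open>A point of projective space is a punctured complex line \<open>[x] = {c x | c \<noteq> 0}\<close>, \<open>x \<noteq> 0\<close>.\<close>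

type_synonym 'n ppoint = "(complex ^ 'n) set"

definition proj :: "complex ^ 'n \<Rightarrow> 'n ppoint" where
  "proj x = {c *s x | c. c \<noteq> 0}"

definition proj_zeros :: "'n::finite cpoly set \<Rightarrow> 'n ppoint set" where
  "proj_zeros P = {proj x | x. x \<noteq> 0 \<and> (\<forall>p\<in>P. eval_poly p x = 0)}"

definition proj_subvariety :: "'n::finite ppoint set \<Rightarrow> bool" where
  "proj_subvariety V \<longleftrightarrow> (\<exists>P. (\<forall>p\<in>P. \<exists>e. homogeneous e p) \<and> V = proj_zeros P)"

text \<open>An effective divisor on projective space is given by a nonzero homogeneous polynomial, and
  a sum of divisors by the product of the polynomials.\<close>

definition div_support :: "'n::finite cpoly \<Rightarrow> 'n ppoint set" where
  "div_support \<sigma> = proj_zeros {\<sigma>}"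

definition linear_system :: "('n::finite \<Rightarrow> 'n cpoly) \<Rightarrow> 'n cpoly set" where
  "linear_system S = {\<Sum>\<mu>\<in>UNIV. const_poly (\<alpha> $ \<mu>) * S \<mu> | \<alpha>. \<alpha> \<noteq> 0}"

definition smooth_divisor :: "'n::finite cpoly \<Rightarrow> bool" where
  "smooth_divisor \<sigma> \<longleftrightarrow> (\<forall>x. x \<noteq> 0 \<and> eval_poly \<sigma> x = 0 \<longrightarrow> gradient \<sigma> x \<noteq> 0)"

text \<open>Simple normal crossings: the divisor is reduced, and the irreducible components passing
  through a common point are smooth there and meet transversally, i.e. the differentials of their
  local equations are linearly independent. The components are the irreducible factors of the
  defining polynomial up to associates. By Euler's formula the gradient of \<open>g\<close> at a zero \<open>x\<close>
  annihilates \<open>x\<close>, hence lives on the tangent space of projective space at \<open>[x]\<close>, where it is the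
  differential of a local equation of the component.\<close>

definition snc_divisor :: "'n::finite cpoly \<Rightarrow> bool" where
  "snc_divisor \<sigma> \<longleftrightarrow> squarefree \<sigma> \<and>
     (\<forall>x G. x \<noteq> 0 \<and> finite G \<and>
            (\<forall>g\<in>G. irreducible g \<and> g dvd \<sigma> \<and> eval_poly g x = 0) \<and>
            pairwise (\<lambda>g h. \<not> g dvd h) G \<longrightarrow>
        (\<forall>c. (\<Sum>g\<in>G. c g *s gradient g x) = 0 \<longrightarrow> (\<forall>g\<in>G. c g = 0)))"


section \<open>The induced partial projective connection and its polar locus\<close>

text \<open>Vector of the Christoffel symbols \<open>\<Gamma>~^l_{a,b}(x)\<close>, indexed by \<open>l\<close>. The linear system has exactly
  one solution where the Jacobian determinant does not vanish, and only these points are used.\<close>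

definition christoffel ::
  "('n::finite \<Rightarrow> 'n cpoly) \<Rightarrow> 'n \<Rightarrow> 'n \<Rightarrow> complex ^ 'n \<Rightarrow> complex ^ 'n" where
  "christoffel S a b x = (THE \<gamma>. \<forall>\<mu>.
     (\<Sum>l\<in>UNIV. eval_poly (pdiff l (S \<mu>)) x * \<gamma> $ l) = eval_poly (pdiff a (pdiff b (S \<mu>))) x)"

text \<open>The coordinate chart \<open>U_j\<close> is identified with the affine hyperplane \<open>z_j = 1\<close>.\<close>

definition chart :: "'n \<Rightarrow> (complex ^ 'n) set" where
  "chart j = {z. z $ j = 1}"

text \<open>\<open>induced_connection S j a b l z\<close> is \<open>(\<Gamma>_j)^l_{a,b}(z)\<close>, meaningful for \<open>z\<close> in \<open>chart j\<close> outside
  the zeros of the Jacobian determinant and for \<open>a, b, l\<close> different from \<open>j\<close>.\<close>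

definition induced_connection ::
  "('n::finite \<Rightarrow> 'n cpoly) \<Rightarrow> 'n \<Rightarrow> 'n \<Rightarrow> 'n \<Rightarrow> 'n \<Rightarrow> complex ^ 'n \<Rightarrow> complex" where
  "induced_connection S j a b l z = christoffel S a b z $ l - z $ l * christoffel S a b z $ j"

text \<open>Holomorphy in several variables on a relatively open subset \<open>W\<close> of \<open>chart j\<close>: existence of
  complex linear derivatives. Only the restriction of \<open>L\<close> to the directions of the chart matters.\<close>

definition chart_holomorphic_on ::
  "'n::finite \<Rightarrow> (complex ^ 'n \<Rightarrow> complex) \<Rightarrow> (complex ^ 'n) set \<Rightarrow> bool" where
  "chart_holomorphic_on j h W \<longleftrightarrow>
     (\<forall>z\<in>W. \<exists>L. (h has_derivative L) (at z within chart j) \<and> (\<forall>c v. L (c *s v) = c * L v))"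

text \<open>A meromorphic connection \<open>d + \<Gamma>\<close> on \<open>chart j\<close> is given by its Christoffel symbols
  \<open>\<Gamma> a b l\<close> with \<open>a, b, l \<noteq> j\<close>, specified outside a nowhere dense analytic set \<open>Z\<close>. It is
  holomorphic on \<open>W\<close> if all its Christoffel symbols extend holomorphically to \<open>W\<close>.\<close>

definition connection_holomorphic_on ::
  "(complex ^ 'n::finite) set \<Rightarrow> 'n \<Rightarrow> ('n \<Rightarrow> 'n \<Rightarrow> 'n \<Rightarrow> complex ^ 'n \<Rightarrow> complex) \<Rightarrow>
   (complex ^ 'n) set \<Rightarrow> bool" where
  "connection_holomorphic_on Z j \<Gamma> W \<longleftrightarrow>
     (\<forall>a b l. a \<noteq> j \<and> b \<noteq> j \<and> l \<noteq> j \<longrightarrow>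
        (\<exists>h. chart_holomorphic_on j h W \<and> (\<forall>z\<in>W - Z. h z = \<Gamma> a b l z)))"

text \<open>The smallest subvariety of projective space outside which the connection is holomorphic; the
  property of \<open>V\<close> below is stable under intersections.\<close>

definition chart_polar_locus ::
  "(complex ^ 'n::finite) set \<Rightarrow> 'n \<Rightarrow> ('n \<Rightarrow> 'n \<Rightarrow> 'n \<Rightarrow> complex ^ 'n \<Rightarrow> complex) \<Rightarrow>
   'n ppoint set" where
  "chart_polar_locus Z j \<Gamma> = \<Inter>{V. proj_subvariety V \<and>
     connection_holomorphic_on Z j \<Gamma> {z \<in> chart j. proj z \<notin> V}}"

definition polar_locus :: "('n::finite \<Rightarrow> 'n cpoly) \<Rightarrow> 'n ppoint set" where
  "polar_locus S =
     (\<Union>j. chart_polar_locus {x. eval_poly (jacobian_det S) x = 0} j (induced_connection S j))"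


section \<open>Value distribution of holomorphic curves\<close>

definition disc :: "ereal \<Rightarrow> complex set" where
  "disc R = {z. ereal (cmod z) < R}"

text \<open>Every holomorphic map from a disc to projective space is \<open>proj \<circ> f\<close> for such an \<open>f\<close>.\<close>

definition reduced_representation :: "ereal \<Rightarrow> (complex \<Rightarrow> complex ^ 'n::finite) \<Rightarrow> bool" where
  "reduced_representation R f \<longleftrightarrow>
     (\<forall>i. (\<lambda>z. f z $ i) holomorphic_on disc R) \<and> (\<forall>z\<in>disc R. f z \<noteq> 0)"

text \<open>Density with respect to Lebesgue measure of the pullback of the Fubini--Study form
  \<open>(i / 2\<pi>) \<partial> \<partial>_bar log \<parallel>f\<parallel>\<^sup>2\<close>, with \<open>\<parallel>f\<parallel>\<close> the Euclidean norm. It equals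
  \<open>(\<parallel>f\<parallel>\<^sup>2 \<parallel>f'\<parallel>\<^sup>2 - |\<langle>f', f\<rangle>|\<^sup>2) / (\<pi> \<parallel>f\<parallel>\<^sup>4)\<close> and does not depend on the representation. The
  form has mass 1 on a projective line, i.e. it represents the Chern class of the hyperplane
  bundle.\<close>

definition fs_density :: "(complex \<Rightarrow> complex ^ 'n::finite) \<Rightarrow> complex \<Rightarrow> real" where
  "fs_density f z =
     (let f' = (\<chi> i. deriv (\<lambda>w. f w $ i) z) in
      ((norm (f z))\<^sup>2 * (norm f')\<^sup>2 - (cmod (\<Sum>i\<in>UNIV. f' $ i * cnj (f z $ i)))\<^sup>2)
        / (pi * (norm (f z)) ^ 4))"

text \<open>Characteristic function with respect to the \<open>d\<close>-th power of the hyperplane bundle, whose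
  Chern form for the induced metric is \<open>d\<close> times the Fubini--Study form.\<close>

definition char_fun_power :: "(complex \<Rightarrow> complex ^ 'n::finite) \<Rightarrow> nat \<Rightarrow> real \<Rightarrow> real" where
  "char_fun_power f d r =
     (LBINT t:{0<..<r}. (LBINT z:cball 0 t. real d * fs_density f z) / t)"

definition char_fun :: "(complex \<Rightarrow> complex ^ 'n::finite) \<Rightarrow> real \<Rightarrow> real" where
  "char_fun f r = char_fun_power f 1 r"

definition growth_index :: "ereal \<Rightarrow> (complex \<Rightarrow> complex ^ 'n::finite) \<Rightarrow> ereal" where
  "growth_index R f = Inf {ereal c | c. c > 0 \<and>
     (\<integral>\<^sup>+ r \<in> {r. 0 < r \<and> ereal r < R}. ennreal (exp (c * char_fun f r)) \<partial>lborel) = \<infinity>}"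

text \<open>Pullback of the divisor of \<open>\<sigma>\<close>: the order at \<open>z\<close> is the vanishing order of \<open>\<sigma> \<circ> f\<close>. The
  sum runs over the zeros only, a finite set when \<open>\<sigma> \<circ> f\<close> is not identically zero and the closed
  disc of radius \<open>t\<close> lies in the domain.\<close>

definition trunc_count ::
  "nat \<Rightarrow> (complex \<Rightarrow> complex ^ 'n::finite) \<Rightarrow> 'n cpoly \<Rightarrow> real \<Rightarrow> nat" where
  "trunc_count k f \<sigma> t =
     (\<Sum>z\<in>{z. cmod z < t \<and> eval_poly \<sigma> (f z) = 0}. min k (nat (zorder (\<lambda>w. eval_poly \<sigma> (f w)) z)))"

definition trunc_count_0 ::
  "nat \<Rightarrow> (complex \<Rightarrow> complex ^ 'n::finite) \<Rightarrow> 'n cpoly \<Rightarrow> real" where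
  "trunc_count_0 k f \<sigma> = Lim (at_right 0) (\<lambda>t. real (trunc_count k f \<sigma> t))"

definition trunc_counting_fun ::
  "nat \<Rightarrow> (complex \<Rightarrow> complex ^ 'n::finite) \<Rightarrow> 'n cpoly \<Rightarrow> real \<Rightarrow> real" where
  "trunc_counting_fun k f \<sigma> r =
     (LBINT t:{0<..<r}. (real (trunc_count k f \<sigma> t) - trunc_count_0 k f \<sigma>) / t)
       + trunc_count_0 k f \<sigma> * ln r"

definition log_plus :: "real \<Rightarrow> real" where
  "log_plus x = max 0 (ln x)"

end

theory Submission
  imports Defs "Jordan_Normal_Form.Determinant" "HOL-Computational_Algebra.Fundamental_Theorem_Algebra"
begin

text \<open>
  The statement is an instance of Cartan's second main theorem. Write \<open>n = k + 1\<close> for the number of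
  coordinates. The functions \<open>S_\<mu> \<circ> f\<close> are linearly independent, since no divisor of the linear
  system contains the image of \<open>f\<close>; they are bounded by a constant times \<open>\<parallel>f\<parallel>^d\<close>; and each
  \<open>\<sigma>_j \<circ> f\<close> is a linear form in them. Cartan's theorem asks that, at each point, the linear
  forms which are small compared with \<open>\<parallel>f\<parallel>^d\<close> be linearly independent. By compactness of the unit
  sphere, sections \<open>\<sigma>_j\<close> that are all sufficiently small at one point have a common zero
  (\<open>common_zero_of_small_values\<close>). Smoothness and normal crossings make their gradients at this
  common zero independent (\<open>snc_gradients_independent\<close>), and a linear relation between the
  coefficient vectors would be inherited by the gradients. So
  \<open>(q - (k + 1)) d T_f(r) \<le> \<Sum> N_k(r, f^* \<sigma>_j) + error\<close>.

  For \<open>k \<ge> 2\<close> or \<open>d = 1\<close> the coefficient \<open>q - (k + 1)\<close> is at least the one that is claimed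
  (\<open>coefficient_le\<close>). For \<open>k = 1\<close> and \<open>d \<ge> 2\<close> the claim is
  \<open>(q d - 2) T_f(r) \<le> \<Sum> N_1 + error\<close>, which is stronger. Here each
  \<open>\<sigma>_j\<close> is a binary form and splits into \<open>d\<close> linear forms. Smoothness separates the factors of
  one \<open>\<sigma>_j\<close>, normal crossings those of different ones, and Cartan's theorem for \<open>f\<close> itself and these \<open>q d\<close> points of the projective line gives the claim.

  Cartan's theorem (\<open>cartan_inequality\<close>) compares the functions with their Wronskian \<open>W\<close>. Where some
  of the forms vanish to high order, \<open>W\<close> vanishes to the sum of these orders, each lowered by at most
  \<open>n - 1\<close>; this is the origin of the truncation (\<open>vanishing_order_inequality\<close>). For the size of \<open>W\<close>
  the lemma on logarithmic derivatives is replaced by a pointwise argument. With the pole sum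
  \<open>Q(z) = X + \<Sum> m_a / |z - a|\<close> over the zeros of all functions involved, the Poisson--Jensen formula
  shows that a quotient of two of them grows by at most a fixed factor on the disc of radius
  \<open>1 / (2 Q(z))\<close> about \<open>z\<close>. Cauchy's estimate then bounds \<open>l\<close>-th derivatives by \<open>Q(z)^l\<close>, so \<open>W\<close>
  costs \<open>n (n - 1) / 2\<close> factors \<open>Q\<close>. Since the circle means of \<open>1 / \<surd>|z - a|\<close> are bounded uniformly in \<open>a\<close>,
  concavity of the logarithm bounds the circle mean of \<open>ln Q\<close> by \<open>2 ln (1 / (\<rho> - r))\<close> up to
  logarithms of \<open>T_f(\<rho>)\<close> and \<open>\<rho>\<close>, for any larger radius \<open>\<rho>\<close>.

  A growth lemma of Borel type chooses \<open>\<rho>\<close> with \<open>T_f(\<rho>) \<le> T_f(r) + 1\<close> and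
  \<open>ln (1 / (\<rho> - r)) \<le> c T_f(r) + O(ln T_f(r))\<close> for \<open>r\<close> outside a set on which \<open>exp (c T_f)\<close> is
  integrable. With \<open>c = c_f + \<epsilon>\<close> the total error is \<open>k (k + 1) (c_f + \<epsilon>) T_f(r)\<close> plus logarithms,
  and \<open>k (k + 1) \<le> k^2 (k + 1)^2 / 2\<close>. The argument needs \<open>T_f\<close> to be unbounded, which follows from
  \<open>c_f < \<infinity>\<close> on a finite disc and from Jensen's formula on the plane.
\<close>

(* The dollar sign is kept for the components of vectors in complex ^ 'n. *)
no_notation Matrix.vec_index (infixl "$" 100)
no_notation fps_nth (infixl "$" 75)

section \<open>Means over circles and the Poisson formula\<close>

definition circle_mean :: "real \<Rightarrow> (complex \<Rightarrow> real) \<Rightarrow> real" where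
  "circle_mean r u = integral {0..2*pi} (\<lambda>\<theta>. u (of_real r * cis \<theta>)) / (2*pi)"

lemma continuous_on_circle_param:
  fixes u :: "complex \<Rightarrow> 'a::real_normed_vector"
  assumes "continuous_on (sphere 0 r) u" "0 \<le> r"
  shows "continuous_on A (\<lambda>\<theta>. u (of_real r * cis \<theta>))"
  by (rule continuous_on_compose2[OF assms(1)])
     (use assms(2) in \<open>auto intro!: continuous_intros simp: norm_mult\<close>)

lemma circle_mean_integrable:
  fixes u :: "complex \<Rightarrow> real"
  assumes "continuous_on (sphere 0 r) u" "0 \<le> r"
  shows "(\<lambda>\<theta>. u (of_real r * cis \<theta>)) integrable_on {0..2*pi}"
  by (intro integrable_continuous_interval continuous_on_circle_param assms)

lemma circle_mean_const [simp]: "circle_mean r (\<lambda>_. c) = c"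
  by (simp add: circle_mean_def)

lemma circle_mean_add:
  assumes "continuous_on (sphere 0 r) u" "continuous_on (sphere 0 r) v" "0 \<le> r"
  shows "circle_mean r (\<lambda>z. u z + v z) = circle_mean r u + circle_mean r v"
  using circle_mean_integrable[OF assms(1,3)] circle_mean_integrable[OF assms(2,3)]
  by (simp add: circle_mean_def Henstock_Kurzweil_Integration.integral_add add_divide_distrib)

lemma circle_mean_diff:
  assumes "continuous_on (sphere 0 r) u" "continuous_on (sphere 0 r) v" "0 \<le> r"
  shows "circle_mean r (\<lambda>z. u z - v z) = circle_mean r u - circle_mean r v"
  using circle_mean_integrable[OF assms(1,3)] circle_mean_integrable[OF assms(2,3)]
  by (simp add: circle_mean_def Henstock_Kurzweil_Integration.integral_diff diff_divide_distrib)

lemma circle_mean_cmult: "circle_mean r (\<lambda>z. c * u z) = c * circle_mean r u"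
  by (simp add: circle_mean_def)

lemma circle_mean_sum:
  assumes "finite I" "\<And>i. i \<in> I \<Longrightarrow> continuous_on (sphere 0 r) (u i)" "0 \<le> r"
  shows "circle_mean r (\<lambda>z. \<Sum>i\<in>I. u i z) = (\<Sum>i\<in>I. circle_mean r (u i))"
  using assms by (simp add: circle_mean_def circle_mean_integrable integral_sum sum_divide_distrib)

lemma circle_mean_mono:
  assumes "continuous_on (sphere 0 r) u" "continuous_on (sphere 0 r) v" "0 \<le> r"
    and "\<And>z. cmod z = r \<Longrightarrow> u z \<le> v z"
  shows "circle_mean r u \<le> circle_mean r v"
  unfolding circle_mean_def
  by (intro divide_right_mono integral_le circle_mean_integrable assms)
     (use assms(3) in \<open>auto simp: norm_mult intro!: assms(4)\<close>)

lemma circle_mean_cong: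
  assumes "\<And>z. cmod z = r \<Longrightarrow> u z = v z" "0 \<le> r"
  shows "circle_mean r u = circle_mean r v"
  unfolding circle_mean_def
  by (intro arg_cong2[where f="(/)"] Henstock_Kurzweil_Integration.integral_cong refl)
     (use assms in \<open>auto simp: norm_mult\<close>)

text \<open>
  Jensen's inequality, from the tangent of the logarithm at the mean value.
\<close>

lemma circle_mean_ln_le:
  assumes "continuous_on (sphere 0 r) u" "0 \<le> r" and pos: "\<And>z. cmod z = r \<Longrightarrow> 0 < u z"
  shows "0 < circle_mean r u" "circle_mean r (\<lambda>z. ln (u z)) \<le> ln (circle_mean r u)"
proof -
  have "compact (sphere (0::complex) r)" "sphere (0::complex) r \<noteq> {}" using assms(2) by auto
  then obtain z0 where z0: "z0 \<in> sphere 0 r" "\<And>z. z \<in> sphere 0 r \<Longrightarrow> u z0 \<le> u z"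
    using continuous_attains_inf assms(1) by metis
  have "0 < u z0" using z0 pos by auto
  also have "u z0 = circle_mean r (\<lambda>_. u z0)" by simp
  also have "\<dots> \<le> circle_mean r u"
    by (rule circle_mean_mono) (use assms z0 in auto)
  finally show p: "0 < circle_mean r u" .
  define L where "L = circle_mean r u"
  have cl: "continuous_on (sphere 0 r) (\<lambda>z. ln (u z))"
    by (intro continuous_intros assms) (use pos in force)
  have L: "0 < L" using p by (simp add: L_def)
  have "circle_mean r (\<lambda>z. ln (u z)) \<le> circle_mean r (\<lambda>z. (1/L) * u z + (ln L - 1))"
  proof (rule circle_mean_mono[OF cl])
    fix z :: complex assume "cmod z = r"
    then have "0 < u z" by (rule pos)
    then have "ln (u z / L) \<le> u z / L - 1" using p by (intro ln_le_minus_one) (simp add: L_def)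
    then show "ln (u z) \<le> (1/L) * u z + (ln L - 1)"
      using p \<open>0 < u z\<close> by (simp add: ln_div L_def)
  qed (use assms L in \<open>auto intro!: continuous_intros\<close>)
  also have "\<dots> = (1/L) * L + (ln L - 1)"
    by (subst circle_mean_add) (use assms L in \<open>auto intro!: continuous_intros simp only: circle_mean_cmult circle_mean_const L_def\<close>)
  also have "\<dots> = ln L" using p by (simp add: L_def)
  finally show "circle_mean r (\<lambda>z. ln (u z)) \<le> ln (circle_mean r u)" by (simp add: L_def)
qed

lemma cauchy_circle:
  fixes H :: "complex \<Rightarrow> complex"
  assumes "continuous_on (cball 0 \<rho>) H" "H holomorphic_on ball 0 \<rho>" "cmod w < \<rho>"
  shows "((\<lambda>\<theta>. H (of_real \<rho> * cis \<theta>) * (of_real \<rho> * cis \<theta> / (of_real \<rho> * cis \<theta> - w)))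
           has_integral (2 * pi * H w)) {0..2*pi}"
proof -
  have "((\<lambda>u. H u/(u-w)) has_contour_integral (2 * of_real pi * \<i> * H w)) (circlepath 0 \<rho>)"
    by (rule Cauchy_integral_circlepath) (use assms in auto)
  then have "((\<lambda>t. H (0 + \<rho> * cis t) / (0 + \<rho> * cis t - w) * \<rho> * \<i> * cis t)
      has_integral (2 * of_real pi * \<i> * H w)) {0..2*pi}"
    unfolding circlepath_def by (subst (asm) has_contour_integral_part_circlepath_iff) auto
  from has_integral_mult_right[OF this, of "-\<i>"] show ?thesis
    by (rule has_integral_eq_rhs[OF has_integral_eq, rotated]) (auto simp: field_simps)
qed

text \<open>
  The kernel \<open>Re ((\<zeta> + w) / (\<zeta> - w))\<close> is the Cauchy kernel \<open>\<zeta> / (\<zeta> - w)\<close> plus the conjugate of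
  \<open>w / (\<zeta> - w)\<close>. On the circle this conjugate equals \<open>cnj w \<zeta> / (\<rho>\<^sup>2 - cnj w \<zeta>)\<close>, which is
  holomorphic in \<open>\<zeta>\<close> on the disc and vanishes at \<open>0\<close>, so it does not contribute.
\<close>

lemma poisson_formula:
  assumes H: "continuous_on (cball 0 \<rho>) H" "H holomorphic_on ball 0 \<rho>" and w: "cmod w < \<rho>"
  shows "circle_mean \<rho> (\<lambda>\<zeta>. Re (H \<zeta>) * Re ((\<zeta> + w) / (\<zeta> - w))) = Re (H w)"
proof -
  have \<rho>: "0 < \<rho>" using w norm_ge_zero[of w] by linarith
  have nz: "of_real (\<rho>\<^sup>2) - cnj w * \<zeta> \<noteq> 0" if "cmod \<zeta> \<le> \<rho>" for \<zeta>
  proof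
    assume "of_real (\<rho>\<^sup>2) - cnj w * \<zeta> = 0"
    then have "cmod (cnj w * \<zeta>) = cmod (of_real (\<rho>\<^sup>2))" by auto
    then have "cmod w * cmod \<zeta> = \<rho>\<^sup>2" by (simp only: norm_mult norm_of_real) simp
    moreover have "cmod w * cmod \<zeta> \<le> cmod w * \<rho>" using that by (simp add: mult_left_mono)
    moreover have "cmod w * \<rho> < \<rho> * \<rho>" using w \<rho> by simp
    ultimately show False by (simp add: power2_eq_square)
  qed
  define G where "G \<zeta> = H \<zeta> * (cnj w * \<zeta> / (of_real (\<rho>\<^sup>2) - cnj w * \<zeta>))" for \<zeta>
  have "continuous_on (cball 0 \<rho>) G" "G holomorphic_on ball 0 \<rho>" unfolding G_def
    using nz by (auto intro!: continuous_intros holomorphic_intros H)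
  from cauchy_circle[OF this, of 0] \<rho>
  have "((\<lambda>\<theta>. G (of_real \<rho> * cis \<theta>)) has_integral 0) {0..2*pi}"
    by (simp add: G_def)
  from has_integral_add[OF cauchy_circle[OF H w] this]
  have "((\<lambda>\<theta>. H (of_real \<rho> * cis \<theta>) * (of_real \<rho> * cis \<theta> / (of_real \<rho> * cis \<theta> - w)) + G (of_real \<rho> * cis \<theta>))
           has_integral (2 * pi * H w)) {0..2*pi}" by simp
  also have "?this \<longleftrightarrow> ((\<lambda>\<theta>. H (of_real \<rho> * cis \<theta>) * of_real (Re ((of_real \<rho> * cis \<theta> + w) / (of_real \<rho> * cis \<theta> - w))))
           has_integral (2 * pi * H w)) {0..2*pi}"
  proof (rule has_integral_cong)
    fix \<theta> :: real
    define \<zeta> where "\<zeta> = of_real \<rho> * cis \<theta>"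
    have n: "cmod \<zeta> = \<rho>" using \<rho> by (simp add: \<zeta>_def norm_mult)
    have ne: "\<zeta> \<noteq> w" using n w by auto
    have zz: "of_real (\<rho>\<^sup>2) = \<zeta> * cnj \<zeta>" by (simp only: complex_norm_square[symmetric] n)
    have z0: "\<zeta> \<noteq> 0" using n \<rho> by auto
    have "cnj w * \<zeta> / (of_real (\<rho>\<^sup>2) - cnj w * \<zeta>) = cnj (w / (\<zeta> - w))"
    proof -
      have "of_real (\<rho>\<^sup>2) - cnj w * \<zeta> = \<zeta> * cnj (\<zeta> - w)" by (simp only: zz) (simp add: algebra_simps)
      then show ?thesis using z0 by simp
    qed
    moreover have "\<zeta> / (\<zeta> - w) + cnj (w / (\<zeta> - w)) = of_real (Re ((\<zeta> + w) / (\<zeta> - w)))"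
    proof -
      have "\<zeta> / (\<zeta> - w) = 1 + w / (\<zeta> - w)" using ne by (simp add: field_simps)
      moreover have "(\<zeta> + w) / (\<zeta> - w) = 1 + 2 * (w / (\<zeta> - w))" using ne by (simp add: field_simps)
      moreover have "\<zeta> / (\<zeta> - w) + cnj (w / (\<zeta> - w)) = 1 + (w / (\<zeta> - w) + cnj (w / (\<zeta> - w)))"
        using calculation by simp
      moreover have "Re (1 + 2 * (w / (\<zeta> - w))) = 1 + 2 * Re (w / (\<zeta> - w))"
        by (metis Re_complex_of_real Re_divide_numeral mult_2 one_complex.simps(1) plus_complex.simps(1))
      ultimately show ?thesis by (simp only: complex_add_cnj) simp
    qed
    ultimately show "H (of_real \<rho> * cis \<theta>) * (of_real \<rho> * cis \<theta> / (of_real \<rho> * cis \<theta> - w)) + G (of_real \<rho> * cis \<theta>)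
       = H (of_real \<rho> * cis \<theta>) * of_real (Re ((of_real \<rho> * cis \<theta> + w) / (of_real \<rho> * cis \<theta> - w)))"
      unfolding G_def \<zeta>_def[symmetric] by (metis distrib_left)
  qed
  finally have "((\<lambda>\<theta>. Re (H (of_real \<rho> * cis \<theta>) * of_real (Re ((of_real \<rho> * cis \<theta> + w) / (of_real \<rho> * cis \<theta> - w)))))
           has_integral Re (2 * pi * H w)) {0..2*pi}"
    by (rule has_integral_linear[OF _ bounded_linear_Re, unfolded o_def])
  then have "((\<lambda>\<theta>. Re (H (of_real \<rho> * cis \<theta>)) * Re ((of_real \<rho> * cis \<theta> + w) / (of_real \<rho> * cis \<theta> - w)))
           has_integral (2 * pi * Re (H w))) {0..2*pi}" by simp
  then show ?thesis unfolding circle_mean_def by (simp add: integral_unique)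
qed

text \<open>
  A zero-free function on a disc has a holomorphic logarithm.
\<close>

lemma poisson_ln_norm:
  assumes h: "h holomorphic_on ball 0 R1" "\<And>z. z \<in> ball 0 R1 \<Longrightarrow> h z \<noteq> 0" and "\<rho> < R1" and w: "cmod w < \<rho>"
  shows "circle_mean \<rho> (\<lambda>\<zeta>. ln (cmod (h \<zeta>)) * Re ((\<zeta> + w) / (\<zeta> - w))) = ln (cmod (h w))"
proof -
  obtain H where H: "H holomorphic_on ball 0 R1" "\<And>z. z \<in> ball 0 R1 \<Longrightarrow> h z = exp (H z)"
    using contractible_imp_holomorphic_log[OF h(1) _ h(2)] convex_imp_contractible[OF convex_ball] by metis
  have sub: "cball 0 \<rho> \<subseteq> ball (0::complex) R1" using assms(3) by auto
  have \<rho>: "0 < \<rho>" using w norm_ge_zero[of w] by linarith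
  have ln: "ln (cmod (h z)) = Re (H z)" if "cmod z \<le> \<rho>" for z
    using H(2)[of z] that assms(3) by simp
  have "circle_mean \<rho> (\<lambda>\<zeta>. Re (H \<zeta>) * Re ((\<zeta> + w) / (\<zeta> - w))) = Re (H w)"
    by (rule poisson_formula[OF _ _ w])
       (use holomorphic_on_subset[OF H(1)] sub order_trans[OF ball_subset_cball sub] in \<open>auto intro!: holomorphic_on_imp_continuous_on\<close>)
  moreover have "circle_mean \<rho> (\<lambda>\<zeta>. ln (cmod (h \<zeta>)) * Re ((\<zeta> + w) / (\<zeta> - w))) =
     circle_mean \<rho> (\<lambda>\<zeta>. Re (H \<zeta>) * Re ((\<zeta> + w) / (\<zeta> - w)))"
    by (rule circle_mean_cong) (use ln \<rho> in auto)
  ultimately show ?thesis using ln[of w] w by simp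
qed

lemma integral_periodic_shift:
  fixes h :: "real \<Rightarrow> real"
  assumes c: "continuous_on UNIV h" and per: "\<And>x. h (x + 2*pi) = h x"
  shows "integral {0..2*pi} (\<lambda>x. h (x + a)) = integral {0..2*pi} h"
proof -
  have int: "h integrable_on {x..y}" for x y
    by (intro integrable_continuous_interval continuous_on_subset[OF c]) auto
  have der: "((\<lambda>a. integral {0..2*pi} (\<lambda>x. h (x + a))) has_real_derivative 0) (at a)" for a
  proof -
    define F where "F y = (if y \<ge> 0 then integral {0..y} h else - integral {y..0} h)" for y
    have F: "integral {x..y} h = F y - F x" if "x \<le> y" for x y
    proof -
      consider "0 \<le> x" | "x < 0" "0 \<le> y" | "y < 0" by linarith
      then show ?thesis
      proof cases
        case 1
        then show ?thesis using that Henstock_Kurzweil_Integration.integral_combine[of 0 x y h] int by (simp add: F_def)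
      next
        case 2
        then show ?thesis using that Henstock_Kurzweil_Integration.integral_combine[of x 0 y h] int by (simp add: F_def)
      next
        case 3
        then show ?thesis using that Henstock_Kurzweil_Integration.integral_combine[of x y 0 h] int by (simp add: F_def)
      qed
    qed
    have dF: "(F has_real_derivative h y) (at y)" for y
    proof -
      have "((\<lambda>u. integral {y - 1..u} h) has_real_derivative h y) (at y within {y-1..y+1})"
        by (rule integral_has_real_derivative) (auto intro: continuous_on_subset[OF c])
      then have "((\<lambda>u. integral {y - 1..u} h) has_real_derivative h y) (at y)"
        by (simp add: at_within_Icc_at)
      then have "((\<lambda>u. integral {y - 1..u} h + F (y - 1)) has_real_derivative h y) (at y)"
        by (auto intro!: derivative_eq_intros)
      then show ?thesis
        by (rule has_field_derivative_transform_within[where d=1]) (auto simp: dist_real_def F)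
    qed
    have "integral {0..2*pi} (\<lambda>x. h (x + a)) = F (2*pi + a) - F a" for a
    proof -
      have "integral {0..2*pi} (\<lambda>x. h (x + a)) = integral {a..2*pi + a} h"
        using integral_shift_Icc_real[of 0 "2*pi" h a] by (simp add: o_def add.commute)
      then show ?thesis by (simp add: F)
    qed
    moreover have "((\<lambda>a. F (2*pi + a) - F a) has_real_derivative h (2*pi + a) * 1 - h a) (at a)"
      by (auto intro!: derivative_eq_intros DERIV_chain2[OF dF])
    ultimately show ?thesis using per[of a] by (simp add: add.commute)
  qed
  have "(\<lambda>a. integral {0..2*pi} (\<lambda>x. h (x + a))) a = (\<lambda>a. integral {0..2*pi} (\<lambda>x. h (x + a))) 0"
    using DERIV_isconst_all der by blast
  then show ?thesis by simp
qed

lemma circle_mean_rotate: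
  assumes "continuous_on (sphere 0 r) u" "0 \<le> r" "cmod c = 1"
  shows "circle_mean r (\<lambda>z. u (c * z)) = circle_mean r u"
proof -
  obtain a where a: "c = cis a" using assms(3) by (metis rcis_cmod_Arg rcis_def mult_1 of_real_1)
  have "integral {0..2*pi} (\<lambda>x. u (of_real r * cis (x + a))) = integral {0..2*pi} (\<lambda>x. u (of_real r * cis x))"
    by (rule integral_periodic_shift) (auto intro!: continuous_on_circle_param assms simp: cis_mult[symmetric])
  then show ?thesis by (simp add: circle_mean_def a cis_mult[symmetric] mult_ac)
qed

text \<open>
  The constant is not sharp; it only has to be positive.
\<close>

lemma sin_ge_third:
  assumes "0 \<le> x" "x \<le> pi / 2" shows "x / 3 \<le> sin x"
proof (cases "x = 0")
  case False
  then have "0 < x" using assms by simp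
  have "x < 2" using assms pi_less_4 by linarith
  define g where "g y = sin y - y / 3" for y :: real
  show ?thesis
  proof (cases "x \<le> 1")
    case True
    have "\<exists>z. 0 < z \<and> z < x \<and> g x - g 0 = (x - 0) * (cos z - 1/3)"
      by (rule MVT2) (use \<open>0<x\<close> in \<open>auto simp: g_def intro!: derivative_eq_intros\<close>)
    then obtain z where z: "0 < z" "z < x" "g x = x * (cos z - 1/3)" by (auto simp: g_def)
    have "cos (pi/3) \<le> cos z" by (rule cos_monotone_0_pi_le) (use z True pi_gt3 in auto)
    then show ?thesis using z \<open>0 < x\<close> using mult_nonneg_nonneg[of x "cos z - 1/3"] unfolding cos_60 g_def by linarith
  next
    case False
    have "sin (pi/6) \<le> sin 1" by (rule sin_monotone_2pi_le) (use pi_gt3 pi_less_4 in auto)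
    also have "\<dots> \<le> sin x" by (rule sin_monotone_2pi_le) (use False assms pi_gt3 in auto)
    finally have "1/2 \<le> sin x" by (simp add: sin_30)
    moreover have "sin (pi/4) \<le> sin x" if "pi/4 \<le> x" by (rule sin_monotone_2pi_le) (use that assms in auto)
    moreover have "2/3 \<le> sin (pi/4)" 
    proof -
      have "4/3 \<le> sqrt 2" by (rule real_le_rsqrt) (simp add: power2_eq_square)
      then show ?thesis by (simp add: sin_45)
    qed
    moreover have "x < 2" by fact
    ultimately show ?thesis using pi_less_4 by (cases "pi/4 \<le> x") linarith+
  qed
qed simp

lemma inverse_sqrt_integral:
  fixes b :: real assumes "a \<le> c"
  shows "((\<lambda>\<theta>. 1 / sqrt \<bar>\<theta> - b\<bar>) has_integral (2 * sqrt (c - b) - 2 * sqrt (a - b))) {a..c}"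
proof (rule fundamental_theorem_of_calculus_interior_strong[of "{b}"])
  show "((\<lambda>\<theta>. 2 * sqrt (\<theta> - b)) has_vector_derivative 1 / sqrt \<bar>\<theta> - b\<bar>) (at \<theta>)"
    if "\<theta> \<in> {a<..<c} - {b}" for \<theta>
  proof -
    have ne: "\<theta> - b \<noteq> 0" using that by auto
    have "(sqrt has_real_derivative 1 / (2 * sqrt \<bar>\<theta> - b\<bar>)) (at (\<theta> - b))"
      by (rule DERIV_real_sqrt_generic[OF ne]) (use real_sqrt_minus[of "b - \<theta>"] in \<open>auto simp: abs_if field_simps\<close>)
    have "((\<lambda>\<theta>. sqrt (\<theta> - b)) has_real_derivative 1 / (2 * sqrt \<bar>\<theta> - b\<bar>) * 1) (at \<theta>)"
      by (rule DERIV_chain2[where f=sqrt and g="\<lambda>\<theta>. \<theta> - b"], fact) (auto intro!: derivative_eq_intros)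
    then have "((\<lambda>\<theta>. sqrt (\<theta> - b)) has_real_derivative 1 / (2 * sqrt \<bar>\<theta> - b\<bar>)) (at \<theta>)" by simp
    from DERIV_cmult[OF this, of 2] show ?thesis by (simp add: has_real_derivative_iff_has_vector_derivative)
  qed
qed (use assms in \<open>auto intro!: continuous_intros\<close>)

lemma abs_sin_ge:
  assumes "0 < x" "x < 2*pi" shows "\<exists>b\<in>{0,pi,2*pi}. \<bar>x - b\<bar> / 3 \<le> \<bar>sin x\<bar>"
proof -
  consider "x \<le> pi/2" | "pi/2 \<le> x" "x \<le> pi" | "pi \<le> x" "x \<le> pi + pi/2" | "pi + pi/2 \<le> x" by linarith
  then show ?thesis
  proof cases
    case 1 then show ?thesis using sin_ge_third[of x] assms by auto
  next
    case 2 then show ?thesis using sin_ge_third[of "pi - x"] assms by (auto simp: sin_diff)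
  next
    case 3 then show ?thesis using sin_ge_third[of "x - pi"] assms by (auto simp: sin_diff)
  next
    case 4 then show ?thesis using sin_ge_third[of "2*pi - x"] assms by (auto simp: sin_diff)
  qed
qed

text \<open>
  After a rotation \<open>a\<close> is a nonnegative real, and \<open>|z - a| \<ge> |Im z| = r |sin \<theta>|\<close>. The
  singularities of \<open>1 / \<surd>|sin \<theta>|\<close> are integrable, with a bound independent of \<open>a\<close>; the logarithmic
  mean of \<open>1 / |z - a|\<close> is controlled through this bound.
\<close>

lemma circle_mean_inverse_sqrt_bound:
  "\<exists>K>0. \<forall>r>0. \<forall>a. cmod a \<noteq> r \<longrightarrow> circle_mean r (\<lambda>z. 1 / sqrt (cmod (z - a))) \<le> K / sqrt r"
proof -
  define k where "k x = sqrt 3 * (1 / sqrt \<bar>x - 0\<bar> + 1 / sqrt \<bar>x - pi\<bar> + 1 / sqrt \<bar>x - 2*pi\<bar>)" for x :: real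
  define K0 where "K0 = sqrt 3 * ((2 * sqrt (2*pi - 0) - 2 * sqrt (0 - 0)) + (2 * sqrt (2*pi - pi) - 2 * sqrt (0 - pi)) + (2 * sqrt (2*pi - 2*pi) - 2 * sqrt (0 - 2*pi)))"
  have k: "(k has_integral K0) {0..2*pi}" unfolding k_def K0_def
    by (intro has_integral_add has_integral_mult_right inverse_sqrt_integral) auto
  have kpos: "0 \<le> k x" for x by (simp add: k_def)
  have "0 \<le> K0" using has_integral_nonneg[OF k] kpos by auto
  show ?thesis
  proof (intro exI[of _ "K0 / (2*pi) + 1"] conjI allI impI)
    show "0 < K0 / (2*pi) + 1" using \<open>0 \<le> K0\<close> by (simp add: add_nonneg_pos)
    fix r :: real and a :: complex assume r: "0 < r" and a: "cmod a \<noteq> r"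
    define s where "s = cmod a"
    obtain c where c: "a = c * of_real s" "cmod c = 1"
    proof (cases "a = 0")
      case True then show ?thesis using that[of 1] by (simp add: s_def)
    next
      case False then show ?thesis using that[of "sgn a"] norm_sgn[of a] by (simp add: s_def sgn_eq)
    qed
    have cont: "continuous_on (sphere 0 r) (\<lambda>z. 1 / sqrt (cmod (z - b)))" if "cmod b = s" for b
      using a that by (auto intro!: continuous_intros simp: s_def)
    have "circle_mean r (\<lambda>z. 1 / sqrt (cmod (z - a))) = circle_mean r (\<lambda>z. 1 / sqrt (cmod (c * z - a)))"
      using circle_mean_rotate[OF cont[of a] _ c(2)] r by (simp add: s_def)
    also have "\<dots> = circle_mean r (\<lambda>z. 1 / sqrt (cmod (z - of_real s)))"
    proof (rule circle_mean_cong)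
      fix z
      have "c * z - a = c * (z - of_real s)" by (simp add: c algebra_simps)
      then show "1 / sqrt (cmod (c * z - a)) = 1 / sqrt (cmod (z - of_real s))" using c(2) by (simp add: norm_mult)
    qed (use r in simp)
    also have "\<dots> \<le> (K0 / sqrt r) / (2*pi)"
      unfolding circle_mean_def
    proof (rule divide_right_mono)
      have sub: "continuous_on (sphere 0 r) (\<lambda>z. 1 / sqrt (cmod (z - of_real s)))" by (rule cont) (simp add: s_def)
      have i1: "((\<lambda>\<theta>. 1 / sqrt (cmod (of_real r * cis \<theta> - of_real s))) has_integral
           integral {0..2*pi} (\<lambda>\<theta>. 1 / sqrt (cmod (of_real r * cis \<theta> - of_real s)))) {0<..<2*pi}"
        using integrable_integral[OF circle_mean_integrable[OF sub]] r by (simp add: has_integral_Icc_iff_Ioo)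
      have i2: "((\<lambda>\<theta>. (1 / sqrt r) * k \<theta>) has_integral (1 / sqrt r) * K0) {0<..<2*pi}"
        using has_integral_mult_right[OF k, of "1 / sqrt r"] by (simp add: has_integral_Icc_iff_Ioo)
      have "integral {0..2*pi} (\<lambda>\<theta>. 1 / sqrt (cmod (of_real r * cis \<theta> - of_real s))) \<le> (1 / sqrt r) * K0"
      proof (rule has_integral_le[OF i1 i2])
        fix \<theta> :: real assume th: "\<theta> \<in> {0<..<2*pi}"
        define b where "b = cmod (of_real r * cis \<theta> - of_real s)"
        have bpos: "0 < b" unfolding b_def using a r s_def
          by (auto simp: norm_mult dest!: arg_cong[where f=cmod])
        have "\<bar>Im (of_real r * cis \<theta> - of_real s)\<bar> \<le> b" unfolding b_def by (rule abs_Im_le_cmod)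
        then have b: "r * \<bar>sin \<theta>\<bar> \<le> b" using r by (simp add: abs_mult)
        obtain c where c: "c \<in> {0,pi,2*pi}" "\<bar>\<theta> - c\<bar> / 3 \<le> \<bar>sin \<theta>\<bar>" using abs_sin_ge[of \<theta>] th unfolding Bex_def greaterThanLessThan_iff by blast
        have "r * (\<bar>\<theta> - c\<bar> / 3) \<le> r * \<bar>sin \<theta>\<bar>" by (rule mult_left_mono[OF c(2)]) (use r in simp)
        then have le: "r * \<bar>\<theta> - c\<bar> / 3 \<le> b" using b by linarith
        show "1 / sqrt b \<le> (1 / sqrt r) * k \<theta>"
        proof (cases "\<theta> = c")
          case False
          have "1 / sqrt b \<le> 1 / sqrt (r * \<bar>\<theta> - c\<bar> / 3)"
            by (rule divide_left_mono) (use le bpos r False in auto)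
          also have "\<dots> = (1 / sqrt r) * (sqrt 3 * (1 / sqrt \<bar>\<theta> - c\<bar>))"
            by (simp add: real_sqrt_mult real_sqrt_divide)
          also have "\<dots> \<le> (1 / sqrt r) * k \<theta>"
            unfolding k_def by (intro mult_left_mono) (use c(1) r in auto)
          finally show ?thesis .
        next
          case True
          then have "\<theta> = pi" using c(1) th by auto
          have "1 / sqrt b \<le> 1 / sqrt r"
          proof -
            have "b = cmod (of_real (r + s))" unfolding b_def \<open>\<theta> = pi\<close> using norm_minus_cancel[of "of_real (r + s) :: complex"] by (simp add: cis_pi del: norm_minus_cancel)
            then have "b = \<bar>r + s\<bar>" by (simp only: norm_of_real)
            then have "r \<le> b" using r by (simp add: s_def)
            then show ?thesis using r by (intro divide_left_mono) auto
          qed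
          also have "\<dots> \<le> (1 / sqrt r) * k \<theta>"
          proof -
            have "1 \<le> sqrt 3 * (1 / sqrt pi + 1 / sqrt pi)"
            proof -
              have "sqrt pi \<le> sqrt 4" using pi_less_4 by (intro real_sqrt_le_mono) simp
              then have "sqrt pi \<le> 2" by simp
              then have "1/2 \<le> 1 / sqrt pi" using pi_gt_zero by (intro divide_left_mono) auto
              moreover have "1 \<le> sqrt 3" by simp
              ultimately show ?thesis using mult_mono[of 1 "sqrt 3" 1 "1 / sqrt pi + 1 / sqrt pi"] by simp
            qed
            then have "1 \<le> k \<theta>" by (simp add: k_def \<open>\<theta> = pi\<close>)
            then show ?thesis using r by (simp add: divide_right_mono)
          qed
          finally show ?thesis .
        qed
      qed
      then show "integral {0..2*pi} (\<lambda>\<theta>. 1 / sqrt (cmod (of_real r * cis \<theta> - of_real s))) \<le> K0 / sqrt r" by simp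
    qed simp
    also have "\<dots> \<le> (K0 / (2*pi) + 1) / sqrt r"
      using r \<open>0 \<le> K0\<close> by (simp add: field_simps)
    finally show "circle_mean r (\<lambda>z. 1 / sqrt (cmod (z - a))) \<le> (K0 / (2*pi) + 1) / sqrt r" .
  qed
qed

section \<open>The Poisson--Jensen formula and counting functions\<close>

lemma holomorphic_factor_zeros:
  assumes "open A" "connected A" "g holomorphic_on A" "\<exists>z\<in>A. g z \<noteq> 0"
    and Z: "finite Z" "Z \<subseteq> {z\<in>A. g z = 0}"
  shows "\<exists>h. h holomorphic_on A \<and> (\<forall>z\<in>A. g z = (\<Prod>a\<in>Z. (z - a) ^ nat (zorder g a)) * h z)
            \<and> (\<forall>z\<in>Z. h z \<noteq> 0)"
proof -
  define m where "m a = nat (zorder g a)" for a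
  define h where "h z = (if z \<in> Z then zor_poly g z z / (\<Prod>b\<in>Z-{z}. (z - b) ^ m b)
                         else g z / (\<Prod>b\<in>Z. (z - b) ^ m b))" for z
  have ex: "\<exists>r>0. cball a r \<subseteq> A \<and> zor_poly g a holomorphic_on cball a r \<and>
      (\<forall>w\<in>cball a r. g w = zor_poly g a w * (w - a) ^ m a \<and> zor_poly g a w \<noteq> 0)" "m a > 0" if "a \<in> Z" for a
  proof -
    have a: "a \<in> A" "g a = 0" using that Z by auto
    show "\<exists>r>0. cball a r \<subseteq> A \<and> zor_poly g a holomorphic_on cball a r \<and>
      (\<forall>w\<in>cball a r. g w = zor_poly g a w * (w - a) ^ m a \<and> zor_poly g a w \<noteq> 0)" "m a > 0"
      using zorder_exist_zero[OF assms(3,1,2) a(1) assms(4)] a(2) unfolding m_def by (simp_all only: if_True zero_less_nat_eq)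
  qed
  have "h field_differentiable (at z)" if "z \<in> A" for z
  proof (cases "z \<in> Z")
    case True
    obtain r where r: "r > 0" "cball z r \<subseteq> A" "zor_poly g z holomorphic_on cball z r"
      "\<And>w. w \<in> cball z r \<Longrightarrow> g w = zor_poly g z w * (w - z) ^ m z \<and> zor_poly g z w \<noteq> 0"
      using ex(1)[OF True] unfolding Bex_def by blast
    have nZ: "b \<notin> ball z r" if "b \<in> Z - {z}" for b
    proof
      assume "b \<in> ball z r"
      then have "g b \<noteq> 0" using r(4)[of b] that by auto
      then show False using Z that by auto
    qed
    have "(\<lambda>w. zor_poly g z w / (\<Prod>b\<in>Z-{z}. (w - b) ^ m b)) holomorphic_on ball z r"
    proof (intro holomorphic_intros holomorphic_on_subset[OF r(3)])
      fix w assume "w \<in> ball z r"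
      then show "(\<Prod>b\<in>Z - {z}. (w - b) ^ m b) \<noteq> 0" using nZ Z(1) by force
    qed auto
    moreover have "h w = zor_poly g z w / (\<Prod>b\<in>Z-{z}. (w - b) ^ m b)" if "w \<in> ball z r" for w
    proof (cases "w = z")
      case False
      then have "w \<notin> Z" using nZ that by blast
      moreover have "(\<Prod>b\<in>Z. (w - b) ^ m b) = (w - z) ^ m z * (\<Prod>b\<in>Z-{z}. (w - b) ^ m b)"
        using True Z(1) by (simp add: prod.remove)
      ultimately show ?thesis using r(4)[of w] that False by (simp add: h_def)
    qed (use True in \<open>simp add: h_def\<close>)
    ultimately have "h holomorphic_on ball z r" by (rule holomorphic_transform[OF _ sym])
    then show ?thesis using r(1) by (auto simp: holomorphic_on_open field_differentiable_def)
  next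
    case False
    define B where "B = A - Z"
    have "open B" using assms(1) Z(1) by (simp add: B_def finite_imp_closed open_Diff)
    have "(\<lambda>w. g w / (\<Prod>b\<in>Z. (w - b) ^ m b)) holomorphic_on B"
      by (intro holomorphic_intros holomorphic_on_subset[OF assms(3)]) (auto simp: B_def Z(1))
    moreover have "h w = g w / (\<Prod>b\<in>Z. (w - b) ^ m b)" if "w \<in> B" for w
      using that by (auto simp: B_def h_def)
    ultimately have "h holomorphic_on B" by (rule holomorphic_transform[OF _ sym])
    moreover have "z \<in> B" using False that by (auto simp: B_def)
    ultimately show ?thesis using \<open>open B\<close> by (auto simp: holomorphic_on_open field_differentiable_def)
  qed
  then have "h holomorphic_on A" by (simp add: holomorphic_on_def field_differentiable_at_within)
  moreover have "g z = (\<Prod>a\<in>Z. (z - a) ^ m a) * h z" if "z \<in> A" for z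
  proof (cases "z \<in> Z")
    case True
    then show ?thesis using ex(2)[OF True] Z by (auto simp: prod.remove[OF Z(1) True] zero_power)
  next
    case False
    then show ?thesis using Z(1) by (auto simp: h_def)
  qed
  moreover have "h z \<noteq> 0" if "z \<in> Z" for z
    using ex(1)[OF that] that Z(1) by (auto simp: h_def)
  ultimately show ?thesis unfolding m_def by blast
qed

text \<open>
  The hypothesis under which Jensen's formula holds without singular integrands. It excludes only
  countably many radii, which are later put into the exceptional set.
\<close>

definition regular_on_circle :: "(complex \<Rightarrow> complex) \<Rightarrow> real \<Rightarrow> bool" where
  "regular_on_circle g \<rho> \<longleftrightarrow> 0 < \<rho> \<and> (\<exists>R'>\<rho>. g holomorphic_on ball 0 R') \<and> (\<forall>z. cmod z = \<rho> \<longrightarrow> g z \<noteq> 0)"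

lemma regular_on_circleD:
  assumes "regular_on_circle g \<rho>"
  shows "0 < \<rho>" "\<And>z. cmod z = \<rho> \<Longrightarrow> g z \<noteq> 0" "finite {z. cmod z < \<rho> \<and> g z = 0}"
    "continuous_on (cball 0 \<rho>) g" "g holomorphic_on ball 0 \<rho>"
    "continuous_on (sphere 0 \<rho>) (\<lambda>z. ln (cmod (g z)))"
proof -
  obtain R' where R': "\<rho> < R'" "g holomorphic_on ball 0 R'" and \<rho>: "0 < \<rho>" 
    and nz: "\<And>z. cmod z = \<rho> \<Longrightarrow> g z \<noteq> 0" using assms by (auto simp: regular_on_circle_def)
  show "0 < \<rho>" "\<And>z. cmod z = \<rho> \<Longrightarrow> g z \<noteq> 0" by fact+
  have sub: "cball 0 \<rho> \<subseteq> ball (0::complex) R'" using R'(1) by auto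
  have "g (of_real \<rho>) \<noteq> 0" using nz \<rho> by auto
  have "\<not> g constant_on ball 0 R' \<or> (\<forall>z\<in>ball 0 R'. g z \<noteq> 0)"
    using \<open>g (of_real \<rho>) \<noteq> 0\<close> R'(1) \<rho> unfolding constant_on_def
    by (metis abs_of_pos mem_ball_0 norm_of_real)
  then have "finite {z\<in>cball 0 \<rho>. g z = 0}"
  proof
    assume "\<not> g constant_on ball 0 R'"
    then show ?thesis
      using holomorphic_compact_finite_zeros[OF R'(2) open_ball connected_ball compact_cball sub] by blast
  next
    assume "\<forall>z\<in>ball 0 R'. g z \<noteq> 0"
    then have "{z\<in>cball 0 \<rho>. g z = 0} = {}" using sub by blast
    then show ?thesis by (simp only: finite.emptyI)
  qed
  then show "finite {z. cmod z < \<rho> \<and> g z = 0}" by (rule finite_subset[rotated]) auto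
  show c: "continuous_on (cball 0 \<rho>) g"
    using holomorphic_on_subset[OF R'(2) sub] holomorphic_on_imp_continuous_on by blast
  show "g holomorphic_on ball 0 \<rho>" using R' by (auto intro: holomorphic_on_subset)
  show "continuous_on (sphere 0 \<rho>) (\<lambda>z. ln (cmod (g z)))"
    by (intro continuous_intros continuous_on_subset[OF c]) (use nz in auto)
qed

lemma zorder_pos_at_zero:
  assumes "regular_on_circle g \<rho>" "cmod a < \<rho>" "g a = 0"
  shows "0 < zorder g a"
proof -
  obtain R' where R': "\<rho> < R'" "g holomorphic_on ball 0 R'" using assms by (auto simp: regular_on_circle_def)
  have "\<exists>w\<in>ball 0 R'. g w \<noteq> 0" using regular_on_circleD(1,2)[OF assms(1)] R'(1)
    by (intro bexI[of _ "of_real \<rho>"]) auto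
  then show ?thesis using zorder_exist_zero[OF R'(2) open_ball connected_ball, of a] assms R' by auto
qed

text \<open>
  Only finitely many zeros lie in the open disc and none on its boundary, so after division by them
  the quotient is zero-free on a slightly larger disc.
\<close>

lemma factor_disc:
  assumes "regular_on_circle g \<rho>"
  defines "Z \<equiv> {z. cmod z < \<rho> \<and> g z = 0}"
  obtains R1 h where "\<rho> < R1" "h holomorphic_on ball 0 R1" "\<And>z. z \<in> ball 0 R1 \<Longrightarrow> h z \<noteq> 0"
    "\<And>z. z \<in> ball 0 R1 \<Longrightarrow> g z = (\<Prod>a\<in>Z. (z - a) ^ nat (zorder g a)) * h z"
proof -
  note reg = regular_on_circleD[OF assms(1)]
  obtain R' where R': "\<rho> < R'" "g holomorphic_on ball 0 R'" using assms by (auto simp: regular_on_circle_def)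
  define s where "s = (\<rho> + R') / 2"
  have s: "\<rho> < s" "s < R'" using R' by (auto simp: s_def)
  have sub: "cball 0 s \<subseteq> ball (0::complex) R'" using s by auto
  have ne: "g (of_real \<rho>) \<noteq> 0" using reg by auto
  have "finite {z\<in>cball 0 s. g z = 0}"
  proof (cases "g constant_on ball 0 R'")
    case True
    then have "g z \<noteq> 0" if "z \<in> ball 0 R'" for z using ne that R'(1) reg(1) unfolding constant_on_def
      by (metis abs_of_pos mem_ball_0 norm_of_real)
    then have "{z\<in>cball 0 s. g z = 0} = {}" using sub by blast
    then show ?thesis by (simp only: finite.emptyI)
  next
    case False
    then show ?thesis
      using holomorphic_compact_finite_zeros[OF R'(2) open_ball connected_ball compact_cball sub] by blast
  qed
  then have fin: "finite (cmod ` {z\<in>cball 0 s. g z = 0 \<and> \<rho> < cmod z})"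
    by (intro finite_imageI) (auto elim!: rev_finite_subset)
  define R1 where "R1 = Min (insert s (cmod ` {z\<in>cball 0 s. g z = 0 \<and> \<rho> < cmod z}))"
  have R1: "\<rho> < R1" "R1 \<le> s" using fin s by (auto simp: R1_def)
  have nz: "cmod z < \<rho>" if "z \<in> ball 0 R1" "g z = 0" for z
  proof (rule ccontr)
    assume "\<not> cmod z < \<rho>"
    then have "\<rho> < cmod z" using reg(2)[of z] that by fastforce
    then have "R1 \<le> cmod z" unfolding R1_def using that R1 fin by (intro Min_le) auto
    then show False using that by simp
  qed
  have sub1: "ball 0 R1 \<subseteq> ball (0::complex) R'" using R1 s by auto
  have "\<exists>h. h holomorphic_on ball 0 R1 \<and> (\<forall>z\<in>ball 0 R1. g z = (\<Prod>a\<in>Z. (z - a) ^ nat (zorder g a)) * h z)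
            \<and> (\<forall>z\<in>Z. h z \<noteq> 0)"
  proof (rule holomorphic_factor_zeros)
    show "\<exists>z\<in>ball 0 R1. g z \<noteq> 0" using ne R1 reg by (intro bexI[of _ "of_real \<rho>"]) auto
    show "finite Z" unfolding Z_def by (rule reg(3))
    show "Z \<subseteq> {z \<in> ball 0 R1. g z = 0}" using R1 by (auto simp: Z_def)
  qed (use R'(2) sub1 in \<open>auto intro: holomorphic_on_subset\<close>)
  then obtain h where h: "h holomorphic_on ball 0 R1"
    "\<And>z. z \<in> ball 0 R1 \<Longrightarrow> g z = (\<Prod>a\<in>Z. (z - a) ^ nat (zorder g a)) * h z" "\<And>z. z \<in> Z \<Longrightarrow> h z \<noteq> 0" by blast
  have "h z \<noteq> 0" if "z \<in> ball 0 R1" for z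
  proof (cases "z \<in> Z")
    case False
    then have "g z \<noteq> 0" using nz that by (auto simp: Z_def)
    then show ?thesis using h(2)[OF that] by auto
  qed (use h in auto)
  then show thesis using that[of R1 h] h R1 by blast
qed

lemma ln_norm_prod_power:
  fixes x :: "'a \<Rightarrow> complex"
  assumes "finite Z" "\<And>a. a \<in> Z \<Longrightarrow> x a \<noteq> 0"
  shows "ln (cmod (\<Prod>a\<in>Z. x a ^ m a)) = (\<Sum>a\<in>Z. real (m a) * ln (cmod (x a)))"
proof -
  have "cmod (\<Prod>a\<in>Z. x a ^ m a) = (\<Prod>a\<in>Z. cmod (x a) ^ m a)"
    by (simp only: prod_norm[symmetric] norm_power)
  also have "ln \<dots> = (\<Sum>a\<in>Z. ln (cmod (x a) ^ m a))" by (rule ln_prod) (use assms in auto)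
  finally show ?thesis using assms by (simp add: ln_realpow)
qed

text \<open>
  On the circle \<open>|\<zeta> - a| = |\<rho>\<^sup>2 - cnj a \<zeta>| / \<rho>\<close>, and the latter is zero-free on the closed disc.
\<close>

lemma poisson_ln_linear:
  assumes "cmod a < \<rho>" "cmod w < \<rho>"
  shows "circle_mean \<rho> (\<lambda>\<zeta>. ln (cmod (\<zeta> - a)) * Re ((\<zeta> + w) / (\<zeta> - w)))
     = ln (cmod (of_real (\<rho>\<^sup>2) - cnj a * w) / \<rho>)"
proof -
  have \<rho>: "0 < \<rho>" using assms(2) norm_ge_zero[of w] by linarith
  define R1 where "R1 = (if a = 0 then \<rho> + 1 else \<rho>\<^sup>2 / cmod a)"
  have R1: "\<rho> < R1" using assms \<rho> by (auto simp: R1_def field_simps power2_eq_square)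
  define h where "h z = (of_real (\<rho>\<^sup>2) - cnj a * z) / of_real \<rho>" for z
  have hnz: "h z \<noteq> 0" if "z \<in> ball 0 R1" for z
  proof
    assume "h z = 0"
    then have "of_real (\<rho>\<^sup>2) = cnj a * z" using \<rho> by (simp add: h_def)
    then have "cmod (of_real (\<rho>\<^sup>2)) = cmod a * cmod z" by (simp only: norm_mult complex_mod_cnj)
    then have e: "\<rho>\<^sup>2 = cmod a * cmod z" by (simp only: norm_of_real) simp
    then have "a \<noteq> 0" using \<rho> by auto
    then show False using e that by (simp add: R1_def field_simps)
  qed
  have "circle_mean \<rho> (\<lambda>\<zeta>. ln (cmod (\<zeta> - a)) * Re ((\<zeta> + w) / (\<zeta> - w))) =
     circle_mean \<rho> (\<lambda>\<zeta>. ln (cmod (h \<zeta>)) * Re ((\<zeta> + w) / (\<zeta> - w)))"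
  proof (rule circle_mean_cong)
    fix z assume z: "cmod z = \<rho>"
    have "of_real (\<rho>\<^sup>2) = z * cnj z" by (simp only: complex_norm_square[symmetric] z)
    then have "of_real (\<rho>\<^sup>2) - cnj a * z = z * cnj (z - a)" by (simp add: algebra_simps)
    then have "cmod (h z) = cmod (z - a)" unfolding h_def using \<rho> z
      by (simp only: norm_divide norm_mult complex_mod_cnj) simp
    then show "ln (cmod (z - a)) * Re ((z + w) / (z - w)) = ln (cmod (h z)) * Re ((z + w) / (z - w))" by simp
  qed (use \<rho> in simp)
  also have "\<dots> = ln (cmod (h w))"
    by (rule poisson_ln_norm[of h R1]) (use hnz R1 assms \<rho> in \<open>auto simp: h_def[abs_def] intro!: holomorphic_intros\<close>)
  also have "cmod (h w) = cmod (of_real (\<rho>\<^sup>2) - cnj a * w) / \<rho>"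
    using \<rho> by (simp only: h_def norm_divide) simp
  finally show ?thesis .
qed

lemma continuous_on_poisson_kernel:
  assumes "cmod w < \<rho>" shows "continuous_on (sphere 0 \<rho>) (\<lambda>\<zeta>. Re ((\<zeta> + w) / (\<zeta> - w)))"
  using assms by (auto intro!: continuous_intros)

lemma poisson_ln_factored:
  assumes Z: "finite Z" "\<And>a. a \<in> Z \<Longrightarrow> cmod a < \<rho>" and w: "cmod w < \<rho>"
    and h: "\<rho> < R1" "h holomorphic_on ball 0 R1" "\<And>z. z \<in> ball 0 R1 \<Longrightarrow> h z \<noteq> 0"
    and g: "\<And>z. z \<in> ball 0 R1 \<Longrightarrow> g z = (\<Prod>a\<in>Z. (z - a) ^ m a) * h z"
  shows "circle_mean \<rho> (\<lambda>\<zeta>. ln (cmod (g \<zeta>)) * Re ((\<zeta> + w) / (\<zeta> - w)))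
     = (\<Sum>a\<in>Z. real (m a) * ln (cmod (of_real (\<rho>\<^sup>2) - cnj a * w) / \<rho>)) + ln (cmod (h w))"
proof -
  have \<rho>: "0 < \<rho>" using w norm_ge_zero[of w] by linarith
  note ck = continuous_on_poisson_kernel[OF w]
  have cl: "continuous_on (sphere 0 \<rho>) (\<lambda>z. ln (cmod (z - a)))" if "a \<in> Z" for a
    using Z(2)[OF that] by (auto intro!: continuous_intros)
  have ch: "continuous_on (sphere 0 \<rho>) (\<lambda>z. ln (cmod (h z)))"
    by (intro continuous_intros holomorphic_on_imp_continuous_on[OF holomorphic_on_subset[OF h(2)]])
       (use h in auto)
  have "circle_mean \<rho> (\<lambda>\<zeta>. ln (cmod (g \<zeta>)) * Re ((\<zeta> + w) / (\<zeta> - w)))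
    = circle_mean \<rho> (\<lambda>\<zeta>. (\<Sum>a\<in>Z. real (m a) * (ln (cmod (\<zeta> - a)) * Re ((\<zeta> + w) / (\<zeta> - w))))
         + ln (cmod (h \<zeta>)) * Re ((\<zeta> + w) / (\<zeta> - w)))"
  proof (rule circle_mean_cong)
    fix z assume z: "cmod z = \<rho>"
    have *: "z - a \<noteq> 0" if "a \<in> Z" for a using Z(2)[OF that] z by auto
    have "ln (cmod (g z)) = ln (cmod (\<Prod>a\<in>Z. (z - a) ^ m a)) + ln (cmod (h z))"
      using g[of z] h(1) h(3)[of z] z * Z(1) by (auto simp: norm_mult ln_mult_pos)
    also have "ln (cmod (\<Prod>a\<in>Z. (z - a) ^ m a)) = (\<Sum>a\<in>Z. real (m a) * ln (cmod (z - a)))"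
      by (rule ln_norm_prod_power) (use Z * in auto)
    finally show "ln (cmod (g z)) * Re ((z + w) / (z - w)) =
       (\<Sum>a\<in>Z. real (m a) * (ln (cmod (z - a)) * Re ((z + w) / (z - w)))) + ln (cmod (h z)) * Re ((z + w) / (z - w))"
      by (simp add: distrib_right sum_distrib_right mult.assoc)
  qed (use \<rho> in simp)
  also have "\<dots> = (\<Sum>a\<in>Z. circle_mean \<rho> (\<lambda>\<zeta>. real (m a) * (ln (cmod (\<zeta> - a)) * Re ((\<zeta> + w) / (\<zeta> - w)))))
      + circle_mean \<rho> (\<lambda>\<zeta>. ln (cmod (h \<zeta>)) * Re ((\<zeta> + w) / (\<zeta> - w)))"
    (is "_ = ?A + ?B")
  proof -
    have "circle_mean \<rho> (\<lambda>\<zeta>. (\<Sum>a\<in>Z. real (m a) * (ln (cmod (\<zeta> - a)) * Re ((\<zeta> + w) / (\<zeta> - w))))) = ?A"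
      by (rule circle_mean_sum[OF Z(1)]) (use \<rho> in \<open>auto intro!: continuous_on_mult continuous_on_const cl ck\<close>)
    moreover have "continuous_on (sphere 0 \<rho>) (\<lambda>\<zeta>. (\<Sum>a\<in>Z. real (m a) * (ln (cmod (\<zeta> - a)) * Re ((\<zeta> + w) / (\<zeta> - w)))))"
      by (auto intro!: continuous_on_sum continuous_on_mult continuous_on_const cl ck)
    ultimately show ?thesis
      using circle_mean_add[OF _ continuous_on_mult[OF ch ck]] \<rho> by simp
  qed
  also have "circle_mean \<rho> (\<lambda>\<zeta>. ln (cmod (h \<zeta>)) * Re ((\<zeta> + w) / (\<zeta> - w))) = ln (cmod (h w))"
    by (rule poisson_ln_norm) (use h w in auto)
  finally show ?thesis by (simp add: circle_mean_cmult poisson_ln_linear Z(2) w)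
qed

theorem poisson_jensen:
  assumes "regular_on_circle g \<rho>" and w: "cmod w < \<rho>" "g w \<noteq> 0"
  shows "ln (cmod (g w)) = (\<Sum>a | cmod a < \<rho> \<and> g a = 0. real (nat (zorder g a)) *
       (ln (cmod (w - a)) - ln (cmod (of_real (\<rho>\<^sup>2) - cnj a * w) / \<rho>)))
     + circle_mean \<rho> (\<lambda>\<zeta>. ln (cmod (g \<zeta>)) * Re ((\<zeta> + w) / (\<zeta> - w)))"
proof -
  define Z where "Z = {a. cmod a < \<rho> \<and> g a = 0}"
  define m where "m a = nat (zorder g a)" for a
  have Z: "finite Z" "\<And>a. a \<in> Z \<Longrightarrow> cmod a < \<rho>"
    using regular_on_circleD(3)[OF assms(1)] by (auto simp: Z_def)
  obtain R1 h where h: "\<rho> < R1" "h holomorphic_on ball 0 R1" "\<And>z. z \<in> ball 0 R1 \<Longrightarrow> h z \<noteq> 0"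
    "\<And>z. z \<in> ball 0 R1 \<Longrightarrow> g z = (\<Prod>a\<in>Z. (z - a) ^ m a) * h z"
    by (rule factor_disc[OF assms(1), folded Z_def m_def]) blast
  have *: "w - a \<noteq> 0" if "a \<in> Z" for a using w that by (auto simp: Z_def)
  have "ln (cmod (g w)) = ln (cmod (\<Prod>a\<in>Z. (w - a) ^ m a)) + ln (cmod (h w))"
    using h(4)[of w] h(1) h(3)[of w] w * Z(1) by (auto simp: norm_mult ln_mult_pos)
  also have "ln (cmod (\<Prod>a\<in>Z. (w - a) ^ m a)) = (\<Sum>a\<in>Z. real (m a) * ln (cmod (w - a)))"
    by (rule ln_norm_prod_power) (use Z * in auto)
  finally show ?thesis using poisson_ln_factored[OF Z w(1) h]
    by (simp add: Z_def[symmetric] m_def[symmetric] right_diff_distrib sum_subtractf)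
qed

text \<open>
  The integrated counting function, with the integral over the radius carried out: a zero \<open>a \<noteq> 0\<close>
  contributes \<open>ln (r / |a|)\<close> and a zero at the origin contributes \<open>ln r\<close>. The weight \<open>\<phi>\<close> is the
  identity or a truncation \<open>min k\<close>.
\<close>

definition count_fun :: "(nat \<Rightarrow> nat) \<Rightarrow> (complex \<Rightarrow> complex) \<Rightarrow> real \<Rightarrow> real" where
  "count_fun \<phi> g r = (\<Sum>a | cmod a < r \<and> g a = 0. real (\<phi> (nat (zorder g a))) *
     (if a = 0 then ln r else ln (r / cmod a)))"

theorem jensen_formula:
  assumes "regular_on_circle g \<rho>"
  shows "circle_mean \<rho> (\<lambda>z. ln (cmod (g z))) = count_fun id g \<rho> + ln (cmod (zor_poly g 0 0))"
proof -
  define Z where "Z = {a. cmod a < \<rho> \<and> g a = 0}"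
  define m where "m a = nat (zorder g a)" for a
  have \<rho>: "0 < \<rho>" using regular_on_circleD(1)[OF assms(1)] .
  have Z: "finite Z" "\<And>a. a \<in> Z \<Longrightarrow> cmod a < \<rho>"
    using regular_on_circleD(3)[OF assms(1)] by (auto simp: Z_def)
  obtain R1 h where h: "\<rho> < R1" "h holomorphic_on ball 0 R1" "\<And>z. z \<in> ball 0 R1 \<Longrightarrow> h z \<noteq> 0"
    "\<And>z. z \<in> ball 0 R1 \<Longrightarrow> g z = (\<Prod>a\<in>Z. (z - a) ^ m a) * h z"
    by (rule factor_disc[OF assms(1), folded Z_def m_def]) blast
  have 1: "circle_mean \<rho> (\<lambda>z. ln (cmod (g z))) = (\<Sum>a\<in>Z. real (m a) * ln \<rho>) + ln (cmod (h 0))"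
  proof -
    have "circle_mean \<rho> (\<lambda>z. ln (cmod (g z))) = circle_mean \<rho> (\<lambda>\<zeta>. ln (cmod (g \<zeta>)) * Re ((\<zeta> + 0) / (\<zeta> - 0)))"
      by (rule circle_mean_cong) (use \<rho> in \<open>auto simp: divide_self_if\<close>)
    also have "\<dots> = (\<Sum>a\<in>Z. real (m a) * ln (cmod (of_real (\<rho>\<^sup>2) - cnj a * 0) / \<rho>)) + ln (cmod (h 0))"
      by (rule poisson_ln_factored[OF Z _ h]) (use \<rho> in auto)
    finally show ?thesis
      using \<rho> by (simp only: mult_zero_right diff_zero norm_of_real) (simp add: power2_eq_square)
  qed
  have gh: "g holomorphic_on ball 0 R1"
  proof (subst holomorphic_cong[OF refl h(4)])
    show "(\<lambda>z. (\<Prod>a\<in>Z. (z - a) ^ m a) * h z) holomorphic_on ball 0 R1"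
      by (intro holomorphic_intros h(2))
  qed
  have nz: "\<exists>w\<in>ball 0 R1. g w \<noteq> 0" using regular_on_circleD(1,2)[OF assms(1)] h(1)
    by (intro bexI[of _ "of_real \<rho>"]) auto
  have "0 \<in> ball (0::complex) R1" using h(1) \<rho> by simp
  note zo = zorder_exist_zero[OF gh open_ball connected_ball this nz]
  from conjunct2[OF zo] obtain r where r: "r > 0" "cball 0 r \<subseteq> ball (0::complex) R1" "zor_poly g 0 holomorphic_on cball 0 r"
    and r4: "\<forall>w\<in>cball 0 r. g w = zor_poly g 0 w * (w - 0) ^ nat (zorder g 0) \<and> zor_poly g 0 w \<noteq> 0"
    by (elim exE conjE) (rule that)
  have r4: "g w = zor_poly g 0 w * w ^ nat (zorder g 0) \<and> zor_poly g 0 w \<noteq> 0" if "w \<in> cball 0 r" for w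
    using bspec[OF r4 that] by simp
  define Z' where "Z' = Z - {0}"
  have lead: "zor_poly g 0 0 = (\<Prod>a\<in>Z'. (0 - a) ^ m a) * h 0"
  proof (cases "0 \<in> Z")
    case False
    then have "g 0 \<noteq> 0" using \<rho> by (auto simp: Z_def)
    then have "zorder g 0 = 0" using conjunct1[OF zo] by auto
    moreover have "g 0 = (\<Prod>a\<in>Z'. (0 - a) ^ m a) * h 0" using h(4)[of 0] h(1) \<rho> False by (simp add: Z'_def)
    ultimately show ?thesis using r(1) r4[of 0] by simp
  next
    case True
    have eq: "zor_poly g 0 w = (\<Prod>a\<in>Z'. (w - a) ^ m a) * h w" if "w \<in> ball 0 r - {0}" for w
    proof -
      have "w \<in> cball 0 r" using that by auto
      moreover from this have "w \<in> ball 0 R1" using r(2) by blast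
      ultimately have "zor_poly g 0 w * w ^ m 0 = w ^ m 0 * (\<Prod>a\<in>Z'. (w - a) ^ m a) * h w"
        using r4[of w] h(4)[of w] True Z(1) by (auto simp: Z'_def prod.remove m_def)
      then show ?thesis using that by simp
    qed
    have l1: "(zor_poly g 0 \<longlongrightarrow> zor_poly g 0 0) (at 0)"
    proof -
      have "continuous_on (ball 0 r) (zor_poly g 0)"
        using holomorphic_on_imp_continuous_on[OF holomorphic_on_subset[OF r(3)]] by auto
      then show ?thesis using r(1) by (simp add: continuous_on_eq_continuous_at isCont_def)
    qed
    have l2: "((\<lambda>w. (\<Prod>a\<in>Z'. (w - a) ^ m a) * h w) \<longlongrightarrow> (\<Prod>a\<in>Z'. (0 - a) ^ m a) * h 0) (at 0)"
    proof -
      have "continuous_on (ball 0 R1) h" using holomorphic_on_imp_continuous_on h by blast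
      then have "isCont h 0" using h(1) \<rho> by (simp add: continuous_on_eq_continuous_at)
      then show ?thesis by (intro tendsto_intros) (simp add: isCont_def)
    qed
    have l3: "eventually (\<lambda>w. zor_poly g 0 w = (\<Prod>a\<in>Z'. (w - a) ^ m a) * h w) (at 0)"
      using eventually_at_in_open[OF open_ball, of 0 0 r] r(1) eq by (auto elim: eventually_mono)
    show ?thesis by (rule LIM_unique[OF Lim_transform_eventually[OF l1 l3] l2])
  qed
  have "h 0 \<noteq> 0" using h(1,3) \<rho> by simp
  have "ln (cmod (zor_poly g 0 0)) = ln (cmod (\<Prod>a\<in>Z'. (0 - a) ^ m a)) + ln (cmod (h 0))"
    unfolding lead norm_mult by (rule ln_mult_pos) (use \<open>h 0 \<noteq> 0\<close> Z(1) in \<open>auto simp: Z'_def\<close>)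
  also have "ln (cmod (\<Prod>a\<in>Z'. (0 - a) ^ m a)) = (\<Sum>a\<in>Z'. real (m a) * ln (cmod (0 - a)))"
    by (rule ln_norm_prod_power) (use Z in \<open>auto simp: Z'_def\<close>)
  finally have 2: "ln (cmod (zor_poly g 0 0)) = (\<Sum>a\<in>Z'. real (m a) * ln (cmod a)) + ln (cmod (h 0))" by simp
  have 3: "(\<Sum>a\<in>Z. real (m a) * (if a = 0 then ln \<rho> else ln (\<rho> / cmod a)))
     = (\<Sum>a\<in>Z. real (m a) * ln \<rho>) - (\<Sum>a\<in>Z'. real (m a) * ln (cmod a))"
  proof -
    have "(\<Sum>a\<in>Z'. real (m a) * ln (cmod a)) = (\<Sum>a\<in>Z. if a = 0 then 0 else real (m a) * ln (cmod a))"
      unfolding Z'_def using Z(1) by (intro sum.mono_neutral_cong_left) auto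
    then show ?thesis
      using \<rho> by (simp add: sum_subtractf[symmetric]) (intro sum.cong refl, auto simp: ln_div right_diff_distrib)
  qed
  show ?thesis using 1 2 3 by (simp add: count_fun_def Z_def[symmetric] m_def[symmetric])
qed

lemma ln_ratio_bound:
  fixes x y :: complex
  assumes "y \<noteq> 0" "cmod (x - y) \<le> cmod y / 2"
  shows "\<bar>ln (cmod x) - ln (cmod y)\<bar> \<le> 2 * (cmod (x - y) / cmod y)"
proof -
  define t where "t = cmod (x - y) / cmod y"
  have y: "0 < cmod y" using assms by simp
  have t: "0 \<le> t" "t \<le> 1/2" using assms by (auto simp: t_def field_simps)
  have e: "cmod y * t = cmod (x - y)" using y by (simp add: t_def)
  have lo: "cmod y * (1 - t) \<le> cmod x" using norm_triangle_ineq2[of y "y - x"] e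
    by (simp add: right_diff_distrib norm_minus_commute)
  have hi: "cmod x \<le> cmod y * (1 + t)" using norm_triangle_ineq[of y "x - y"] e by (simp add: distrib_left)
  have x: "0 < cmod x" using lo y t mult_pos_pos[of "cmod y" "1 - t"] by linarith
  have "ln (cmod x) \<le> ln (cmod y * (1 + t))" using hi x y t by (subst ln_le_cancel_iff) auto
  also have "\<dots> = ln (cmod y) + ln (1 + t)" using y t by (simp add: ln_mult_pos)
  also have "ln (1 + t) \<le> t" using t by (simp add: ln_add_one_self_le_self)
  finally have 1: "ln (cmod x) - ln (cmod y) \<le> 2 * t" using t by simp
  have "ln (cmod y) + ln (1 - t) = ln (cmod y * (1 - t))" using y t by (simp add: ln_mult_pos)
  also have "\<dots> \<le> ln (cmod x)" using lo x y t by (subst ln_le_cancel_iff) auto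
  finally have "ln (cmod y) + ln (1 - t) \<le> ln (cmod x)" .
  moreover have "- t - 2 * t\<^sup>2 \<le> ln (1 - t)" using t by (rule ln_one_minus_pos_lower_bound)
  moreover have "2 * t\<^sup>2 \<le> t" using t mult_left_mono[of "2 * t" 1 t] by (simp add: power2_eq_square)
  ultimately have "- (2 * t) \<le> ln (cmod x) - ln (cmod y)" by linarith
  then show ?thesis using 1 unfolding t_def[symmetric] by (simp add: abs_le_iff)
qed

section \<open>Wronskians\<close>

definition wronskian :: "nat \<Rightarrow> (nat \<Rightarrow> complex \<Rightarrow> complex) \<Rightarrow> complex \<Rightarrow> complex" where
  "wronskian n G z = Determinant.det (Matrix.mat n n (\<lambda>(l, i). (deriv ^^ l) (G i) z))"

lemma wronskian_expand:
  "wronskian n G z = (\<Sum>p | p permutes {0..<n}. signof p * (\<Prod>l = 0..<n. (deriv ^^ l) (G (p l)) z))"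
proof -
  have "p l < n" if "p permutes {0..<n}" "l < n" for p l
    using permutes_in_image[OF that(1), of l] that(2) by auto
  then have "(\<Prod>l = 0..<n. Matrix.mat n n (\<lambda>(l, i). (deriv ^^ l) (G i) z) $$ (l, p l))
      = (\<Prod>l = 0..<n. (deriv ^^ l) (G (p l)) z)" if "p permutes {0..<n}" for p
    using that by (intro prod.cong) auto
  then show ?thesis unfolding wronskian_def by (subst det_def') auto
qed

lemma wronskian_cong:
  assumes "open S" "z \<in> S" "\<And>i w. i < n \<Longrightarrow> w \<in> S \<Longrightarrow> G i w = H i w"
  shows "wronskian n G z = wronskian n H z"
proof -
  have "(deriv ^^ l) (G i) z = (deriv ^^ l) (H i) z" if "i < n" for l i
  proof (rule higher_deriv_cong_ev)
    show "eventually (\<lambda>w. G i w = H i w) (nhds z)"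
      using eventually_nhds_in_open[OF assms(1,2)] by eventually_elim (use assms that in auto)
  qed simp
  then show ?thesis unfolding wronskian_def by (intro arg_cong[where f=Determinant.det] eq_matI) auto
qed

text \<open>
  By Leibniz' rule the Wronskian matrix of \<open>h G\<close> is that of \<open>G\<close> multiplied by a lower triangular
  matrix with diagonal entries \<open>h\<close>.
\<close>

lemma wronskian_mult:
  assumes "open S" "z \<in> S" "h holomorphic_on S" "\<And>i. i < n \<Longrightarrow> G i holomorphic_on S"
  shows "wronskian n (\<lambda>i w. h w * G i w) z = h z ^ n * wronskian n G z"
proof -
  define A where "A = Matrix.mat n n (\<lambda>(l, m). if m \<le> l then of_nat (l choose m) * (deriv ^^ (l - m)) h z else 0)"
  define M where "M = Matrix.mat n n (\<lambda>(l, i). (deriv ^^ l) (G i) z)"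
  have A: "A \<in> carrier_mat n n" and M: "M \<in> carrier_mat n n" by (auto simp: A_def M_def)
  have "Matrix.mat n n (\<lambda>(l, i). (deriv ^^ l) (\<lambda>w. h w * G i w) z) = A * M"
  proof (rule eq_matI)
    fix l i assume "l < dim_row (A * M)" "i < dim_col (A * M)"
    then have l: "l < n" and i: "i < n" using A M by auto
    have "(deriv ^^ l) (\<lambda>w. h w * G i w) z = (deriv ^^ l) (\<lambda>w. G i w * h w) z" by (simp add: mult.commute)
    also have "\<dots> = (\<Sum>j = 0..l. of_nat (l choose j) * (deriv ^^ j) (G i) z * (deriv ^^ (l - j)) h z)"
      by (rule higher_deriv_mult[OF _ assms(3,1,2)]) (use assms(4) i in auto)
    also have "\<dots> = (\<Sum>j = 0..<n. (if j \<le> l then of_nat (l choose j) * (deriv ^^ (l - j)) h z else 0) * (deriv ^^ j) (G i) z)"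
      by (intro sum.mono_neutral_cong_left) (use l in auto)
    also have "\<dots> = (A * M) $$ (l, i)"
      using l i by (simp add: A_def M_def scalar_prod_def)
    finally show "Matrix.mat n n (\<lambda>(l, i). (deriv ^^ l) (\<lambda>w. h w * G i w) z) $$ (l, i) = (A * M) $$ (l, i)"
      using l i by simp
  qed (use A M in auto)
  then have "wronskian n (\<lambda>i w. h w * G i w) z = Determinant.det A * Determinant.det M"
    unfolding wronskian_def using det_mult[OF A M] by simp
  also have "Determinant.det A = prod_list (diag_mat A)"
    by (rule det_lower_triangular[OF _ A]) (auto simp: A_def)
  also have "diag_mat A = map (\<lambda>i. h z) [0..<n]"
    unfolding diag_mat_def by (intro map_cong) (auto simp: A_def)
  also have "prod_list (map (\<lambda>i. h z) [0..<n]) = h z ^ n" by (simp add: map_replicate_const)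
  finally show ?thesis by (simp add: wronskian_def M_def)
qed

lemma higher_deriv_linear_combination:
  assumes "open S" "z \<in> S" "finite I" "\<And>j. j \<in> I \<Longrightarrow> G j holomorphic_on S"
  shows "(deriv ^^ l) (\<lambda>w. \<Sum>j\<in>I. c j * G j w) z = (\<Sum>j\<in>I. c j * (deriv ^^ l) (G j) z)"
  using assms(3,4)
proof (induction I rule: finite_induct)
  case (insert i I)
  have "(deriv ^^ l) (\<lambda>w. c i * G i w + (\<Sum>j\<in>I. c j * G j w)) z
    = (deriv ^^ l) (\<lambda>w. c i * G i w) z + (deriv ^^ l) (\<lambda>w. \<Sum>j\<in>I. c j * G j w) z"
    by (rule higher_deriv_add[OF _ _ assms(1,2)]) (use insert in \<open>auto intro!: holomorphic_intros\<close>)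
  also have "(deriv ^^ l) (\<lambda>w. c i * G i w) z = c i * (deriv ^^ l) (G i) z"
    by (rule higher_deriv_cmult[where A=S]) (use assms insert in auto)
  finally show ?case using insert by simp
next
  case empty
  have "(deriv ^^ l) (\<lambda>w. 0) = (\<lambda>w. 0::complex)" by (induction l) auto
  then show ?case by simp
qed

lemma wronskian_linear:
  assumes "open S" "z \<in> S" "\<And>j. j < n \<Longrightarrow> G j holomorphic_on S"
    and "\<And>i w. i < n \<Longrightarrow> w \<in> S \<Longrightarrow> F i w = (\<Sum>j<n. B i j * G j w)"
  shows "wronskian n F z = Determinant.det (Matrix.mat n n (\<lambda>(j, i). B i j)) * wronskian n G z"
proof -
  define M where "M = Matrix.mat n n (\<lambda>(l, i). (deriv ^^ l) (G i) z)"
  define C where "C = Matrix.mat n n (\<lambda>(j, i). B i j)"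
  have C: "C \<in> carrier_mat n n" and M: "M \<in> carrier_mat n n" by (auto simp: C_def M_def)
  have "wronskian n F z = wronskian n (\<lambda>i w. \<Sum>j<n. B i j * G j w) z"
    by (rule wronskian_cong[OF assms(1,2)]) (use assms(4) in auto)
  also have "Matrix.mat n n (\<lambda>(l, i). (deriv ^^ l) (\<lambda>w. \<Sum>j<n. B i j * G j w) z) = M * C"
  proof (rule eq_matI)
    fix l i assume "l < dim_row (M * C)" "i < dim_col (M * C)"
    then have li: "l < n" "i < n" by (auto simp: M_def C_def)
    have "(deriv ^^ l) (\<lambda>w. \<Sum>j<n. B i j * G j w) z = (\<Sum>j<n. B i j * (deriv ^^ l) (G j) z)"
      by (rule higher_deriv_linear_combination[OF assms(1,2)]) (use assms(3) in auto)
    then show "Matrix.mat n n (\<lambda>(l, i). (deriv ^^ l) (\<lambda>w. \<Sum>j<n. B i j * G j w) z) $$ (l, i) = (M * C) $$ (l, i)"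
      using li by (simp add: M_def C_def scalar_prod_def atLeast0LessThan mult.commute)
  qed (auto simp: M_def C_def)
  then have "wronskian n (\<lambda>i w. \<Sum>j<n. B i j * G j w) z = Determinant.det M * Determinant.det C"
    unfolding wronskian_def using det_mult[OF M C] by simp
  finally show ?thesis by (simp add: wronskian_def M_def C_def)
qed

lemma holomorphic_on_wronskian:
  assumes "open S" "\<And>i. i < n \<Longrightarrow> G i holomorphic_on S"
  shows "wronskian n G holomorphic_on S"
proof -
  have h: "(deriv ^^ l) (G i) holomorphic_on S" if "i < n" for l i
    using holomorphic_higher_deriv[OF _ assms(1)] assms(2) that by blast
  have "(\<lambda>z. \<Sum>p | p permutes {0..<n}. signof p * (\<Prod>l = 0..<n. (deriv ^^ l) (G (p l)) z)) holomorphic_on S"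
  proof -
    have "p l < n" if "p permutes {0..<n}" "l < n" for p l
      using permutes_in_image[OF that(1), of l] that(2) by auto
    then show ?thesis by (intro holomorphic_on_sum holomorphic_on_mult holomorphic_on_prod holomorphic_on_const h) auto
  qed
  then show ?thesis by (subst holomorphic_cong[OF refl wronskian_expand]) auto
qed

lemma higher_deriv_vanishing_order:
  assumes "open S" "u holomorphic_on S" "l \<le> m"
  shows "\<exists>v. v holomorphic_on S \<and> (\<forall>w\<in>S. (deriv ^^ l) (\<lambda>w. (w - a) ^ m * u w) w = (w - a) ^ (m - l) * v w)"
  using assms(3)
proof (induction l)
  case 0
  then show ?case using assms(2) by auto
next
  case (Suc l)
  then obtain v where v: "v holomorphic_on S"
    "\<And>w. w \<in> S \<Longrightarrow> (deriv ^^ l) (\<lambda>w. (w - a) ^ m * u w) w = (w - a) ^ (m - l) * v w" by auto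
  define p where "p = m - Suc l"
  have p: "m - l = Suc p" using Suc by (simp add: p_def)
  show ?case
  proof (intro exI conjI ballI)
    show "(\<lambda>w. of_nat (Suc p) * v w + (w - a) * deriv v w) holomorphic_on S"
      by (intro holomorphic_intros v(1) holomorphic_deriv assms(1))
    fix w assume w: "w \<in> S"
    have "(deriv ^^ Suc l) (\<lambda>w. (w - a) ^ m * u w) w = deriv ((deriv ^^ l) (\<lambda>w. (w - a) ^ m * u w)) w" by simp
    also have "\<dots> = deriv (\<lambda>w. (w - a) ^ Suc p * v w) w"
    proof (rule deriv_cong_ev)
      show "eventually (\<lambda>w. (deriv ^^ l) (\<lambda>w. (w - a) ^ m * u w) w = (w - a) ^ Suc p * v w) (nhds w)"
        using eventually_nhds_in_open[OF assms(1) w] by eventually_elim (use v(2) p in auto)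
    qed simp
    also have "\<dots> = (w - a) ^ p * (of_nat (Suc p) * v w + (w - a) * deriv v w)"
    proof (rule DERIV_imp_deriv)
      have "(v has_field_derivative deriv v w) (at w)" using holomorphic_derivI[OF v(1) assms(1) w] .
      moreover have "((\<lambda>w. (w - a) ^ Suc p) has_field_derivative (1 + of_nat p) * (1 * (w - a) ^ p)) (at w)"
        by (rule DERIV_power_Suc) (auto intro!: derivative_eq_intros)
      ultimately have "((\<lambda>w. (w - a) ^ Suc p * v w) has_field_derivative
          (1 + of_nat p) * (1 * (w - a) ^ p) * v w + deriv v w * (w - a) ^ Suc p) (at w)"
        by (intro DERIV_mult)
      then show "((\<lambda>w. (w - a) ^ Suc p * v w) has_field_derivative
          (w - a) ^ p * (of_nat (Suc p) * v w + (w - a) * deriv v w)) (at w)"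
        by (rule DERIV_cong) (simp add: algebra_simps)
    qed
    finally show "(deriv ^^ Suc l) (\<lambda>w. (w - a) ^ m * u w) w
        = (w - a) ^ (m - Suc l) * (of_nat (Suc p) * v w + (w - a) * deriv v w)" by (simp add: p_def)
  qed
qed

text \<open>
  Differentiating lowers an order of vanishing by at most \<open>n - 1\<close> in each column, and every term of
  the determinant takes one factor from each column.
\<close>

lemma wronskian_vanishing_order:
  assumes S: "open S" and u: "\<And>i. i < n \<Longrightarrow> u i holomorphic_on S"
    and G: "\<And>i w. i < n \<Longrightarrow> w \<in> S \<Longrightarrow> G i w = (w - a) ^ m i * u i w"
  shows "\<exists>q. q holomorphic_on S \<and> (\<forall>w\<in>S. wronskian n G w = (w - a) ^ (\<Sum>i<n. m i - (n - 1)) * q w)"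
proof -
  have "\<exists>v. v holomorphic_on S \<and> (\<forall>w\<in>S. (deriv ^^ l) (G i) w = (w - a) ^ (m i - (n - 1)) * v w)"
    if "i < n" "l < n" for i l
  proof -
    have eq: "(deriv ^^ l) (G i) w = (deriv ^^ l) (\<lambda>w. (w - a) ^ m i * u i w) w" if "w \<in> S" for w
    proof (rule higher_deriv_cong_ev)
      show "eventually (\<lambda>w. G i w = (w - a) ^ m i * u i w) (nhds w)"
        using eventually_nhds_in_open[OF S that] by eventually_elim (use G \<open>i < n\<close> in auto)
    qed simp
    show ?thesis
    proof (cases "l \<le> m i")
      case True
      from higher_deriv_vanishing_order[OF S u[OF that(1)] True, of a]
      obtain v where v: "v holomorphic_on S"
        "\<And>w. w \<in> S \<Longrightarrow> (deriv ^^ l) (\<lambda>w. (w - a) ^ m i * u i w) w = (w - a) ^ (m i - l) * v w" by auto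
      have "m i - l = (m i - (n - 1)) + (m i - l - (m i - (n - 1)))" using that True by simp
      then have "(w - a) ^ (m i - l) * v w = (w - a) ^ (m i - (n - 1)) * ((w - a) ^ (m i - l - (m i - (n - 1))) * v w)" for w
        by (metis mult.assoc power_add)
      then show ?thesis using v eq
        by (intro exI[of _ "\<lambda>w. (w - a) ^ (m i - l - (m i - (n - 1))) * v w"]) (auto intro!: holomorphic_intros)
    next
      case False
      then have z: "m i - (n - 1) = 0" using that by simp
      have "G i holomorphic_on S"
        by (subst holomorphic_cong[OF refl G[OF that(1)]]) (auto intro!: holomorphic_intros u that)
      then show ?thesis using z holomorphic_higher_deriv[OF _ S]
        by (intro exI[of _ "(deriv ^^ l) (G i)"]) auto
    qed
  qed
  then obtain v where v: "\<And>i l. i < n \<Longrightarrow> l < n \<Longrightarrow> v i l holomorphic_on S"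
    "\<And>i l w. i < n \<Longrightarrow> l < n \<Longrightarrow> w \<in> S \<Longrightarrow> (deriv ^^ l) (G i) w = (w - a) ^ (m i - (n - 1)) * v i l w"
    by metis
  define q where "q w = (\<Sum>p | p permutes {0..<n}. signof p * (\<Prod>l = 0..<n. v (p l) l w))" for w
  have pn: "p l < n" if "p permutes {0..<n}" "l < n" for p l
    using permutes_in_image[OF that(1), of l] that(2) by auto
  have "q holomorphic_on S" unfolding q_def
    by (intro holomorphic_intros v(1)) (use pn in auto)
  moreover have "wronskian n G w = (w - a) ^ (\<Sum>i<n. m i - (n - 1)) * q w" if w: "w \<in> S" for w
  proof -
    have "wronskian n G w = (\<Sum>p | p permutes {0..<n}. signof p * (\<Prod>l = 0..<n. (deriv ^^ l) (G (p l)) w))"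
      by (rule wronskian_expand)
    also have "\<dots> = (\<Sum>p | p permutes {0..<n}. (w - a) ^ (\<Sum>i<n. m i - (n - 1)) * (signof p * (\<Prod>l = 0..<n. v (p l) l w)))"
    proof (intro sum.cong refl)
      fix p assume "p \<in> {p. p permutes {0..<n}}"
      then have p: "p permutes {0..<n}" by simp
      have "(\<Prod>l = 0..<n. (deriv ^^ l) (G (p l)) w) = (\<Prod>l = 0..<n. (w - a) ^ (m (p l) - (n - 1)) * v (p l) l w)"
        by (intro prod.cong refl v(2)) (use pn[OF p] w in auto)
      also have "\<dots> = (\<Prod>l = 0..<n. (w - a) ^ (m (p l) - (n - 1))) * (\<Prod>l = 0..<n. v (p l) l w)"
        by (rule prod.distrib)
      also have "(\<Prod>l = 0..<n. (w - a) ^ (m (p l) - (n - 1))) = (\<Prod>l = 0..<n. (w - a) ^ (m l - (n - 1)))"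
        using prod.permute[OF p, of "\<lambda>l. (w - a) ^ (m l - (n - 1))"] by (simp add: o_def)
      also have "\<dots> = (w - a) ^ (\<Sum>i<n. m i - (n - 1))" by (simp add: power_sum atLeast0LessThan)
      finally show "signof p * (\<Prod>l = 0..<n. (deriv ^^ l) (G (p l)) w)
        = (w - a) ^ (\<Sum>i<n. m i - (n - 1)) * (signof p * (\<Prod>l = 0..<n. v (p l) l w))" by (simp add: mult_ac)
    qed
    finally show ?thesis by (simp add: q_def sum_distrib_left)
  qed
  ultimately show ?thesis by blast
qed

text \<open>
  The exponent of \<open>Q\<close> is \<open>0 + 1 + \<dots> + (n - 1)\<close>, as every term of the determinant contains one
  derivative of each order.
\<close>

lemma norm_wronskian_le:
  assumes "\<And>i l. i < n \<Longrightarrow> l < n \<Longrightarrow> cmod ((deriv ^^ l) (G i) z) \<le> A i * K * Q ^ l"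
    and "\<And>i. i < n \<Longrightarrow> 0 \<le> A i" "0 \<le> K" "0 \<le> Q"
  shows "cmod (wronskian n G z) \<le> fact n * K ^ n * (\<Prod>i<n. A i) * Q ^ (n * (n - 1) div 2)"
proof -
  have pn: "p l < n" if "p permutes {0..<n}" "l < n" for p l
    using permutes_in_image[OF that(1), of l] that(2) by auto
  have "wronskian n G z = (\<Sum>p | p permutes {0..<n}. signof p * (\<Prod>l = 0..<n. (deriv ^^ l) (G (p l)) z))"
    by (rule wronskian_expand)
  also have "cmod \<dots> \<le> (\<Sum>p | p permutes {0..<n}. K ^ n * (\<Prod>i<n. A i) * Q ^ (n * (n - 1) div 2))"
  proof (rule sum_norm_le)
    fix p assume "p \<in> {p. p permutes {0..<n}}"
    then have p: "p permutes {0..<n}" by simp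
    have "cmod (signof p * (\<Prod>l = 0..<n. (deriv ^^ l) (G (p l)) z)) = (\<Prod>l = 0..<n. cmod ((deriv ^^ l) (G (p l)) z))"
      by (simp add: norm_mult prod_norm sign_def)
    also have "\<dots> \<le> (\<Prod>l = 0..<n. A (p l) * K * Q ^ l)"
      by (intro prod_mono conjI assms(1)) (use pn[OF p] in auto)
    also have "\<dots> = (\<Prod>l = 0..<n. A (p l)) * K ^ n * Q ^ (\<Sum>l = 0..<n. l)"
      by (simp add: prod.distrib power_sum)
    also have "(\<Prod>l = 0..<n. A (p l)) = (\<Prod>l<n. A l)"
      using prod.permute[OF p, of A] by (simp add: o_def atLeast0LessThan)
    also have "(\<Sum>l = 0..<n. l) = n * (n - 1) div 2"
      using gauss_sum_nat[of "n - 1"] by (cases n) (auto simp: atLeast0LessThan lessThan_Suc_atMost atMost_atLeast0)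
    finally show "cmod (signof p * (\<Prod>l = 0..<n. (deriv ^^ l) (G (p l)) z)) \<le> K ^ n * (\<Prod>i<n. A i) * Q ^ (n * (n - 1) div 2)"
      by (simp add: mult_ac)
  qed
  also have "\<dots> = fact n * K ^ n * (\<Prod>i<n. A i) * Q ^ (n * (n - 1) div 2)"
    by (simp add: card_permutations[of _ n])
  finally show ?thesis .
qed

lemma wronskian_one_first:
  assumes "open S" "z \<in> S" "\<And>w. w \<in> S \<Longrightarrow> G 0 w = 1"
  shows "wronskian (Suc n) G z = wronskian n (\<lambda>i. deriv (G (Suc i))) z"
proof -
  define A where "A = Matrix.mat (Suc n) (Suc n) (\<lambda>(l, i). (deriv ^^ l) (G i) z)"
  have A: "A \<in> carrier_mat (Suc n) (Suc n)" by (simp add: A_def)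
  have c0: "(deriv ^^ l) (G 0) z = (if l = 0 then 1 else 0)" for l
  proof -
    have "(deriv ^^ l) (G 0) z = (deriv ^^ l) (\<lambda>w. 1) z"
    proof (rule higher_deriv_cong_ev)
      show "eventually (\<lambda>w. G 0 w = 1) (nhds z)"
        using eventually_nhds_in_open[OF assms(1,2)] by eventually_elim (use assms in auto)
    qed simp
    then show ?thesis by (simp add: higher_deriv_const)
  qed
  have "Determinant.det A = (\<Sum>l<Suc n. A $$ (l, 0) * cofactor A l 0)"
    by (rule laplace_expansion_column[OF A]) simp
  also have "\<dots> = (\<Sum>l<Suc n. if l = 0 then cofactor A l 0 else 0)"
    by (intro sum.cong refl) (auto simp: A_def c0)
  also have "\<dots> = cofactor A 0 0" by (simp add: sum.delta)
  also have "\<dots> = Determinant.det (mat_delete A 0 0)" by (simp add: cofactor_def)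
  also have "mat_delete A 0 0 = Matrix.mat n n (\<lambda>(l, i). (deriv ^^ l) (deriv (G (Suc i))) z)"
    by (rule eq_matI) (auto simp: mat_delete_def A_def funpow_swap1)
  finally show ?thesis by (simp add: wronskian_def A_def)
qed

text \<open>
  Induction on \<open>n\<close>: dividing by the first function makes it constant, and the Wronskian of
  \<open>1, \<phi>_1, \<dots>, \<phi>_n\<close> is that of the derivatives \<open>\<phi>_i'\<close>, which are again independent.
\<close>

theorem wronskian_nonzero:
  assumes "open S" "connected S" "S \<noteq> {}" "\<And>i. i < n \<Longrightarrow> G i holomorphic_on S"
    and indep: "\<And>c. (\<forall>z\<in>S. (\<Sum>i<n. c i * G i z) = 0) \<Longrightarrow> \<forall>i<n. c i = 0"
  shows "\<exists>z\<in>S. wronskian n G z \<noteq> 0"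
  using assms
proof (induction n arbitrary: G S)
  case 0
  then show ?case by (auto simp: wronskian_def Determinant.det_def)
next
  case (Suc n)
  have "\<exists>z\<in>S. G 0 z \<noteq> 0"
  proof (rule ccontr)
    assume "\<not> ?thesis"
    then have "\<forall>z\<in>S. (\<Sum>i<Suc n. (if i = 0 then 1 else 0) * G i z) = 0"
      by (auto simp: sum.delta if_distrib[of "\<lambda>x. x * _"] cong: if_cong)
    from Suc.prems(5)[OF this] show False by auto
  qed
  then obtain z0 where z0: "z0 \<in> S" "G 0 z0 \<noteq> 0" by blast
  have "open {z\<in>S. G 0 z \<noteq> 0}"
  proof -
    have "continuous_on S (G 0)" using Suc.prems(4) holomorphic_on_imp_continuous_on by blast
    then have "open (S \<inter> G 0 -` (- {0}))" using Suc.prems(1) by (intro continuous_open_preimage) auto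
    moreover have "S \<inter> G 0 -` (- {0}) = {z\<in>S. G 0 z \<noteq> 0}" by auto
    ultimately show ?thesis by simp
  qed
  then obtain r where r: "r > 0" "ball z0 r \<subseteq> {z\<in>S. G 0 z \<noteq> 0}" using z0 openE by blast
  define B where "B = ball z0 r"
  have B: "open B" "connected B" "B \<noteq> {}" "B \<subseteq> S" "\<And>z. z \<in> B \<Longrightarrow> G 0 z \<noteq> 0" using r by (auto simp: B_def)
  define \<phi> where "\<phi> i z = G i z / G 0 z" for i z
  have GB: "G i holomorphic_on B" if "i < Suc n" for i using Suc.prems(4)[OF that] B(4) holomorphic_on_subset by blast
  have \<phi>: "\<phi> i holomorphic_on B" if "i < Suc n" for i
    unfolding \<phi>_def using B(5) by (intro holomorphic_intros GB that) auto
  have "\<exists>z\<in>B. wronskian n (\<lambda>i. deriv (\<phi> (Suc i))) z \<noteq> 0"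
  proof (rule Suc.IH[OF B(1,2,3)])
    show "deriv (\<phi> (Suc i)) holomorphic_on B" if "i < n" for i
      using holomorphic_deriv[OF \<phi> B(1)] that by auto
    fix c assume c: "\<forall>z\<in>B. (\<Sum>i<n. c i * deriv (\<phi> (Suc i)) z) = 0"
    define \<Phi> where "\<Phi> z = (\<Sum>i<n. c i * \<phi> (Suc i) z)" for z
    have "(\<Phi> has_field_derivative 0) (at z)" if "z \<in> B" for z
    proof -
      have "(\<Phi> has_field_derivative (\<Sum>i<n. c i * deriv (\<phi> (Suc i)) z)) (at z)"
        unfolding \<Phi>_def by (intro DERIV_sum DERIV_cmult holomorphic_derivI[OF \<phi> B(1) that]) auto
      then show ?thesis using c that by simp
    qed
    then have "\<Phi> constant_on B" using has_field_derivative_0_imp_constant_on[of B \<Phi>] B by blast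
    then obtain C where C: "\<And>z. z \<in> B \<Longrightarrow> \<Phi> z = C" unfolding constant_on_def by blast
    define c' where "c' i = (case i of 0 \<Rightarrow> - C | Suc j \<Rightarrow> c j)" for i
    have B0: "(\<Sum>i<Suc n. c' i * G i z) = 0" if "z \<in> B" for z
    proof -
      have "(\<Sum>i<Suc n. c' i * G i z) = - C * G 0 z + (\<Sum>i<n. c i * G (Suc i) z)"
        by (simp add: sum.lessThan_Suc_shift c'_def del: sum.lessThan_Suc)
      also have "(\<Sum>i<n. c i * G (Suc i) z) = \<Phi> z * G 0 z"
        using B(5)[OF that] by (simp add: \<Phi>_def \<phi>_def sum_distrib_right)
      finally show ?thesis using C[OF that] by simp
    qed
    have "\<forall>z\<in>S. (\<Sum>i<Suc n. c' i * G i z) = 0"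
    proof
      fix z assume z: "z \<in> S"
      have "z0 \<in> B" using r by (simp add: B_def)
      have "z0 islimpt B" using \<open>z0 \<in> B\<close> B(1) by (simp add: open_imp_islimpt)
      show "(\<Sum>i<Suc n. c' i * G i z) = 0"
        by (rule analytic_continuation[of "\<lambda>z. \<Sum>i<Suc n. c' i * G i z" S B z0])
           (use Suc.prems B B0 z z0 \<open>z0 islimpt B\<close> in \<open>auto intro!: holomorphic_intros simp del: sum.lessThan_Suc\<close>)
    qed
    from Suc.prems(5)[OF this] have "\<forall>i<Suc n. c' i = 0" .
    then show "\<forall>i<n. c i = 0" by (auto simp: c'_def dest: spec[of _ "Suc _"])
  qed
  then obtain z where z: "z \<in> B" "wronskian n (\<lambda>i. deriv (\<phi> (Suc i))) z \<noteq> 0" by blast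
  have "wronskian (Suc n) G z = wronskian (Suc n) (\<lambda>i w. G 0 w * \<phi> i w) z"
    by (rule wronskian_cong[OF B(1) z(1)]) (use B(5) in \<open>auto simp: \<phi>_def\<close>)
  also have "\<dots> = G 0 z ^ Suc n * wronskian (Suc n) \<phi> z"
    by (rule wronskian_mult[OF B(1) z(1)]) (use GB \<phi> in auto)
  also have "wronskian (Suc n) \<phi> z = wronskian n (\<lambda>i. deriv (\<phi> (Suc i))) z"
    by (rule wronskian_one_first[OF B(1) z(1)]) (use B(5) in \<open>auto simp: \<phi>_def\<close>)
  finally show ?case using z B by auto
qed

section \<open>Size of the Wronskian\<close>

text \<open>
  In the Poisson--Jensen formula the increment of \<open>ln |g|\<close> from \<open>z\<close> to \<open>w\<close> has, besides the Poisson
  integrals, one contribution from each zero and one from its reflection in the circle. Each group is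
  at most \<open>2 |w - z| Q \<le> 1\<close>, because \<open>Q\<close> dominates both the pole sum at \<open>z\<close> and the number of zeros
  divided by the distance to the circle.
\<close>

lemma log_increment_bound:
  assumes reg: "regular_on_circle g \<rho>" and z: "cmod z < \<rho>" "g z \<noteq> 0" and Q: "0 < Q"
    and sum: "(\<Sum>a | cmod a < \<rho> \<and> g a = 0. real (nat (zorder g a)) / cmod (z - a)) \<le> Q"
    and num: "(\<Sum>a | cmod a < \<rho> \<and> g a = 0. real (nat (zorder g a))) \<le> Q * (\<rho> - cmod z)"
    and Q\<delta>: "1 \<le> Q * (\<rho> - cmod z)"
    and w: "cmod (w - z) \<le> 1 / (2 * Q)"
  defines "PI \<equiv> \<lambda>w. circle_mean \<rho> (\<lambda>\<zeta>. ln (cmod (g \<zeta>)) * Re ((\<zeta> + w) / (\<zeta> - w)))"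
  shows "cmod w < \<rho>" "g w \<noteq> 0" "\<bar>(ln (cmod (g w)) - ln (cmod (g z))) - (PI w - PI z)\<bar> \<le> 2"
proof -
  define Z where "Z = {a. cmod a < \<rho> \<and> g a = 0}"
  define m where "m a = nat (zorder g a)" for a
  define s where "s = cmod (w - z)"
  define \<delta> where "\<delta> = \<rho> - cmod z"
  have \<rho>: "0 < \<rho>" and fin: "finite Z" using regular_on_circleD[OF reg] by (auto simp: Z_def)
  have \<delta>: "0 < \<delta>" using z by (simp add: \<delta>_def)
  have s: "0 \<le> s" "2 * s * Q \<le> 1" using w Q by (auto simp: s_def field_simps)
  have s\<delta>: "2 * s \<le> \<delta>"
  proof -
    have "2 * s * 1 \<le> 2 * s * (Q * \<delta>)" using Q\<delta> s by (intro mult_left_mono) (auto simp: \<delta>_def)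
    also have "\<dots> = (2 * s * Q) * \<delta>" by simp
    also have "\<dots> \<le> 1 * \<delta>" using s \<delta> by (intro mult_right_mono) auto
    finally show ?thesis by simp
  qed
  have m1: "1 \<le> real (m a)" if "a \<in> Z" for a
    using zorder_pos_at_zero[OF reg, of a] that by (auto simp: Z_def m_def)
  have az: "a \<noteq> z" if "a \<in> Z" for a using that z by (auto simp: Z_def)
  have sa: "2 * s \<le> cmod (z - a)" if a: "a \<in> Z" for a
  proof -
    have "1 / cmod (z - a) \<le> real (m a) / cmod (z - a)" using m1[OF a] by (simp add: divide_right_mono)
    also have "\<dots> \<le> (\<Sum>a\<in>Z. real (m a) / cmod (z - a))"
      by (rule member_le_sum[OF a]) (use fin in auto)
    also have "\<dots> \<le> Q" using sum by (simp add: Z_def m_def)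
    finally have q: "1 \<le> Q * cmod (z - a)" using az[OF a] by (simp add: field_simps)
    have "2 * s * 1 \<le> 2 * s * (Q * cmod (z - a))" using q s by (intro mult_left_mono) auto
    also have "\<dots> = (2 * s * Q) * cmod (z - a)" by simp
    also have "\<dots> \<le> 1 * cmod (z - a)" using s by (intro mult_right_mono) auto
    finally show ?thesis by simp
  qed
  show wr: "cmod w < \<rho>" using norm_triangle_ineq[of z "w - z"] s\<delta> \<delta> s by (simp add: s_def[symmetric] \<delta>_def)
  show gw: "g w \<noteq> 0"
  proof
    assume "g w = 0"
    then have "w \<in> Z" using wr by (simp add: Z_def)
    from sa[OF this] az[OF this] show False by (simp add: s_def norm_minus_commute)
  qed
  define A where "A a = ln (cmod (w - a)) - ln (cmod (z - a))" for a
  define B where "B a = ln (cmod (of_real (\<rho>\<^sup>2) - cnj a * w)) - ln (cmod (of_real (\<rho>\<^sup>2) - cnj a * z))" for a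
  have A: "\<bar>A a\<bar> \<le> 2 * s / cmod (z - a)" if "a \<in> Z" for a
    using ln_ratio_bound[of "z - a" "w - a"] az[OF that] sa[OF that] by (simp add: A_def s_def)
  have low: "\<rho> * \<delta> \<le> cmod (of_real (\<rho>\<^sup>2) - cnj a * z)" if "a \<in> Z" for a
  proof -
    have "cmod a * cmod z \<le> \<rho> * cmod z" using that by (intro mult_right_mono) (auto simp: Z_def)
    moreover have "cmod (of_real (\<rho>\<^sup>2)) - cmod (cnj a * z) \<le> cmod (of_real (\<rho>\<^sup>2) - cnj a * z)"
      by (rule norm_triangle_ineq2)
    moreover have "cmod (of_real (\<rho>\<^sup>2)) = \<rho>\<^sup>2" by (simp only: norm_of_real) simp
    ultimately show ?thesis by (simp add: \<delta>_def norm_mult algebra_simps power2_eq_square)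
  qed
  have Bnz: "of_real (\<rho>\<^sup>2) - cnj a * w \<noteq> 0" "of_real (\<rho>\<^sup>2) - cnj a * z \<noteq> 0"
    and B: "\<bar>B a\<bar> \<le> 2 * s / \<delta>" if "a \<in> Z" for a
  proof -
    have p: "0 < \<rho> * \<delta>" using \<rho> \<delta> by simp
    show nz: "of_real (\<rho>\<^sup>2) - cnj a * z \<noteq> 0" using low[OF that] p by auto
    have d: "cmod ((of_real (\<rho>\<^sup>2) - cnj a * w) - (of_real (\<rho>\<^sup>2) - cnj a * z)) \<le> \<rho> * s"
    proof -
      have "(of_real (\<rho>\<^sup>2) - cnj a * w) - (of_real (\<rho>\<^sup>2) - cnj a * z) = - (cnj a * (w - z))" by (simp add: algebra_simps)
      then have "cmod ((of_real (\<rho>\<^sup>2) - cnj a * w) - (of_real (\<rho>\<^sup>2) - cnj a * z)) = cmod a * s"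
        by (simp only: norm_minus_cancel norm_mult complex_mod_cnj s_def)
      also have "\<dots> \<le> \<rho> * s" using that s by (intro mult_right_mono) (auto simp: Z_def)
      finally show ?thesis .
    qed
    have d2: "\<rho> * s \<le> cmod (of_real (\<rho>\<^sup>2) - cnj a * z) / 2"
    proof -
      have "\<rho> * (2 * s) \<le> \<rho> * \<delta>" using s\<delta> \<rho> by (intro mult_left_mono) auto
      then show ?thesis using low[OF that] by linarith
    qed
    show "of_real (\<rho>\<^sup>2) - cnj a * w \<noteq> 0"
    proof
      assume "of_real (\<rho>\<^sup>2) - cnj a * w = 0"
      then have "cmod (of_real (\<rho>\<^sup>2) - cnj a * z) \<le> \<rho> * s" using d by (simp add: norm_minus_commute)
      then show False using d2 low[OF that] p by simp
    qed
    have "\<bar>B a\<bar> \<le> 2 * (cmod ((of_real (\<rho>\<^sup>2) - cnj a * w) - (of_real (\<rho>\<^sup>2) - cnj a * z)) / cmod (of_real (\<rho>\<^sup>2) - cnj a * z))"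
      unfolding B_def by (rule ln_ratio_bound[OF nz]) (use d d2 in linarith)
    also have "\<dots> \<le> 2 * ((\<rho> * s) / (\<rho> * \<delta>))"
      by (intro mult_left_mono frac_le d low[OF that] p) (use \<rho> s in auto)
    finally show "\<bar>B a\<bar> \<le> 2 * s / \<delta>" using \<rho> by simp
  qed
  have "(ln (cmod (g w)) - ln (cmod (g z))) - (PI w - PI z) = (\<Sum>a\<in>Z. real (m a) * (A a - B a))"
  proof -
    have "real (m a) * (A a - B a) = real (m a) * (ln (cmod (w - a)) - ln (cmod (of_real (\<rho>\<^sup>2) - cnj a * w) / \<rho>)) -
      real (m a) * (ln (cmod (z - a)) - ln (cmod (of_real (\<rho>\<^sup>2) - cnj a * z) / \<rho>))" if "a \<in> Z" for a
      using \<rho> Bnz[OF that] unfolding A_def B_def by (simp only: ln_div zero_less_norm_iff) (simp add: ln_div algebra_simps)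
    then have "(\<Sum>a\<in>Z. real (m a) * (A a - B a)) = (\<Sum>a\<in>Z. real (m a) * (ln (cmod (w - a)) - ln (cmod (of_real (\<rho>\<^sup>2) - cnj a * w) / \<rho>))) -
      (\<Sum>a\<in>Z. real (m a) * (ln (cmod (z - a)) - ln (cmod (of_real (\<rho>\<^sup>2) - cnj a * z) / \<rho>)))"
      by (simp add: sum_subtractf[symmetric])
    then show ?thesis using poisson_jensen[OF reg wr gw] poisson_jensen[OF reg z]
      unfolding PI_def Z_def m_def by linarith
  qed
  also have "\<bar>\<dots>\<bar> \<le> (\<Sum>a\<in>Z. real (m a) * (2 * s / cmod (z - a) + 2 * s / \<delta>))"
  proof (rule order_trans[OF sum_abs], rule sum_mono)
    fix a assume a: "a \<in> Z"
    have "\<bar>A a - B a\<bar> \<le> 2 * s / cmod (z - a) + 2 * s / \<delta>" using A[OF a] B[OF a] by linarith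
    then show "\<bar>real (m a) * (A a - B a)\<bar> \<le> real (m a) * (2 * s / cmod (z - a) + 2 * s / \<delta>)"
      by (simp only: abs_mult abs_of_nat) (intro mult_left_mono, auto)
  qed
  also have "\<dots> = 2 * s * (\<Sum>a\<in>Z. real (m a) / cmod (z - a)) + 2 * s / \<delta> * (\<Sum>a\<in>Z. real (m a))"
    by (simp add: distrib_left sum.distrib sum_distrib_left sum_divide_distrib mult_ac)
  also have "\<dots> \<le> 2 * s * Q + 2 * s / \<delta> * (Q * \<delta>)"
    using sum num s \<delta> by (intro add_mono mult_left_mono) (auto simp: Z_def m_def \<delta>_def)
  also have "\<dots> \<le> 2" using s \<delta> by (simp add: mult_ac)
  finally show "\<bar>(ln (cmod (g w)) - ln (cmod (g z))) - (PI w - PI z)\<bar> \<le> 2" .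
qed

text \<open>
  The zeros of \<open>g\<close> and of \<open>g0\<close> contribute at most \<open>2\<close> each by the preceding lemma. The difference of
  the Poisson kernels at \<open>z\<close> and \<open>w\<close> is of order \<open>\<rho> |w - z| / (\<rho> - |z|)\<^sup>2\<close>, so the proximity
  hypothesis bounds the remaining integral by \<open>1\<close>.
\<close>

lemma quotient_increment_bound:
  assumes reg: "regular_on_circle g \<rho>" "regular_on_circle g0 \<rho>"
    and z: "cmod z < \<rho>" "g z \<noteq> 0" "g0 z \<noteq> 0" and Q: "0 < Q"
    and sum: "(\<Sum>a | cmod a < \<rho> \<and> g a = 0. real (nat (zorder g a)) / cmod (z - a)) \<le> Q"
             "(\<Sum>a | cmod a < \<rho> \<and> g0 a = 0. real (nat (zorder g0 a)) / cmod (z - a)) \<le> Q"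
    and num: "(\<Sum>a | cmod a < \<rho> \<and> g a = 0. real (nat (zorder g a))) \<le> Q * (\<rho> - cmod z)"
             "(\<Sum>a | cmod a < \<rho> \<and> g0 a = 0. real (nat (zorder g0 a))) \<le> Q * (\<rho> - cmod z)"
    and Q\<delta>: "1 \<le> Q * (\<rho> - cmod z)"
    and prox: "4 * \<rho> * circle_mean \<rho> (\<lambda>\<zeta>. \<bar>ln (cmod (g \<zeta>)) - ln (cmod (g0 \<zeta>))\<bar>) \<le> Q * (\<rho> - cmod z)\<^sup>2"
    and w: "cmod (w - z) \<le> 1 / (2 * Q)"
  shows "cmod w < \<rho>" "g0 w \<noteq> 0" "cmod (g w / g0 w) \<le> exp 5 * cmod (g z / g0 z)"
proof -
  note i1 = log_increment_bound[OF reg(1) z(1,2) Q sum(1) num(1) Q\<delta> w]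
  note i2 = log_increment_bound[OF reg(2) z(1,3) Q sum(2) num(2) Q\<delta> w]
  show wr: "cmod w < \<rho>" and nz: "g0 w \<noteq> 0" using i1(1) i2(2) by auto
  define s where "s = cmod (w - z)"
  define \<delta> where "\<delta> = \<rho> - cmod z"
  have \<rho>: "0 < \<rho>" using regular_on_circleD(1)[OF reg(1)] .
  have \<delta>: "0 < \<delta>" using z by (simp add: \<delta>_def)
  have s: "0 \<le> s" "2 * s * Q \<le> 1" using w Q by (auto simp: s_def field_simps)
  have s\<delta>: "2 * s \<le> \<delta>"
  proof -
    have "2 * s * 1 \<le> 2 * s * (Q * \<delta>)" using Q\<delta> s by (intro mult_left_mono) (auto simp: \<delta>_def)
    also have "\<dots> = (2 * s * Q) * \<delta>" by simp
    also have "\<dots> \<le> 1 * \<delta>" using s \<delta> by (intro mult_right_mono) auto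
    finally show ?thesis by simp
  qed
  define k where "k u \<zeta> = Re ((\<zeta> + u) / (\<zeta> - u))" for u \<zeta> :: complex
  define u where "u \<zeta> = ln (cmod (g \<zeta>)) - ln (cmod (g0 \<zeta>))" for \<zeta>
  note cg = regular_on_circleD(6)[OF reg(1)] regular_on_circleD(6)[OF reg(2)]
  have cu: "continuous_on (sphere 0 \<rho>) u" unfolding u_def by (intro continuous_intros cg)
  have ck: "continuous_on (sphere 0 \<rho>) (k w)" "continuous_on (sphere 0 \<rho>) (k z)"
    unfolding k_def using continuous_on_poisson_kernel wr z by auto
  define D where "D = circle_mean \<rho> (\<lambda>\<zeta>. u \<zeta> * (k w \<zeta> - k z \<zeta>))"
  have Deq: "circle_mean \<rho> (\<lambda>\<zeta>. ln (cmod (g \<zeta>)) * k w \<zeta>) - circle_mean \<rho> (\<lambda>\<zeta>. ln (cmod (g \<zeta>)) * k z \<zeta>)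
     - (circle_mean \<rho> (\<lambda>\<zeta>. ln (cmod (g0 \<zeta>)) * k w \<zeta>) - circle_mean \<rho> (\<lambda>\<zeta>. ln (cmod (g0 \<zeta>)) * k z \<zeta>)) = D"
  proof -
    have "D = circle_mean \<rho> (\<lambda>\<zeta>. (ln (cmod (g \<zeta>)) * k w \<zeta> - ln (cmod (g \<zeta>)) * k z \<zeta>) - (ln (cmod (g0 \<zeta>)) * k w \<zeta> - ln (cmod (g0 \<zeta>)) * k z \<zeta>))"
      unfolding D_def u_def by (simp add: algebra_simps)
    then show ?thesis using \<rho>
      by (simp add: circle_mean_diff continuous_on_diff continuous_on_mult cg ck)
  qed
  have kdiff: "\<bar>k w \<zeta> - k z \<zeta>\<bar> \<le> 4 * \<rho> * s / \<delta>\<^sup>2" if "cmod \<zeta> = \<rho>" for \<zeta>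
  proof -
    have d1: "\<delta> \<le> cmod (\<zeta> - z)" using norm_triangle_ineq2[of \<zeta> z] that by (simp add: \<delta>_def)
    have d2: "\<delta> / 2 \<le> cmod (\<zeta> - w)"
    proof -
      have "cmod (\<zeta> - z) \<le> cmod (\<zeta> - w) + s" using norm_triangle_ineq[of "\<zeta> - w" "w - z"] by (simp add: s_def)
      then show ?thesis using d1 s\<delta> by simp
    qed
    have ne: "\<zeta> \<noteq> w" "\<zeta> \<noteq> z" using d1 d2 \<delta> by auto
    have "(\<zeta> + w) / (\<zeta> - w) - (\<zeta> + z) / (\<zeta> - z) = 2 * \<zeta> * (w - z) / ((\<zeta> - w) * (\<zeta> - z))"
      using ne by (simp add: field_simps)
    then have "k w \<zeta> - k z \<zeta> = Re (2 * \<zeta> * (w - z) / ((\<zeta> - w) * (\<zeta> - z)))" by (simp add: k_def flip: minus_complex.sel)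
    also have "\<bar>\<dots>\<bar> \<le> cmod (2 * \<zeta> * (w - z) / ((\<zeta> - w) * (\<zeta> - z)))" by (rule abs_Re_le_cmod)
    also have "\<dots> = 2 * \<rho> * s / (cmod (\<zeta> - w) * cmod (\<zeta> - z))" by (simp add: norm_mult norm_divide that s_def)
    also have "\<dots> \<le> 2 * \<rho> * s / (\<delta> / 2 * \<delta>)"
      using d1 d2 \<delta> \<rho> s by (intro divide_left_mono mult_mono mult_pos_pos) (auto intro: mult_pos_pos)
    finally show ?thesis by (simp add: power2_eq_square)
  qed
  have "D \<le> circle_mean \<rho> (\<lambda>\<zeta>. 4 * \<rho> * s / \<delta>\<^sup>2 * \<bar>u \<zeta>\<bar>)"
    unfolding D_def
  proof (rule circle_mean_mono)
    fix \<zeta> :: complex assume "cmod \<zeta> = \<rho>"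
    have "u \<zeta> * (k w \<zeta> - k z \<zeta>) \<le> \<bar>u \<zeta>\<bar> * \<bar>k w \<zeta> - k z \<zeta>\<bar>" by (simp flip: abs_mult)
    also have "\<dots> \<le> \<bar>u \<zeta>\<bar> * (4 * \<rho> * s / \<delta>\<^sup>2)" by (intro mult_left_mono kdiff abs_ge_zero) fact
    finally show "u \<zeta> * (k w \<zeta> - k z \<zeta>) \<le> 4 * \<rho> * s / \<delta>\<^sup>2 * \<bar>u \<zeta>\<bar>" by (simp add: mult.commute)
  next
    show "continuous_on (sphere 0 \<rho>) (\<lambda>\<zeta>. 4 * \<rho> * s / \<delta>\<^sup>2 * \<bar>u \<zeta>\<bar>)"
      by (intro continuous_on_mult continuous_on_const continuous_on_rabs cu)
    show "continuous_on (sphere 0 \<rho>) (\<lambda>\<zeta>. u \<zeta> * (k w \<zeta> - k z \<zeta>))"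
      by (intro continuous_on_mult continuous_on_diff cu ck)
  qed (use \<rho> in simp)
  also have "\<dots> = s / \<delta>\<^sup>2 * (4 * \<rho> * circle_mean \<rho> (\<lambda>\<zeta>. \<bar>u \<zeta>\<bar>))" by (subst circle_mean_cmult) simp
  also have "\<dots> \<le> s / \<delta>\<^sup>2 * (Q * \<delta>\<^sup>2)"
    using prox s by (intro mult_left_mono) (auto simp: u_def \<delta>_def)
  also have "\<dots> = s * Q" using \<delta> by simp
  also have "\<dots> \<le> 1" using s by simp
  finally have D: "D \<le> 1" .
  have "(ln (cmod (g w)) - ln (cmod (g0 w))) - (ln (cmod (g z)) - ln (cmod (g0 z))) \<le> 5"
    using i1(3) i2(3) D Deq unfolding k_def by linarith
  then have "ln (cmod (g w)) - ln (cmod (g0 w)) \<le> 5 + (ln (cmod (g z)) - ln (cmod (g0 z)))" by simp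
  moreover have "ln (cmod (g w / g0 w)) = ln (cmod (g w)) - ln (cmod (g0 w))"
    using i1(2) nz by (simp add: norm_divide ln_div)
  moreover have "ln (exp 5 * cmod (g z / g0 z)) = 5 + (ln (cmod (g z)) - ln (cmod (g0 z)))"
    using z by (simp add: norm_divide ln_mult_pos ln_div)
  ultimately have "ln (cmod (g w / g0 w)) \<le> ln (exp 5 * cmod (g z / g0 z))" by simp
  then show "cmod (g w / g0 w) \<le> exp 5 * cmod (g z / g0 z)"
    using i1(2) nz z by (subst (asm) ln_le_cancel_iff) auto
qed

text \<open>
  The quotients \<open>G_i / G_0\<close> stay within a factor \<open>exp 5\<close> of their values at \<open>z\<close> on the disc of radius
  \<open>1 / (2 Q)\<close>, so Cauchy's estimate bounds their \<open>l\<close>-th derivatives by multiples of \<open>(2 Q)^l\<close>. This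
  takes the place of the lemma on the logarithmic derivative.
\<close>

lemma norm_wronskian_le_log_derivative:
  assumes n: "0 < n" and reg: "\<And>i. i < n \<Longrightarrow> regular_on_circle (G i) \<rho>"
    and z: "cmod z < \<rho>" "\<And>i. i < n \<Longrightarrow> G i z \<noteq> 0" and Q: "0 < Q"
    and sum: "\<And>i. i < n \<Longrightarrow> (\<Sum>a | cmod a < \<rho> \<and> G i a = 0. real (nat (zorder (G i) a)) / cmod (z - a)) \<le> Q"
    and num: "\<And>i. i < n \<Longrightarrow> (\<Sum>a | cmod a < \<rho> \<and> G i a = 0. real (nat (zorder (G i) a))) \<le> Q * (\<rho> - cmod z)"
    and Q\<delta>: "1 \<le> Q * (\<rho> - cmod z)"
    and prox: "\<And>i. i < n \<Longrightarrow> 4 * \<rho> * circle_mean \<rho> (\<lambda>\<zeta>. \<bar>ln (cmod (G i \<zeta>)) - ln (cmod (G 0 \<zeta>))\<bar>) \<le> Q * (\<rho> - cmod z)\<^sup>2"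
  shows "cmod (wronskian n G z) \<le> fact n * (fact n * exp 5) ^ n * (\<Prod>i<n. cmod (G i z)) * (2 * Q) ^ (n * (n - 1) div 2)"
proof -
  define s where "s = 1 / (2 * Q)"
  have s: "0 < s" using Q by (simp add: s_def)
  define \<phi> where "\<phi> i w = G i w / G 0 w" for i w
  define U where "U = {w\<in>ball 0 \<rho>. G 0 w \<noteq> 0}"
  have bound: "cmod w < \<rho>" "G 0 w \<noteq> 0" "cmod (\<phi> i w) \<le> exp 5 * cmod (\<phi> i z)"
    if "i < n" "cmod (w - z) \<le> s" for i w
    using quotient_increment_bound[OF reg[OF that(1)] reg[OF n] z(1) z(2)[OF that(1)] z(2)[OF n] Q sum[OF that(1)] sum[OF n]
      num[OF that(1)] num[OF n] Q\<delta> prox[OF that(1)], of w] that(2) by (auto simp: s_def \<phi>_def)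
  have sub: "cball z s \<subseteq> U" using bound(1,2)[OF n] by (auto simp: U_def dist_norm norm_minus_commute)
  have hol: "G i holomorphic_on ball 0 \<rho>" if "i < n" for i using regular_on_circleD(5)[OF reg[OF that]] .
  have \<phi>U: "\<phi> i holomorphic_on U" if "i < n" for i unfolding \<phi>_def
    by (intro holomorphic_intros holomorphic_on_subset[OF hol] that n) (auto simp: U_def)
  have "G 0 w \<noteq> 0" if "w \<in> ball z s" for w
  proof -
    have "w \<in> U" using that sub ball_subset_cball[of z s] by blast
    then show ?thesis by (simp add: U_def)
  qed
  then have "wronskian n G z = wronskian n (\<lambda>i w. G 0 w * \<phi> i w) z"
    by (intro wronskian_cong[OF open_ball[of z s]]) (use s in \<open>auto simp: \<phi>_def\<close>)
  also have "\<dots> = G 0 z ^ n * wronskian n \<phi> z"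
  proof (rule wronskian_mult[OF open_ball[of z s]])
    show "G 0 holomorphic_on ball z s"
    proof (rule holomorphic_on_subset[OF hol[OF n]])
      have "U \<subseteq> ball 0 \<rho>" by (auto simp: U_def)
      then show "ball z s \<subseteq> ball 0 \<rho>" using sub ball_subset_cball[of z s] by blast
    qed
    show "\<phi> i holomorphic_on ball z s" if "i < n" for i
      by (rule holomorphic_on_subset[OF \<phi>U[OF that]]) (use sub ball_subset_cball[of z s] in blast)
  qed (use s in auto)
  finally have W: "wronskian n G z = G 0 z ^ n * wronskian n \<phi> z" .
  have der: "cmod ((deriv ^^ l) (\<phi> i) z) \<le> cmod (\<phi> i z) * (fact n * exp 5) * (2 * Q) ^ l" if "i < n" "l < n" for i l
  proof -
    have "cmod ((deriv ^^ l) (\<phi> i) z) \<le> fact l * (exp 5 * cmod (\<phi> i z)) / s ^ l"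
    proof (rule Cauchy_inequality)
      show "\<phi> i holomorphic_on ball z s"
        by (rule holomorphic_on_subset[OF \<phi>U[OF that(1)]]) (use sub ball_subset_cball[of z s] in blast)
      show "continuous_on (cball z s) (\<phi> i)"
        by (rule continuous_on_subset[OF holomorphic_on_imp_continuous_on[OF \<phi>U[OF that(1)]] sub])
      show "cmod (\<phi> i x) \<le> exp 5 * cmod (\<phi> i z)" if "cmod (z - x) = s" for x
        using bound(3)[OF \<open>i < n\<close>, of x] that by (simp add: norm_minus_commute)
    qed (rule s)
    also have "\<dots> = fact l * (exp 5 * cmod (\<phi> i z) * (2 * Q) ^ l)" using Q by (simp add: s_def power_divide field_simps)
    also have "\<dots> \<le> fact n * (exp 5 * cmod (\<phi> i z) * (2 * Q) ^ l)"
      using that(2) Q by (intro mult_right_mono fact_mono) auto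
    finally show ?thesis by (simp add: mult_ac)
  qed
  have "cmod (wronskian n \<phi> z) \<le> fact n * (fact n * exp 5) ^ n * (\<Prod>i<n. cmod (\<phi> i z)) * (2 * Q) ^ (n * (n - 1) div 2)"
    by (rule norm_wronskian_le[OF der]) (use Q in auto)
  then have "cmod (wronskian n G z) \<le> cmod (G 0 z) ^ n * (fact n * (fact n * exp 5) ^ n * (\<Prod>i<n. cmod (\<phi> i z)) * (2 * Q) ^ (n * (n - 1) div 2))"
    unfolding W norm_mult norm_power by (rule mult_left_mono) simp
  also have "\<dots> = fact n * (fact n * exp 5) ^ n * (cmod (G 0 z) ^ n * (\<Prod>i<n. cmod (\<phi> i z))) * (2 * Q) ^ (n * (n - 1) div 2)"
    by (simp add: mult_ac)
  also have "cmod (G 0 z) ^ n * (\<Prod>i<n. cmod (\<phi> i z)) = (\<Prod>i<n. cmod (G i z))"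
    using z(2)[OF n] by (simp add: \<phi>_def norm_divide prod_dividef)
  finally show ?thesis .
qed

lemma continuous_on_ln_pole_sum:
  assumes X: "0 < X" and I: "finite I" "\<And>i. i \<in> I \<Longrightarrow> cmod (p i) \<noteq> r"
  shows "continuous_on (sphere 0 r) (\<lambda>z. ln (X + (\<Sum>i\<in>I. real (m i) / cmod (z - p i))))"
proof (intro continuous_on_ln continuous_on_add continuous_on_const continuous_on_sum)
  show "continuous_on (sphere 0 r) (\<lambda>z. real (m i) / cmod (z - p i))" if "i \<in> I" for i
    using I(2)[OF that] by (auto intro!: continuous_intros)
  have "0 < X + (\<Sum>i\<in>I. real (m i) / cmod (z - p i))" for z
    using X by (intro add_pos_nonneg sum_nonneg) auto
  then show "\<forall>z\<in>sphere 0 r. X + (\<Sum>i\<in>I. real (m i) / cmod (z - p i)) \<noteq> 0"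
    by (metis less_irrefl)
qed

text \<open>
  Subadditivity of the square root gives \<open>ln Q = 2 ln \<surd>Q \<le> 2 ln Y\<close>, where \<open>Y\<close> is a sum of terms
  \<open>m / \<surd>|z - p|\<close> whose circle means are bounded uniformly in \<open>p\<close>; then concavity applies. Without
  the square root the means of the single poles would be unbounded.
\<close>

lemma circle_mean_ln_pole_sum_le:
  assumes K: "\<And>r a. 0 < r \<Longrightarrow> cmod a \<noteq> r \<Longrightarrow> circle_mean r (\<lambda>z. 1 / sqrt (cmod (z - a))) \<le> K / sqrt r"
    and r: "0 < r" and X: "0 < X" and I: "finite I" "\<And>i. i \<in> I \<Longrightarrow> cmod (p i) \<noteq> r"
  shows "circle_mean r (\<lambda>z. ln (X + (\<Sum>i\<in>I. real (m i) / cmod (z - p i))))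
      \<le> 2 * ln (sqrt X + K / sqrt r * (\<Sum>i\<in>I. real (m i)))"
proof -
  define Y where "Y z = sqrt X + (\<Sum>i\<in>I. real (m i) * (1 / sqrt (cmod (z - p i))))" for z
  have c2: "continuous_on (sphere 0 r) (\<lambda>z. 1 / sqrt (cmod (z - p i)))" if "i \<in> I" for i
    using I(2)[OF that] by (auto intro!: continuous_intros)
  have cY: "continuous_on (sphere 0 r) Y" unfolding Y_def
    by (intro continuous_on_add continuous_on_const continuous_on_sum continuous_on_mult c2)
  have Qpos: "0 < X + (\<Sum>i\<in>I. real (m i) / cmod (z - p i))" for z
    using X by (intro add_pos_nonneg sum_nonneg) auto
  have Ypos: "0 < Y z" for z unfolding Y_def
    using X by (intro add_pos_nonneg sum_nonneg) auto
  note cQ = continuous_on_ln_pole_sum[of X I p r m, OF X I]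
  have "circle_mean r (\<lambda>z. ln (X + (\<Sum>i\<in>I. real (m i) / cmod (z - p i)))) \<le> circle_mean r (\<lambda>z. 2 * ln (Y z))"
  proof (rule circle_mean_mono[OF cQ])
    show "continuous_on (sphere 0 r) (\<lambda>z. 2 * ln (Y z))"
      by (intro continuous_intros cY) (use Ypos in \<open>auto simp: less_imp_neq[symmetric]\<close>)
    fix z :: complex assume "cmod z = r"
    have sq: "sqrt (a + (\<Sum>i\<in>A. b i)) \<le> sqrt a + (\<Sum>i\<in>A. sqrt (b i))" if "finite A" "0 \<le> a" "\<And>i. 0 \<le> b i" for a A and b :: "_ \<Rightarrow> real"
      using that(1)
    proof (induction A rule: finite_induct)
      case (insert x A)
      have "sqrt ((a + sum b A) + b x) \<le> sqrt (a + sum b A) + sqrt (b x)"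
        by (rule sqrt_add_le_add_sqrt) (use that in \<open>auto intro!: add_nonneg_nonneg sum_nonneg\<close>)
      then show ?case using insert by (simp add: add_ac)
    qed simp
    have "sqrt (X + (\<Sum>i\<in>I. real (m i) / cmod (z - p i))) \<le> sqrt X + (\<Sum>i\<in>I. sqrt (real (m i) / cmod (z - p i)))"
      by (rule sq) (use I X in auto)
    also have "\<dots> \<le> Y z" unfolding Y_def
    proof (intro add_left_mono sum_mono)
      fix i
      have "sqrt (real (m i)) \<le> real (m i)"
      proof (cases "m i = 0")
        case False
        then have "real (m i) \<le> (real (m i))\<^sup>2" by (simp add: power2_eq_square)
        then show ?thesis by (simp add: real_le_lsqrt)
      qed simp
      then show "sqrt (real (m i) / cmod (z - p i)) \<le> real (m i) * (1 / sqrt (cmod (z - p i)))"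
        by (simp add: real_sqrt_divide divide_right_mono)
    qed
    finally have "ln (sqrt (X + (\<Sum>i\<in>I. real (m i) / cmod (z - p i)))) \<le> ln (Y z)"
      using Qpos[of z] Ypos[of z] by (subst ln_le_cancel_iff) auto
    then show "ln (X + (\<Sum>i\<in>I. real (m i) / cmod (z - p i))) \<le> 2 * ln (Y z)"
      using Qpos[of z] by (simp add: ln_sqrt)
  qed (use r in auto)
  also have "\<dots> = 2 * circle_mean r (\<lambda>z. ln (Y z))" by (rule circle_mean_cmult)
  also have "\<dots> \<le> 2 * ln (circle_mean r Y)"
    using circle_mean_ln_le(2)[OF cY] Ypos r by simp
  also have "circle_mean r Y = sqrt X + (\<Sum>i\<in>I. real (m i) * circle_mean r (\<lambda>z. 1 / sqrt (cmod (z - p i))))"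
    unfolding Y_def
    by (subst circle_mean_add, simp, intro continuous_on_sum continuous_on_mult continuous_on_const c2, assumption, use r in simp,
        subst circle_mean_sum[OF I(1)], intro continuous_on_mult continuous_on_const c2, assumption, use r in simp)
       (simp only: circle_mean_cmult circle_mean_const)
  also have "2 * ln \<dots> \<le> 2 * ln (sqrt X + K / sqrt r * (\<Sum>i\<in>I. real (m i)))"
  proof -
    have le: "(\<Sum>i\<in>I. real (m i) * circle_mean r (\<lambda>z. 1 / sqrt (cmod (z - p i)))) \<le> K / sqrt r * (\<Sum>i\<in>I. real (m i))"
      unfolding sum_distrib_left
      by (rule sum_mono) (use K[OF r I(2)] in \<open>simp add: mult.commute[of "K / sqrt r"] mult_left_mono del: times_divide_eq_right times_divide_eq_left\<close>)
    have ge: "0 \<le> (\<Sum>i\<in>I. real (m i) * circle_mean r (\<lambda>z. 1 / sqrt (cmod (z - p i))))"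
    proof (intro sum_nonneg mult_nonneg_nonneg)
      fix i assume "i \<in> I"
      have "circle_mean r (\<lambda>z. 0) \<le> circle_mean r (\<lambda>z. 1 / sqrt (cmod (z - p i)))"
        by (rule circle_mean_mono) (use c2[OF \<open>i \<in> I\<close>] r in auto)
      then show "0 \<le> circle_mean r (\<lambda>z. 1 / sqrt (cmod (z - p i)))" by simp
    qed simp
    have "0 < sqrt X" using X by simp
    then show ?thesis using le ge by (intro mult_left_mono ln_mono) linarith+
  qed
  finally show ?thesis .
qed

text \<open>
  Zeros in the smaller disc have \<open>ln (\<rho>' / |a|) \<ge> ln (\<rho>' / \<rho>)\<close>. The correction accounts for the
  zero at the origin, whose weight \<open>ln \<rho>'\<close> may be negative.
\<close>

lemma count_fun_lower_bound:
  assumes reg: "regular_on_circle g \<rho>'" and r: "0 < r0" "r0 \<le> \<rho>" "\<rho> \<le> \<rho>'"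
  shows "(\<Sum>a | cmod a < \<rho> \<and> g a = 0. real (nat (zorder g a))) * ln (\<rho>' / \<rho>) - real (nat (zorder g 0)) * \<bar>ln r0\<bar>
     \<le> count_fun id g \<rho>'"
proof -
  define Z where "Z \<rho> = {a. cmod a < \<rho> \<and> g a = 0}" for \<rho>
  define m where "m a = nat (zorder g a)" for a
  have fin': "finite (Z \<rho>')" using regular_on_circleD(3)[OF reg] by (simp add: Z_def)
  have sub: "Z \<rho> \<subseteq> Z \<rho>'" using r by (auto simp: Z_def)
  have fin: "finite (Z \<rho>)" using finite_subset[OF sub fin'] .
  define b where "b a = (if a = 0 then ln \<rho>' else ln (\<rho>' / cmod a))" for a :: complex
  have l0: "- \<bar>ln r0\<bar> \<le> ln \<rho>" using r ln_mono[of r0 \<rho>] by linarith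
  have ge: "ln (\<rho>' / \<rho>) - (if a = 0 then \<bar>ln r0\<bar> else 0) \<le> b a" if "a \<in> Z \<rho>" for a
  proof (cases "a = 0")
    case True
    then show ?thesis using l0 r by (simp add: b_def ln_div)
  next
    case False
    have "\<rho>' / \<rho> \<le> \<rho>' / cmod a" using that False r by (intro divide_left_mono) (auto simp: Z_def)
    then show ?thesis using False r by (simp add: b_def)
  qed
  have "(\<Sum>a\<in>Z \<rho>. real (m a)) * ln (\<rho>' / \<rho>) - real (m 0) * \<bar>ln r0\<bar>
     \<le> (\<Sum>a\<in>Z \<rho>. real (m a) * (ln (\<rho>' / \<rho>) - (if a = 0 then \<bar>ln r0\<bar> else 0)))"
  proof -
    have "(\<Sum>a\<in>Z \<rho>. real (m a) * (if a = 0 then \<bar>ln r0\<bar> else 0)) = (\<Sum>a\<in>Z \<rho>. if a = 0 then real (m 0) * \<bar>ln r0\<bar> else 0)"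
      by (intro sum.cong) auto
    also have "\<dots> \<le> real (m 0) * \<bar>ln r0\<bar>" using fin by (simp add: sum.delta)
    finally show ?thesis by (simp add: right_diff_distrib sum_subtractf sum_distrib_right)
  qed
  also have "\<dots> \<le> (\<Sum>a\<in>Z \<rho>. real (m a) * b a)"
    by (intro sum_mono mult_left_mono ge) auto
  also have "\<dots> \<le> (\<Sum>a\<in>Z \<rho>'. real (m a) * b a)"
  proof (rule sum_mono2[OF fin' sub])
    fix a assume "a \<in> Z \<rho>' - Z \<rho>"
    then have "a \<noteq> 0" "cmod a \<le> \<rho>'" using r by (auto simp: Z_def)
    then show "0 \<le> real (m a) * b a" by (simp add: b_def)
  qed
  finally show ?thesis by (simp add: count_fun_def Z_def m_def b_def)
qed

lemma zorder_ge_of_factor: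
  assumes S: "open S" "connected S" "a \<in> S" and q: "q holomorphic_on S"
    and W: "\<And>w. w \<in> S \<Longrightarrow> W w = (w - a) ^ E * q w" and nz: "\<exists>w\<in>S. W w \<noteq> 0"
  shows "int E \<le> zorder W a"
proof -
  have qnz: "\<exists>w\<in>S. q w \<noteq> 0" using W nz by auto
  note zo = zorder_exist_zero[OF q S qnz]
  from conjunct2[OF zo] obtain r where r: "r > 0" "cball a r \<subseteq> S" "zor_poly q a holomorphic_on cball a r"
    and r4: "\<forall>w\<in>cball a r. q w = zor_poly q a w * (w - a) ^ nat (zorder q a) \<and> zor_poly q a w \<noteq> 0"
    by (elim exE conjE) (rule that)
  have "zorder W a = int (E + nat (zorder q a))"
  proof (rule zorder_eqI[of "ball a r"])
    show "zor_poly q a holomorphic_on ball a r" using r(3) ball_subset_cball holomorphic_on_subset by blast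
    show "zor_poly q a a \<noteq> 0" using r4 r(1) by simp
    fix w assume w: "w \<in> ball a r" "w \<noteq> a"
    then have "w \<in> cball a r" by auto
    then show "W w = zor_poly q a w * (w - a) powi int (E + nat (zorder q a))"
      unfolding power_int_of_nat using W[of w] r(2) bspec[OF r4, of w] by (auto simp: power_add mult_ac)
  qed (use r in auto)
  then show ?thesis by simp
qed

section \<open>Vanishing order of the Wronskian and truncated counting\<close>

lemma disc_cases: "disc R = UNIV \<or> (\<exists>r. disc R = ball 0 r)"
proof (cases R)
  case (real r)
  then have "disc R = ball 0 r" by (auto simp: disc_def)
  then show ?thesis by blast
next
  case PInf
  then show ?thesis by (auto simp: disc_def)
next
  case MInf
  then have "disc R = ball 0 0" by (auto simp: disc_def)
  then show ?thesis by blast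
qed

lemma open_disc: "open (disc R)" and connected_disc: "connected (disc R)"
  using disc_cases[of R] by auto

lemma ball_subset_disc: "ereal s \<le> R \<Longrightarrow> ball 0 s \<subseteq> disc R"
  by (auto simp: disc_def) (meson ereal_less(1) less_ereal.simps(1) less_le_trans)

lemma cball_subset_disc: "ereal s < R \<Longrightarrow> cball 0 s \<subseteq> disc R"
  by (auto simp: disc_def) (meson ereal_less_eq(3) le_less_trans)

lemma regular_on_circleI:
  assumes "h holomorphic_on disc R" "0 < \<rho>" "ereal \<rho> < R" "\<And>z. cmod z = \<rho> \<Longrightarrow> h z \<noteq> 0"
  shows "regular_on_circle h \<rho>"
proof -
  obtain R' where R': "ereal \<rho> < ereal R'" "ereal R' < R" using ereal_dense2[OF assms(3)] by blast
  then have "h holomorphic_on ball 0 R'" using assms(1) ball_subset_disc holomorphic_on_subset by (metis less_imp_le)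
  then show ?thesis using R' assms by (auto simp: regular_on_circle_def)
qed

lemma countable_zeros_disc:
  assumes "h holomorphic_on disc R" "\<exists>z\<in>disc R. h z \<noteq> 0"
  shows "countable {z\<in>disc R. h z = 0}"
proof (cases "h constant_on disc R")
  case True
  then have "{z\<in>disc R. h z = 0} = {}" using assms(2) by (auto simp: constant_on_def)
  then show ?thesis by (simp only: countable_empty)
next
  case False
  have "{z\<in>disc R. h z = 0} \<subseteq> (\<Union>s\<in>{s\<in>\<rat>. ereal s < R}. {z\<in>cball 0 s. h z = 0})"
  proof
    fix z assume z: "z \<in> {z\<in>disc R. h z = 0}"
    then obtain t where t: "ereal (cmod z) < ereal t" "ereal t < R" using ereal_dense2[of "cmod z" R] by (auto simp: disc_def)
    then obtain s where s: "s \<in> \<rat>" "cmod z < s" "s < t" using Rats_dense_in_real[of "cmod z" t] by auto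
    then have "ereal s < R" using t by (meson ereal_less_eq(3) le_less_trans less_imp_le)
    then show "z \<in> (\<Union>s\<in>{s\<in>\<rat>. ereal s < R}. {z\<in>cball 0 s. h z = 0})" using s z by auto
  qed
  moreover have "countable (\<Union>s\<in>{s\<in>\<rat>. ereal s < R}. {z\<in>cball 0 s. h z = 0})"
  proof (rule countable_UN)
    show "countable {s\<in>\<rat>. ereal s < R}" using countable_rat by (rule countable_subset[rotated]) auto
    fix s assume "s \<in> {s\<in>\<rat>. ereal s < R}"
    then show "countable {z\<in>cball 0 s. h z = 0}"
      using holomorphic_compact_finite_zeros[OF assms(1) open_disc connected_disc compact_cball cball_subset_disc False]
      by (auto intro: countable_finite)
  qed
  ultimately show ?thesis using countable_subset by blast
qed

lemma nonzero_on_open_subset: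
  assumes "h holomorphic_on S" "open S" "connected S" "\<exists>z\<in>S. h z \<noteq> 0" "open T" "T \<subseteq> S" "T \<noteq> {}"
  shows "\<exists>z\<in>T. h z \<noteq> 0"
proof (rule ccontr)
  assume c: "\<not> ?thesis"
  obtain a where a: "a \<in> T" using assms by blast
  have "a islimpt T" using a assms(5) by (simp add: open_imp_islimpt)
  from analytic_continuation[OF assms(1,2,3,6) _ this] a assms(6) c have "h z = 0" if "z \<in> S" for z
    using that by blast
  then show False using assms(4) by blast
qed

text \<open>
  The Wronskian of \<open>F\<close> is a constant multiple of the Wronskian of the functions \<open>G\<close>, among which are
  all \<open>g_j\<close> that vanish at \<open>a\<close>. So it vanishes at \<open>a\<close> at least to the order
  \<open>\<Sum> max 0 (ord g_j - (n - 1))\<close>.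
\<close>

lemma vanishing_order_inequality:
  fixes g :: "'j \<Rightarrow> complex \<Rightarrow> complex"
  assumes S: "open S" "connected S" "a \<in> S" and n: "0 < n"
    and F: "\<And>i. i < n \<Longrightarrow> F i holomorphic_on S" and G: "\<And>i. i < n \<Longrightarrow> G i holomorphic_on S"
    and FG: "\<And>i w. i < n \<Longrightarrow> w \<in> S \<Longrightarrow> F i w = (\<Sum>l<n. B i l * G l w)"
    and W: "\<exists>z\<in>S. wronskian n F z \<noteq> 0"
    and I: "finite I" "J \<subseteq> I" and e: "inj_on e J" "e ` J \<subseteq> {..<n}" "\<And>j. j \<in> J \<Longrightarrow> G (e j) = g j"
    and g: "\<And>j. j \<in> I \<Longrightarrow> g j holomorphic_on S" "\<And>j. j \<in> I \<Longrightarrow> \<exists>z\<in>S. g j z \<noteq> 0"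
    and IJ: "\<And>j. j \<in> I - J \<Longrightarrow> g j a \<noteq> 0"
  shows "(\<Sum>j\<in>I. nat (zorder (g j) a)) \<le> nat (zorder (wronskian n F) a) + (\<Sum>j\<in>I. min (n - 1) (nat (zorder (g j) a)))"
proof -
  define m where "m j = nat (zorder (g j) a)" for j
  have J: "finite J" using I finite_subset by blast
  have zo: "\<exists>r>0. cball a r \<subseteq> S \<and> zor_poly (g j) a holomorphic_on cball a r \<and>
     (\<forall>w\<in>cball a r. g j w = zor_poly (g j) a w * (w - a) ^ m j)" if "j \<in> J" for j
  proof -
    have "j \<in> I" using that I by auto
    note zo = zorder_exist_zero[OF g(1)[OF this] S g(2)[OF this]]
    show ?thesis using conjunct2[OF zo] unfolding m_def by blast
  qed
  have "\<exists>r>0. ball a r \<subseteq> S \<and> (\<forall>j\<in>J. zor_poly (g j) a holomorphic_on ball a r \<and>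
     (\<forall>w\<in>ball a r. g j w = zor_poly (g j) a w * (w - a) ^ m j))"
    using J zo
  proof (induction J rule: finite_induct)
    case empty
    then show ?case using openE[OF S(1,3)] by auto
  next
    case (insert j J)
    obtain r1 where r1: "r1 > 0" "ball a r1 \<subseteq> S" "\<And>j. j\<in>J \<Longrightarrow> zor_poly (g j) a holomorphic_on ball a r1"
      "\<And>j w. j \<in> J \<Longrightarrow> w\<in>ball a r1 \<Longrightarrow> g j w = zor_poly (g j) a w * (w - a) ^ m j"
      using insert.IH insert.prems by blast
    obtain r2 where r2: "r2 > 0" "cball a r2 \<subseteq> S" "zor_poly (g j) a holomorphic_on cball a r2"
      "\<And>w. w \<in> cball a r2 \<Longrightarrow> g j w = zor_poly (g j) a w * (w - a) ^ m j"
      using insert.prems[of j] by blast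
    define r where "r = min r1 r2"
    have b: "ball a r \<subseteq> ball a r1" "ball a r \<subseteq> cball a r2" by (auto simp: r_def)
    have "zor_poly (g i) a holomorphic_on ball a r" if "i \<in> insert j J" for i
      using that r1(3) r2(3) b holomorphic_on_subset by blast
    moreover have "g i w = zor_poly (g i) a w * (w - a) ^ m i" if "i \<in> insert j J" "w \<in> ball a r" for i w
      using that r1(4) r2(4) b by blast
    ultimately show ?case using r1 r2 b by (intro exI[of _ r]) (auto simp: r_def)
  qed
  then obtain r where r: "r > 0" "ball a r \<subseteq> S" "\<And>j. j\<in>J \<Longrightarrow> zor_poly (g j) a holomorphic_on ball a r"
      "\<And>j w. j \<in> J \<Longrightarrow> w\<in>ball a r \<Longrightarrow> g j w = zor_poly (g j) a w * (w - a) ^ m j"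
    by blast
  define M where "M i = (if i \<in> e ` J then m (the_inv_into J e i) else 0)" for i
  define u where "u i = (if i \<in> e ` J then zor_poly (g (the_inv_into J e i)) a else G i)" for i
  have inv: "the_inv_into J e (e j) = j" if "j \<in> J" for j using the_inv_into_f_f[OF e(1) that] .
  have "\<exists>q. q holomorphic_on ball a r \<and> (\<forall>w\<in>ball a r. wronskian n G w = (w - a) ^ (\<Sum>i<n. M i - (n - 1)) * q w)"
  proof (rule wronskian_vanishing_order[OF open_ball])
    show "u i holomorphic_on ball a r" if "i < n" for i
      using r(2,3) holomorphic_on_subset[OF G[OF that]] inv by (auto simp: u_def)
    show "G i w = (w - a) ^ M i * u i w" if "i < n" "w \<in> ball a r" for i w
    proof (cases "i \<in> e ` J")
      case True
      then obtain j where j: "j \<in> J" "i = e j" by blast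
      then show ?thesis using r(4)[OF j(1) that(2)] e(3)[OF j(1)] inv[OF j(1)] by (simp add: M_def u_def)
    qed (simp add: M_def u_def)
  qed
  then obtain q where q: "q holomorphic_on ball a r"
    "\<And>w. w\<in>ball a r \<Longrightarrow> wronskian n G w = (w - a) ^ (\<Sum>i<n. M i - (n - 1)) * q w" by blast
  define c where "c = Determinant.det (Matrix.mat n n (\<lambda>(j, i). B i j))"
  have "int (\<Sum>i<n. M i - (n - 1)) \<le> zorder (wronskian n F) a"
  proof (rule zorder_ge_of_factor[OF open_ball connected_ball])
    show "a \<in> ball a r" using r(1) by simp
    show "(\<lambda>w. c * q w) holomorphic_on ball a r" by (intro holomorphic_intros q(1))
    show "wronskian n F w = (w - a) ^ (\<Sum>i<n. M i - (n - 1)) * (c * q w)" if "w \<in> ball a r" for w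
    proof -
      have "wronskian n F w = c * wronskian n G w" unfolding c_def
        by (rule wronskian_linear[OF S(1)]) (use that r(2) G FG in auto)
      then show ?thesis using q(2)[OF that] by simp
    qed
    show "\<exists>w\<in>ball a r. wronskian n F w \<noteq> 0"
      by (rule nonzero_on_open_subset[OF holomorphic_on_wronskian[OF S(1) F] S(1,2) W]) (use r in auto)
  qed
  moreover have "(\<Sum>j\<in>J. m j - (n - 1)) \<le> (\<Sum>i<n. M i - (n - 1))"
  proof -
    have "(\<Sum>j\<in>J. m j - (n - 1)) = (\<Sum>j\<in>J. M (e j) - (n - 1))"
      by (intro sum.cong refl) (simp add: M_def inv)
    also have "\<dots> = (\<Sum>i\<in>e ` J. M i - (n - 1))" by (simp add: sum.reindex[OF e(1)])
    also have "\<dots> \<le> (\<Sum>i<n. M i - (n - 1))" by (rule sum_mono2) (use e(2) in auto)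
    finally show ?thesis .
  qed
  ultimately have A: "(\<Sum>j\<in>J. m j - (n - 1)) \<le> nat (zorder (wronskian n F) a)" by linarith
  have m0: "m j = 0" if "j \<in> I - J" for j
    using conjunct1[OF zorder_exist_zero[OF g(1) S g(2), of j]] that IJ[OF that] by (auto simp: m_def)
  have "(\<Sum>j\<in>I. m j) = (\<Sum>j\<in>J. m j)" using I m0 by (intro sum.mono_neutral_right) auto
  also have "\<dots> = (\<Sum>j\<in>J. m j - (n - 1)) + (\<Sum>j\<in>J. min (n - 1) (m j))"
    by (simp add: sum.distrib[symmetric] cong: sum.cong) (intro sum.cong refl, auto simp: min_def)
  also have "(\<Sum>j\<in>J. min (n - 1) (m j)) \<le> (\<Sum>j\<in>I. min (n - 1) (m j))"
    using I by (intro sum_mono2) auto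
  finally show ?thesis using A unfolding m_def by linarith
qed

text \<open>
  Weighted summation of the pointwise inequality of the orders. The weight \<open>ln (r / |a|)\<close> is
  nonnegative except possibly at the origin, and there it is bounded below by \<open>- |ln r0|\<close>.
\<close>

lemma count_fun_comparison:
  fixes g :: "'j \<Rightarrow> complex \<Rightarrow> complex"
  assumes I: "finite I" and reg: "\<And>j. j \<in> I \<Longrightarrow> regular_on_circle (g j) r" "regular_on_circle W r"
    and r0: "0 < r0" "r0 \<le> r"
    and zero: "\<And>a j. cmod a < r \<Longrightarrow> j \<in> I \<Longrightarrow> g j a \<noteq> 0 \<Longrightarrow> zorder (g j) a = 0"
      "\<And>a. cmod a < r \<Longrightarrow> W a \<noteq> 0 \<Longrightarrow> zorder W a = 0"
    and ineq: "\<And>a. cmod a < r \<Longrightarrow> (\<Sum>j\<in>I. nat (zorder (g j) a)) \<le> nat (zorder W a) + (\<Sum>j\<in>I. min k (nat (zorder (g j) a)))"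
  shows "(\<Sum>j\<in>I. count_fun id (g j) r) - count_fun id W r
     \<le> (\<Sum>j\<in>I. count_fun (min k) (g j) r) + \<bar>ln r0\<bar> * (real (nat (zorder W 0)) + (\<Sum>j\<in>I. real (min k (nat (zorder (g j) 0)))))"
proof -
  define A where "A = {a. cmod a < r \<and> W a = 0} \<union> (\<Union>j\<in>I. {a. cmod a < r \<and> g j a = 0})"
  have A: "finite A" unfolding A_def using I reg regular_on_circleD(3) by blast
  have Ar: "cmod a < r" if "a \<in> A" for a using that by (auto simp: A_def)
  define b where "b a = (if a = 0 then ln r else ln (r / cmod a))" for a :: complex
  have cj: "count_fun \<phi> (g j) r = (\<Sum>a\<in>A. real (\<phi> (nat (zorder (g j) a))) * b a)" if "j \<in> I" "\<phi> 0 = 0" for \<phi> j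
    unfolding count_fun_def b_def[symmetric]
  proof (rule sum.mono_neutral_left[OF A])
    show "{a. cmod a < r \<and> g j a = 0} \<subseteq> A" using that by (auto simp: A_def)
    show "\<forall>a\<in>A - {a. cmod a < r \<and> g j a = 0}. real (\<phi> (nat (zorder (g j) a))) * b a = 0"
    proof
      fix a assume "a \<in> A - {a. cmod a < r \<and> g j a = 0}"
      then have "cmod a < r" "g j a \<noteq> 0" by (auto simp: A_def)
      then show "real (\<phi> (nat (zorder (g j) a))) * b a = 0" using zero(1)[of a j] that by simp
    qed
  qed
  have cW: "count_fun id W r = (\<Sum>a\<in>A. real (nat (zorder W a)) * b a)"
    unfolding count_fun_def b_def[symmetric] id_def
  proof (rule sum.mono_neutral_left[OF A])
    show "{a. cmod a < r \<and> W a = 0} \<subseteq> A" by (auto simp: A_def)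
    show "\<forall>a\<in>A - {a. cmod a < r \<and> W a = 0}. real (nat (zorder W a)) * b a = 0"
    proof
      fix a assume "a \<in> A - {a. cmod a < r \<and> W a = 0}"
      then have "cmod a < r" "W a \<noteq> 0" by (auto simp: A_def)
      then show "real (nat (zorder W a)) * b a = 0" using zero(2)[of a] by simp
    qed
  qed
  define D where "D a = (\<Sum>j\<in>I. real (nat (zorder (g j) a))) - real (nat (zorder W a)) - (\<Sum>j\<in>I. real (min k (nat (zorder (g j) a))))" for a
  have Dle: "D a \<le> 0" if "cmod a < r" for a
    using of_nat_mono[OF ineq[OF that], where 'a=real] by (simp add: D_def)
  have "(\<Sum>j\<in>I. count_fun id (g j) r) - count_fun id W r - (\<Sum>j\<in>I. count_fun (min k) (g j) r) = (\<Sum>a\<in>A. D a * b a)"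
  proof -
    have "(\<Sum>j\<in>I. count_fun id (g j) r) = (\<Sum>a\<in>A. (\<Sum>j\<in>I. real (nat (zorder (g j) a))) * b a)"
      by (simp add: cj sum_distrib_right) (rule sum.swap)
    moreover have "(\<Sum>j\<in>I. count_fun (min k) (g j) r) = (\<Sum>a\<in>A. (\<Sum>j\<in>I. real (min k (nat (zorder (g j) a)))) * b a)"
      by (simp add: cj[where \<phi>="min k"] sum_distrib_right) (rule sum.swap)
    ultimately show ?thesis unfolding cW D_def by (simp add: left_diff_distrib sum_subtractf)
  qed
  also have "\<dots> \<le> (\<Sum>a\<in>A. if a = 0 then \<bar>ln r0\<bar> * (- D 0) else 0)"
  proof (rule sum_mono)
    fix a assume a: "a \<in> A"
    show "D a * b a \<le> (if a = 0 then \<bar>ln r0\<bar> * (- D 0) else 0)"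
    proof (cases "a = 0")
      case True
      have "- \<bar>ln r0\<bar> \<le> ln r" using r0 ln_mono[of r0 r] by linarith
      then have "D 0 * ln r \<le> D 0 * (- \<bar>ln r0\<bar>)" using Dle[OF Ar[OF a]] True by (intro mult_left_mono_neg) auto
      then show ?thesis using True by (simp add: b_def mult.commute)
    next
      case False
      have "0 \<le> b a" using Ar[OF a] False by (simp add: b_def)
      then show ?thesis using Dle[OF Ar[OF a]] False by (simp add: mult_nonpos_nonneg)
    qed
  qed
  also have "\<dots> \<le> \<bar>ln r0\<bar> * (- D 0)"
    using A Dle[of 0] r0 by (simp add: sum.delta mult_nonneg_nonpos)
  also have "\<dots> \<le> \<bar>ln r0\<bar> * (real (nat (zorder W 0)) + (\<Sum>j\<in>I. real (min k (nat (zorder (g j) 0)))))"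
    by (rule mult_left_mono) (auto simp: D_def sum_nonneg)
  finally show ?thesis by simp
qed

section \<open>Cartan's inequality\<close>

text \<open>
  The members \<open>g_j\<close> with \<open>j \<in> J\<close>, placed at the positions \<open>e j\<close>, are part of a system \<open>G\<close> of \<open>n\<close>
  functions, taken from the given ones, which spans all \<open>F_i\<close>. This is how linear independence of the
  forms indexed by \<open>J\<close> is used.
\<close>

definition completable :: "complex set \<Rightarrow> nat \<Rightarrow> (nat \<Rightarrow> complex \<Rightarrow> complex) \<Rightarrow> ('j \<Rightarrow> complex \<Rightarrow> complex) \<Rightarrow> 'j set \<Rightarrow> 'j set \<Rightarrow> bool" where
  "completable D n F g I J \<longleftrightarrow> (\<exists>G B e. (\<forall>l<n. G l \<in> g ` I \<union> F ` {..<n}) \<and>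
     inj_on e J \<and> e ` J \<subseteq> {..<n} \<and> (\<forall>j\<in>J. G (e j) = g j) \<and>
     (\<forall>i<n. \<forall>w\<in>D. F i w = (\<Sum>l<n. B i l * G l w)))"

text \<open>
  Here \<open>\<eta>\<close> is the distance between the radii \<open>r\<close> and \<open>\<rho>'\<close>. The terms under the square root are
  at most quadratic in \<open>1 / \<eta>\<close>, \<open>\<rho>'\<close> and \<open>V\<close> separately, and \<open>N\<close> is linear in each. So \<open>ln (1 / \<eta>)\<close> occurs
  with coefficient \<open>1\<close>, on which the constant in the main error term depends.
\<close>

lemma ln_error_bound:
  assumes \<eta>: "0 < \<eta>" "\<eta> \<le> 1" "\<eta> / 4 \<le> \<delta>" and \<rho>: "0 \<le> \<rho>" "\<rho> \<le> \<rho>'" and V: "0 \<le> (V::real)"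
    and N: "0 \<le> N" "N \<le> c * (4 * \<rho>' * V / \<eta>)" and c: "0 \<le> c" and K: "0 \<le> K"
  defines "M \<equiv> (16 * c + 144) + 4 * c * K"
  shows "ln (sqrt (1 / \<delta> + N / \<delta> + 8 * \<rho> * V / \<delta>\<^sup>2) + K * N)
     \<le> ln M + ln (1 / \<eta>) + ln (1 + \<rho>') + ln (1 + V)"
proof -
  define y where "y = (1 + \<rho>') * (1 + V)"
  have \<delta>: "0 < \<delta>" using \<eta> by linarith
  have \<rho>': "0 \<le> \<rho>'" using \<rho> by linarith
  have y1: "1 \<le> y" unfolding y_def using mult_mono[of 1 "1 + \<rho>'" 1 "1 + V"] \<rho>' V by simp
  have yV: "\<rho>' * V \<le> y" using \<rho>' V by (simp add: y_def algebra_simps)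
  have i\<delta>: "1 / \<delta> \<le> 4 / \<eta>" using \<eta> \<delta> by (simp add: field_simps)
  have \<eta>2: "1 / \<eta> \<le> 1 / \<eta>\<^sup>2" using \<eta> by (simp add: power2_eq_square field_simps)
  have N': "N \<le> 4 * c * y / \<eta>"
  proof -
    have "c * (4 * \<rho>' * V / \<eta>) = 4 * c / \<eta> * (\<rho>' * V)" by simp
    also have "\<dots> \<le> 4 * c / \<eta> * y" by (intro mult_left_mono yV) (use c \<eta> in auto)
    finally show ?thesis using N by simp
  qed
  have t1: "1 / \<delta> \<le> 16 * y / \<eta>\<^sup>2"
  proof -
    have "1 / \<delta> \<le> 4 * (1 / \<eta>)" using i\<delta> by simp
    also have "\<dots> \<le> 4 * (1 / \<eta>\<^sup>2)" using \<eta>2 by (intro mult_left_mono) auto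
    also have "\<dots> \<le> 16 * y / \<eta>\<^sup>2" using y1 \<eta> by (simp add: divide_right_mono)
    finally show ?thesis .
  qed
  have t2: "N / \<delta> \<le> 16 * c * y / \<eta>\<^sup>2"
  proof -
    have "N / \<delta> = N * (1 / \<delta>)" by simp
    also have "\<dots> \<le> (4 * c * y / \<eta>) * (4 / \<eta>)" by (intro mult_mono N' i\<delta>) (use c y1 \<eta> \<delta> in auto)
    also have "\<dots> = 16 * c * y / \<eta>\<^sup>2" by (simp add: power2_eq_square)
    finally show ?thesis .
  qed
  have t3: "8 * \<rho> * V / \<delta>\<^sup>2 \<le> 128 * y / \<eta>\<^sup>2"
  proof -
    have "8 * \<rho> * V / \<delta>\<^sup>2 = 8 * (\<rho> * V) * (1 / \<delta>)\<^sup>2" by (simp add: power_divide)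
    also have "\<dots> \<le> 8 * y * (4 / \<eta>)\<^sup>2"
    proof (intro mult_mono power_mono i\<delta>)
      have "\<rho> * V \<le> \<rho>' * V" using \<rho> V by (intro mult_right_mono)
      then show "\<rho> * V \<le> y" using yV by linarith
    qed (use \<delta> y1 \<rho> V in auto)
    also have "\<dots> = 128 * y / \<eta>\<^sup>2" by (simp add: power_divide)
    finally show ?thesis .
  qed
  define m where "m = 16 * c + 144"
  have m1: "1 \<le> m" using c by (simp add: m_def)
  have "1 / \<delta> + N / \<delta> + 8 * \<rho> * V / \<delta>\<^sup>2 \<le> m * y / \<eta>\<^sup>2"
    using t1 t2 t3 by (simp add: m_def distrib_right add_divide_distrib)
  also have "\<dots> \<le> (m * y)\<^sup>2 / \<eta>\<^sup>2"
    using m1 y1 mult_mono[of 1 m 1 y] self_le_power[of "m * y" 2] by (intro divide_right_mono) auto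
  also have "\<dots> = (m * y / \<eta>)\<^sup>2" by (simp add: power_divide)
  finally have s: "sqrt (1 / \<delta> + N / \<delta> + 8 * \<rho> * V / \<delta>\<^sup>2) \<le> m * y / \<eta>"
    using m1 y1 \<eta> by (intro real_le_lsqrt) auto
  have kN: "K * N \<le> 4 * c * K * y / \<eta>" using mult_left_mono[OF N' K] by (simp add: mult_ac)
  have pos: "0 < sqrt (1 / \<delta> + N / \<delta> + 8 * \<rho> * V / \<delta>\<^sup>2)"
    using \<delta> N(1) \<rho> V by (simp add: add_pos_nonneg)
  have "ln (sqrt (1 / \<delta> + N / \<delta> + 8 * \<rho> * V / \<delta>\<^sup>2) + K * N) \<le> ln (M * y / \<eta>)"
  proof (rule ln_mono)
    show "0 < sqrt (1 / \<delta> + N / \<delta> + 8 * \<rho> * V / \<delta>\<^sup>2) + K * N"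
      using pos K N(1) by (intro add_pos_nonneg) auto
    show "sqrt (1 / \<delta> + N / \<delta> + 8 * \<rho> * V / \<delta>\<^sup>2) + K * N \<le> M * y / \<eta>"
      using s kN by (simp add: M_def m_def distrib_right add_divide_distrib)
  qed
  also have "\<dots> = ln M + ln (1 / \<eta>) + ln (1 + \<rho>') + ln (1 + V)"
  proof -
    have "0 < M" using c K by (simp add: M_def add_pos_nonneg add_nonneg_pos)
    moreover have "M * y / \<eta> = M * (1 / \<eta>) * (1 + \<rho>') * (1 + V)" by (simp add: y_def)
    moreover have "0 < 1 / \<eta>" "0 < 1 + \<rho>'" "0 < 1 + V" using \<eta> \<rho>' V by auto
    ultimately show ?thesis by (metis ln_mult_pos mult_pos_pos)
  qed
  finally show ?thesis .
qed

text \<open>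
  At a point of the circle \<open>|z| = r\<close> let \<open>J\<close> be the set of small \<open>g_j\<close>. Up to constants, \<open>|W|\<close> is the
  Wronskian of the completed system \<open>G\<close>, hence at most \<open>\<Prod> |G_i|\<close> times \<open>Q^(n (n - 1) / 2)\<close>. The
  members of \<open>G\<close> outside \<open>J\<close> are at most a multiple of \<open>exp v\<close>, and the \<open>g_j\<close> with \<open>j \<notin> J\<close> are at least a multiple
  of \<open>exp v\<close>. This gives \<open>ln |W| + (card I - n) v \<le> \<Sum> ln |g_j| + (n (n - 1) / 2) ln Q + O(1)\<close>, where
  \<open>J\<close> has disappeared. Taking circle means, Jensen's formula turns the logarithms into counting
  functions, which are compared by the vanishing orders.
\<close>

theorem cartan_inequality:
  fixes R :: ereal and F :: "nat \<Rightarrow> complex \<Rightarrow> complex" and g :: "'j \<Rightarrow> complex \<Rightarrow> complex" and v :: "complex \<Rightarrow> real"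
  assumes R: "0 < R" and n: "0 < n"
    and v: "continuous_on (disc R) v"
    and mono: "\<And>r s. 0 < r \<Longrightarrow> r \<le> s \<Longrightarrow> ereal s < R \<Longrightarrow> circle_mean r v \<le> circle_mean s v"
    and F: "\<And>i. i < n \<Longrightarrow> F i holomorphic_on disc R"
    and indep: "\<And>c. (\<forall>z\<in>disc R. (\<Sum>i<n. c i * F i z) = 0) \<Longrightarrow> \<forall>i<n. c i = 0"
    and I: "finite I" and g: "\<And>j. j \<in> I \<Longrightarrow> g j holomorphic_on disc R" "\<And>j. j \<in> I \<Longrightarrow> \<exists>z\<in>disc R. g j z \<noteq> 0"
    and C0: "0 < C0" "\<And>i z. i < n \<Longrightarrow> z \<in> disc R \<Longrightarrow> cmod (F i z) \<le> C0 * exp (v z)"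
      "\<And>j z. j \<in> I \<Longrightarrow> z \<in> disc R \<Longrightarrow> cmod (g j z) \<le> C0 * exp (v z)"
    and c0: "0 < c0"
    and small: "\<And>z. z \<in> disc R \<Longrightarrow>
      \<exists>J\<subseteq>I. (\<forall>j\<in>I-J. c0 * exp (v z) \<le> cmod (g j z)) \<and> completable (disc R) n F g I J"
  shows "\<exists>C r0 Bad. 0 < r0 \<and> ereal r0 < R \<and> countable Bad \<and>
     (\<forall>r \<rho>'. r0 \<le> r \<and> r < \<rho>' \<and> \<rho>' \<le> r + 1 \<and> ereal \<rho>' < R \<and> r \<notin> Bad \<longrightarrow>
        0 \<le> circle_mean \<rho>' v + C \<and>
        (real (card I) - real n) * circle_mean r v
          \<le> (\<Sum>j\<in>I. count_fun (min (n - 1)) (g j) r)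
            + real (n * (n - 1)) * (ln (1 / (\<rho>' - r)) + ln (1 + \<rho>') + ln (1 + (circle_mean \<rho>' v + C))) + C)"
proof -
  define D where "D = disc R"
  have D: "open D" "connected D" by (simp_all add: D_def open_disc connected_disc)
  define H where "H = g ` I \<union> F ` {..<n}"
  define W where "W = wronskian n F"
  have finH: "finite H" using I by (simp add: H_def)
  have D0: "0 \<in> D" using R by (simp add: D_def disc_def zero_ereal_def)
  have Fnz: "\<exists>z\<in>D. F i z \<noteq> 0" if "i < n" for i
  proof (rule ccontr)
    assume "\<not> ?thesis"
    then have "\<forall>z\<in>disc R. (\<Sum>l<n. (if l = i then 1 else 0) * F l z) = 0"
      using that by (auto simp: D_def if_distrib[of "\<lambda>x. x * _"] cong: if_cong)
    from indep[OF this] show False using that by auto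
  qed
  have Whol: "W holomorphic_on D" unfolding W_def using holomorphic_on_wronskian[OF D(1)] F by (simp add: D_def)
  have Wnz: "\<exists>z\<in>D. W z \<noteq> 0" unfolding W_def
    by (rule wronskian_nonzero[OF D]) (use D0 F indep in \<open>auto simp: D_def\<close>)
  have Hhol: "h holomorphic_on D" if "h \<in> insert W H" for h using that F g Whol by (auto simp: H_def D_def)
  have Hnz: "\<exists>z\<in>D. h z \<noteq> 0" if "h \<in> insert W H" for h using that Fnz g(2) Wnz by (auto simp: H_def D_def)
  have Hle: "cmod (h z) \<le> C0 * exp (v z)" if "h \<in> H" "z \<in> D" for h z using that C0 by (auto simp: H_def D_def)
  \<comment> \<open>Radii whose circle contains a zero of one of the functions or of the Wronskian.\<close>
  define Bad where "Bad = cmod ` (\<Union>h\<in>insert W H. {z\<in>D. h z = 0})"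
  have Bad: "countable Bad" unfolding Bad_def
  proof (intro countable_image countable_UN)
    show "countable (insert W H)" using finH by (simp add: countable_finite)
    show "countable {z\<in>D. h z = 0}" if "h \<in> insert W H" for h
      unfolding D_def by (rule countable_zeros_disc) (use Hhol[OF that] Hnz[OF that] in \<open>simp_all add: D_def\<close>)
  qed
  have reg: "regular_on_circle h \<rho>" if "h \<in> insert W H" "0 < \<rho>" "ereal \<rho> < R" "\<rho> \<notin> Bad" for h \<rho>
  proof (rule regular_on_circleI[OF Hhol[OF that(1), unfolded D_def] that(2,3)])
    fix z assume z: "cmod z = \<rho>"
    then have "z \<in> D" using that by (auto simp: D_def disc_def)
    then show "h z \<noteq> 0" using that z by (auto simp: Bad_def)
  qed
  \<comment> \<open>A positive lower bound for the radii controls the contribution of zeros at the origin.\<close>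
  obtain r0 where r0: "0 < r0" "ereal r0 < R" using ereal_dense2[OF R] by (auto simp: zero_ereal_def)
  define L1 where "L1 h = real (nat (zorder h 0)) * \<bar>ln r0\<bar> + \<bar>ln (cmod (zor_poly h 0 0))\<bar>" for h
  define L where "L = (\<Sum>h\<in>insert W H. L1 h)"
  have L1: "L1 h \<le> L" if "h \<in> insert W H" for h unfolding L_def
    by (rule member_le_sum[OF that]) (use finH in \<open>auto simp: L1_def\<close>)
  have L1nn: "0 \<le> L1 h" for h by (simp add: L1_def)
  have cv: "continuous_on (sphere 0 \<rho>) v" if "ereal \<rho> < R" for \<rho>
    by (rule continuous_on_subset[OF v]) (use that in \<open>auto simp: disc_def\<close>)
  have low: "- L \<le> circle_mean \<rho> (\<lambda>z. ln (cmod (h z)))"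
    if "h \<in> insert W H" "r0 \<le> \<rho>" "ereal \<rho> < R" "\<rho> \<notin> Bad" for h \<rho>
  proof -
    have "regular_on_circle h \<rho>" using reg that r0 by auto
    from count_fun_lower_bound[OF this r0(1) that(2) order_refl] jensen_formula[OF this] L1[OF that(1)]
    show ?thesis using r0 that by (simp add: L1_def)
  qed
  have upp: "circle_mean \<rho> (\<lambda>z. ln (cmod (h z))) \<le> circle_mean \<rho> v + \<bar>ln C0\<bar>"
    if "h \<in> H" "0 < \<rho>" "ereal \<rho> < R" "\<rho> \<notin> Bad" for h \<rho>
  proof -
    have rg: "regular_on_circle h \<rho>" using reg that by auto
    have "circle_mean \<rho> (\<lambda>z. ln (cmod (h z))) \<le> circle_mean \<rho> (\<lambda>z. v z + \<bar>ln C0\<bar>)"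
    proof (rule circle_mean_mono[OF regular_on_circleD(6)[OF rg]])
      show "continuous_on (sphere 0 \<rho>) (\<lambda>z. v z + \<bar>ln C0\<bar>)" by (intro continuous_intros cv that)
      fix z assume z: "cmod z = \<rho>"
      then have zD: "z \<in> D" using that by (auto simp: D_def disc_def)
      have "0 < cmod (h z)" using regular_on_circleD(2)[OF rg z] by simp
      then have "ln (cmod (h z)) \<le> ln (C0 * exp (v z))" using Hle[OF that(1) zD] by (intro ln_mono)
      also have "\<dots> = ln C0 + v z" using C0(1) by (simp add: ln_mult_pos)
      finally show "ln (cmod (h z)) \<le> v z + \<bar>ln C0\<bar>" by linarith
    qed (use that in simp)
    then show ?thesis using that by (simp add: circle_mean_add cv)
  qed
  \<comment> \<open>There are only finitely many subsets \<open>J\<close>; fixing one completion for each makes all constants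
      uniform in the point.\<close>
  define ok where "ok J t \<longleftrightarrow> (\<forall>l<n. fst t l \<in> H) \<and>
     inj_on (snd (snd t)) J \<and> snd (snd t) ` J \<subseteq> {..<n} \<and> (\<forall>j\<in>J. fst t (snd (snd t) j) = g j) \<and>
     (\<forall>i<n. \<forall>w\<in>D. F i w = (\<Sum>l<n. fst (snd t) i l * fst t l w))"
    for J and t :: "(nat \<Rightarrow> complex \<Rightarrow> complex) \<times> (nat \<Rightarrow> nat \<Rightarrow> complex) \<times> ('j \<Rightarrow> nat)"
  define tt where "tt J = (SOME t. ok J t)" for J
  define G where "G J = fst (tt J)" for J
  define B where "B J = fst (snd (tt J))" for J
  define e where "e J = snd (snd (tt J))" for J
  have "ok J (tt J)" if comp: "completable D n F g I J" for J
  proof -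
    obtain G0 B0 e0 where "(\<forall>l<n. G0 l \<in> g ` I \<union> F ` {..<n}) \<and>
     inj_on e0 J \<and> e0 ` J \<subseteq> {..<n} \<and> (\<forall>j\<in>J. G0 (e0 j) = g j) \<and>
     (\<forall>i<n. \<forall>w\<in>D. F i w = (\<Sum>l<n. B0 i l * G0 l w))" using comp unfolding completable_def by (elim exE) (rule that)
    then have "ok J (G0, B0, e0)" unfolding ok_def H_def fst_conv snd_conv .
    then show ?thesis unfolding tt_def by (rule someI)
  qed
  then have GBe: "(\<forall>l<n. G J l \<in> H) \<and>
     inj_on (e J) J \<and> (e J) ` J \<subseteq> {..<n} \<and> (\<forall>j\<in>J. G J (e J j) = g j) \<and>
     (\<forall>i<n. \<forall>w\<in>D. F i w = (\<Sum>l<n. B J i l * G J l w))" if "completable D n F g I J" for J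
    using that unfolding ok_def G_def B_def e_def by blast
  define cd where "cd J = Determinant.det (Matrix.mat n n (\<lambda>(l, i). B J i l))" for J
  define cmax where "cmax = 1 + (\<Sum>J\<in>Pow I. cmod (cd J))"
  have cmax: "cmod (cd J) \<le> cmax" if "J \<subseteq> I" for J
    using member_le_sum[of J "Pow I" "\<lambda>J. cmod (cd J)"] that I by (simp add: cmax_def)
  have cmax1: "1 \<le> cmax" by (simp add: cmax_def sum_nonneg)
  define Kc where "Kc = cmax * (fact n * (fact n * exp 5) ^ n)"
  have Kc: "0 < Kc" using cmax1 by (simp add: Kc_def)
  define N where "N = n * (n - 1) div 2"
  have N2: "2 * real N = real (n * (n - 1))"
  proof -
    have "2 * N = n * (n - 1)" unfolding N_def by (intro dvd_mult_div_cancel) (cases "even n", auto)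
    then show ?thesis by (metis of_nat_mult of_nat_numeral)
  qed
  define cI where "cI = card I"
  define C1 where "C1 = ln Kc + real n * \<bar>ln C0\<bar> + real cI * \<bar>ln c0\<bar> + real N * ln 2"
  define CZ where "CZ = \<bar>ln r0\<bar> * (real (nat (zorder W 0)) + (\<Sum>j\<in>I. real (min (n - 1) (nat (zorder (g j) 0)))))"
  define CJ where "CJ = (\<Sum>j\<in>I. \<bar>ln (cmod (zor_poly (g j) 0 0))\<bar>) + \<bar>ln (cmod (zor_poly W 0 0))\<bar>"
  obtain K where K: "0 < K" "\<And>r a. 0 < r \<Longrightarrow> cmod a \<noteq> r \<Longrightarrow> circle_mean r (\<lambda>z. 1 / sqrt (cmod (z - a))) \<le> K / sqrt r"
    using circle_mean_inverse_sqrt_bound by blast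
  define cH where "cH = real (card H)"
  define M where "M = (16 * cH + 144) + 4 * cH * (K / sqrt r0)"
  define Cv where "Cv = \<bar>ln C0\<bar> + L"
  define C where "C = Cv + \<bar>C1 + CZ + CJ + real N * 2 * ln M\<bar>"
  have Lnn: "0 \<le> L" unfolding L_def by (intro sum_nonneg L1nn)
  have key: "0 \<le> circle_mean \<rho>' v + C \<and>
        (real cI - real n) * circle_mean r v
          \<le> (\<Sum>j\<in>I. count_fun (min (n - 1)) (g j) r)
            + real (n * (n - 1)) * (ln (1 / (\<rho>' - r)) + ln (1 + \<rho>') + ln (1 + (circle_mean \<rho>' v + C))) + C"
    if r: "r0 \<le> r" "r < \<rho>'" "\<rho>' \<le> r + 1" "ereal \<rho>' < R" "r \<notin> Bad" for r \<rho>'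
  proof -
    define \<eta> where "\<eta> = \<rho>' - r"
    have \<eta>: "0 < \<eta>" "\<eta> \<le> 1" using r by (auto simp: \<eta>_def)
    have ex: "\<exists>x. a < x \<and> x < b \<and> x \<notin> Bad" if "a < b" for a b
    proof -
      have "uncountable {a<..<b}" using that by (simp add: uncountable_open_interval)
      then have "\<not> {a<..<b} \<subseteq> Bad" using Bad countable_subset by blast
      then show ?thesis by auto
    qed
    \<comment> \<open>The Poisson formula is used on the circle of radius \<open>\<rho>\<close>; the number of zeros inside it is
        estimated from the yet larger radius \<open>\<rho>2\<close>. Both avoid the zeros of all functions.\<close>
    obtain \<rho> where \<rho>: "r + \<eta>/4 < \<rho>" "\<rho> < r + \<eta>/2" "\<rho> \<notin> Bad" using ex[of "r + \<eta>/4" "r + \<eta>/2"] \<eta> by auto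
    obtain \<rho>2 where \<rho>2: "r + 3*\<eta>/4 < \<rho>2" "\<rho>2 < \<rho>'" "\<rho>2 \<notin> Bad"
    proof -
      have "r + 3*\<eta>/4 < \<rho>'" using \<eta> by (simp add: \<eta>_def field_simps)
      from ex[OF this] show ?thesis using that by blast
    qed
    have ord: "r < \<rho>" "\<rho> < \<rho>2" "\<rho>2 < \<rho>'" "0 < r" using \<rho> \<rho>2 \<eta> r r0 by auto
    have lt: "ereal r < R" "ereal \<rho> < R" "ereal \<rho>2 < R"
      using ord r(4) by (meson ereal_less_eq(3) le_less_trans less_imp_le order_trans)+
    define V where "V = circle_mean \<rho>' v + Cv"
    have V\<rho>: "circle_mean \<rho> v + Cv \<le> V" "circle_mean \<rho>2 v + Cv \<le> V"
      using mono[of \<rho> \<rho>'] mono[of \<rho>2 \<rho>'] ord r by (auto simp: V_def)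
    define m where "m h a = nat (zorder h a)" for h :: "complex \<Rightarrow> complex" and a
    define Z where "Z h = {a. cmod a < \<rho> \<and> h a = 0}" for h :: "complex \<Rightarrow> complex"
    define nh where "nh h = (\<Sum>a\<in>Z h. real (m h a))" for h
    have r0\<rho>: "r0 \<le> \<rho>" "r0 \<le> \<rho>2" using ord r by auto
    have regH: "regular_on_circle h r" "regular_on_circle h \<rho>" "regular_on_circle h \<rho>2" if "h \<in> insert W H" for h
      using reg[OF that] lt \<rho>(3) \<rho>2(3) r(5) ord by auto
    have finZ: "finite (Z h)" if "h \<in> insert W H" for h using regular_on_circleD(3)[OF regH(2)[OF that]] by (simp add: Z_def)
    have nhnn: "0 \<le> nh h" for h by (simp add: nh_def sum_nonneg)
    \<comment> \<open>Jensen's formula on the circle of radius \<open>\<rho>2\<close> bounds the number of zeros in the smaller disc.\<close>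
    have nh: "nh h \<le> 4 * \<rho>' * V / \<eta>" "0 \<le> V" if "h \<in> H" for h
    proof -
      have hW: "h \<in> insert W H" using that by simp
      have a: "nh h * ln (\<rho>2 / \<rho>) \<le> V"
      proof -
        have "nh h * ln (\<rho>2 / \<rho>) - real (nat (zorder h 0)) * \<bar>ln r0\<bar> \<le> count_fun id h \<rho>2"
          unfolding nh_def Z_def m_def by (rule count_fun_lower_bound[OF regH(3)[OF hW] r0(1) r0\<rho>(1)]) (use ord in simp)
        moreover have "count_fun id h \<rho>2 = circle_mean \<rho>2 (\<lambda>z. ln (cmod (h z))) - ln (cmod (zor_poly h 0 0))"
          using jensen_formula[OF regH(3)[OF hW]] by simp
        moreover have "circle_mean \<rho>2 (\<lambda>z. ln (cmod (h z))) \<le> circle_mean \<rho>2 v + \<bar>ln C0\<bar>"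
          by (rule upp[OF that]) (use ord lt \<rho>2 in auto)
        ultimately have "nh h * ln (\<rho>2 / \<rho>) \<le> circle_mean \<rho>2 v + \<bar>ln C0\<bar> + L1 h" by (simp add: L1_def)
        then show ?thesis using L1[OF hW] V\<rho>(2) by (simp add: Cv_def)
      qed
      have lb: "\<eta> / (4 * \<rho>') \<le> ln (\<rho>2 / \<rho>)"
      proof -
        have "ln (\<rho> / \<rho>2) \<le> \<rho> / \<rho>2 - 1" using ord by (intro ln_le_minus_one) auto
        then have "1 - \<rho> / \<rho>2 \<le> ln (\<rho>2 / \<rho>)" using ord by (simp add: ln_div)
        moreover have "1 - \<rho> / \<rho>2 = (\<rho>2 - \<rho>) / \<rho>2" using ord by (simp add: field_simps)
        moreover have "(\<eta> / 4) / \<rho>' \<le> (\<rho>2 - \<rho>) / \<rho>2" using \<rho> \<rho>2 ord \<eta> by (intro frac_le) auto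
        ultimately show ?thesis by simp
      qed
      have "nh h * (\<eta> / (4 * \<rho>')) \<le> V" using mult_left_mono[OF lb nhnn[of h]] a by linarith
      then show "nh h \<le> 4 * \<rho>' * V / \<eta>" using ord \<eta> by (simp add: field_simps)
      have "0 \<le> nh h * (\<eta> / (4 * \<rho>'))" using nhnn ord \<eta> by auto
      then show "0 \<le> V" using \<open>nh h * (\<eta> / (4 * \<rho>')) \<le> V\<close> by linarith
    qed
    have F0H: "F 0 \<in> H" using n by (auto simp: H_def)
    have V0: "0 \<le> V" using nh(2)[OF F0H] .
    define P where "P = Sigma H Z"
    have finP: "finite P" unfolding P_def using finH finZ by (intro finite_SigmaI) auto
    define Nt where "Nt = (\<Sum>p\<in>P. real (m (fst p) (snd p)))"
    have Nt_eq: "Nt = (\<Sum>h\<in>H. nh h)" unfolding Nt_def P_def nh_def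
      by (subst sum.Sigma) (use finH finZ in \<open>auto simp: case_prod_beta\<close>)
    have Nt: "0 \<le> Nt" "Nt \<le> cH * (4 * \<rho>' * V / \<eta>)"
    proof -
      show "0 \<le> Nt" by (simp add: Nt_def sum_nonneg)
      have "Nt \<le> (\<Sum>h\<in>H. 4 * \<rho>' * V / \<eta>)" unfolding Nt_eq by (intro sum_mono nh)
      then show "Nt \<le> cH * (4 * \<rho>' * V / \<eta>)" by (simp add: cH_def)
    qed
    define \<delta> where "\<delta> = \<rho> - r"
    have \<delta>: "0 < \<delta>" "\<eta> / 4 \<le> \<delta>" using ord \<rho> by (auto simp: \<delta>_def)
    \<comment> \<open>The three summands meet the three hypotheses on \<open>Q\<close> of the Wronskian bound.\<close>
    define X where "X = 1 / \<delta> + Nt / \<delta> + 8 * \<rho> * V / \<delta>\<^sup>2"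
    have Xpos: "0 < X" unfolding X_def using \<delta> Nt V0 ord by (intro add_pos_nonneg) auto
    have X1: "1 \<le> X * \<delta>" "Nt \<le> X * \<delta>" "8 * \<rho> * V \<le> X * \<delta>\<^sup>2"
    proof -
      have e1: "X * \<delta> = 1 + Nt + 8 * \<rho> * V / \<delta>" using \<delta> by (simp add: X_def field_simps power2_eq_square)
      have "0 \<le> 8 * \<rho> * V / \<delta>" using \<delta> V0 ord by auto
      then show "1 \<le> X * \<delta>" "Nt \<le> X * \<delta>" using e1 Nt by auto
      have "X * \<delta>\<^sup>2 = \<delta> + Nt * \<delta> + 8 * \<rho> * V" using \<delta> by (simp add: X_def field_simps power2_eq_square)
      then show "8 * \<rho> * V \<le> X * \<delta>\<^sup>2" using \<delta> Nt by simp
    qed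
    define Q where "Q z = X + (\<Sum>p\<in>P. real (m (fst p) (snd p)) / cmod (z - snd p))" for z
    have QX: "X \<le> Q z" for z by (simp add: Q_def sum_nonneg)
    have Qpos: "0 < Q z" for z using QX[of z] Xpos by linarith
    have Pr: "cmod (snd p) \<noteq> r" if "p \<in> P" for p
    proof
      assume c: "cmod (snd p) = r"
      have "fst p \<in> H" "fst p (snd p) = 0" using that by (auto simp: P_def Z_def)
      then show False using regular_on_circleD(2)[OF regH(1)[of "fst p"] c] by simp
    qed
    have Qsum: "(\<Sum>a\<in>Z h. real (m h a) / cmod (z - a)) \<le> Q z" if "h \<in> H" for h z
    proof -
      have "(\<Sum>a\<in>Z h. real (m h a) / cmod (z - a)) \<le> (\<Sum>h\<in>H. \<Sum>a\<in>Z h. real (m h a) / cmod (z - a))"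
        by (rule member_le_sum[OF that]) (auto intro!: sum_nonneg finH)
      also have "\<dots> = (\<Sum>p\<in>P. real (m (fst p) (snd p)) / cmod (z - snd p))"
        unfolding P_def by (subst sum.Sigma) (use finH finZ in \<open>auto simp: case_prod_beta\<close>)
      finally show ?thesis using Xpos by (simp add: Q_def)
    qed
    \<comment> \<open>Both logarithms are at most \<open>v\<close> plus a constant and have circle means bounded below.\<close>
    have prox: "4 * \<rho> * circle_mean \<rho> (\<lambda>\<zeta>. \<bar>ln (cmod (h \<zeta>)) - ln (cmod (h0 \<zeta>))\<bar>) \<le> X * \<delta>\<^sup>2"
      if h: "h \<in> H" "h0 \<in> H" for h h0
    proof -
      have rg: "regular_on_circle h \<rho>" "regular_on_circle h0 \<rho>" using regH(2) h by auto
      note ch = regular_on_circleD(6)[OF rg(1)] regular_on_circleD(6)[OF rg(2)]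
      have "circle_mean \<rho> (\<lambda>\<zeta>. \<bar>ln (cmod (h \<zeta>)) - ln (cmod (h0 \<zeta>))\<bar>)
         \<le> circle_mean \<rho> (\<lambda>\<zeta>. (2 * (v \<zeta> + \<bar>ln C0\<bar>) - ln (cmod (h \<zeta>))) - ln (cmod (h0 \<zeta>)))"
      proof (rule circle_mean_mono)
        fix \<zeta> assume \<zeta>: "cmod \<zeta> = \<rho>"
        then have zD: "\<zeta> \<in> D" using lt by (auto simp: D_def disc_def)
        have b: "ln (cmod (k \<zeta>)) \<le> v \<zeta> + \<bar>ln C0\<bar>" if "k \<in> H" "regular_on_circle k \<rho>" for k
        proof -
          have "0 < cmod (k \<zeta>)" using regular_on_circleD(2)[OF that(2) \<zeta>] by simp
          then have "ln (cmod (k \<zeta>)) \<le> ln (C0 * exp (v \<zeta>))" using Hle[OF that(1) zD] by (intro ln_mono)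
          also have "\<dots> = ln C0 + v \<zeta>" using C0(1) by (simp add: ln_mult_pos)
          finally show ?thesis by linarith
        qed
        show "\<bar>ln (cmod (h \<zeta>)) - ln (cmod (h0 \<zeta>))\<bar> \<le> (2 * (v \<zeta> + \<bar>ln C0\<bar>) - ln (cmod (h \<zeta>))) - ln (cmod (h0 \<zeta>))"
          using b[OF h(1) rg(1)] b[OF h(2) rg(2)] by (auto simp: abs_le_iff)
      qed (use ord in \<open>auto intro!: continuous_on_diff continuous_on_mult continuous_on_add continuous_on_const continuous_on_rabs ch cv lt\<close>)
      also have "\<dots> = 2 * (circle_mean \<rho> v + \<bar>ln C0\<bar>) - circle_mean \<rho> (\<lambda>\<zeta>. ln (cmod (h \<zeta>))) - circle_mean \<rho> (\<lambda>\<zeta>. ln (cmod (h0 \<zeta>)))"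
        using ord lt by (simp add: circle_mean_diff circle_mean_add circle_mean_cmult continuous_on_diff continuous_on_mult continuous_on_add ch cv)
      also have "\<dots> \<le> 2 * V" using low[of h \<rho>] low[of h0 \<rho>] h lt \<rho> r0\<rho> V\<rho>(1) by (simp add: Cv_def)
      finally have "4 * \<rho> * circle_mean \<rho> (\<lambda>\<zeta>. \<bar>ln (cmod (h \<zeta>)) - ln (cmod (h0 \<zeta>))\<bar>) \<le> 4 * \<rho> * (2 * V)"
        using ord by (intro mult_left_mono) auto
      also have "\<dots> = 8 * \<rho> * V" by simp
      finally show ?thesis using X1(3) by linarith
    qed
    have pointwise: "ln (cmod (W z)) + (real cI - real n) * v z \<le> (\<Sum>j\<in>I. ln (cmod (g j z))) + (C1 + real N * ln (Q z))"
      if z: "cmod z = r" for z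
    proof -
      have zD: "z \<in> D" using z lt by (auto simp: D_def disc_def)
      have nz: "h z \<noteq> 0" if "h \<in> insert W H" for h using regular_on_circleD(2)[OF regH(1)[OF that] z] .
      obtain J where J: "J \<subseteq> I" "\<And>j. j \<in> I - J \<Longrightarrow> c0 * exp (v z) \<le> cmod (g j z)" "completable D n F g I J"
        using small[of z] zD unfolding D_def by blast
      have GH: "\<And>l. l < n \<Longrightarrow> G J l \<in> H" and eJ: "inj_on (e J) J" "(e J) ` J \<subseteq> {..<n}" "\<And>j. j \<in> J \<Longrightarrow> G J (e J j) = g j"
        and FG: "\<And>i w. i < n \<Longrightarrow> w \<in> D \<Longrightarrow> F i w = (\<Sum>l<n. B J i l * G J l w)"
        using GBe[OF J(3)] by auto
      have finJ: "finite J" using J(1) I finite_subset by blast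
      have WG: "W z = cd J * wronskian n (G J) z" unfolding W_def cd_def
        by (rule wronskian_linear[OF D(1) zD]) (use GH Hhol FG in auto)
      have Wle: "cmod (wronskian n (G J) z) \<le> fact n * (fact n * exp 5) ^ n * (\<Prod>i<n. cmod (G J i z)) * (2 * Q z) ^ (n * (n - 1) div 2)"
      proof (rule norm_wronskian_le_log_derivative[OF n])
        show "regular_on_circle (G J i) \<rho>" if "i < n" for i using regH(2) GH[OF that] by auto
        show "cmod z < \<rho>" using z ord by simp
        show "G J i z \<noteq> 0" if "i < n" for i using nz GH[OF that] by auto
        show "0 < Q z" by (rule Qpos)
        show "(\<Sum>a | cmod a < \<rho> \<and> G J i a = 0. real (nat (zorder (G J i) a)) / cmod (z - a)) \<le> Q z" if "i < n" for i
          using Qsum[OF GH[OF that]] by (simp add: Z_def m_def)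
        have XQ: "X * \<delta> \<le> Q z * (\<rho> - cmod z)" "X * \<delta>\<^sup>2 \<le> Q z * (\<rho> - cmod z)\<^sup>2"
          using QX[of z] \<delta> z by (auto simp: \<delta>_def intro!: mult_right_mono)
        show "(\<Sum>a | cmod a < \<rho> \<and> G J i a = 0. real (nat (zorder (G J i) a))) \<le> Q z * (\<rho> - cmod z)" if "i < n" for i
        proof -
          have "nh (G J i) \<le> Nt" unfolding Nt_eq by (rule member_le_sum[OF GH[OF that]]) (use nhnn finH in auto)
          then show ?thesis using X1(2) XQ(1) by (simp add: nh_def Z_def m_def)
        qed
        show "1 \<le> Q z * (\<rho> - cmod z)" using X1(1) XQ(1) by linarith
        show "4 * \<rho> * circle_mean \<rho> (\<lambda>\<zeta>. \<bar>ln (cmod (G J i \<zeta>)) - ln (cmod (G J 0 \<zeta>))\<bar>) \<le> Q z * (\<rho> - cmod z)\<^sup>2" if "i < n" for i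
          using prox[OF GH[OF that] GH[OF n]] XQ(2) by linarith
      qed
      have Gpos: "0 < cmod (G J i z)" if "i < n" for i using nz GH[OF that] by auto
      have Ppos: "0 < (\<Prod>i<n. cmod (G J i z))" by (rule prod_pos) (use Gpos in auto)
      have "cmod (W z) \<le> Kc * (\<Prod>i<n. cmod (G J i z)) * (2 * Q z) ^ N"
      proof -
        have "cmod (W z) \<le> cmax * (fact n * (fact n * exp 5) ^ n * (\<Prod>i<n. cmod (G J i z)) * (2 * Q z) ^ (n * (n - 1) div 2))"
          unfolding WG norm_mult by (intro mult_mono cmax J Wle) (use cmax1 in auto)
        then show ?thesis by (simp add: Kc_def N_def mult_ac)
      qed
      then have "ln (cmod (W z)) \<le> ln (Kc * (\<Prod>i<n. cmod (G J i z)) * (2 * Q z) ^ N)"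
        using nz[of W] by (intro ln_mono) auto
      also have "\<dots> = ln Kc + (\<Sum>i<n. ln (cmod (G J i z))) + real N * (ln 2 + ln (Q z))"
      proof -
        have "ln (\<Prod>i<n. cmod (G J i z)) = (\<Sum>i<n. ln (cmod (G J i z)))" by (rule ln_prod) (use Gpos in auto)
        then show ?thesis using Kc Ppos Qpos[of z] by (simp add: ln_mult_pos ln_realpow distrib_left)
      qed
      finally have A1: "ln (cmod (W z)) \<le> ln Kc + (\<Sum>i<n. ln (cmod (G J i z))) + real N * (ln 2 + ln (Q z))" .
      have cJ: "card J \<le> n" using card_mono[OF _ eJ(2)] card_image[OF eJ(1)] by simp
      have cJI: "card J \<le> cI" using card_mono[OF I J(1)] by (simp add: cI_def)
      have A2: "(\<Sum>i<n. ln (cmod (G J i z))) \<le> (\<Sum>j\<in>J. ln (cmod (g j z))) + (real n - real (card J)) * (ln C0 + v z)"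
      proof -
        have "(\<Sum>i<n. ln (cmod (G J i z))) = (\<Sum>i\<in>{..<n} - e J ` J. ln (cmod (G J i z))) + (\<Sum>i\<in>e J ` J. ln (cmod (G J i z)))"
          using sum.subset_diff[OF eJ(2)] by simp
        also have "(\<Sum>i\<in>e J ` J. ln (cmod (G J i z))) = (\<Sum>j\<in>J. ln (cmod (g j z)))"
          using eJ(3) by (simp add: sum.reindex[OF eJ(1)])
        also have "(\<Sum>i\<in>{..<n} - e J ` J. ln (cmod (G J i z))) \<le> (\<Sum>i\<in>{..<n} - e J ` J. ln C0 + v z)"
        proof (rule sum_mono)
          fix i assume "i \<in> {..<n} - e J ` J"
          then have i: "i < n" by auto
          have "ln (cmod (G J i z)) \<le> ln (C0 * exp (v z))" using Gpos[OF i] Hle[OF GH[OF i] zD] by (intro ln_mono)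
          then show "ln (cmod (G J i z)) \<le> ln C0 + v z" using C0(1) by (simp add: ln_mult_pos)
        qed
        also have "\<dots> = (real n - real (card J)) * (ln C0 + v z)"
          using card_Diff_subset[OF _ eJ(2)] finJ cJ card_image[OF eJ(1)] by (simp add: of_nat_diff)
        finally show ?thesis by simp
      qed
      have A3: "(real cI - real (card J)) * (ln c0 + v z) \<le> (\<Sum>j\<in>I-J. ln (cmod (g j z)))"
      proof -
        have "(\<Sum>j\<in>I-J. ln c0 + v z) \<le> (\<Sum>j\<in>I-J. ln (cmod (g j z)))"
        proof (rule sum_mono)
          fix j assume j: "j \<in> I - J"
          have "ln (c0 * exp (v z)) \<le> ln (cmod (g j z))" using J(2)[OF j] c0 by (intro ln_mono) auto
          then show "ln c0 + v z \<le> ln (cmod (g j z))" using c0 by (simp add: ln_mult_pos)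
        qed
        moreover have "real (card (I - J)) = real cI - real (card J)"
          using card_Diff_subset[OF finJ J(1)] cJI by (simp add: cI_def of_nat_diff)
        ultimately show ?thesis by simp
      qed
      have A4: "(\<Sum>j\<in>I. ln (cmod (g j z))) = (\<Sum>j\<in>J. ln (cmod (g j z))) + (\<Sum>j\<in>I-J. ln (cmod (g j z)))"
        using sum.subset_diff[OF J(1) I, of "\<lambda>j. ln (cmod (g j z))"] by simp
      have A5: "(real n - real (card J)) * ln C0 \<le> real n * \<bar>ln C0\<bar>"
      proof -
        have "(real n - real (card J)) * ln C0 \<le> (real n - real (card J)) * \<bar>ln C0\<bar>"
          by (rule mult_left_mono) (use cJ in auto)
        also have "\<dots> \<le> real n * \<bar>ln C0\<bar>" by (rule mult_right_mono) auto
        finally show ?thesis .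
      qed
      have A6: "- (real cI * \<bar>ln c0\<bar>) \<le> (real cI - real (card J)) * ln c0"
      proof -
        have "(real cI - real (card J)) * (- ln c0) \<le> (real cI - real (card J)) * \<bar>ln c0\<bar>"
          by (rule mult_left_mono) (use cJI in auto)
        also have "\<dots> \<le> real cI * \<bar>ln c0\<bar>" by (rule mult_right_mono) auto
        finally show ?thesis by simp
      qed
      show ?thesis using A1 A2 A3 A4 A5 A6 unfolding C1_def by (simp add: algebra_simps)
    qed
    have cgj: "continuous_on (sphere 0 r) (\<lambda>z. ln (cmod (g j z)))" if "j \<in> I" for j
      using regular_on_circleD(6)[OF regH(1)[of "g j"]] that by (simp add: H_def)
    have cW: "continuous_on (sphere 0 r) (\<lambda>z. ln (cmod (W z)))"
      using regular_on_circleD(6)[OF regH(1)[of W]] by simp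
    have cQ: "continuous_on (sphere 0 r) (\<lambda>z. ln (Q z))" unfolding Q_def
      by (rule continuous_on_ln_pole_sum[OF Xpos finP Pr])
    have cvr: "continuous_on (sphere 0 r) v" by (rule cv[OF lt(1)])
    have "circle_mean r (\<lambda>z. ln (cmod (W z)) + (real cI - real n) * v z)
       \<le> circle_mean r (\<lambda>z. (\<Sum>j\<in>I. ln (cmod (g j z))) + (C1 + real N * ln (Q z)))"
      by (rule circle_mean_mono[OF _ _ _ pointwise])
         (use ord in \<open>auto intro!: continuous_on_add continuous_on_mult continuous_on_const continuous_on_sum cW cgj cQ cvr\<close>)
    then have int: "circle_mean r (\<lambda>z. ln (cmod (W z))) + (real cI - real n) * circle_mean r v
       \<le> (\<Sum>j\<in>I. circle_mean r (\<lambda>z. ln (cmod (g j z)))) + (C1 + real N * circle_mean r (\<lambda>z. ln (Q z)))"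
      using ord I
      by (simp add: circle_mean_add circle_mean_sum circle_mean_cmult continuous_on_add continuous_on_mult continuous_on_sum cW cgj cQ cvr)
    have jW: "circle_mean r (\<lambda>z. ln (cmod (W z))) = count_fun id W r + ln (cmod (zor_poly W 0 0))"
      by (rule jensen_formula[OF regH(1)]) simp
    have jg: "circle_mean r (\<lambda>z. ln (cmod (g j z))) = count_fun id (g j) r + ln (cmod (zor_poly (g j) 0 0))" if "j \<in> I" for j
      by (rule jensen_formula[OF regH(1)]) (use that in \<open>auto simp: H_def\<close>)
    have rD: "a \<in> D" if "cmod a < r" for a
    proof -
      have "ereal (cmod a) < ereal r" using that by simp
      also note lt(1)
      finally show ?thesis by (simp add: D_def disc_def)
    qed
    have zz: "zorder h a = 0" if "h \<in> insert W H" "cmod a < r" "h a \<noteq> 0" for h a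
      using conjunct1[OF zorder_exist_zero[OF Hhol[OF that(1)] D rD[OF that(2)] Hnz[OF that(1)]]] that(3) by simp
    have cmp: "(\<Sum>j\<in>I. count_fun id (g j) r) - count_fun id W r \<le> (\<Sum>j\<in>I. count_fun (min (n - 1)) (g j) r) + CZ"
      unfolding CZ_def
    proof (rule count_fun_comparison[OF I _ _ r0(1) r(1)])
      show "regular_on_circle (g j) r" if "j \<in> I" for j using regH(1)[of "g j"] that by (simp add: H_def)
      show "regular_on_circle W r" using regH(1) by simp
      show "zorder (g j) a = 0" if "cmod a < r" "j \<in> I" "g j a \<noteq> 0" for a j
        using zz[of "g j" a] that by (simp add: H_def)
      show "zorder W a = 0" if "cmod a < r" "W a \<noteq> 0" for a using zz[of W a] that by simp
      fix a assume a: "cmod a < r"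
      obtain J where J: "J \<subseteq> I" "\<And>j. j \<in> I - J \<Longrightarrow> c0 * exp (v a) \<le> cmod (g j a)" "completable D n F g I J"
        using small[of a] rD[OF a] unfolding D_def by blast
      have GH: "\<And>l. l < n \<Longrightarrow> G J l \<in> H" and eJ: "inj_on (e J) J" "(e J) ` J \<subseteq> {..<n}" "\<And>j. j \<in> J \<Longrightarrow> G J (e J j) = g j"
        and FG: "\<And>i w. i < n \<Longrightarrow> w \<in> D \<Longrightarrow> F i w = (\<Sum>l<n. B J i l * G J l w)"
        using GBe[OF J(3)] by auto
      show "(\<Sum>j\<in>I. nat (zorder (g j) a)) \<le> nat (zorder W a) + (\<Sum>j\<in>I. min (n - 1) (nat (zorder (g j) a)))"
        unfolding W_def
      proof (rule vanishing_order_inequality[OF D rD[OF a] n _ _ FG _ I J(1) eJ])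
        show "\<exists>z\<in>D. wronskian n F z \<noteq> 0" using Wnz by (simp add: W_def)
        show "g j a \<noteq> 0" if "j \<in> I - J" for j
        proof -
          have "0 < c0 * exp (v a)" using c0 by simp
          then show ?thesis using J(2)[OF that] by auto
        qed
      qed (use F g GH Hhol in \<open>auto simp: D_def\<close>)
    qed
    have Qmean: "circle_mean r (\<lambda>z. ln (Q z)) \<le> 2 * (ln M + ln (1 / \<eta>) + ln (1 + \<rho>') + ln (1 + V))"
    proof -
      have "circle_mean r (\<lambda>z. ln (Q z)) \<le> 2 * ln (sqrt X + K / sqrt r * Nt)"
        unfolding Q_def Nt_def by (rule circle_mean_ln_pole_sum_le[OF K(2) ord(4) Xpos finP Pr])
      also have "\<dots> \<le> 2 * ln (sqrt X + K / sqrt r0 * Nt)"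
      proof -
        have "K / sqrt r * Nt \<le> K / sqrt r0 * Nt"
          using K(1) r r0 Nt(1) by (intro mult_right_mono divide_left_mono) auto
        moreover have "0 < sqrt X + K / sqrt r * Nt" using Xpos K(1) ord Nt(1) by (intro add_pos_nonneg) auto
        ultimately show ?thesis by (intro mult_left_mono ln_mono) auto
      qed
      also have "ln (sqrt X + K / sqrt r0 * Nt) \<le> ln M + ln (1 / \<eta>) + ln (1 + \<rho>') + ln (1 + V)"
        unfolding X_def M_def
        by (rule ln_error_bound[OF \<eta> \<delta>(2) _ _ V0 Nt]) (use ord K(1) r0 in \<open>auto simp: cH_def\<close>)
      finally show ?thesis by simp
    qed
    have VC: "V \<le> circle_mean \<rho>' v + C" by (simp add: V_def C_def)
    have lV: "ln (1 + V) \<le> ln (1 + (circle_mean \<rho>' v + C))" using VC V0 by (intro ln_mono) auto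
    have sumle: "(\<Sum>j\<in>I. ln (cmod (zor_poly (g j) 0 0))) - ln (cmod (zor_poly W 0 0)) \<le> CJ"
    proof -
      have "(\<Sum>j\<in>I. ln (cmod (zor_poly (g j) 0 0))) \<le> (\<Sum>j\<in>I. \<bar>ln (cmod (zor_poly (g j) 0 0))\<bar>)" by (intro sum_mono) simp
      then show ?thesis unfolding CJ_def by linarith
    qed
    have sumj: "(\<Sum>j\<in>I. circle_mean r (\<lambda>z. ln (cmod (g j z)))) = (\<Sum>j\<in>I. count_fun id (g j) r) + (\<Sum>j\<in>I. ln (cmod (zor_poly (g j) 0 0)))"
      by (simp add: jg sum.distrib)
    have "real N * circle_mean r (\<lambda>z. ln (Q z)) \<le> real N * (2 * (ln M + ln (1 / \<eta>) + ln (1 + \<rho>') + ln (1 + (circle_mean \<rho>' v + C))))"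
      using Qmean lV by (intro mult_left_mono) auto
    also have "\<dots> = real N * 2 * ln M + (2 * real N) * (ln (1 / \<eta>) + ln (1 + \<rho>') + ln (1 + (circle_mean \<rho>' v + C)))"
      by (simp add: algebra_simps)
    finally have E: "real N * circle_mean r (\<lambda>z. ln (Q z)) \<le> real N * 2 * ln M + real (n * (n - 1)) * (ln (1 / \<eta>) + ln (1 + \<rho>') + ln (1 + (circle_mean \<rho>' v + C)))"
      unfolding N2 .
    have "C1 + CZ + CJ + real N * 2 * ln M \<le> C" using Lnn by (simp add: C_def Cv_def)
    then have "(real cI - real n) * circle_mean r v
          \<le> (\<Sum>j\<in>I. count_fun (min (n - 1)) (g j) r)
            + real (n * (n - 1)) * (ln (1 / \<eta>) + ln (1 + \<rho>') + ln (1 + (circle_mean \<rho>' v + C))) + C"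
      using int jW sumj cmp sumle E by linarith
    then show ?thesis using VC V0 by (simp add: \<eta>_def)
  qed
  show ?thesis
    by (rule exI[of _ C], rule exI[of _ r0], rule exI[of _ Bad]) (use r0 Bad key in \<open>auto simp: cI_def\<close>)
qed

section \<open>Area integrals in polar coordinates\<close>

lemma nn_integral_real_pair:
  fixes f :: "real \<times> real \<Rightarrow> ennreal"
  assumes "f \<in> borel_measurable borel"
  shows "(\<integral>\<^sup>+p. f p \<partial>lborel) = (\<integral>\<^sup>+y. \<integral>\<^sup>+x. f (x, y) \<partial>lborel \<partial>lborel)"
    and "(\<integral>\<^sup>+p. f p \<partial>lborel) = (\<integral>\<^sup>+x. \<integral>\<^sup>+y. f (x, y) \<partial>lborel \<partial>lborel)"
proof -
  have m: "f \<in> borel_measurable (lborel \<Otimes>\<^sub>M lborel)" using assms by (simp add: lborel_prod)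
  show "(\<integral>\<^sup>+p. f p \<partial>lborel) = (\<integral>\<^sup>+y. \<integral>\<^sup>+x. f (x, y) \<partial>lborel \<partial>lborel)"
    using lborel_pair.nn_integral_snd[OF m] by (simp add: lborel_prod)
  show "(\<integral>\<^sup>+p. f p \<partial>lborel) = (\<integral>\<^sup>+x. \<integral>\<^sup>+y. f (x, y) \<partial>lborel \<partial>lborel)"
    using lborel.nn_integral_fst[OF m] by (simp add: lborel_prod)
qed

lemma nn_integral_shear_fst:
  assumes [measurable]: "f \<in> borel_measurable borel"
  shows "(\<integral>\<^sup>+p. f (fst p + t * snd p, snd p) \<partial>lborel) = (\<integral>\<^sup>+p. f p \<partial>(lborel :: (real \<times> real) measure))"
proof -
  have [measurable]: "(\<lambda>p. f (fst p + t * snd p, snd p)) \<in> borel_measurable borel"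
    by (rule measurable_compose[OF _ assms]) (intro borel_measurable_continuous_onI continuous_intros)
  have "(\<integral>\<^sup>+p. f (fst p + t * snd p, snd p) \<partial>lborel) = (\<integral>\<^sup>+y. \<integral>\<^sup>+x. f (x + t * y, y) \<partial>lborel \<partial>lborel)"
    by (subst nn_integral_real_pair(1)) auto
  also have "\<dots> = (\<integral>\<^sup>+y. \<integral>\<^sup>+x. f (x, y) \<partial>lborel \<partial>lborel)"
  proof (rule nn_integral_cong)
    fix y :: real
    show "(\<integral>\<^sup>+x. f (x + t * y, y) \<partial>lborel) = (\<integral>\<^sup>+x. f (x, y) \<partial>lborel)"
      using nn_integral_real_affine[of "\<lambda>x. f (x, y)" 1 "t * y"] by (simp add: add.commute)
  qed
  also have "\<dots> = (\<integral>\<^sup>+p. f p \<partial>lborel)"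
    by (rule nn_integral_real_pair(1)[symmetric]) fact
  finally show ?thesis .
qed

lemma nn_integral_shear_snd:
  assumes [measurable]: "f \<in> borel_measurable borel"
  shows "(\<integral>\<^sup>+p. f (fst p, snd p + t * fst p) \<partial>lborel) = (\<integral>\<^sup>+p. f p \<partial>(lborel :: (real \<times> real) measure))"
proof -
  have [measurable]: "(\<lambda>p. f (fst p, snd p + t * fst p)) \<in> borel_measurable borel"
    by (rule measurable_compose[OF _ assms]) (intro borel_measurable_continuous_onI continuous_intros)
  have "(\<integral>\<^sup>+p. f (fst p, snd p + t * fst p) \<partial>lborel) = (\<integral>\<^sup>+x. \<integral>\<^sup>+y. f (x, y + t * x) \<partial>lborel \<partial>lborel)"
    by (subst nn_integral_real_pair(2)) auto
  also have "\<dots> = (\<integral>\<^sup>+x. \<integral>\<^sup>+y. f (x, y) \<partial>lborel \<partial>lborel)"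
  proof (rule nn_integral_cong)
    fix x :: real
    show "(\<integral>\<^sup>+y. f (x, y + t * x) \<partial>lborel) = (\<integral>\<^sup>+y. f (x, y) \<partial>lborel)"
      using nn_integral_real_affine[of "\<lambda>y. f (x, y)" 1 "t * x"] by (simp add: add.commute)
  qed
  also have "\<dots> = (\<integral>\<^sup>+p. f p \<partial>lborel)"
    by (rule nn_integral_real_pair(2)[symmetric]) fact
  finally show ?thesis .
qed

lemma measurable_Complex_pair [measurable]: "(\<lambda>p. Complex (fst p) (snd p)) \<in> borel_measurable borel"
proof -
  have "(\<lambda>p::real\<times>real. Complex (fst p) (snd p)) = (\<lambda>p. of_real (fst p) + \<i> * of_real (snd p))"
    by (auto simp: complex_eq_iff)
  then show ?thesis by (simp add: borel_measurable_continuous_onI continuous_intros)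
qed

lemma lborel_complex_eq_distr: "(lborel :: complex measure) = distr lborel borel (\<lambda>p. Complex (fst p) (snd p))"
proof (rule lborel_eqI)
  fix l u :: complex assume le: "\<And>b. b \<in> Basis \<Longrightarrow> l \<bullet> b \<le> u \<bullet> b"
  have b: "Re l \<le> Re u" "Im l \<le> Im u" using le[of 1] le[of \<i>] by (auto simp: Basis_complex_def)
  have "emeasure (distr lborel borel (\<lambda>p. Complex (fst p) (snd p))) (box l u)
      = emeasure lborel ((\<lambda>p. Complex (fst p) (snd p)) -` box l u \<inter> space (lborel :: (real \<times> real) measure))"
    by (rule emeasure_distr) (auto simp: measurable_lborel1)
  also have "(\<lambda>p. Complex (fst p) (snd p)) -` box l u \<inter> space (lborel :: (real \<times> real) measure) = box (Re l, Im l) (Re u, Im u)"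
    by (auto simp: box_def Basis_complex_def Basis_prod_def inner_Pair_0)
  also have "emeasure lborel (box (Re l, Im l) (Re u, Im u)) = ennreal ((Re u - Re l) * (Im u - Im l))"
  proof -
    have "box (Re l, Im l) (Re u, Im u) = box (Re l) (Re u) \<times> box (Im l) (Im u)"
      by (auto simp: box_def Basis_prod_def)
    then show ?thesis using b
      by (simp add: lborel_prod[symmetric] lborel.emeasure_pair_measure_Times ennreal_mult)
  qed
  also have "(Re u - Re l) * (Im u - Im l) = (\<Prod>b\<in>Basis. (u - l) \<bullet> b)"
    by (simp add: Basis_complex_def)
  finally show "emeasure (distr lborel borel (\<lambda>p. Complex (fst p) (snd p))) (box l u) = ennreal (\<Prod>b\<in>Basis. (u - l) \<bullet> b)" .
qed simp

lemma nn_integral_lborel_complex: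
  assumes "f \<in> borel_measurable borel"
  shows "(\<integral>\<^sup>+z. f z \<partial>(lborel :: complex measure)) = (\<integral>\<^sup>+p. f (Complex (fst p) (snd p)) \<partial>lborel)"
  by (subst lborel_complex_eq_distr, rule nn_integral_distr) (use assms in \<open>auto simp: measurable_lborel1\<close>)

text \<open>
  A rotation by an angle other than \<open>\<pi>\<close> is a product of three shears, and a shear preserves area by
  Fubini's theorem and translation invariance on the line.
\<close>

lemma nn_integral_rotate_aux:
  assumes f: "f \<in> borel_measurable borel" and a: "cos (a / 2) \<noteq> 0"
  shows "(\<integral>\<^sup>+z. f (cis a * z) \<partial>lborel) = (\<integral>\<^sup>+z. f z \<partial>lborel)"
proof -
  note [measurable] = f
  \<comment> \<open>Rotation by \<open>a\<close> is the composition of the horizontal shear by \<open>t\<close>, the vertical shear by \<open>sin a\<close>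
      and again the horizontal shear by \<open>t\<close>.\<close>
  define t where "t = - tan (a / 2)"
  define s where "s = sin a"
  have sa: "sin a = 2 * sin (a/2) * cos (a/2)" using sin_double[of "a/2"] by simp
  have ca: "cos a = 1 - 2 * (sin (a/2))\<^sup>2" using cos_double_sin[of "a/2"] by simp
  have e1: "1 + t * s = cos a" unfolding t_def s_def sa ca tan_def using a by (simp add: power2_eq_square)
  have e2: "2 * t + t * t * s = - sin a"
  proof -
    have "2 * t + t * t * s = t * (1 + cos a)" by (simp add: e1[symmetric] algebra_simps)
    also have "1 + cos a = 2 * (cos (a/2))\<^sup>2" using cos_double_cos[of "a/2"] by simp
    finally show ?thesis unfolding t_def sa tan_def using a by (simp add: power2_eq_square)
  qed
  define g where "g p = f (Complex (fst p) (snd p))" for p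
  have gm [measurable]: "g \<in> borel_measurable borel" unfolding g_def by measurable
  have g1: "(\<lambda>p. g (fst p + t * snd p, snd p)) \<in> borel_measurable borel"
    by (rule measurable_compose[OF _ gm]) (intro borel_measurable_continuous_onI continuous_intros)
  have g2: "(\<lambda>p. g (fst p + t * (snd p + s * fst p), snd p + s * fst p)) \<in> borel_measurable borel"
    by (rule measurable_compose[OF _ gm]) (intro borel_measurable_continuous_onI continuous_intros)
  have "(\<integral>\<^sup>+p. g p \<partial>lborel) = (\<integral>\<^sup>+p. g (fst p + t * snd p, snd p) \<partial>lborel)"
    by (rule nn_integral_shear_fst[symmetric, OF gm])
  also have "\<dots> = (\<integral>\<^sup>+p. g (fst p + t * (snd p + s * fst p), snd p + s * fst p) \<partial>lborel)"
    using nn_integral_shear_snd[OF g1, of s] by simp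
  also have "\<dots> = (\<integral>\<^sup>+p. g ((fst p + t * snd p) + t * (snd p + s * (fst p + t * snd p)), snd p + s * (fst p + t * snd p)) \<partial>lborel)"
    using nn_integral_shear_fst[OF g2, of t] by simp
  also have "\<dots> = (\<integral>\<^sup>+p. f (cis a * Complex (fst p) (snd p)) \<partial>lborel)"
  proof (rule nn_integral_cong)
    fix p :: "real \<times> real"
    have 1: "(fst p + t * snd p) + t * (snd p + s * (fst p + t * snd p)) = (1 + t * s) * fst p + (2 * t + t * t * s) * snd p"
      by (simp add: algebra_simps)
    have 2: "snd p + s * (fst p + t * snd p) = s * fst p + (1 + t * s) * snd p" by (simp add: algebra_simps)
    have "Complex ((1 + t * s) * fst p + (2 * t + t * t * s) * snd p) (s * fst p + (1 + t * s) * snd p) = cis a * Complex (fst p) (snd p)"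
      by (simp only: e1 e2) (simp add: s_def complex_eq_iff)
    then show "g ((fst p + t * snd p) + t * (snd p + s * (fst p + t * snd p)), snd p + s * (fst p + t * snd p)) = f (cis a * Complex (fst p) (snd p))"
      unfolding 1 unfolding 2 g_def by simp
  qed
  also have "\<dots> = (\<integral>\<^sup>+z. f (cis a * z) \<partial>lborel)"
    by (rule nn_integral_lborel_complex[symmetric]) measurable
  finally show ?thesis unfolding g_def by (simp add: nn_integral_lborel_complex[OF f])
qed

text \<open>
  The excluded angle is handled by rotating twice by half of it.
\<close>

lemma nn_integral_rotate:
  assumes f: "f \<in> borel_measurable borel" and c: "cmod c = 1"
  shows "(\<integral>\<^sup>+z. f (c * z) \<partial>lborel) = (\<integral>\<^sup>+z. f z \<partial>lborel)"
proof -
  note [measurable] = f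
  define a where "a = Arg c / 2"
  have cc: "c = cis a * cis a" using c rcis_cmod_Arg[of c] by (simp add: a_def cis_mult rcis_def)
  have "cos (a / 2) > 0" by (rule cos_gt_zero_pi) (use Arg_bounded[of c] in \<open>auto simp: a_def\<close>)
  then have nz: "cos (a / 2) \<noteq> 0" by simp
  have "(\<integral>\<^sup>+z. f (c * z) \<partial>lborel) = (\<integral>\<^sup>+z. f (cis a * (cis a * z)) \<partial>lborel)" by (simp add: cc mult.assoc)
  also have "\<dots> = (\<integral>\<^sup>+z. f (cis a * z) \<partial>lborel)"
    using nn_integral_rotate_aux[of "\<lambda>z. f (cis a * z)" a] nz by simp
  also have "\<dots> = (\<integral>\<^sup>+z. f z \<partial>lborel)" by (rule nn_integral_rotate_aux[OF f nz])
  finally show ?thesis .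
qed

text \<open>
  Both measures give the mass \<open>\<pi> a\<^sup>2\<close> to the half-line up to \<open>a \<ge> 0\<close>.
\<close>

lemma distr_cmod_lborel:
  "distr (lborel :: complex measure) borel cmod = density lborel (\<lambda>s. ennreal (2 * pi * s) * indicator {0..} s)"
proof (rule measure_eqI_generator_eq[where E="range atMost" and \<Omega>=UNIV and A="\<lambda>i::nat. {..real i}"])
  show "Int_stable (range (atMost :: real \<Rightarrow> real set))"
    by (auto simp: Int_stable_def intro!: image_eqI[of _ _ "min _ _"])
  show "sets (distr lborel borel cmod) = sigma_sets UNIV (range atMost)"
    by (simp add: borel_eq_atMost)
  show "sets (density lborel (\<lambda>s. ennreal (2 * pi * s) * indicator {0..} s)) = sigma_sets UNIV (range atMost)"
    by (simp add: borel_eq_atMost)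
  have L: "emeasure (distr (lborel :: complex measure) borel cmod) {..a} = (if 0 \<le> a then ennreal (pi * a\<^sup>2) else 0)" for a
  proof -
    have "emeasure (distr (lborel :: complex measure) borel cmod) {..a} = emeasure lborel (cmod -` {..a} \<inter> space lborel)"
      by (rule emeasure_distr) auto
    also have "cmod -` {..a} \<inter> space lborel = cball 0 a" by auto
    finally show ?thesis by (auto simp: emeasure_cball unit_ball_vol_2)
  qed
  have D: "emeasure (density lborel (\<lambda>s. ennreal (2 * pi * s) * indicator {0..} s)) {..a} = (if 0 \<le> a then ennreal (pi * a\<^sup>2) else 0)" for a
  proof (cases "0 \<le> a")
    case True
    have "emeasure (density lborel (\<lambda>s. ennreal (2 * pi * s) * indicator {0..} s)) {..a}
       = (\<integral>\<^sup>+s. ennreal (2 * pi * s) * indicator {0..} s * indicator {..a} s \<partial>lborel)"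
      by (rule emeasure_density) auto
    also have "\<dots> = (\<integral>\<^sup>+s. ennreal (2 * pi * s) * indicator {0..a} s \<partial>lborel)"
      by (intro nn_integral_cong) (auto simp: indicator_def)
    also have "\<dots> = ennreal (pi * a\<^sup>2 - pi * 0\<^sup>2)"
      by (rule nn_integral_FTC_Icc[where F="\<lambda>s. pi * s\<^sup>2"])
         (use True in \<open>auto intro!: derivative_eq_intros simp: has_real_derivative_iff_has_vector_derivative[symmetric]\<close>)
    finally show ?thesis using True by simp
  next
    case False
    have "emeasure (density lborel (\<lambda>s. ennreal (2 * pi * s) * indicator {0..} s)) {..a}
       = (\<integral>\<^sup>+s. ennreal (2 * pi * s) * indicator {0..} s * indicator {..a} s \<partial>lborel)"
      by (rule emeasure_density) auto
    also have "\<dots> = (\<integral>\<^sup>+s. 0 \<partial>(lborel :: real measure))"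
      by (rule nn_integral_cong) (use False in \<open>auto simp: indicator_def\<close>)
    finally show ?thesis using False by simp
  qed
  show "emeasure (distr lborel borel cmod) X = emeasure (density lborel (\<lambda>s. ennreal (2 * pi * s) * indicator {0..} s)) X"
    if "X \<in> range atMost" for X using that L D by auto
  show "emeasure (distr lborel borel cmod) {..real i} \<noteq> \<infinity>" for i by (simp add: L)
  show "(\<Union>i. {..real i}) = UNIV" by (auto simp: real_arch_simple)
qed auto

lemma nn_integral_continuous_Icc:
  fixes h :: "real \<Rightarrow> real"
  assumes "continuous_on {a..b} h" "\<And>x. x \<in> {a..b} \<Longrightarrow> 0 \<le> h x"
  shows "(\<integral>\<^sup>+x. ennreal (h x) * indicator {a..b} x \<partial>lborel) = ennreal (integral {a..b} h)"
proof -
  have int: "set_integrable lborel {a..b} h" by (rule borel_integrable_atLeastAtMost') fact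
  have "(\<integral>\<^sup>+x. ennreal (h x) * indicator {a..b} x \<partial>lborel) = (\<integral>\<^sup>+x. ennreal (indicator {a..b} x *\<^sub>R h x) \<partial>lborel)"
    by (intro nn_integral_cong) (auto simp: indicator_def)
  also have "\<dots> = ennreal (\<integral>x. indicator {a..b} x *\<^sub>R h x \<partial>lborel)"
    by (rule nn_integral_eq_integral) (use int assms(2) in \<open>auto simp: set_integrable_def indicator_def\<close>)
  also have "(\<integral>x. indicator {a..b} x *\<^sub>R h x \<partial>lborel) = integral {a..b} h"
    using set_borel_integral_eq_integral(2)[OF int] by (simp add: set_lebesgue_integral_def)
  finally show ?thesis .
qed

lemma nn_integral_radial:
  assumes G [measurable]: "G \<in> borel_measurable borel"
  shows "(\<integral>\<^sup>+z. G (cmod z) \<partial>lborel) = (\<integral>\<^sup>+s. G s * ennreal (2 * pi * s) * indicator {0..} s \<partial>lborel)"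
proof -
  have "(\<integral>\<^sup>+z. G (cmod z) \<partial>lborel) = (\<integral>\<^sup>+s. G s \<partial>distr (lborel :: complex measure) borel cmod)"
    by (rule nn_integral_distr[symmetric]) auto
  also have "\<dots> = (\<integral>\<^sup>+s. ennreal (2 * pi * s) * indicator {0..} s * G s \<partial>lborel)"
    unfolding distr_cmod_lborel by (rule nn_integral_density) auto
  finally show ?thesis by (simp add: mult_ac)
qed

lemma continuous_on_circle_mean:
  assumes "continuous_on (cball 0 t) g"
  shows "continuous_on {0..t} (\<lambda>s. circle_mean s g)"
proof -
  have "continuous_on ({0..t} \<times> {0..2*pi}) (\<lambda>p. g (of_real (fst p) * cis (snd p)))"
    by (rule continuous_on_compose2[OF assms]) (auto intro!: continuous_intros simp: norm_mult)
  then have "continuous_on ({0..t} \<times> cbox 0 (2*pi)) (\<lambda>(s, \<theta>). g (of_real s * cis \<theta>))"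
    by (simp add: case_prod_beta)
  from integral_continuous_on_param[OF this]
  show ?thesis unfolding circle_mean_def by (intro continuous_intros) auto
qed

text \<open>
  By rotation invariance the area integral is unchanged when the integrand is averaged over rotations.
  The average is radial, and for radial functions the image measure under \<open>cmod\<close> is known.
\<close>

lemma area_integral_polar:
  fixes g :: "complex \<Rightarrow> real"
  assumes t: "0 \<le> t" and c: "continuous_on (cball 0 t) g" and nn: "\<And>z. 0 \<le> g z"
  shows "(LBINT z:cball 0 t. g z) = integral {0..t} (\<lambda>s. 2 * pi * s * circle_mean s g)"
proof -
  define gg where "gg z = ennreal (indicator (cball 0 t) z * g z)" for z
  have gm: "(\<lambda>z. indicator (cball 0 t) z * g z) \<in> borel_measurable borel"
    using borel_measurable_continuous_on_indicator[OF _ c] by (simp add: mult.commute)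
  have ggm [measurable]: "gg \<in> borel_measurable borel" unfolding gg_def using gm by measurable
  define m where "m s = ennreal (indicator {0..t} s * circle_mean s g)" for s
  have mm [measurable]: "m \<in> borel_measurable borel" unfolding m_def
    using borel_measurable_continuous_on_indicator[OF _ continuous_on_circle_mean[OF c]] by (simp add: mult.commute)
  have cs: "continuous_on (sphere 0 s) g" if "s \<le> t" for s
    by (rule continuous_on_subset[OF c]) (use that in auto)
  have circ: "(\<integral>\<^sup>+\<theta>. gg (cis \<theta> * z) * indicator {0..2*pi} \<theta> \<partial>lborel) = ennreal (2 * pi) * m (cmod z)" for z
  proof (cases "cmod z \<le> t")
    case True
    obtain c where c: "z = c * of_real (cmod z)" "cmod c = 1"
    proof (cases "z = 0")
      case True then show ?thesis using that[of 1] by simp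
    next
      case False then show ?thesis using that[of "sgn z"] norm_sgn[of z] by (simp add: sgn_eq)
    qed
    have cont: "continuous_on {0..2*pi} (\<lambda>\<theta>. g (c * (of_real (cmod z) * cis \<theta>)))"
      by (rule continuous_on_compose2[OF cs[OF True]]) (use c(2) in \<open>auto intro!: continuous_intros simp: norm_mult\<close>)
    have cz: "cis \<theta> * z = c * (of_real (cmod z) * cis \<theta>)" for \<theta> by (subst c(1)) (simp add: mult_ac)
    have "(\<integral>\<^sup>+\<theta>. gg (cis \<theta> * z) * indicator {0..2*pi} \<theta> \<partial>lborel)
       = (\<integral>\<^sup>+\<theta>. ennreal (g (c * (of_real (cmod z) * cis \<theta>))) * indicator {0..2*pi} \<theta> \<partial>lborel)"
      using True by (intro nn_integral_cong) (auto simp: gg_def cz[symmetric] norm_mult)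
    also have "\<dots> = ennreal (integral {0..2*pi} (\<lambda>\<theta>. g (c * (of_real (cmod z) * cis \<theta>))))"
      by (rule nn_integral_continuous_Icc[OF cont nn])
    also have "integral {0..2*pi} (\<lambda>\<theta>. g (c * (of_real (cmod z) * cis \<theta>))) = 2 * pi * circle_mean (cmod z) (\<lambda>z. g (c * z))"
      by (simp add: circle_mean_def)
    also have "circle_mean (cmod z) (\<lambda>z. g (c * z)) = circle_mean (cmod z) g"
      by (rule circle_mean_rotate[OF cs[OF True] _ c(2)]) simp
    finally show ?thesis using True by (simp add: m_def ennreal_mult')
  qed (auto simp: gg_def m_def norm_mult)
  have "ennreal (2 * pi) * (\<integral>\<^sup>+z. gg z \<partial>lborel) = (\<integral>\<^sup>+\<theta>. (\<integral>\<^sup>+z. gg z \<partial>lborel) * indicator {0..2*pi} \<theta> \<partial>lborel)"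
    by (subst nn_integral_cmult_indicator) (auto simp: mult.commute)
  also have "\<dots> = (\<integral>\<^sup>+\<theta>. (\<integral>\<^sup>+z. gg (cis \<theta> * z) * indicator {0..2*pi} \<theta> \<partial>lborel) \<partial>lborel)"
  proof (rule nn_integral_cong)
    fix \<theta> :: real
    have "(\<integral>\<^sup>+z. gg (cis \<theta> * z) * indicator {0..2*pi} \<theta> \<partial>lborel) = (\<integral>\<^sup>+z. gg (cis \<theta> * z) \<partial>lborel) * indicator {0..2*pi} \<theta>"
      by (rule nn_integral_multc) measurable
    then show "(\<integral>\<^sup>+z. gg z \<partial>lborel) * indicator {0..2*pi} \<theta> = (\<integral>\<^sup>+z. gg (cis \<theta> * z) * indicator {0..2*pi} \<theta> \<partial>lborel)"
      by (simp add: nn_integral_rotate)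
  qed
  also have "\<dots> = (\<integral>\<^sup>+z. (\<integral>\<^sup>+\<theta>. gg (cis \<theta> * z) * indicator {0..2*pi} \<theta> \<partial>lborel) \<partial>lborel)"
  proof (rule lborel_pair.Fubini')
    have "(\<lambda>p. cis (snd p) * fst p) \<in> borel_measurable (borel :: (complex \<times> real) measure)"
      by (intro borel_measurable_continuous_onI continuous_intros)
    from measurable_compose[OF this ggm]
    have "(\<lambda>p. gg (cis (snd p) * fst p)) \<in> borel_measurable (borel :: (complex \<times> real) measure)" .
    moreover have "(\<lambda>p. indicator {0..2*pi} (snd p) :: ennreal) \<in> borel_measurable (borel :: (complex \<times> real) measure)"
      by (rule measurable_compose[of snd borel borel])
         (auto intro!: borel_measurable_continuous_onI continuous_on_snd continuous_on_id)
    ultimately have "(\<lambda>p. gg (cis (snd p) * fst p) * indicator {0..2*pi} (snd p)) \<in> borel_measurable (borel :: (complex \<times> real) measure)"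
      by (rule borel_measurable_times_ennreal)
    then show "(\<lambda>(z, \<theta>). gg (cis \<theta> * z) * indicator {0..2*pi} \<theta>) \<in> borel_measurable (lborel \<Otimes>\<^sub>M lborel)"
      by (simp add: lborel_prod case_prod_beta)
  qed
  also have "\<dots> = ennreal (2 * pi) * (\<integral>\<^sup>+z. m (cmod z) \<partial>lborel)"
    unfolding circ by (rule nn_integral_cmult) measurable
  finally have "(\<integral>\<^sup>+z. gg z \<partial>lborel) = (\<integral>\<^sup>+z. m (cmod z) \<partial>lborel)"
    by (simp add: ennreal_mult_cancel_left)
  also have "\<dots> = (\<integral>\<^sup>+s. m s * ennreal (2 * pi * s) * indicator {0..} s \<partial>lborel)"
    by (rule nn_integral_radial) measurable
  also have "\<dots> = (\<integral>\<^sup>+s. ennreal (2 * pi * s * circle_mean s g) * indicator {0..t} s \<partial>lborel)"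
  proof (rule nn_integral_cong)
    fix s :: real
    have "0 \<le> circle_mean s g" if "0 \<le> s" "s \<le> t"
    proof -
      have "circle_mean s (\<lambda>_. 0) \<le> circle_mean s g" by (rule circle_mean_mono) (use that cs nn in auto)
      then show ?thesis by simp
    qed
    then show "m s * ennreal (2 * pi * s) * indicator {0..} s = ennreal (2 * pi * s * circle_mean s g) * indicator {0..t} s"
      by (auto simp: m_def indicator_def ennreal_mult'[symmetric] mult_ac)
  qed
  finally have A: "(\<integral>\<^sup>+z. gg z \<partial>lborel) = (\<integral>\<^sup>+s. ennreal (2 * pi * s * circle_mean s g) * indicator {0..t} s \<partial>lborel)" .
  have cI: "continuous_on {0..t} (\<lambda>s. 2 * pi * s * circle_mean s g)"
    by (intro continuous_intros continuous_on_circle_mean c)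
  have B: "(LBINT z:cball 0 t. g z) = enn2real (\<integral>\<^sup>+z. gg z \<partial>lborel)"
    unfolding set_lebesgue_integral_def gg_def
    by (subst integral_eq_nn_integral) (use gm nn in auto)
  have "0 \<le> 2 * pi * s * circle_mean s g" if "s \<in> {0..t}" for s
  proof -
    have "circle_mean s (\<lambda>_. 0) \<le> circle_mean s g" by (rule circle_mean_mono) (use that cs nn in auto)
    then show ?thesis using that by simp
  qed
  from nn_integral_continuous_Icc[OF cI this] have C: "(\<integral>\<^sup>+s. ennreal (2 * pi * s * circle_mean s g) * indicator {0..t} s \<partial>lborel)
     = ennreal (integral {0..t} (\<lambda>s. 2 * pi * s * circle_mean s g))"
    and nnI: "0 \<le> integral {0..t} (\<lambda>s. 2 * pi * s * circle_mean s g)"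
    using \<open>\<And>s. s \<in> {0..t} \<Longrightarrow> 0 \<le> 2 * pi * s * circle_mean s g\<close>
    by (auto intro!: integral_nonneg integrable_continuous_interval cI simp del: zero_le_mult_iff mult_nonneg_nonneg)
  show ?thesis using A B C nnI by simp
qed

section \<open>The characteristic function as a circle mean\<close>

lemma norm_vec_power2: "(norm (x :: complex ^ 'n::finite))\<^sup>2 = (\<Sum>i\<in>UNIV. (cmod (x $ i))\<^sup>2)"
  by (simp add: norm_vec_def L2_set_def sum_nonneg)

text \<open>
  The sums \<open>fs_phi\<close>, \<open>fs_psi\<close> and \<open>fs_energy\<close> are the Hermitian products of \<open>f'\<close> with \<open>f\<close>, of \<open>f''\<close> with
  \<open>f\<close>, and of \<open>f'\<close> with \<open>f'\<close>.
\<close>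

definition fs_phi :: "(complex \<Rightarrow> complex ^ 'n::finite) \<Rightarrow> complex \<Rightarrow> complex" where
  "fs_phi f z = (\<Sum>i\<in>UNIV. deriv (\<lambda>w. f w $ i) z * cnj (f z $ i))"

definition fs_psi :: "(complex \<Rightarrow> complex ^ 'n::finite) \<Rightarrow> complex \<Rightarrow> complex" where
  "fs_psi f z = (\<Sum>i\<in>UNIV. deriv (deriv (\<lambda>w. f w $ i)) z * cnj (f z $ i))"

definition fs_energy :: "(complex \<Rightarrow> complex ^ 'n::finite) \<Rightarrow> complex \<Rightarrow> real" where
  "fs_energy f z = (\<Sum>i\<in>UNIV. (cmod (deriv (\<lambda>w. f w $ i) z))\<^sup>2)"

lemma fs_density_eq:
  "fs_density f z = ((norm (f z))\<^sup>2 * fs_energy f z - (cmod (fs_phi f z))\<^sup>2) / (pi * ((norm (f z))\<^sup>2)\<^sup>2)"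
  unfolding fs_density_def Let_def fs_energy_def fs_phi_def norm_vec_power2[of "\<chi> i. deriv (\<lambda>w. f w $ i) z"]
  by simp

text \<open>
  Cauchy--Schwarz.
\<close>

lemma fs_density_nonneg: "0 \<le> fs_density f z"
proof -
  define f' where "f' = (\<chi> i. deriv (\<lambda>w. f w $ i) z)"
  have "cmod (\<Sum>i\<in>UNIV. f' $ i * cnj (f z $ i)) \<le> (\<Sum>i\<in>UNIV. \<bar>cmod (f' $ i)\<bar> * \<bar>cmod (f z $ i)\<bar>)"
    by (rule order_trans[OF norm_sum]) (simp add: norm_mult)
  also have "\<dots> \<le> norm f' * norm (f z)"
    unfolding norm_vec_def by (rule L2_set_mult_ineq)
  finally have "(cmod (\<Sum>i\<in>UNIV. f' $ i * cnj (f z $ i)))\<^sup>2 \<le> (norm f' * norm (f z))\<^sup>2" by (rule power_mono) simp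
  then have "0 \<le> (norm (f z))\<^sup>2 * (norm f')\<^sup>2 - (cmod (\<Sum>i\<in>UNIV. f' $ i * cnj (f z $ i)))\<^sup>2"
    by (simp add: power_mult_distrib mult.commute)
  then show ?thesis unfolding fs_density_def Let_def f'_def[symmetric] by (intro divide_nonneg_nonneg) auto
qed

context
  fixes f :: "complex \<Rightarrow> complex ^ 'n::finite" and D :: "complex set"
  assumes D: "open D" and hol: "\<And>i. (\<lambda>z. f z $ i) holomorphic_on D" and nz: "\<And>z. z \<in> D \<Longrightarrow> f z \<noteq> 0"
begin

lemma comp_vd:
  assumes "(\<gamma> has_vector_derivative w) (at t)" "\<gamma> t \<in> D"
  shows "((\<lambda>t. f (\<gamma> t) $ i) has_vector_derivative w * deriv (\<lambda>w. f w $ i) (\<gamma> t)) (at t)"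
    "((\<lambda>t. deriv (\<lambda>w. f w $ i) (\<gamma> t)) has_vector_derivative w * deriv (deriv (\<lambda>w. f w $ i)) (\<gamma> t)) (at t)"
  using field_vector_diff_chain_at[OF assms(1) holomorphic_derivI[OF hol D assms(2)]]
    field_vector_diff_chain_at[OF assms(1) holomorphic_derivI[OF holomorphic_deriv[OF hol D] D assms(2)]]
  by (simp_all add: o_def)

lemma vd_cnj: "(h has_vector_derivative h') F \<Longrightarrow> ((\<lambda>t. cnj (h t)) has_vector_derivative cnj h') F"
  by (rule bounded_linear.has_vector_derivative[OF bounded_linear_cnj])

lemma vd_ray: "((\<lambda>t. of_real t * c) has_vector_derivative (c :: complex)) (at t)"
  unfolding has_vector_derivative_def scaleR_conv_of_real[symmetric]
  by (rule bounded_linear_imp_has_derivative) (rule bounded_linear_scaleR_left)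

lemma norm_sq_derivative:
  assumes "(\<gamma> has_vector_derivative w) (at t)" "\<gamma> t \<in> D"
  shows "((\<lambda>t. (norm (f (\<gamma> t)))\<^sup>2) has_real_derivative 2 * Re (w * fs_phi f (\<gamma> t))) (at t)"
proof -
  note c = comp_vd(1)[OF assms]
  have "((\<lambda>t. \<Sum>i\<in>UNIV. f (\<gamma> t) $ i * cnj (f (\<gamma> t) $ i)) has_vector_derivative
     (\<Sum>i\<in>UNIV. f (\<gamma> t) $ i * cnj (w * deriv (\<lambda>w. f w $ i) (\<gamma> t)) + (w * deriv (\<lambda>w. f w $ i) (\<gamma> t)) * cnj (f (\<gamma> t) $ i))) (at t)"
    by (intro has_vector_derivative_sum has_vector_derivative_mult c vd_cnj)
  from bounded_linear.has_vector_derivative[OF bounded_linear_Re this]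
  have "((\<lambda>t. (norm (f (\<gamma> t)))\<^sup>2) has_vector_derivative
     Re (\<Sum>i\<in>UNIV. f (\<gamma> t) $ i * cnj (w * deriv (\<lambda>w. f w $ i) (\<gamma> t)) + (w * deriv (\<lambda>w. f w $ i) (\<gamma> t)) * cnj (f (\<gamma> t) $ i))) (at t)"
    by (simp add: norm_vec_power2 complex_norm_square[symmetric] flip: of_real_power)
  also have "Re (\<Sum>i\<in>UNIV. f (\<gamma> t) $ i * cnj (w * deriv (\<lambda>w. f w $ i) (\<gamma> t)) + (w * deriv (\<lambda>w. f w $ i) (\<gamma> t)) * cnj (f (\<gamma> t) $ i))
     = (\<Sum>i\<in>UNIV. 2 * Re (w * deriv (\<lambda>w. f w $ i) (\<gamma> t) * cnj (f (\<gamma> t) $ i)))"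
    unfolding Re_sum by (intro sum.cong refl) (simp add: algebra_simps)
  also have "\<dots> = 2 * Re (w * fs_phi f (\<gamma> t))"
    by (simp add: fs_phi_def sum_distrib_left mult.assoc del: times_complex.sel)
  finally show ?thesis by (simp add: has_real_derivative_iff_has_vector_derivative)
qed

lemma phi_derivative:
  assumes "(\<gamma> has_vector_derivative w) (at t)" "\<gamma> t \<in> D"
  shows "((\<lambda>t. fs_phi f (\<gamma> t)) has_vector_derivative w * fs_psi f (\<gamma> t) + cnj w * of_real (fs_energy f (\<gamma> t))) (at t)"
proof -
  note c = comp_vd[OF assms]
  have "((\<lambda>t. fs_phi f (\<gamma> t)) has_vector_derivative
     (\<Sum>i\<in>UNIV. deriv (\<lambda>w. f w $ i) (\<gamma> t) * cnj (w * deriv (\<lambda>w. f w $ i) (\<gamma> t)) + (w * deriv (deriv (\<lambda>w. f w $ i)) (\<gamma> t)) * cnj (f (\<gamma> t) $ i))) (at t)"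
    unfolding fs_phi_def by (intro has_vector_derivative_sum has_vector_derivative_mult c vd_cnj)
  also have "(\<Sum>i\<in>UNIV. deriv (\<lambda>w. f w $ i) (\<gamma> t) * cnj (w * deriv (\<lambda>w. f w $ i) (\<gamma> t)) + (w * deriv (deriv (\<lambda>w. f w $ i)) (\<gamma> t)) * cnj (f (\<gamma> t) $ i))
     = w * fs_psi f (\<gamma> t) + cnj w * of_real (fs_energy f (\<gamma> t))"
    unfolding fs_psi_def fs_energy_def of_real_sum complex_norm_square sum_distrib_left sum.distrib[symmetric]
    by (intro sum.cong refl) (simp add: mult_ac)
  finally show ?thesis .
qed

lemma continuous_fs:
  "continuous_on D f" "continuous_on D (fs_phi f)" "continuous_on D (fs_psi f)" "continuous_on D (fs_energy f)"
proof -
  have c: "continuous_on D (\<lambda>z. f z $ i)" "continuous_on D (deriv (\<lambda>z. f z $ i))" "continuous_on D (deriv (deriv (\<lambda>z. f z $ i)))" for i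
    using hol[of i] holomorphic_deriv[OF hol D, of i] holomorphic_deriv[OF holomorphic_deriv[OF hol D] D, of i]
    by (auto intro: holomorphic_on_imp_continuous_on)
  show "continuous_on D f" using continuous_on_vec_lambda[of D "\<lambda>i z. f z $ i"] c(1) by simp
  show "continuous_on D (fs_phi f)" "continuous_on D (fs_psi f)" "continuous_on D (fs_energy f)"
    unfolding fs_phi_def fs_psi_def fs_energy_def by (intro continuous_intros c)+
qed

lemma continuous_fs_density: "continuous_on D (fs_density f)"
  unfolding fs_density_eq[abs_def] by (intro continuous_intros continuous_fs) (use nz in auto)

lemma continuous_on_polar:
  assumes "continuous_on D h" "ball 0 R' \<subseteq> D"
  shows "continuous_on ({-R'<..<R'} \<times> A) (\<lambda>p. h (of_real (fst p) * cis (snd p)))"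
  by (rule continuous_on_compose2[OF assms(1)]) (auto intro!: continuous_intros subsetD[OF assms(2)] simp: norm_mult)

lemma circle_mean_ln_norm_derivative:
  assumes "ball 0 R' \<subseteq> D" "\<bar>t\<bar> < R'"
  shows "((\<lambda>t. circle_mean t (\<lambda>z. ln (norm (f z)))) has_real_derivative
     (integral {0..2*pi} (\<lambda>\<theta>. Re (cis \<theta> * fs_phi f (of_real t * cis \<theta>)) / (norm (f (of_real t * cis \<theta>)))\<^sup>2) / (2*pi))) (at t)"
    "continuous_on {-R'<..<R'} (\<lambda>t. integral {0..2*pi} (\<lambda>\<theta>. Re (cis \<theta> * fs_phi f (of_real t * cis \<theta>)) / (norm (f (of_real t * cis \<theta>)))\<^sup>2) / (2*pi))"
proof -
  define U where "U = {-R'<..<R'}"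
  have aw: "at t within U = at t" by (rule at_within_open) (use assms in \<open>auto simp: U_def\<close>)
  have inD: "of_real t * cis \<theta> \<in> D" if "t \<in> U" for t \<theta>
    using assms(1) that by (auto simp: U_def norm_mult)
  have c: "continuous_on (U \<times> cbox 0 (2*pi)) (\<lambda>(t, \<theta>). Re (cis \<theta> * fs_phi f (of_real t * cis \<theta>)) / (norm (f (of_real t * cis \<theta>)))\<^sup>2)"
    unfolding case_prod_beta U_def
    by (intro continuous_intros continuous_on_polar[OF continuous_fs(1) assms(1)] continuous_on_polar[OF continuous_fs(2) assms(1)])
       (use nz inD in \<open>auto simp: U_def\<close>)
  have d: "((\<lambda>t. ln (norm (f (of_real t * cis \<theta>)))) has_real_derivative Re (cis \<theta> * fs_phi f (of_real t * cis \<theta>)) / (norm (f (of_real t * cis \<theta>)))\<^sup>2) (at t)"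
    if "t \<in> U" for t \<theta>
  proof -
    note g = vd_ray[of "cis \<theta>" t]
    have p: "0 < (norm (f (of_real t * cis \<theta>)))\<^sup>2" using nz[OF inD[OF that]] by simp
    have "((\<lambda>t. ln ((norm (f (of_real t * cis \<theta>)))\<^sup>2) / 2) has_real_derivative
        1 / (norm (f (of_real t * cis \<theta>)))\<^sup>2 * (2 * Re (cis \<theta> * fs_phi f (of_real t * cis \<theta>))) / 2) (at t)"
      by (intro DERIV_cdivide DERIV_chain2[where f=ln and g="\<lambda>t. (norm (f (of_real t * cis \<theta>)))\<^sup>2", OF DERIV_ln_divide[OF p]]
           norm_sq_derivative[OF g inD[OF that]])
    moreover have "(\<lambda>t. ln ((norm (f (of_real t * cis \<theta>)))\<^sup>2) / 2) = (\<lambda>t. ln (norm (f (of_real t * cis \<theta>))))"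
    proof
      fix t
      show "ln ((norm (f (of_real t * cis \<theta>)))\<^sup>2) / 2 = ln (norm (f (of_real t * cis \<theta>)))"
        by (cases "f (of_real t * cis \<theta>) = 0") (auto simp: ln_realpow)
    qed
    ultimately have "((\<lambda>t. ln (norm (f (of_real t * cis \<theta>)))) has_real_derivative
        1 / (norm (f (of_real t * cis \<theta>)))\<^sup>2 * (2 * Re (cis \<theta> * fs_phi f (of_real t * cis \<theta>))) / 2) (at t)" by (simp only:)
    then show ?thesis by (rule DERIV_cong) (simp del: times_complex.sel)
  qed
  have "((\<lambda>t. integral (cbox 0 (2*pi)) (\<lambda>\<theta>. ln (norm (f (of_real t * cis \<theta>))))) has_real_derivative
    integral (cbox 0 (2*pi)) (\<lambda>\<theta>. Re (cis \<theta> * fs_phi f (of_real t * cis \<theta>)) / (norm (f (of_real t * cis \<theta>)))\<^sup>2)) (at t within U)"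
  proof (rule leibniz_rule_field_derivative[OF _ _ c])
    show "((\<lambda>t. ln (norm (f (of_real t * cis \<theta>)))) has_real_derivative Re (cis \<theta> * fs_phi f (of_real t * cis \<theta>)) / (norm (f (of_real t * cis \<theta>)))\<^sup>2) (at t within U)"
      if "t \<in> U" for t \<theta> using d[OF that] by (rule has_field_derivative_at_within)
    show "(\<lambda>\<theta>. ln (norm (f (of_real t * cis \<theta>)))) integrable_on cbox 0 (2*pi)" if "t \<in> U" for t
    proof -
      have "continuous_on {0..2*pi} (\<lambda>\<theta>. f (of_real t * cis \<theta>))"
        by (rule continuous_on_compose2[OF continuous_fs(1)]) (use inD[OF that] in \<open>auto intro!: continuous_intros\<close>)
      then show ?thesis by (intro integrable_continuous) (use nz inD[OF that] in \<open>auto intro!: continuous_intros\<close>)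
    qed
  qed (use assms in \<open>auto simp: U_def\<close>)
  then have "((\<lambda>t. integral {0..2*pi} (\<lambda>\<theta>. ln (norm (f (of_real t * cis \<theta>))))) has_real_derivative
    integral {0..2*pi} (\<lambda>\<theta>. Re (cis \<theta> * fs_phi f (of_real t * cis \<theta>)) / (norm (f (of_real t * cis \<theta>)))\<^sup>2)) (at t)"
    unfolding box_real aw .
  then show "((\<lambda>t. circle_mean t (\<lambda>z. ln (norm (f z)))) has_real_derivative
     (integral {0..2*pi} (\<lambda>\<theta>. Re (cis \<theta> * fs_phi f (of_real t * cis \<theta>)) / (norm (f (of_real t * cis \<theta>)))\<^sup>2) / (2*pi))) (at t)"
    unfolding circle_mean_def by (rule DERIV_cdivide)
  show "continuous_on {-R'<..<R'} (\<lambda>t. integral {0..2*pi} (\<lambda>\<theta>. Re (cis \<theta> * fs_phi f (of_real t * cis \<theta>)) / (norm (f (of_real t * cis \<theta>)))\<^sup>2) / (2*pi))"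
    using integral_continuous_on_param[OF c] unfolding U_def by (intro continuous_intros) auto
qed

text \<open>
  The divergence theorem for \<open>ln \<parallel>f\<parallel>\<close> on an annulus, in infinitesimal form: the radial derivative of
  the flux differs from the Laplacian, which is \<open>2 \<pi>\<close> times the Fubini--Study density, by a derivative
  along the circle, whose integral vanishes by periodicity.
\<close>

lemma radial_flux_derivative:
  assumes "ball 0 R' \<subseteq> D" "0 < t" "t < R'"
  shows "((\<lambda>t. circle_mean t (\<lambda>z. Re (z * fs_phi f z) / (norm (f z))\<^sup>2)) has_real_derivative 2 * pi * t * circle_mean t (fs_density f)) (at t)"
proof -
  define U where "U = {-R'<..<R'}"
  define p where "p z = (norm (f z))\<^sup>2" for z
  define \<Phi> where "\<Phi> = fs_phi f"
  define \<Psi> where "\<Psi> = fs_psi f"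
  define E where "E = fs_energy f"
  define q where "q z c = (Re (c * \<Phi> z + z * (c * \<Psi> z + cnj c * of_real (E z))) * p z - Re (z * \<Phi> z) * (2 * Re (c * \<Phi> z))) / (p z)\<^sup>2" for z c
  have inD: "of_real t * cis \<theta> \<in> D" if "t \<in> U" for t \<theta>
    using assms(1) that by (auto simp: U_def norm_mult)
  have pp: "0 < p z" if "z \<in> D" for z using nz[OF that] by (simp add: p_def)
  have cp: "continuous_on D p" unfolding p_def by (intro continuous_intros continuous_fs)
  have der: "((\<lambda>t. Re (\<gamma> t * \<Phi> (\<gamma> t)) / p (\<gamma> t)) has_real_derivative q (\<gamma> t) w) (at t)"
    "((\<lambda>t. Im (\<gamma> t * \<Phi> (\<gamma> t)) / p (\<gamma> t)) has_real_derivative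
      (Im (w * \<Phi> (\<gamma> t) + \<gamma> t * (w * \<Psi> (\<gamma> t) + cnj w * of_real (E (\<gamma> t)))) * p (\<gamma> t) - Im (\<gamma> t * \<Phi> (\<gamma> t)) * (2 * Re (w * \<Phi> (\<gamma> t)))) / (p (\<gamma> t))\<^sup>2) (at t)"
    if g: "(\<gamma> has_vector_derivative w) (at t)" "\<gamma> t \<in> D" for \<gamma> w t
  proof -
    have N: "((\<lambda>t. \<gamma> t * \<Phi> (\<gamma> t)) has_vector_derivative w * \<Phi> (\<gamma> t) + \<gamma> t * (w * \<Psi> (\<gamma> t) + cnj w * of_real (E (\<gamma> t)))) (at t)"
      by (subst add.commute) (unfold \<Phi>_def \<Psi>_def E_def, intro has_vector_derivative_mult g phi_derivative)
    have P: "((\<lambda>t. p (\<gamma> t)) has_real_derivative 2 * Re (w * \<Phi> (\<gamma> t))) (at t)"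
      unfolding p_def \<Phi>_def by (rule norm_sq_derivative[OF g])
    have P0: "p (\<gamma> t) \<noteq> 0" using pp[OF g(2)] by simp
    have "((\<lambda>t. Re (\<gamma> t * \<Phi> (\<gamma> t))) has_real_derivative Re (w * \<Phi> (\<gamma> t) + \<gamma> t * (w * \<Psi> (\<gamma> t) + cnj w * of_real (E (\<gamma> t))))) (at t)"
      "((\<lambda>t. Im (\<gamma> t * \<Phi> (\<gamma> t))) has_real_derivative Im (w * \<Phi> (\<gamma> t) + \<gamma> t * (w * \<Psi> (\<gamma> t) + cnj w * of_real (E (\<gamma> t))))) (at t)"
      using bounded_linear.has_vector_derivative[OF bounded_linear_Re N] bounded_linear.has_vector_derivative[OF bounded_linear_Im N]
      by (simp_all only: has_real_derivative_iff_has_vector_derivative)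
    from DERIV_divide[OF this(1) P P0] DERIV_divide[OF this(2) P P0]
    show "((\<lambda>t. Re (\<gamma> t * \<Phi> (\<gamma> t)) / p (\<gamma> t)) has_real_derivative q (\<gamma> t) w) (at t)"
    "((\<lambda>t. Im (\<gamma> t * \<Phi> (\<gamma> t)) / p (\<gamma> t)) has_real_derivative
      (Im (w * \<Phi> (\<gamma> t) + \<gamma> t * (w * \<Psi> (\<gamma> t) + cnj w * of_real (E (\<gamma> t)))) * p (\<gamma> t) - Im (\<gamma> t * \<Phi> (\<gamma> t)) * (2 * Re (w * \<Phi> (\<gamma> t)))) / (p (\<gamma> t))\<^sup>2) (at t)"
      unfolding q_def power2_eq_square .
  qed
  have cq: "continuous_on (U \<times> cbox 0 (2*pi)) (\<lambda>(t, \<theta>). q (of_real t * cis \<theta>) (cis \<theta>))"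
    unfolding case_prod_beta q_def U_def \<Phi>_def \<Psi>_def E_def
    by (intro continuous_intros continuous_on_polar[OF cp assms(1)] continuous_on_polar[OF continuous_fs(2) assms(1)]
         continuous_on_polar[OF continuous_fs(3) assms(1)] continuous_on_polar[OF continuous_fs(4) assms(1)])
       (use pp inD in \<open>auto simp: U_def less_imp_neq[symmetric]\<close>)
  have tU: "t \<in> U" using assms by (auto simp: U_def)
  have "((\<lambda>t. integral (cbox 0 (2*pi)) (\<lambda>\<theta>. Re ((of_real t * cis \<theta>) * \<Phi> (of_real t * cis \<theta>)) / p (of_real t * cis \<theta>))) has_real_derivative
    integral (cbox 0 (2*pi)) (\<lambda>\<theta>. q (of_real t * cis \<theta>) (cis \<theta>))) (at t within U)"
  proof (rule leibniz_rule_field_derivative[OF _ _ cq tU])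
    show "((\<lambda>t. Re ((of_real t * cis \<theta>) * \<Phi> (of_real t * cis \<theta>)) / p (of_real t * cis \<theta>)) has_real_derivative q (of_real t * cis \<theta>) (cis \<theta>)) (at t within U)"
      if "t \<in> U" for t \<theta>
    proof (rule has_field_derivative_at_within, rule der(1)[of "\<lambda>t. of_real t * cis \<theta>" "cis \<theta>" t, OF _ inD[OF that]])
      show "((\<lambda>t. of_real t * cis \<theta>) has_vector_derivative cis \<theta>) (at t)" by (rule vd_ray)
    qed
    show "(\<lambda>\<theta>. Re ((of_real t * cis \<theta>) * \<Phi> (of_real t * cis \<theta>)) / p (of_real t * cis \<theta>)) integrable_on cbox 0 (2*pi)" if "t \<in> U" for t
    proof -
      have c: "continuous_on {0..2*pi} (\<lambda>\<theta>. h (of_real t * cis \<theta>))" if "continuous_on D h" for h :: "complex \<Rightarrow> 'z::topological_space"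
        by (rule continuous_on_compose2[OF that]) (use inD[OF \<open>t \<in> U\<close>] in \<open>auto intro!: continuous_intros\<close>)
      have "continuous_on (cbox 0 (2*pi)) (\<lambda>\<theta>. Re ((of_real t * cis \<theta>) * \<Phi> (of_real t * cis \<theta>)) / p (of_real t * cis \<theta>))"
        unfolding box_real \<Phi>_def
        by (intro continuous_intros c[OF cp] c[OF continuous_fs(2)]) (use pp inD[OF that] in \<open>auto simp: less_imp_neq[symmetric]\<close>)
      then show ?thesis by (rule integrable_continuous)
    qed
  qed (simp add: U_def)
  then have A: "((\<lambda>t. circle_mean t (\<lambda>z. Re (z * \<Phi> z) / p z)) has_real_derivative
     integral {0..2*pi} (\<lambda>\<theta>. q (of_real t * cis \<theta>) (cis \<theta>)) / (2*pi)) (at t)"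
    unfolding circle_mean_def box_real at_within_open[OF tU, unfolded U_def, OF open_greaterThanLessThan, folded U_def] by (rule DERIV_cdivide)
  define J where "J \<theta> = (let z = of_real t * cis \<theta>; w = \<i> * z in
     (Im (w * \<Phi> z + z * (w * \<Psi> z + cnj w * of_real (E z))) * p z - Im (z * \<Phi> z) * (2 * Re (w * \<Phi> z))) / (p z)\<^sup>2)" for \<theta>
  have J0: "(J has_integral 0) {0..2*pi}"
  proof -
    have "(J has_integral (Im ((of_real t * cis (2*pi)) * \<Phi> (of_real t * cis (2*pi))) / p (of_real t * cis (2*pi)) -
        Im ((of_real t * cis 0) * \<Phi> (of_real t * cis 0)) / p (of_real t * cis 0))) {0..2*pi}"
    proof (rule fundamental_theorem_of_calculus)
      fix \<theta> :: real
      have "((\<lambda>\<theta>. of_real t * cis \<theta>) has_vector_derivative of_real t * (\<i> * cis \<theta>)) (at \<theta>)"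
      proof (intro has_vector_derivative_mult_right)
        have "((\<lambda>x. exp (\<i> * x)) has_field_derivative \<i> * exp (\<i> * of_real \<theta>)) (at (of_real \<theta>))"
          by (auto intro!: derivative_eq_intros)
        from has_vector_derivative_real_field[OF this] show "(cis has_vector_derivative \<i> * cis \<theta>) (at \<theta>)"
          by (simp add: cis_conv_exp[abs_def])
      qed
      then have g: "((\<lambda>\<theta>. of_real t * cis \<theta>) has_vector_derivative \<i> * (of_real t * cis \<theta>)) (at \<theta>)" by (simp add: mult_ac)
      from der(2)[of "\<lambda>\<theta>. of_real t * cis \<theta>" "\<i> * (of_real t * cis \<theta>)" \<theta>, OF g inD[OF tU]]
      have "((\<lambda>\<theta>. Im ((of_real t * cis \<theta>) * \<Phi> (of_real t * cis \<theta>)) / p (of_real t * cis \<theta>)) has_real_derivative J \<theta>) (at \<theta>)"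
        unfolding J_def Let_def .
      then show "((\<lambda>\<theta>. Im ((of_real t * cis \<theta>) * \<Phi> (of_real t * cis \<theta>)) / p (of_real t * cis \<theta>)) has_vector_derivative J \<theta>) (at \<theta> within {0..2*pi})"
        by (simp add: has_real_derivative_iff_has_vector_derivative has_vector_derivative_at_within)
    qed simp
    then show ?thesis by (simp add: cis.code)
  qed
  have alg: "t * q z c = (let w = \<i> * z in
     (Im (w * \<Phi> z + z * (w * \<Psi> z + cnj w * of_real (E z))) * p z - Im (z * \<Phi> z) * (2 * Re (w * \<Phi> z))) / (p z)\<^sup>2) + 2 * pi * t\<^sup>2 * fs_density f z"
    if z: "z = of_real t * c" "cmod c = 1" "z \<in> D" for z c
  proof -
    have P: "0 < p z" using pp z by auto
    have zc: "z * cnj z = of_real (t\<^sup>2)" using z complex_norm_square[of c] by (simp add: power2_eq_square mult_ac)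
    define N where "N = z * \<Phi> z"
    define B where "B = z * \<Phi> z + z * z * \<Psi> z"
    have "t * q z c = ((Re (of_real t * (c * \<Phi> z + z * (c * \<Psi> z + cnj c * of_real (E z))))) * p z - Re N * (2 * Re (of_real t * (c * \<Phi> z)))) / (p z)\<^sup>2"
    proof -
      have Ret: "Re (of_real t * x) = t * Re x" for x by simp
      have gen: "t * ((A * P - B * (2 * C)) / Q) = ((t * A) * P - B * (2 * (t * C))) / Q" for A P B C Q :: real
        by (simp add: algebra_simps)
      show ?thesis unfolding q_def N_def Ret by (rule gen)
    qed
    also have "of_real t * (c * \<Phi> z + z * (c * \<Psi> z + cnj c * of_real (E z))) = B + z * cnj z * of_real (E z)"
      using z(1) by (simp add: B_def algebra_simps)
    also have "of_real t * (c * \<Phi> z) = N" using z(1) by (simp add: N_def)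
    finally have 1: "t * q z c = ((Re B + t\<^sup>2 * E z) * p z - 2 * (Re N)\<^sup>2) / (p z)\<^sup>2"
      unfolding zc by (simp add: power2_eq_square)
    have "(\<i> * z) * \<Phi> z + z * ((\<i> * z) * \<Psi> z + cnj (\<i> * z) * of_real (E z)) = \<i> * (B - z * cnj z * of_real (E z))"
      by (simp add: B_def algebra_simps)
    then have 2: "(let w = \<i> * z in
     (Im (w * \<Phi> z + z * (w * \<Psi> z + cnj w * of_real (E z))) * p z - Im (z * \<Phi> z) * (2 * Re (w * \<Phi> z))) / (p z)\<^sup>2)
       = ((Re B - t\<^sup>2 * E z) * p z + 2 * (Im N)\<^sup>2) / (p z)\<^sup>2"
      unfolding Let_def mult.assoc[of \<i> z] N_def[symmetric] by (simp only: zc) (simp add: power2_eq_square)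
    have "cmod N ^ 2 = t\<^sup>2 * (cmod (\<Phi> z))\<^sup>2" using z by (simp add: N_def norm_mult power_mult_distrib)
    then have 3: "(Re N)\<^sup>2 + (Im N)\<^sup>2 = t\<^sup>2 * (cmod (\<Phi> z))\<^sup>2" by (simp add: cmod_power2)
    have 4: "2 * pi * t\<^sup>2 * fs_density f z = (2 * t\<^sup>2 * E z * p z - 2 * ((Re N)\<^sup>2 + (Im N)\<^sup>2)) / (p z)\<^sup>2"
    proof -
      have "2 * pi * t\<^sup>2 * fs_density f z = (2 * t\<^sup>2 * (p z * E z - (cmod (\<Phi> z))\<^sup>2)) / (p z)\<^sup>2"
        unfolding fs_density_eq E_def p_def \<Phi>_def by simp
      then show ?thesis unfolding 3 by (simp add: right_diff_distrib mult_ac)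
    qed
    show ?thesis unfolding 1 2 4 add_divide_distrib[symmetric] by (rule arg_cong[where f="\<lambda>x. x / (p z)\<^sup>2"]) (simp add: algebra_simps)
  qed
  have cd: "continuous_on (sphere 0 t) (fs_density f)"
    by (rule continuous_on_subset[OF continuous_fs_density]) (use assms in auto)
  have "((\<lambda>\<theta>. fs_density f (of_real t * cis \<theta>)) has_integral (2 * pi * circle_mean t (fs_density f))) {0..2*pi}"
    using integrable_integral[OF circle_mean_integrable[OF cd]] assms by (simp add: circle_mean_def)
  from has_integral_add[OF J0 has_integral_mult_right[OF this, of "2 * pi * t\<^sup>2"]]
  have "((\<lambda>\<theta>. t * q (of_real t * cis \<theta>) (cis \<theta>)) has_integral (2 * pi * t\<^sup>2 * (2 * pi * circle_mean t (fs_density f)))) {0..2*pi}"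
    using alg[OF refl _ inD[OF tU]] by (simp add: J_def Let_def)
  then have "integral {0..2*pi} (\<lambda>\<theta>. t * q (of_real t * cis \<theta>) (cis \<theta>)) = 2 * pi * t\<^sup>2 * (2 * pi * circle_mean t (fs_density f))"
    by (rule integral_unique)
  then have "integral {0..2*pi} (\<lambda>\<theta>. q (of_real t * cis \<theta>) (cis \<theta>)) = 2 * pi * t * (2 * pi * circle_mean t (fs_density f))"
    using assms by (simp add: power2_eq_square)
  then have eqn: "integral {0..2*pi} (\<lambda>\<theta>. q (of_real t * cis \<theta>) (cis \<theta>)) / (2*pi) = 2 * pi * t * circle_mean t (fs_density f)"
    by simp
  show ?thesis using A unfolding eqn \<Phi>_def p_def .
qed

text \<open>
  Integration of the flux derivative from \<open>0\<close>, where the flux vanishes.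
\<close>

lemma area_integral_fs_density:
  assumes "ball 0 R' \<subseteq> D" "0 < t" "t < R'"
  shows "(LBINT z:cball 0 t. fs_density f z) = circle_mean t (\<lambda>z. Re (z * fs_phi f z) / (norm (f z))\<^sup>2)"
proof -
  have sub: "cball 0 t \<subseteq> D" using assms by auto
  have "(LBINT z:cball 0 t. fs_density f z) = integral {0..t} (\<lambda>s. 2 * pi * s * circle_mean s (fs_density f))"
    by (rule area_integral_polar[OF _ continuous_on_subset[OF continuous_fs_density sub] fs_density_nonneg]) (use assms in simp)
  also have "\<dots> = circle_mean t (\<lambda>z. Re (z * fs_phi f z) / (norm (f z))\<^sup>2) - circle_mean 0 (\<lambda>z. Re (z * fs_phi f z) / (norm (f z))\<^sup>2)"
  proof (rule integral_unique, rule fundamental_theorem_of_calculus_interior)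
    show "continuous_on {0..t} (\<lambda>t. circle_mean t (\<lambda>z. Re (z * fs_phi f z) / (norm (f z))\<^sup>2))"
      by (rule continuous_on_circle_mean)
         (intro continuous_intros continuous_on_subset[OF continuous_fs(1) sub] continuous_on_subset[OF continuous_fs(2) sub], use nz sub in auto)
    fix s assume "s \<in> {0<..<t}"
    then show "((\<lambda>t. circle_mean t (\<lambda>z. Re (z * fs_phi f z) / (norm (f z))\<^sup>2)) has_vector_derivative 2 * pi * s * circle_mean s (fs_density f)) (at s)"
      using radial_flux_derivative[OF assms(1), of s] assms by (simp add: has_real_derivative_iff_has_vector_derivative)
  qed (use assms in simp)
  also have "circle_mean 0 (\<lambda>z. Re (z * fs_phi f z) / (norm (f z))\<^sup>2) = 0" by (simp add: circle_mean_def)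
  finally show ?thesis by simp
qed

end

text \<open>
  The logarithmic radial derivative of the circle mean of \<open>ln \<parallel>f\<parallel>\<close> is the flux through the circle,
  that is, the area integral of the density. A second integration gives the characteristic function,
  and nonnegativity of the density gives monotonicity.
\<close>

lemma char_fun_as_circle_mean:
  fixes f :: "complex \<Rightarrow> complex ^ 'n::finite"
  assumes rep: "reduced_representation R f"
  shows char_fun_power_eq_circle_mean: "\<And>r d. 0 < r \<Longrightarrow> ereal r < R \<Longrightarrow>
      char_fun_power f d r = real d * (circle_mean r (\<lambda>z. ln (norm (f z))) - ln (norm (f 0)))"
    and circle_mean_ln_norm_mono: "\<And>r s. 0 < r \<Longrightarrow> r \<le> s \<Longrightarrow> ereal s < R \<Longrightarrow>
      circle_mean r (\<lambda>z. ln (norm (f z))) \<le> circle_mean s (\<lambda>z. ln (norm (f z)))"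
    and continuous_on_circle_mean_ln_norm:
      "continuous_on {r. 0 < r \<and> ereal r < R} (\<lambda>r. circle_mean r (\<lambda>z. ln (norm (f z))))"
proof -
  define D where "D = disc R"
  have D: "open D" and hol: "\<And>i. (\<lambda>z. f z $ i) holomorphic_on D" and nz: "\<And>z. z \<in> D \<Longrightarrow> f z \<noteq> 0"
    using rep open_disc by (auto simp: D_def reduced_representation_def)
  define M where "M t = circle_mean t (\<lambda>z. ln (norm (f z)))" for t
  define K where "K t = integral {0..2*pi} (\<lambda>\<theta>. Re (cis \<theta> * fs_phi f (of_real t * cis \<theta>)) / (norm (f (of_real t * cis \<theta>)))\<^sup>2) / (2*pi)" for t
  have R'ex: "\<exists>R'>r. ball 0 R' \<subseteq> D" if r: "ereal r < R" for r
  proof -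
    obtain R' where R': "ereal r < ereal R'" "ereal R' < R" using ereal_dense2[OF r] by blast
    have "ball 0 R' \<subseteq> D" unfolding D_def by (rule ball_subset_disc) (use R'(2) in \<open>rule less_imp_le\<close>)
    then show ?thesis using R'(1) by auto
  qed
  have der: "(M has_real_derivative K t) (at t)" if t: "ereal \<bar>t\<bar> < R" for t
  proof -
    obtain R' where "\<bar>t\<bar> < R'" "ball 0 R' \<subseteq> D" using R'ex[OF t] by blast
    then show ?thesis using circle_mean_ln_norm_derivative(1)[OF D hol nz] unfolding M_def K_def by blast
  qed
  have area: "(LBINT z:cball 0 t. fs_density f z) = t * K t" if t: "0 < t" "ereal t < R" for t
  proof -
    obtain R' where R': "t < R'" "ball 0 R' \<subseteq> D" using R'ex[OF t(2)] by blast
    have "(LBINT z:cball 0 t. fs_density f z) = circle_mean t (\<lambda>z. Re (z * fs_phi f z) / (norm (f z))\<^sup>2)"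
      by (rule area_integral_fs_density[OF D hol nz R'(2) t(1) R'(1)])
    also have "\<dots> = integral {0..2*pi} (\<lambda>\<theta>. t * (Re (cis \<theta> * fs_phi f (of_real t * cis \<theta>)) / (norm (f (of_real t * cis \<theta>)))\<^sup>2)) / (2*pi)"
    proof -
      have e: "Re (of_real t * cis \<theta> * x) = t * Re (cis \<theta> * x)" for \<theta> x by (simp add: algebra_simps)
      show ?thesis unfolding circle_mean_def e by simp
    qed
    also have "\<dots> = t * K t" unfolding K_def by (subst integral_mult_right) simp
    finally show ?thesis .
  qed
  have Knn: "0 \<le> K t" if t: "0 < t" "ereal t < R" for t
  proof -
    have "0 \<le> (LBINT z:cball 0 t. fs_density f z)"
      unfolding set_lebesgue_integral_def by (rule integral_nonneg_AE) (simp add: fs_density_nonneg)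
    then show ?thesis using area[OF t] t by (simp add: zero_le_mult_iff)
  qed
  have lt: "ereal x < R" if "x \<le> y" "ereal y < R" for x y
  proof -
    have "ereal x \<le> ereal y" using that by simp
    also note that(2)
    finally show ?thesis .
  qed
  show "circle_mean r (\<lambda>z. ln (norm (f z))) \<le> circle_mean s (\<lambda>z. ln (norm (f z)))"
    if "0 < r" "r \<le> s" "ereal s < R" for r s
    unfolding M_def[symmetric]
  proof (rule DERIV_nonneg_imp_nondecreasing[OF that(2)])
    fix x assume "r \<le> x" "x \<le> s"
    then have "ereal \<bar>x\<bar> < R" "0 < x" "ereal x < R" using that lt by auto
    then show "\<exists>y. (M has_real_derivative y) (at x) \<and> 0 \<le> y" using der Knn by blast
  qed
  show "continuous_on {r. 0 < r \<and> ereal r < R} (\<lambda>r. circle_mean r (\<lambda>z. ln (norm (f z))))"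
    unfolding M_def[symmetric] 
  proof (rule continuous_at_imp_continuous_on, rule ballI)
    fix x assume "x \<in> {r. 0 < r \<and> ereal r < R}"
    then show "isCont M x" by (intro DERIV_isCont[OF der]) simp
  qed
  show "char_fun_power f d r = real d * (circle_mean r (\<lambda>z. ln (norm (f z))) - ln (norm (f 0)))"
    if r: "0 < r" "ereal r < R" for r d
  proof -
    obtain R' where R': "r < R'" "ball 0 R' \<subseteq> D" using R'ex[OF r(2)] by blast
    have cK: "continuous_on {0..r} K"
      using circle_mean_ln_norm_derivative(2)[OF D hol nz R'(2), of 0] R' r unfolding K_def
      by (auto intro: continuous_on_subset)
    have "char_fun_power f d r = (LBINT t:{0<..<r}. real d * K t)"
      unfolding char_fun_power_def
    proof (rule set_lebesgue_integral_cong)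
      show "\<forall>t. t \<in> {0<..<r} \<longrightarrow> (LBINT z:cball 0 t. real d * fs_density f z) / t = real d * K t"
      proof (intro allI impI)
        fix t assume "t \<in> {0<..<r}"
        then have t: "0 < t" "ereal t < R" using lt[of t r] r by auto
        show "(LBINT z:cball 0 t. real d * fs_density f z) / t = real d * K t"
          using area[OF t] t by (simp add: set_integral_mult_right)
      qed
    qed simp
    also have "\<dots> = real d * (LBINT t:{0<..<r}. K t)" by (simp add: set_integral_mult_right)
    also have "(LBINT t:{0<..<r}. K t) = integral {0<..<r} K"
    proof (rule set_borel_integral_eq_integral(2))
      have "set_integrable lborel {0..r} K" by (rule borel_integrable_atLeastAtMost'[OF cK])
      then show "set_integrable lborel {0<..<r} K" by (rule set_integrable_subset) auto
    qed
    also have "\<dots> = integral {0..r} K" by (simp add: integral_open_interval_real)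
    also have "\<dots> = M r - M 0"
    proof (rule integral_unique, rule fundamental_theorem_of_calculus)
      fix x assume "x \<in> {0..r}"
      then have "ereal \<bar>x\<bar> < R" using lt[of x r] r by auto
      then show "(M has_vector_derivative K x) (at x within {0..r})"
        using der by (simp add: has_real_derivative_iff_has_vector_derivative has_vector_derivative_at_within)
    qed (use r in simp)
    also have "M 0 = ln (norm (f 0))" by (simp add: M_def circle_mean_def)
    finally show ?thesis by (simp add: M_def)
  qed
qed

section \<open>The growth lemma and the exceptional set\<close>

text \<open>
  A radius with \<open>m \<le> T r < m + 1\<close> is bad if every \<open>\<rho> > r\<close> with \<open>T \<rho> \<le> T r + 1\<close> is closer to \<open>r\<close> than
  \<open>exp (- c (T r + 1)) / T(r)\<^sup>2\<close>. Two bad radii of the same level \<open>m\<close> satisfy \<open>T s \<le> T r + 1\<close>, so the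
  bad radii of level \<open>m\<close> lie in one interval of length at most \<open>exp (- c (m + 1)) / m\<^sup>2\<close>, on which
  \<open>exp (c T)\<close> has integral at most \<open>1 / m\<^sup>2\<close>. The function \<open>h\<close> is a measurable majorant.
\<close>

lemma borel_growth_lemma:
  fixes T :: "real \<Rightarrow> real" and R :: ereal
  assumes c: "0 \<le> c" and r1: "0 < r1"
    and cont: "continuous_on {r. 0 < r \<and> ereal r < R} T"
    and T1: "\<And>r. r1 \<le> r \<Longrightarrow> ereal r < R \<Longrightarrow> 1 \<le> T r"
  shows "\<exists>E h. E \<in> sets borel \<and> E \<subseteq> {r. r1 \<le> r \<and> ereal r < R} \<and>
     h \<in> borel_measurable borel \<and> (\<integral>\<^sup>+r. h r \<partial>lborel) < \<infinity> \<and> (\<forall>r\<in>E. ennreal (exp (c * T r)) \<le> h r) \<and>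
     (\<forall>r. r1 \<le> r \<and> ereal r < R \<and> r \<notin> E \<longrightarrow>
        (\<exists>\<rho>>r. ereal \<rho> < R \<and> T \<rho> \<le> T r + 1 \<and> ln (1 / (\<rho> - r)) \<le> c * (T r + 1) + 2 * ln (T r)))"
proof -
  define S where "S m = {r. r1 \<le> r \<and> ereal r < R \<and> real m \<le> T r \<and> T r < real m + 1 \<and>
     (\<forall>\<rho>>r. ereal \<rho> < R \<and> T \<rho> \<le> T r + 1 \<longrightarrow> \<rho> - r < exp (- c * (T r + 1)) / (T r)\<^sup>2)}" for m
  define l where "l m = exp (- c * (real m + 1)) / (real m)\<^sup>2" for m
  define a where "a m = Inf (S m)" for m
  define U where "U m = {r. 0 < r \<and> ereal r < R} \<inter> {r. T r < real m + 1}" for m :: nat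
  define Em where "Em m = {a m..a m + l m} \<inter> {r1..} \<inter> U m" for m
  define E where "E = (\<Union>m. Em (Suc m))"
  have openI: "open {r. 0 < r \<and> ereal r < R}"
  proof -
    have "{r. 0 < r \<and> ereal r < R} = {0<..} \<inter> ereal -` {..<R}" by auto
    moreover have "open (ereal -` {..<R})" by (rule open_ereal_vimage) simp
    ultimately show ?thesis by (simp only: open_Int open_greaterThan)
  qed
  have "open (U m)" for m
  proof -
    have "U m = {r. 0 < r \<and> ereal r < R} \<inter> T -` {..<real m + 1}" by (auto simp: U_def)
    then show ?thesis using continuous_open_preimage[OF cont openI] by auto
  qed
  then have Eb: "E \<in> sets borel" unfolding E_def Em_def by auto
  have sub: "S m \<subseteq> Em m" if m: "0 < m" for m
  proof
    fix r assume r: "r \<in> S m"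
    have bdd: "bdd_below (S m)" by (rule bdd_belowI[of _ r1]) (auto simp: S_def)
    have "a m \<le> r" unfolding a_def by (rule cInf_lower[OF r bdd])
    moreover have "r - l m \<le> a m" unfolding a_def
    proof (rule cInf_greatest)
      show "S m \<noteq> {}" using r by auto
      fix s assume s: "s \<in> S m"
      show "r - l m \<le> s"
      proof (cases "s < r")
        case True
        have "r - s < exp (- c * (T s + 1)) / (T s)\<^sup>2" using s r True by (auto simp: S_def)
        also have "\<dots> \<le> l m" unfolding l_def
          by (intro frac_le power_mono) (use s m c in \<open>auto simp: S_def intro: mult_left_mono\<close>)
        finally show ?thesis by simp
      next
        case False
        have "0 \<le> l m" by (simp add: l_def)
        then show ?thesis using False by simp
      qed
    qed
    ultimately show "r \<in> Em m" using r r1 by (auto simp: Em_def U_def S_def)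
  qed
  define h where "h r = (suminf (\<lambda>m. ennreal (exp (c * (real (Suc m) + 1))) * indicator {a (Suc m)..a (Suc m) + l (Suc m)} r))" for r
  have hm: "h \<in> borel_measurable borel" unfolding h_def by measurable
  have "(\<integral>\<^sup>+r. h r \<partial>lborel) = (suminf (\<lambda>m. \<integral>\<^sup>+r. ennreal (exp (c * (real (Suc m) + 1))) * indicator {a (Suc m)..a (Suc m) + l (Suc m)} r \<partial>lborel))"
    unfolding h_def by (rule nn_integral_suminf) measurable
  also have "\<dots> = (suminf (\<lambda>m. ennreal (1 / (real (Suc m))\<^sup>2)))"
  proof (rule suminf_cong)
    fix m
    have "0 \<le> l (Suc m)" by (simp add: l_def)
    then have "(\<integral>\<^sup>+r. ennreal (exp (c * (real (Suc m) + 1))) * indicator {a (Suc m)..a (Suc m) + l (Suc m)} r \<partial>lborel)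
       = ennreal (exp (c * (real (Suc m) + 1))) * ennreal (l (Suc m))"
      by (subst nn_integral_cmult_indicator) auto
    also have "\<dots> = ennreal (exp (c * (real (Suc m) + 1)) * l (Suc m))" by (rule ennreal_mult[symmetric]) (auto simp: l_def)
    also have "exp (c * (real (Suc m) + 1)) * l (Suc m) = 1 / (real (Suc m))\<^sup>2"
      by (simp add: l_def exp_minus del: of_nat_Suc)
    finally show "(\<integral>\<^sup>+r. ennreal (exp (c * (real (Suc m) + 1))) * indicator {a (Suc m)..a (Suc m) + l (Suc m)} r \<partial>lborel) = ennreal (1 / (real (Suc m))\<^sup>2)" .
  qed
  also have "\<dots> < \<infinity>"
  proof -
    have "summable (\<lambda>m. 1 / (real (Suc m))\<^sup>2)"
      using inverse_power_summable[of 2, where 'a=real] by (subst summable_Suc_iff) (simp add: field_simps)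
    then have "(suminf (\<lambda>m. ennreal (1 / (real (Suc m))\<^sup>2))) \<noteq> \<infinity>" unfolding infinity_ennreal_def by (intro ennreal_suminf_neq_top) auto
    then show ?thesis by (simp add: less_top)
  qed
  finally have hf: "(\<integral>\<^sup>+r. h r \<partial>lborel) < \<infinity>" .
  have hE: "ennreal (exp (c * T r)) \<le> h r" if "r \<in> E" for r
  proof -
    obtain m where m: "r \<in> Em (Suc m)" using \<open>r \<in> E\<close> by (auto simp: E_def)
    then have "ennreal (exp (c * T r)) \<le> ennreal (exp (c * (real (Suc m) + 1)))"
      using c by (intro ennreal_leI) (auto simp: Em_def U_def intro!: mult_left_mono)
    also have "\<dots> = ennreal (exp (c * (real (Suc m) + 1))) * indicator {a (Suc m)..a (Suc m) + l (Suc m)} r"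
      using m by (auto simp: Em_def)
    also have "\<dots> \<le> h r"
    proof -
      define X where "X m = ennreal (exp (c * (real (Suc m) + 1))) * indicator {a (Suc m)..a (Suc m) + l (Suc m)} r" for m
      have "sum X {m} \<le> suminf X" by (rule sum_le_suminf) auto
      then have "X m \<le> suminf X" by simp
      then show ?thesis unfolding h_def X_def .
    qed
    finally show ?thesis .
  qed
  have good: "\<exists>\<rho>>r. ereal \<rho> < R \<and> T \<rho> \<le> T r + 1 \<and> ln (1 / (\<rho> - r)) \<le> c * (T r + 1) + 2 * ln (T r)"
    if r: "r1 \<le> r" "ereal r < R" "r \<notin> E" for r
  proof -
    have Tr: "1 \<le> T r" using T1 r by auto
    define m where "m = nat \<lfloor>T r\<rfloor>"
    have m: "0 < m" "real m \<le> T r" "T r < real m + 1" using Tr by (auto simp: m_def of_nat_nat)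
    obtain m' where m': "m = Suc m'" using m(1) by (cases m) auto
    have "r \<notin> Em m" using r(3) m' by (auto simp: E_def)
    then have "r \<notin> S m" using sub[OF m(1)] by auto
    then obtain \<rho> where \<rho>: "\<rho> > r" "ereal \<rho> < R" "T \<rho> \<le> T r + 1" "exp (- c * (T r + 1)) / (T r)\<^sup>2 \<le> \<rho> - r"
      using r m unfolding S_def by force
    have "ln (exp (- c * (T r + 1)) / (T r)\<^sup>2) \<le> ln (\<rho> - r)" using \<rho>(4) Tr by (intro ln_mono) auto
    moreover have "ln (exp (- c * (T r + 1)) / (T r)\<^sup>2) = - c * (T r + 1) - 2 * ln (T r)"
      using Tr by (simp add: ln_div ln_realpow)
    moreover have "ln (1 / (\<rho> - r)) = - ln (\<rho> - r)" using \<rho>(1) by (simp add: ln_div)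
    ultimately show ?thesis using \<rho> by (intro exI[of _ \<rho>]) auto
  qed
  have "E \<subseteq> {r. r1 \<le> r \<and> ereal r < R}" by (auto simp: E_def Em_def U_def)
  then show ?thesis using Eb hm hf hE good by (intro exI[of _ E] exI[of _ h]) blast
qed

text \<open>
  The exceptional set consists of an initial interval, where \<open>T\<close> may be small, the countable set \<open>Bad\<close>,
  and the set of the growth lemma. Beyond the initial interval \<open>T \<ge> exp 1\<close>, so that constants and
  \<open>ln T\<close> are absorbed into multiples of \<open>log_plus (T r)\<close>.
\<close>

lemma exceptional_set_estimate:
  fixes T Cnt :: "real \<Rightarrow> real" and R :: ereal
  assumes c: "0 \<le> c" and P: "0 \<le> P" and D: "0 \<le> D"
    and mono: "\<And>r s. 0 < r \<Longrightarrow> r \<le> s \<Longrightarrow> ereal s < R \<Longrightarrow> T r \<le> T s"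
    and cont: "continuous_on {r. 0 < r \<and> ereal r < R} T"
    and unbdd: "\<And>B. \<exists>r>0. ereal r < R \<and> B < T r"
    and r0: "0 < r0" "ereal r0 < R" and Bad: "countable Bad"
    and main: "\<And>r \<rho>. r0 \<le> r \<Longrightarrow> r < \<rho> \<Longrightarrow> \<rho> \<le> r + 1 \<Longrightarrow> ereal \<rho> < R \<Longrightarrow> r \<notin> Bad \<Longrightarrow>
       0 \<le> D * (T \<rho> + b) + C \<and>
       A * (D * (T r + b)) \<le> Cnt r + P * (ln (1 / (\<rho> - r)) + ln (1 + \<rho>) + ln (1 + (D * (T \<rho> + b) + C))) + C"
  shows "\<exists>C'. \<exists>E \<in> sets borel. E \<subseteq> {r. 0 < r \<and> ereal r < R} \<and>
     (\<integral>\<^sup>+ r \<in> E. ennreal (exp (c * T r)) \<partial>lborel) < \<infinity> \<and>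
     (\<forall>r. 0 < r \<and> ereal r < R \<and> r \<notin> E \<longrightarrow>
        A * (D * T r) \<le> Cnt r + C' * (log_plus (T r) + log_plus r) + P * c * T r)"
proof -
  obtain r2 where r2: "0 < r2" "ereal r2 < R" "exp 1 < T r2" using unbdd by blast
  define r1 where "r1 = max r0 r2"
  have r1: "0 < r1" "ereal r1 < R" "r0 \<le> r1" using r0 r2 by (auto simp: r1_def max_def)
  have Te: "exp 1 \<le> T r" if "r1 \<le> r" "ereal r < R" for r
    using mono[of r2 r] r2 that by (auto simp: r1_def)
  have T1: "1 \<le> T r" if "r1 \<le> r" "ereal r < R" for r
    using Te[OF that] exp_ge_add_one_self[of 1] by linarith
  obtain E0 h where E0: "E0 \<in> sets borel" "E0 \<subseteq> {r. r1 \<le> r \<and> ereal r < R}"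
     "h \<in> borel_measurable borel" "(\<integral>\<^sup>+r. h r \<partial>lborel) < \<infinity>" "\<And>r. r\<in>E0 \<Longrightarrow> ennreal (exp (c * T r)) \<le> h r"
     and good: "\<And>r. r1 \<le> r \<Longrightarrow> ereal r < R \<Longrightarrow> r \<notin> E0 \<Longrightarrow>
        \<exists>\<rho>>r. ereal \<rho> < R \<and> T \<rho> \<le> T r + 1 \<and> ln (1 / (\<rho> - r)) \<le> c * (T r + 1) + 2 * ln (T r)"
    using borel_growth_lemma[OF c r1(1) cont T1] by blast
  define B where "B = Bad \<inter> {r. 0 < r \<and> ereal r < R}"
  define E where "E = {0<..<r1} \<union> B \<union> E0"
  have cB: "countable B" using Bad by (auto simp: B_def)
  have Bb: "B \<in> sets borel" using cB by (rule sets.countable[rotated]) auto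
  have Eb: "E \<in> sets borel" unfolding E_def using Bb E0(1) by auto
  have Esub: "E \<subseteq> {r. 0 < r \<and> ereal r < R}"
  proof
    fix r assume "r \<in> E"
    then consider "r \<in> {0<..<r1}" | "r \<in> B" | "r \<in> E0" by (auto simp: E_def)
    then show "r \<in> {r. 0 < r \<and> ereal r < R}"
    proof cases
      case 1
      then have "ereal r < ereal r1" by simp
      also note r1(2)
      finally show ?thesis using 1 by simp
    qed (use E0(2) r1 in \<open>auto simp: B_def\<close>)
  qed
  have "(\<integral>\<^sup>+ r \<in> E. ennreal (exp (c * T r)) \<partial>lborel) \<le> (\<integral>\<^sup>+r. ennreal (exp (c * T r1)) * indicator {0<..<r1} r + h r \<partial>lborel)"
  proof (rule nn_integral_mono_AE)
    have "AE r in lborel. r \<notin> B"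
      by (rule AE_not_in) (rule countable_imp_null_set_lborel[OF cB])
    then show "AE r in lborel. ennreal (exp (c * T r)) * indicator E r \<le> ennreal (exp (c * T r1)) * indicator {0<..<r1} r + h r"
    proof eventually_elim
      fix r assume rB: "r \<notin> B"
      show "ennreal (exp (c * T r)) * indicator E r \<le> ennreal (exp (c * T r1)) * indicator {0<..<r1} r + h r"
      proof (cases "r \<in> E0")
        case True
        then show ?thesis using E0(5)[OF True] by (auto simp: indicator_def intro: add_increasing)
      next
        case False
        show ?thesis
        proof (cases "r \<in> {0<..<r1}")
          case True
          have "T r \<le> T r1" using True r1 by (intro mono) auto
          then have "ennreal (exp (c * T r)) \<le> ennreal (exp (c * T r1))" using c by (intro ennreal_leI) (simp add: mult_left_mono)
          then show ?thesis using True by (auto simp: indicator_def intro: add_increasing2)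
        next
          case F: False
          then have "r \<notin> E" using False rB by (auto simp: E_def)
          then show ?thesis by simp
        qed
      qed
    qed
  qed
  also have "\<dots> = (\<integral>\<^sup>+r. ennreal (exp (c * T r1)) * indicator {0<..<r1} r \<partial>lborel) + (\<integral>\<^sup>+r. h r \<partial>lborel)"
    by (rule nn_integral_add) (use E0(3) in auto)
  also have "\<dots> < \<infinity>"
  proof -
    have "(\<integral>\<^sup>+r. ennreal (exp (c * T r1)) * indicator {0<..<r1} r \<partial>lborel) = ennreal (exp (c * T r1)) * ennreal r1"
      by (subst nn_integral_cmult_indicator) (use r1 in auto)
    also have "\<dots> < \<infinity>" by (simp add: ennreal_mult_less_top)
    finally show ?thesis using E0(4) by simp
  qed
  finally have Efin: "(\<integral>\<^sup>+ r \<in> E. ennreal (exp (c * T r)) \<partial>lborel) < \<infinity>" .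
  define K where "K = 1 + D * (2 + \<bar>b\<bar>) + \<bar>C\<bar>"
  have K1: "1 \<le> K" using D by (simp add: K_def)
  define c0 where "c0 = - (A * D * b) + P * c + P * ln 3 + P * ln K + C"
  define C' where "C' = \<bar>c0\<bar> + 3 * P"
  have "A * (D * T r) \<le> Cnt r + C' * (log_plus (T r) + log_plus r) + P * c * T r"
    if r: "0 < r" "ereal r < R" "r \<notin> E" for r
  proof -
    have rr: "r1 \<le> r" "r \<notin> Bad" "r \<notin> E0" using r by (auto simp: E_def B_def)
    obtain \<rho>0 where \<rho>0: "r < \<rho>0" "ereal \<rho>0 < R" "T \<rho>0 \<le> T r + 1" "ln (1 / (\<rho>0 - r)) \<le> c * (T r + 1) + 2 * ln (T r)"
      using good[OF rr(1) r(2) rr(3)] by blast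
    have Tr: "exp 1 \<le> T r" "1 \<le> T r" using Te T1 rr r by auto
    have lT: "1 \<le> ln (T r)" using ln_mono[OF Tr(1)] by simp
    define \<rho> where "\<rho> = min \<rho>0 (r + 1)"
    have \<rho>: "r < \<rho>" "\<rho> \<le> r + 1" "ereal \<rho> < R" using \<rho>0 by (auto simp: \<rho>_def min_def intro: le_less_trans[of _ "ereal \<rho>0"])
    have T\<rho>: "T \<rho> \<le> T r + 1" using mono[of \<rho> \<rho>0] \<rho> \<rho>0 r by (auto simp: \<rho>_def)
    have l1: "ln (1 / (\<rho> - r)) \<le> c * (T r + 1) + 2 * ln (T r)"
    proof (cases "\<rho>0 \<le> r + 1")
      case False
      have "0 \<le> c * (T r + 1) + 2 * ln (T r)" using c Tr lT by simp
      then show ?thesis using False by (simp add: \<rho>_def min_def)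
    qed (use \<rho>0 in \<open>simp add: \<rho>_def min_def\<close>)
    have l2: "ln (1 + \<rho>) \<le> ln 3 + log_plus r"
    proof (cases "1 \<le> r")
      case True
      have "ln (1 + \<rho>) \<le> ln (3 * r)" using \<rho> r True by (intro ln_mono) auto
      also have "\<dots> = ln 3 + ln r" using r by (simp add: ln_mult_pos)
      also have "\<dots> \<le> ln 3 + log_plus r" by (simp add: log_plus_def)
      finally show ?thesis .
    next
      case False
      have "ln (1 + \<rho>) \<le> ln 3" using \<rho> r False by (intro ln_mono) auto
      also have "\<dots> \<le> ln 3 + log_plus r" by (simp add: log_plus_def)
      finally show ?thesis .
    qed
    note m = main[OF order_trans[OF r1(3) rr(1)] \<rho> rr(2)]
    have l3: "ln (1 + (D * (T \<rho> + b) + C)) \<le> ln K + ln (T r)"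
    proof -
      have "T \<rho> + b \<le> T r * (2 + \<bar>b\<bar>)"
      proof -
        have "\<bar>b\<bar> * 1 \<le> \<bar>b\<bar> * T r" using Tr by (intro mult_left_mono) auto
        then show ?thesis using T\<rho> Tr by (simp add: distrib_left mult.commute)
      qed
      then have "D * (T \<rho> + b) \<le> D * (T r * (2 + \<bar>b\<bar>))" using D by (rule mult_left_mono)
      moreover have "\<bar>C\<bar> * 1 \<le> \<bar>C\<bar> * T r" using Tr by (intro mult_left_mono) auto
      ultimately have "1 + (D * (T \<rho> + b) + C) \<le> K * T r" using Tr by (simp add: K_def algebra_simps)
      then have "ln (1 + (D * (T \<rho> + b) + C)) \<le> ln (K * T r)" using m by (intro ln_mono) auto
      also have "\<dots> = ln K + ln (T r)" using K1 Tr by (simp add: ln_mult_pos)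
      finally show ?thesis .
    qed
    have "P * (ln (1 / (\<rho> - r)) + ln (1 + \<rho>) + ln (1 + (D * (T \<rho> + b) + C)))
       \<le> P * ((c * (T r + 1) + 2 * ln (T r)) + (ln 3 + log_plus r) + (ln K + ln (T r)))"
      using l1 l2 l3 P by (intro mult_left_mono add_mono)
    then have "A * (D * (T r + b)) \<le> Cnt r + P * ((c * (T r + 1) + 2 * ln (T r)) + (ln 3 + log_plus r) + (ln K + ln (T r))) + C"
      using m by linarith
    then have "A * (D * T r) \<le> Cnt r + P * c * T r + c0 + 3 * P * ln (T r) + P * log_plus r"
      by (simp add: c0_def algebra_simps)
    also have "c0 \<le> \<bar>c0\<bar> * ln (T r)" using mult_left_mono[OF lT, of "\<bar>c0\<bar>"] by simp
    also have "P * log_plus r \<le> C' * log_plus r" unfolding C'_def using P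
      by (intro mult_right_mono) (auto simp: log_plus_def)
    finally show ?thesis using lT by (simp add: C'_def log_plus_def algebra_simps)
  qed
  then show ?thesis using Eb Esub Efin by (intro exI[of _ C'] bexI[of _ E]) auto
qed

section \<open>Polynomials in several variables\<close>

abbreviation (input) lk where "lk \<equiv> Poly_Mapping.lookup"

lemma eval_poly_superset:
  assumes "finite K" "Poly_Mapping.keys p \<subseteq> K"
  shows "eval_poly p x = (\<Sum>m\<in>K. lk p m * (\<Prod>i\<in>UNIV. (x $ i) ^ lk m i))"
  unfolding eval_poly_def by (rule sum.mono_neutral_left) (use assms in \<open>auto simp: in_keys_iff\<close>)

lemma eval_poly_zero [simp]: "eval_poly 0 x = 0"
  by (simp add: eval_poly_def)

lemma eval_poly_add [simp]: "eval_poly (p + q) x = eval_poly p x + eval_poly q x"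
proof -
  define K where "K = Poly_Mapping.keys p \<union> Poly_Mapping.keys q"
  have K: "finite K" "Poly_Mapping.keys p \<subseteq> K" "Poly_Mapping.keys q \<subseteq> K" "Poly_Mapping.keys (p + q) \<subseteq> K"
    using Poly_Mapping.keys_add[of p q] by (auto simp: K_def)
  show ?thesis
    by (simp add: eval_poly_superset[OF K(1,2)] eval_poly_superset[OF K(1,3)] eval_poly_superset[OF K(1,4)]
        lookup_add distrib_right sum.distrib)
qed

lemma eval_poly_sum [simp]: "eval_poly (\<Sum>i\<in>I. p i) x = (\<Sum>i\<in>I. eval_poly (p i) x)"
  by (induction I rule: infinite_finite_induct) auto

lemma eval_poly_single [simp]: "eval_poly (Poly_Mapping.single m c) x = c * (\<Prod>i\<in>UNIV. (x $ i) ^ lk m i)"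
  by (subst eval_poly_superset[of "{m}"]) auto

lemma poly_sum_monomials: "p = (\<Sum>m\<in>Poly_Mapping.keys p. Poly_Mapping.single m (lk p m))"
proof (rule poly_mapping_eqI)
  fix k
  have "lk (\<Sum>m\<in>Poly_Mapping.keys p. Poly_Mapping.single m (lk p m)) k = (\<Sum>m\<in>Poly_Mapping.keys p. if k = m then lk p m else 0)"
    unfolding lookup_sum by (intro sum.cong refl) (auto simp: lookup_single when_def)
  also have "\<dots> = lk p k" by (simp add: in_keys_iff)
  finally show "lk p k = lk (\<Sum>m\<in>Poly_Mapping.keys p. Poly_Mapping.single m (lk p m)) k" by simp
qed

lemma eval_poly_mult [simp]: "eval_poly (p * q) x = eval_poly p x * eval_poly q x"
proof -
  have 1: "eval_poly (Poly_Mapping.single m c * Poly_Mapping.single m' c') x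
      = eval_poly (Poly_Mapping.single m c) x * eval_poly (Poly_Mapping.single m' c') x" for m m' c c'
    by (simp add: mult_single lookup_add power_add prod.distrib)
  have "eval_poly (p * q) x = eval_poly ((\<Sum>m\<in>Poly_Mapping.keys p. Poly_Mapping.single m (lk p m)) *
      (\<Sum>m\<in>Poly_Mapping.keys q. Poly_Mapping.single m (lk q m))) x"
    using poly_sum_monomials[of p] poly_sum_monomials[of q] by simp
  also have "\<dots> = (\<Sum>m\<in>Poly_Mapping.keys p. eval_poly (Poly_Mapping.single m (lk p m)) x) *
      (\<Sum>m\<in>Poly_Mapping.keys q. eval_poly (Poly_Mapping.single m (lk q m)) x)"
    unfolding sum_product eval_poly_sum 1 ..
  also have "\<dots> = eval_poly (\<Sum>m\<in>Poly_Mapping.keys p. Poly_Mapping.single m (lk p m)) x *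
      eval_poly (\<Sum>m\<in>Poly_Mapping.keys q. Poly_Mapping.single m (lk q m)) x"
    by (simp only: eval_poly_sum)
  finally show ?thesis using poly_sum_monomials[of p] poly_sum_monomials[of q] by simp
qed

lemma eval_poly_const [simp]: "eval_poly (const_poly c) x = c"
  by (simp add: const_poly_def)

lemma eval_poly_one [simp]: "eval_poly 1 x = 1"
  using eval_poly_const[of 1 x] by (simp add: const_poly_def)

lemma eval_poly_diff [simp]: "eval_poly (p - q) x = eval_poly p x - eval_poly q x"
  using eval_poly_add[of "p - q" q x] by simp

lemma eval_poly_pdiff:
  "eval_poly (pdiff i p) x = (\<Sum>m\<in>Poly_Mapping.keys p. lk p m * (of_nat (lk m i) * (x $ i) ^ (lk m i - 1) * (\<Prod>j\<in>UNIV-{i}. (x $ j) ^ lk m j)))"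
proof -
  have "eval_poly (pdiff i p) x = (\<Sum>m\<in>Poly_Mapping.keys p. (of_nat (lk m i) * lk p m) * (\<Prod>j\<in>UNIV. (x $ j) ^ lk (m - Poly_Mapping.single i 1) j))"
    by (simp add: pdiff_def)
  also have "\<dots> = (\<Sum>m\<in>Poly_Mapping.keys p. lk p m * (of_nat (lk m i) * (x $ i) ^ (lk m i - 1) * (\<Prod>j\<in>UNIV-{i}. (x $ j) ^ lk m j)))"
  proof (intro sum.cong refl)
    fix m
    have "(\<Prod>j\<in>UNIV. (x $ j) ^ lk (m - Poly_Mapping.single i 1) j) = (x $ i) ^ (lk m i - 1) * (\<Prod>j\<in>UNIV-{i}. (x $ j) ^ lk (m - Poly_Mapping.single i 1) j)"
      by (subst prod.remove[of UNIV i]) (auto simp: lookup_minus)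
    also have "(\<Prod>j\<in>UNIV-{i}. (x $ j) ^ lk (m - Poly_Mapping.single i 1) j) = (\<Prod>j\<in>UNIV-{i}. (x $ j) ^ lk m j)"
      by (intro prod.cong refl) (auto simp: lookup_minus lookup_single when_def)
    finally show "of_nat (lk m i) * lk p m * (\<Prod>j\<in>UNIV. (x $ j) ^ lk (m - Poly_Mapping.single i 1) j)
      = lk p m * (of_nat (lk m i) * (x $ i) ^ (lk m i - 1) * (\<Prod>j\<in>UNIV-{i}. (x $ j) ^ lk m j))" by (simp add: mult_ac)
  qed
  finally show ?thesis .
qed

lemma eval_poly_partial_derivative:
  "((\<lambda>t. eval_poly p (x + t *s axis i 1)) has_field_derivative eval_poly (pdiff i p) x) (at 0)"
proof -
  have e: "eval_poly p (x + t *s axis i 1) = (\<Sum>m\<in>Poly_Mapping.keys p. lk p m * ((x $ i + t) ^ lk m i * (\<Prod>j\<in>UNIV-{i}. (x $ j) ^ lk m j)))" for t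
    unfolding eval_poly_def
  proof (intro sum.cong refl)
    fix m
    have "(\<Prod>j\<in>UNIV. ((x + t *s axis i 1) $ j) ^ lk m j) = (x $ i + t) ^ lk m i * (\<Prod>j\<in>UNIV-{i}. ((x + t *s axis i 1) $ j) ^ lk m j)"
      by (subst prod.remove[of UNIV i]) (auto simp: axis_def)
    also have "(\<Prod>j\<in>UNIV-{i}. ((x + t *s axis i 1) $ j) ^ lk m j) = (\<Prod>j\<in>UNIV-{i}. (x $ j) ^ lk m j)"
      by (intro prod.cong refl) (auto simp: axis_def)
    finally show "lk p m * (\<Prod>j\<in>UNIV. ((x + t *s axis i 1) $ j) ^ lk m j) = lk p m * ((x $ i + t) ^ lk m i * (\<Prod>j\<in>UNIV-{i}. (x $ j) ^ lk m j))" by simp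
  qed
  have d: "((\<lambda>t. (x $ i + t) ^ n) has_field_derivative of_nat n * (x $ i) ^ (n - 1)) (at 0)" for n
    by (auto intro!: derivative_eq_intros)
  show ?thesis unfolding e eval_poly_pdiff
    by (intro DERIV_sum DERIV_cmult DERIV_cmult_right d)
qed

text \<open>
  Obtained from the product rule for functions of one variable along the coordinate lines.
\<close>

lemma gradient_mult_at_zero:
  assumes "eval_poly g x = 0"
  shows "gradient (g * h) x = eval_poly h x *s gradient g x"
proof (subst Finite_Cartesian_Product.vec_eq_iff, intro allI)
  fix i
  have "((\<lambda>t. eval_poly g (x + t *s axis i 1) * eval_poly h (x + t *s axis i 1)) has_field_derivative
     eval_poly (pdiff i g) x * eval_poly h (x + 0 *s axis i 1) + eval_poly (pdiff i h) x * eval_poly g (x + 0 *s axis i 1)) (at 0)"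
    by (rule DERIV_mult[OF eval_poly_partial_derivative eval_poly_partial_derivative])
  then have "((\<lambda>t. eval_poly (g * h) (x + t *s axis i 1)) has_field_derivative eval_poly (pdiff i g) x * eval_poly h x) (at 0)"
    using assms by simp
  from DERIV_unique[OF this eval_poly_partial_derivative]
  show "gradient (g * h) x $ i = (eval_poly h x *s gradient g x) $ i" by (simp add: gradient_def mult.commute)
qed

lemma euler_identity:
  assumes "homogeneous d p"
  shows "(\<Sum>i\<in>UNIV. x $ i * gradient p x $ i) = of_nat d * eval_poly p x"
proof -
  have "(\<Sum>i\<in>UNIV. x $ i * gradient p x $ i)
     = (\<Sum>i\<in>UNIV. \<Sum>m\<in>Poly_Mapping.keys p. of_nat (lk m i) * (lk p m * (\<Prod>j\<in>UNIV. (x $ j) ^ lk m j)))"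
    unfolding gradient_def vec_lambda_beta eval_poly_pdiff sum_distrib_left
  proof (intro sum.cong refl)
    fix i m
    show "x $ i * (lk p m * (of_nat (lk m i) * x $ i ^ (lk m i - 1) * (\<Prod>j\<in>UNIV - {i}. x $ j ^ lk m j)))
      = of_nat (lk m i) * (lk p m * (\<Prod>j\<in>UNIV. (x $ j) ^ lk m j))"
      by (cases "lk m i") (auto simp: prod.remove[of UNIV i])
  qed
  also have "\<dots> = (\<Sum>m\<in>Poly_Mapping.keys p. \<Sum>i\<in>UNIV. of_nat (lk m i) * (lk p m * (\<Prod>j\<in>UNIV. (x $ j) ^ lk m j)))"
    by (rule sum.swap)
  also have "\<dots> = (\<Sum>m\<in>Poly_Mapping.keys p. of_nat d * (lk p m * (\<Prod>j\<in>UNIV. (x $ j) ^ lk m j)))"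
  proof (intro sum.cong refl)
    fix m assume "m \<in> Poly_Mapping.keys p"
    then have "(\<Sum>i\<in>UNIV. lk m i) = d" using assms by (auto simp: homogeneous_def)
    then have "(\<Sum>i\<in>UNIV. (of_nat (lk m i) :: complex)) = of_nat d" by (simp flip: of_nat_sum)
    then show "(\<Sum>i\<in>UNIV. of_nat (lk m i) * (lk p m * (\<Prod>j\<in>UNIV. (x $ j) ^ lk m j))) = of_nat d * (lk p m * (\<Prod>j\<in>UNIV. (x $ j) ^ lk m j))"
      by (simp flip: sum_distrib_right)
  qed
  finally show ?thesis by (simp add: eval_poly_def sum_distrib_left)
qed

lemma eval_poly_homogeneous:
  assumes "homogeneous d p" shows "eval_poly p (c *s x) = c ^ d * eval_poly p x"
proof -
  have "(\<Prod>i\<in>UNIV. (c * x $ i) ^ lk m i) = c ^ d * (\<Prod>i\<in>UNIV. (x $ i) ^ lk m i)" if "m \<in> Poly_Mapping.keys p" for m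
  proof -
    have "(\<Sum>i\<in>UNIV. lk m i) = d" using assms that by (auto simp: homogeneous_def)
    then show ?thesis by (simp add: power_mult_distrib prod.distrib power_sum[symmetric])
  qed
  then show ?thesis by (simp add: eval_poly_def sum_distrib_left mult_ac cong: sum.cong)
qed

lemma continuous_on_eval_poly: "continuous_on A (eval_poly p)"
  unfolding eval_poly_def[abs_def] by (intro continuous_intros)

lemma holomorphic_on_eval_poly:
  fixes f :: "complex \<Rightarrow> complex ^ 'n::finite"
  assumes "\<And>i. (\<lambda>z. f z $ i) holomorphic_on A" shows "(\<lambda>z. eval_poly p (f z)) holomorphic_on A"
  unfolding eval_poly_def by (intro holomorphic_intros assms)

lemma lookup_pdiff: "lk (pdiff i p) k = of_nat (lk k i + 1) * lk p (k + Poly_Mapping.single i 1)"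
proof -
  have "lk (pdiff i p) k = (\<Sum>m\<in>Poly_Mapping.keys p. if m = k + Poly_Mapping.single i 1 then of_nat (lk m i) * lk p m else 0)"
    unfolding pdiff_def lookup_sum
  proof (intro sum.cong refl)
    fix m
    show "lk (Poly_Mapping.single (m - Poly_Mapping.single i 1) (of_nat (lk m i) * lk p m)) k
       = (if m = k + Poly_Mapping.single i 1 then of_nat (lk m i) * lk p m else 0)"
    proof (cases "lk m i = 0")
      case True
      then show ?thesis by (auto simp: lookup_add dest: arg_cong[where f="\<lambda>m. lk m i"])
    next
      case False
      have "m - Poly_Mapping.single i 1 = k \<longleftrightarrow> m = k + Poly_Mapping.single i 1"
      proof
        assume a: "m - Poly_Mapping.single i 1 = k"
        show "m = k + Poly_Mapping.single i 1"
          unfolding a[symmetric] by (rule poly_mapping_eqI) (use False in \<open>auto simp: lookup_add lookup_minus lookup_single when_def\<close>)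
      qed simp
      then show ?thesis by (auto simp: lookup_single when_def)
    qed
  qed
  also have "\<dots> = of_nat (lk k i + 1) * lk p (k + Poly_Mapping.single i 1)"
    by (auto simp: in_keys_iff lookup_add)
  finally show ?thesis .
qed

text \<open>
  Induction on a bound for the degree: all partial derivatives vanish as functions, hence as
  polynomials, so the polynomial is constant.
\<close>

lemma eval_poly_eq_zero_imp:
  fixes p :: "'n::finite cpoly"
  assumes "\<And>x. eval_poly p x = 0" shows "p = 0"
proof -
  have "p = 0" if "\<And>m. m \<in> Poly_Mapping.keys p \<Longrightarrow> (\<Sum>i\<in>UNIV. lk m i) \<le> N" "\<And>x. eval_poly p x = 0" for N and p :: "'n cpoly"
    using that
  proof (induction N arbitrary: p)
    case 0
    have "lk p m = 0" if "m \<noteq> 0" for m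
    proof (rule ccontr)
      assume "lk p m \<noteq> 0"
      then have "\<And>i. lk m i = 0" using 0(1)[of m] by (auto simp: in_keys_iff)
      then have "m = 0" by (intro poly_mapping_eqI) auto
      then show False using that by simp
    qed
    then have p: "p = Poly_Mapping.single 0 (lk p 0)" by (intro poly_mapping_eqI) (auto simp: lookup_single when_def)
    have "lk p 0 = 0" using 0(2)[of 0] by (subst (asm) p) simp
    then show ?case using p by simp
  next
    case (Suc N)
    have d: "pdiff i p = 0" for i
    proof (rule Suc.IH)
      fix m assume "m \<in> Poly_Mapping.keys (pdiff i p)"
      then have "m + Poly_Mapping.single i 1 \<in> Poly_Mapping.keys p" by (auto simp: in_keys_iff lookup_pdiff)
      from Suc.prems(1)[OF this] show "(\<Sum>i\<in>UNIV. lk m i) \<le> N"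
        by (simp add: lookup_add sum.distrib lookup_single when_def)
    next
      fix x
      have "((\<lambda>t. eval_poly p (x + t *s axis i 1)) has_field_derivative 0) (at 0)" by (simp add: Suc.prems(2))
      then show "eval_poly (pdiff i p) x = 0" using eval_poly_partial_derivative[of p x i] DERIV_unique by blast
    qed
    have "lk p m = 0" if m: "m \<noteq> 0" for m
    proof -
      obtain i where i: "lk m i \<noteq> 0" using m by (metis lookup_zero poly_mapping_eqI)
      have e: "(m - Poly_Mapping.single i 1) + Poly_Mapping.single i 1 = m"
        by (rule poly_mapping_eqI) (use i in \<open>auto simp: lookup_add lookup_minus lookup_single when_def\<close>)
      have "lk (pdiff i p) (m - Poly_Mapping.single i 1) = 0" by (simp add: d)
      moreover have "of_nat (lk (m - Poly_Mapping.single i 1) i + 1) \<noteq> (0 :: complex)" by (simp only: of_nat_eq_0_iff)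
      ultimately show ?thesis unfolding lookup_pdiff e by (simp only: mult_eq_0_iff simp_thms)
    qed
    then have p: "p = Poly_Mapping.single 0 (lk p 0)" by (intro poly_mapping_eqI) (auto simp: lookup_single when_def)
    have "lk p 0 = 0" using Suc.prems(2)[of 0] by (subst (asm) p) simp
    then show ?case using p by simp
  qed
  moreover have "(\<Sum>i\<in>UNIV. lk m i) \<le> (\<Sum>m\<in>Poly_Mapping.keys p. \<Sum>i\<in>UNIV. lk m i)" if "m \<in> Poly_Mapping.keys p" for m
    by (rule member_le_sum[OF that]) auto
  ultimately show ?thesis using assms by blast
qed

text \<open>
  The restriction of a polynomial to the line through \<open>0\<close> and \<open>v\<close>. Its degree serves as an additive
  measure of size on the divisors of a homogeneous polynomial that does not vanish at \<open>v\<close>.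
\<close>

definition ray_poly :: "complex ^ 'n::finite \<Rightarrow> 'n cpoly \<Rightarrow> complex poly" where
  "ray_poly v p = (\<Sum>m\<in>Poly_Mapping.keys p. monom (lk p m * (\<Prod>i\<in>UNIV. (v $ i) ^ lk m i)) (\<Sum>i\<in>UNIV. lk m i))"

lemma poly_ray_poly: "poly (ray_poly v p) t = eval_poly p (t *s v)"
  unfolding ray_poly_def eval_poly_def poly_sum poly_monom
  by (intro sum.cong refl) (simp add: power_mult_distrib prod.distrib power_sum[symmetric])

lemma ray_poly_mult: "ray_poly v (p * q) = ray_poly v p * ray_poly v q"
  by (subst poly_eq_poly_eq_iff[symmetric]) (auto simp: poly_ray_poly)

lemma ray_poly_homogeneous:
  assumes "homogeneous d p" shows "ray_poly v p = monom (eval_poly p v) d"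
  by (subst poly_eq_poly_eq_iff[symmetric]) (auto simp: poly_ray_poly eval_poly_homogeneous[OF assms] poly_monom)

text \<open>
  Restriction to the line through \<open>a\<close> and \<open>b\<close> and the identity theorem.
\<close>

lemma eval_poly_zero_product:
  fixes p q :: "'n::finite cpoly"
  assumes "\<And>x. eval_poly p x * eval_poly q x = 0" "eval_poly q b \<noteq> 0"
  shows "eval_poly p a = 0"
proof -
  define P where "P t = eval_poly p (b + t *s (a - b))" for t
  define Q where "Q t = eval_poly q (b + t *s (a - b))" for t
  have h: "P holomorphic_on UNIV" "Q holomorphic_on UNIV" unfolding P_def Q_def
    by (auto intro!: holomorphic_on_eval_poly holomorphic_intros)
  have "open (UNIV \<inter> Q -` (- {0}))"
    by (rule continuous_open_preimage) (use h holomorphic_on_imp_continuous_on in auto)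
  then have o: "open {t. Q t \<noteq> 0}" by (simp add: vimage_def)
  have Q0: "0 \<in> {t. Q t \<noteq> 0}" using assms(2) by (simp add: Q_def)
  have "0 islimpt {t. Q t \<noteq> 0}" using o Q0 by (simp add: open_imp_islimpt)
  from analytic_continuation[OF h(1) open_UNIV connected_UNIV subset_UNIV UNIV_I this, of 1]
  have "P 1 = 0" using assms(1) by (force simp: P_def Q_def)
  then show ?thesis by (simp add: P_def)
qed

lemma const_poly_dvd_one: "c \<noteq> 0 \<Longrightarrow> (const_poly c :: 'n::finite cpoly) dvd 1"
  by (rule dvdI[of _ _ "const_poly (1/c)"]) (simp add: const_poly_def mult_single)

text \<open>
  On a ray where \<open>\<sigma>\<close> does not vanish, \<open>\<sigma>\<close> is a monomial, so a divisor \<open>b\<close> can have a zero only at the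
  origin. As \<open>b\<close> is constant along the ray of \<open>v\<close>, it does not vanish at the origin, so by the
  fundamental theorem of algebra it is constant along all such rays, with the common value at \<open>0\<close>.
\<close>

lemma divisor_of_homogeneous_constant_ray:
  fixes \<sigma> b h :: "'n::finite cpoly"
  assumes hom: "homogeneous d \<sigma>" and bh: "\<sigma> = b * h" and v: "eval_poly \<sigma> v \<noteq> 0" and deg: "degree (ray_poly v b) = 0"
  shows "b dvd 1"
proof -
  have b0: "eval_poly b 0 \<noteq> 0"
  proof
    assume b0: "eval_poly b 0 = 0"
    obtain c where c: "ray_poly v b = [:c:]" using deg by (metis degree_eq_zeroE)
    have "eval_poly b 0 = eval_poly b v" using poly_ray_poly[of v b 0] poly_ray_poly[of v b 1] c by simp
    then show False using v b0 by (simp add: bh)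
  qed
  have eq: "eval_poly b w = eval_poly b 0" if w: "eval_poly \<sigma> w \<noteq> 0" for w
  proof -
    have prod: "ray_poly w b * ray_poly w h = monom (eval_poly \<sigma> w) d"
      using ray_poly_homogeneous[OF hom, of w] by (simp add: bh ray_poly_mult)
    have "constant (poly (ray_poly w b))"
    proof (rule ccontr)
      assume nc: "\<not> constant (poly (ray_poly w b))"
      obtain z where z: "poly (ray_poly w b) z = 0" using Fundamental_Theorem_Algebra.fundamental_theorem_of_algebra[OF nc] ..
      have "poly (monom (eval_poly \<sigma> w) d) z = 0" unfolding prod[symmetric] poly_mult z by simp
      then have "z = 0" using w by (auto simp: poly_monom)
      then show False using z b0 by (simp add: poly_ray_poly)
    qed
    then have "poly (ray_poly w b) 1 = poly (ray_poly w b) 0" unfolding constant_def by blast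
    then show ?thesis by (simp add: poly_ray_poly)
  qed
  have "eval_poly (b - const_poly (eval_poly b 0)) w = 0" for w
  proof (rule eval_poly_zero_product[OF _ v])
    fix x show "eval_poly (b - const_poly (eval_poly b 0)) x * eval_poly \<sigma> x = 0"
      using eq[of x] by (cases "eval_poly \<sigma> x = 0") auto
  qed
  then have "b - const_poly (eval_poly b 0) = 0" by (rule eval_poly_eq_zero_imp)
  then have "b = const_poly (eval_poly b 0)" by simp
  then show ?thesis using const_poly_dvd_one[OF b0, where 'n='n] by simp
qed

text \<open>
  Among the divisors of \<open>\<sigma>\<close> vanishing at \<open>x\<close>, one with a restriction to the ray of minimal degree is
  irreducible: if it is a product, the factor vanishing at \<open>x\<close> already has this degree, so the other
  one is a unit. This avoids unique factorization.
\<close>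

lemma irreducible_factor_through_point:
  fixes \<sigma> :: "'n::finite cpoly"
  assumes hom: "homogeneous d \<sigma>" and v: "eval_poly \<sigma> v \<noteq> 0" and x: "eval_poly \<sigma> x = 0"
  shows "\<exists>g. irreducible g \<and> g dvd \<sigma> \<and> eval_poly g x = 0"
proof -
  define A where "A = {g. g dvd \<sigma> \<and> eval_poly g x = 0}"
  have "\<sigma> \<in> A" using x by (simp add: A_def)
  then obtain g where g: "g \<in> A" "\<And>h. h \<in> A \<Longrightarrow> degree (ray_poly v g) \<le> degree (ray_poly v h)"
    using arg_min_natI[of "\<lambda>g. g \<in> A" \<sigma> "\<lambda>g. degree (ray_poly v g)"] arg_min_nat_le[of "\<lambda>g. g \<in> A" _ "\<lambda>g. degree (ray_poly v g)"]
    by metis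
  have nz: "ray_poly v h \<noteq> 0" if "h dvd \<sigma>" for h
  proof
    assume "ray_poly v h = 0"
    then have "eval_poly h v = 0" using poly_ray_poly[of v h 1] by simp
    then show False using that v by (auto elim: dvdE)
  qed
  have unit: "a dvd 1 \<or> b dvd 1" if ab: "g = a * b" for a b
  proof -
    have main: "b dvd 1" if ab: "g = a * b" and a0: "eval_poly a x = 0" for a b
    proof -
      have ad: "a dvd \<sigma>" "b dvd \<sigma>" using g(1) ab by (auto simp: A_def elim!: dvd_mult_left dvd_mult_right)
      then have "degree (ray_poly v g) \<le> degree (ray_poly v a)" using g(2) a0 by (auto simp: A_def)
      moreover have "degree (ray_poly v g) = degree (ray_poly v a) + degree (ray_poly v b)"
        unfolding ab ray_poly_mult by (rule degree_mult_eq) (use nz ad in auto)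
      ultimately have "degree (ray_poly v b) = 0" by simp
      moreover obtain h where "\<sigma> = b * h" using ad(2) by (auto elim: dvdE)
      ultimately show ?thesis using divisor_of_homogeneous_constant_ray[OF hom _ v] by blast
    qed
    have "eval_poly a x = 0 \<or> eval_poly b x = 0" using g(1) ab by (simp add: A_def)
    then show ?thesis using main[of a b] main[of b a] ab by (auto simp: mult.commute)
  qed
  have "g \<noteq> 0" using nz[of g] g(1) by (auto simp: A_def ray_poly_def)
  moreover have "\<not> g dvd 1"
  proof
    assume "g dvd 1"
    then obtain k where "1 = g * k" by (auto elim: dvdE)
    then have "eval_poly 1 x = eval_poly g x * eval_poly k x" by (metis eval_poly_mult)
    then show False using g(1) by (simp add: A_def)
  qed
  ultimately have "irreducible g" using unit by (auto intro: irreducibleI)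
  then show ?thesis using g(1) by (auto simp: A_def)
qed

section \<open>Normal crossings and general position\<close>

text \<open>
  Each \<open>\<sigma> j\<close> has an irreducible factor \<open>g j\<close> through \<open>x\<close>, and by smoothness the gradient of \<open>\<sigma> j\<close> at
  \<open>x\<close> is a nonzero multiple of that of \<open>g j\<close>. Factors of different \<open>\<sigma> j\<close> do not divide each other,
  since the product is squarefree, so the normal crossings condition applies to them.
\<close>

lemma snc_gradients_independent:
  fixes \<sigma> :: "nat \<Rightarrow> 'n::finite cpoly"
  assumes I: "finite I" and hom: "\<And>j. j \<in> I \<Longrightarrow> homogeneous d (\<sigma> j)" and nz: "\<And>j. j \<in> I \<Longrightarrow> \<exists>v. eval_poly (\<sigma> j) v \<noteq> 0"
    and smooth: "\<And>j. j \<in> I \<Longrightarrow> smooth_divisor (\<sigma> j)" and snc: "snc_divisor (\<Prod>j\<in>I. \<sigma> j)"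
    and x: "x \<noteq> 0" and J: "J \<subseteq> I" "\<And>j. j \<in> J \<Longrightarrow> eval_poly (\<sigma> j) x = 0"
    and c: "(\<Sum>j\<in>J. c j *s gradient (\<sigma> j) x) = 0"
  shows "\<forall>j\<in>J. c j = 0"
proof -
  have ex: "\<exists>g. irreducible g \<and> g dvd \<sigma> j \<and> eval_poly g x = 0" if "j \<in> J" for j
  proof -
    have jI: "j \<in> I" using J that by blast
    obtain v where v: "eval_poly (\<sigma> j) v \<noteq> 0" using nz[OF jI] by blast
    show ?thesis by (rule irreducible_factor_through_point[OF hom[OF jI] v J(2)[OF that]])
  qed
  define g where "g j = (SOME g. irreducible g \<and> g dvd \<sigma> j \<and> eval_poly g x = 0)" for j
  have g: "irreducible (g j) \<and> g j dvd \<sigma> j \<and> eval_poly (g j) x = 0" if "j \<in> J" for j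
    unfolding g_def by (rule someI_ex[OF ex[OF that]])
  define h where "h j = (SOME h. \<sigma> j = g j * h)" for j
  have h: "\<sigma> j = g j * h j" if "j \<in> J" for j
    unfolding h_def by (rule someI_ex) (use g[OF that] in \<open>unfold dvd_def, blast\<close>)
  have grad: "gradient (\<sigma> j) x = eval_poly (h j) x *s gradient (g j) x" if "j \<in> J" for j
    using gradient_mult_at_zero[of "g j" x "h j"] g[OF that] h[OF that] by simp
  have hx: "eval_poly (h j) x \<noteq> 0" if "j \<in> J" for j
  proof
    assume "eval_poly (h j) x = 0"
    then have "gradient (\<sigma> j) x = 0" using grad[OF that] by simp
    then show False using smooth[of j] J that x by (auto simp: smooth_divisor_def)
  qed
  have ndvd: "\<not> g i dvd g j" if ij: "i \<in> J" "j \<in> J" "i \<noteq> j" for i j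
  proof
    assume "g i dvd g j"
    then have "g i dvd \<sigma> j" using g ij dvd_trans by blast
    moreover have "g i dvd \<sigma> i" using g ij by blast
    ultimately have "g i ^ 2 dvd \<sigma> i * \<sigma> j" by (simp add: power2_eq_square mult_dvd_mono)
    moreover have "\<sigma> i * \<sigma> j dvd (\<Prod>j\<in>I. \<sigma> j)"
    proof -
      have "(\<Prod>j\<in>I. \<sigma> j) = \<sigma> i * (\<sigma> j * (\<Prod>l\<in>I-{i}-{j}. \<sigma> l))"
        using ij J I by (subst prod.remove[of I i], blast, blast, subst prod.remove[of "I-{i}" j]) auto
      then show ?thesis by (metis dvd_triv_left mult.assoc)
    qed
    ultimately have "g i ^ 2 dvd (\<Prod>j\<in>I. \<sigma> j)" by (rule dvd_trans)
    then have "g i dvd 1" using snc by (auto simp: snc_divisor_def squarefree_def)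
    then show False using g[OF ij(1)] irreducible_not_unit by blast
  qed
  have inj: "inj_on g J"
  proof (rule inj_onI, rule ccontr)
    fix i j assume "i \<in> J" "j \<in> J" "g i = g j" "i \<noteq> j"
    then show False using ndvd[of i j] by simp
  qed
  define G where "G = g ` J"
  define cc where "cc = (\<lambda>y. c (the_inv_into J g y) * eval_poly (h (the_inv_into J g y)) x)"
  have "finite G" using finite_subset[OF J(1) I] by (simp add: G_def)
  moreover have "\<forall>y\<in>G. irreducible y \<and> y dvd (\<Prod>j\<in>I. \<sigma> j) \<and> eval_poly y x = 0"
  proof
    fix y assume "y \<in> G"
    then obtain j where j: "j \<in> J" "y = g j" by (auto simp: G_def)
    have "\<sigma> j dvd (\<Prod>j\<in>I. \<sigma> j)" using I J j by (intro dvd_prodI) auto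
    then show "irreducible y \<and> y dvd (\<Prod>j\<in>I. \<sigma> j) \<and> eval_poly y x = 0" using g[OF j(1)] j(2) dvd_trans by blast
  qed
  moreover have "pairwise (\<lambda>g h. \<not> g dvd h) G" using ndvd by (auto simp: pairwise_def G_def)
  moreover have "(\<Sum>y\<in>G. cc y *s gradient y x) = 0"
  proof -
    have "(\<Sum>y\<in>G. cc y *s gradient y x) = (\<Sum>j\<in>J. cc (g j) *s gradient (g j) x)"
      unfolding G_def by (rule sum.reindex_cong[OF inj]) auto
    also have "\<dots> = (\<Sum>j\<in>J. c j *s gradient (\<sigma> j) x)"
      by (intro sum.cong refl) (simp add: cc_def the_inv_into_f_f[OF inj] grad)
    finally show ?thesis using c by simp
  qed
  ultimately have "\<forall>y\<in>G. cc y = 0" using snc x unfolding snc_divisor_def by blast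
  then show ?thesis using hx by (auto simp: G_def cc_def the_inv_into_f_f[OF inj])
qed

text \<open>
  For each of the finitely many subsets \<open>J\<close> without common zero, the maximum of \<open>|s_j|\<close> over \<open>j \<in> J\<close> has
  a positive lower bound on the unit sphere. The least of these bounds serves for all subsets.
\<close>

lemma common_zero_of_small_values:
  fixes s :: "'j \<Rightarrow> complex ^ 'n::finite \<Rightarrow> complex"
  assumes I: "finite I" and cont: "\<And>j. j \<in> I \<Longrightarrow> continuous_on UNIV (s j)"
    and hom: "\<And>j x t. j \<in> I \<Longrightarrow> s j (t *s x) = t ^ d * s j x"
  shows "\<exists>\<epsilon>>0. \<forall>x. x \<noteq> 0 \<longrightarrow> (\<exists>x0. x0 \<noteq> 0 \<and> (\<forall>j\<in>I. cmod (s j x) < \<epsilon> * norm x ^ d \<longrightarrow> s j x0 = 0))"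
proof -
  define bad where "bad J \<longleftrightarrow> (\<forall>x0. x0 \<noteq> 0 \<longrightarrow> (\<exists>j\<in>J. s j x0 \<noteq> 0))" for J
  have ex: "\<exists>e>0. \<forall>x\<in>sphere 0 1. \<exists>j\<in>J. e \<le> cmod (s j x)" if J: "J \<subseteq> I" "bad J" for J
  proof -
    have finJ: "finite J" using J I finite_subset by blast
    define u where "u x = (\<Sum>j\<in>J. cmod (s j x))" for x
    have cu: "continuous_on (sphere 0 1) u" unfolding u_def
      by (intro continuous_intros continuous_on_subset[OF cont]) (use J in auto)
    have ne: "sphere (0 :: complex ^ 'n) 1 \<noteq> {}" by simp
    obtain x0 where x0: "x0 \<in> sphere 0 1" "\<And>x. x \<in> sphere 0 1 \<Longrightarrow> u x0 \<le> u x"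
      using continuous_attains_inf[OF compact_sphere ne cu] by blast
    have "x0 \<noteq> 0" using x0 by auto
    then obtain j0 where j0: "j0 \<in> J" "s j0 x0 \<noteq> 0" using J by (auto simp: bad_def)
    have "0 < u x0" unfolding u_def using j0 finJ by (intro sum_pos2[of J j0]) auto
    define e where "e = u x0 / (real (card J) + 1)"
    have e: "0 < e" using \<open>0 < u x0\<close> by (simp add: e_def)
    have "\<exists>j\<in>J. e \<le> cmod (s j x)" if "x \<in> sphere 0 1" for x
    proof (rule ccontr)
      assume "\<not> ?thesis"
      then have "\<And>j. j \<in> J \<Longrightarrow> cmod (s j x) \<le> e" by force
      then have "u x \<le> real (card J) * e" unfolding u_def using sum_bounded_above[of J "\<lambda>j. cmod (s j x)" e] by simp
      also have "\<dots> < (real (card J) + 1) * e" using e by simp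
      also have "\<dots> = u x0" by (simp add: e_def)
      finally show False using x0(2)[OF that] by simp
    qed
    then show ?thesis using e by blast
  qed
  define eJ where "eJ J = (SOME e. e > 0 \<and> (\<forall>x\<in>sphere 0 1. \<exists>j\<in>J. e \<le> cmod (s j x)))" for J
  have eJ: "eJ J > 0 \<and> (\<forall>x\<in>sphere 0 1. \<exists>j\<in>J. eJ J \<le> cmod (s j x))" if J: "J \<subseteq> I" "bad J" for J
    unfolding eJ_def by (rule someI_ex) (use ex[OF J] in blast)
  define \<epsilon> where "\<epsilon> = Min (insert 1 (eJ ` {J. J \<subseteq> I \<and> bad J}))"
  have fin: "finite (insert 1 (eJ ` {J. J \<subseteq> I \<and> bad J}))" using I by simp
  have \<epsilon>0: "0 < \<epsilon>" unfolding \<epsilon>_def using fin eJ by (subst Min_gr_iff) auto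
  have "\<exists>x0. x0 \<noteq> 0 \<and> (\<forall>j\<in>I. cmod (s j x) < \<epsilon> * norm x ^ d \<longrightarrow> s j x0 = 0)" if x: "x \<noteq> 0" for x
  proof (rule ccontr)
    assume c: "\<not> ?thesis"
    define J where "J = {j\<in>I. cmod (s j x) < \<epsilon> * norm x ^ d}"
    have J: "J \<subseteq> I" "bad J" using c by (auto simp: J_def bad_def)
    define y where "y = of_real (1 / norm x) *s x"
    have "norm y = 1"
    proof -
      have "y = (1 / norm x) *\<^sub>R x" unfolding y_def Finite_Cartesian_Product.vec_eq_iff vector_scaleR_component by (simp add: scaleR_conv_of_real)
      then show ?thesis using x by simp
    qed
    then have "y \<in> sphere 0 1" by simp
    then obtain j where j: "j \<in> J" "eJ J \<le> cmod (s j y)" using eJ[OF J] by blast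
    have "\<epsilon> \<le> eJ J" unfolding \<epsilon>_def using fin J by (intro Min_le) auto
    moreover have "cmod (s j y) = cmod (s j x) / norm x ^ d"
    proof -
      have "j \<in> I" using j J by blast
      from hom[OF this, of "of_real (1 / norm x)" x] show ?thesis
        unfolding y_def by (simp add: norm_mult norm_divide norm_power power_divide)
    qed
    moreover have "cmod (s j x) / norm x ^ d < \<epsilon>" using j x by (simp add: J_def field_simps)
    ultimately show False using j by simp
  qed
  then show ?thesis using \<epsilon>0 by blast
qed

section \<open>Truncated counting functions of pulled back divisors\<close>

lemma finite_zeros_in_disc:
  assumes "g holomorphic_on disc R" "\<exists>z\<in>disc R. g z \<noteq> 0" "ereal r < R"
  shows "finite {a. cmod a < r \<and> g a = 0}"
proof (cases "g constant_on disc R")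
  case True
  then have "g z \<noteq> 0" if "z \<in> disc R" for z
    using assms(2) that unfolding constant_on_def by metis
  then have "{a. cmod a < r \<and> g a = 0} = {}"
    using cball_subset_disc[OF assms(3)] by (auto simp: subset_iff)
  then show ?thesis by (simp only: finite.emptyI)
next
  case False
  have "finite {z\<in>cball 0 r. g z = 0}"
    by (rule holomorphic_compact_finite_zeros[OF assms(1) open_disc connected_disc compact_cball cball_subset_disc[OF assms(3)] False])
  then show ?thesis by (rule finite_subset[rotated]) auto
qed

lemma zorder_pos_at_zero_disc:
  assumes "g holomorphic_on disc R" "\<exists>z\<in>disc R. g z \<noteq> 0" "a \<in> disc R" "g a = 0"
  shows "0 < zorder g a"
  using zorder_exist_zero[OF assms(1) open_disc connected_disc assms(3,2)] assms(4) by auto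

lemma has_bochner_integral_inverse:
  assumes s: "0 < s" "s < (r::real)"
  shows "has_bochner_integral lborel (\<lambda>t. indicator {0<..<r} t *\<^sub>R (if s < t then 1 / t else 0)) (ln (r / s))"
proof -
  have "has_bochner_integral lborel (\<lambda>t. (1 / t) * indicator {s..r} t) (ln r - ln s)"
    by (rule has_bochner_integral_FTC_Icc_real) (use s in \<open>auto intro!: derivative_eq_intros continuous_intros\<close>)
  also have "has_bochner_integral lborel (\<lambda>t. (1 / t) * indicator {s..r} t) (ln r - ln s)
    \<longleftrightarrow> has_bochner_integral lborel (\<lambda>t. indicator {0<..<r} t *\<^sub>R (if s < t then 1 / t else 0)) (ln r - ln s)"
  proof (rule has_bochner_integral_cong_AE)
    show "AE t in lborel. (1 / t) * indicator {s..r} t = indicator {0<..<r} t *\<^sub>R (if s < t then 1 / t else 0)"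
      using AE_lborel_singleton[of s] AE_lborel_singleton[of r]
      by eventually_elim (use s in \<open>auto simp: indicator_def\<close>)
  qed measurable
  finally show ?thesis using s by (simp add: ln_div)
qed

text \<open>
  Only finitely many zeros matter for radii up to \<open>r\<close>; each zero \<open>a \<noteq> 0\<close> contributes the integral of
  \<open>1 / t\<close> from \<open>|a|\<close> to \<open>r\<close>, and the counting function at \<open>0\<close> is the contribution of the origin.
\<close>

lemma trunc_counting_fun_eq_count_fun:
  fixes f :: "complex \<Rightarrow> complex ^ 'n::finite" and \<sigma> :: "'n cpoly"
  defines "g \<equiv> \<lambda>w. eval_poly \<sigma> (f w)"
  assumes hol: "g holomorphic_on disc R" and nz: "\<exists>z\<in>disc R. g z \<noteq> 0" and r: "0 < r" "ereal r < R"
  shows "trunc_counting_fun k f \<sigma> r = count_fun (min k) g r"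
proof -
  define Z where "Z = {a. cmod a < r \<and> g a = 0}"
  define m where "m a = real (min k (nat (zorder g a)))" for a
  define m0 where "m0 = (if g 0 = 0 then m 0 else 0)"
  have Z: "finite Z" unfolding Z_def by (rule finite_zeros_in_disc[OF hol nz r(2)])
  have cnt: "real (trunc_count k f \<sigma> t) = m0 + (\<Sum>a\<in>Z-{0}. if cmod a < t then m a else 0)" if t: "0 < t" "t < r" for t
  proof -
    have "real (trunc_count k f \<sigma> t) = (\<Sum>a | cmod a < t \<and> g a = 0. m a)"
      unfolding trunc_count_def m_def of_nat_sum by (simp add: g_def)
    also have "{a. cmod a < t \<and> g a = 0} = {a\<in>Z. cmod a < t}" using t by (auto simp: Z_def)
    also have "(\<Sum>a\<in>{a\<in>Z. cmod a < t}. m a) = (\<Sum>a\<in>Z. if cmod a < t then m a else 0)"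
      using Z by (simp add: sum.If_cases Int_def)
    also have "\<dots> = m0 + (\<Sum>a\<in>Z-{0}. if cmod a < t then m a else 0)"
    proof (cases "g 0 = 0")
      case True
      then have "0 \<in> Z" using r by (simp add: Z_def)
      then show ?thesis using Z t True by (simp add: sum.remove m0_def)
    next
      case False
      then have "Z - {0} = Z" by (auto simp: Z_def)
      then show ?thesis using False by (simp add: m0_def)
    qed
    finally show ?thesis .
  qed
  have "eventually (\<lambda>t. real (trunc_count k f \<sigma> t) = m0) (at_right 0)"
  proof -
    define \<delta> where "\<delta> = Min (insert r (cmod ` (Z - {0})))"
    have \<delta>: "0 < \<delta>" "\<delta> \<le> r" "\<And>a. a \<in> Z - {0} \<Longrightarrow> \<delta> \<le> cmod a"
      unfolding \<delta>_def using Z r by auto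
    have "real (trunc_count k f \<sigma> t) = m0" if "0 < t" "t < \<delta>" for t
    proof -
      have "(\<Sum>a\<in>Z-{0}. if cmod a < t then m a else 0) = 0" using \<delta>(3) that by (intro sum.neutral) force
      then show ?thesis using cnt[of t] that \<delta> by simp
    qed
    then show ?thesis using \<delta>(1) by (auto simp: eventually_at_right_field)
  qed
  then have "((\<lambda>t. real (trunc_count k f \<sigma> t)) \<longlongrightarrow> m0) (at_right 0)"
    by (rule tendsto_eventually)
  then have c0: "trunc_count_0 k f \<sigma> = m0" unfolding trunc_count_0_def by (intro tendsto_Lim) auto
  have "has_bochner_integral lborel (\<lambda>t. \<Sum>a\<in>Z-{0}. m a * (indicator {0<..<r} t *\<^sub>R (if cmod a < t then 1 / t else 0)))
     (\<Sum>a\<in>Z-{0}. m a * ln (r / cmod a))"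
    by (intro has_bochner_integral_sum has_bochner_integral_mult_right has_bochner_integral_inverse) (auto simp: Z_def)
  also have "(\<lambda>t. \<Sum>a\<in>Z-{0}. m a * (indicator {0<..<r} t *\<^sub>R (if cmod a < t then 1 / t else 0)))
     = (\<lambda>t. indicator {0<..<r} t *\<^sub>R ((real (trunc_count k f \<sigma> t) - trunc_count_0 k f \<sigma>) / t))"
  proof
    fix t
    show "(\<Sum>a\<in>Z-{0}. m a * (indicator {0<..<r} t *\<^sub>R (if cmod a < t then 1 / t else 0)))
       = indicator {0<..<r} t *\<^sub>R ((real (trunc_count k f \<sigma> t) - trunc_count_0 k f \<sigma>) / t)"
      by (cases "t \<in> {0<..<r}") (auto simp: cnt c0 sum_divide_distrib split: if_splits intro!: sum.cong)
  qed
  finally have int: "(LBINT t:{0<..<r}. (real (trunc_count k f \<sigma> t) - trunc_count_0 k f \<sigma>) / t)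
     = (\<Sum>a\<in>Z-{0}. m a * ln (r / cmod a))"
    unfolding set_lebesgue_integral_def by (rule has_bochner_integral_integral_eq)
  have "count_fun (min k) g r = m0 * ln r + (\<Sum>a\<in>Z-{0}. m a * ln (r / cmod a))"
  proof (cases "g 0 = 0")
    case True
    then have "0 \<in> Z" using r by (simp add: Z_def)
    then show ?thesis using Z True unfolding count_fun_def Z_def[symmetric] m_def[symmetric]
      by (simp add: sum.remove m0_def)
  next
    case False
    then have "0 \<notin> Z" by (auto simp: Z_def)
    then show ?thesis using False unfolding count_fun_def Z_def[symmetric] m_def[symmetric]
      by (auto simp: m0_def intro!: sum.cong)
  qed
  then show ?thesis unfolding trunc_counting_fun_def int by (simp add: c0)
qed

section \<open>The second main theorem for linear forms\<close>

text \<open>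
  The independent coefficient vectors extend to a basis inside their union with the standard basis;
  the linear forms belonging to the basis are the completed system.
\<close>

lemma completable_of_independent:
  fixes \<alpha> :: "'j \<Rightarrow> complex ^ 'm::finite" and \<phi> :: "'m \<Rightarrow> complex \<Rightarrow> complex"
  assumes h: "bij_betw h {..<CARD('m)} (UNIV :: 'm set)" and J: "finite J" "J \<subseteq> I"
    and ind: "\<And>c. (\<Sum>j\<in>J. c j *s \<alpha> j) = 0 \<Longrightarrow> \<forall>j\<in>J. c j = 0"
  shows "completable D CARD('m) (\<lambda>i. \<phi> (h i)) (\<lambda>j z. \<Sum>\<mu>\<in>UNIV. \<alpha> j $ \<mu> * \<phi> \<mu> z) I J"
proof -
  define L where "L b z = (\<Sum>\<mu>\<in>UNIV. b $ \<mu> * \<phi> \<mu> z)" for b :: "complex ^ 'm" and z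
  have L_axis: "L (axis \<mu> 1) = \<phi> \<mu>" for \<mu>
  proof
    fix z
    have "L (axis \<mu> 1) z = (\<Sum>\<nu>\<in>UNIV. if \<nu> = \<mu> then \<phi> \<nu> z else 0)"
      unfolding L_def by (intro sum.cong refl) (auto simp: axis_def)
    then show "L (axis \<mu> 1) z = \<phi> \<mu> z" by simp
  qed
  have inj: "inj_on \<alpha> J"
  proof (rule inj_onI, rule ccontr)
    fix i j assume ij: "i \<in> J" "j \<in> J" "\<alpha> i = \<alpha> j" "i \<noteq> j"
    define c where "c l = (if l = i then 1 else if l = j then -1 else 0 :: complex)" for l
    have "(\<Sum>l\<in>J. c l *s \<alpha> l) = (\<Sum>l\<in>{i,j}. c l *s \<alpha> l)"
      by (rule sum.mono_neutral_right) (use J ij in \<open>auto simp: c_def\<close>)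
    also have "\<dots> = 0" using ij by (simp add: c_def)
    finally have "\<forall>l\<in>J. c l = 0" by (rule ind)
    then have "c i = 0" using ij(1) by blast
    then show False by (simp add: c_def)
  qed
  have "vec.independent (\<alpha> ` J)"
    unfolding vec.dependent_finite[OF finite_imageI[OF J(1)]]
  proof
    assume "\<exists>u. (\<exists>v\<in>\<alpha> ` J. u v \<noteq> 0) \<and> (\<Sum>v\<in>\<alpha> ` J. u v *s v) = 0"
    then obtain u v where u: "v \<in> \<alpha> ` J" "u v \<noteq> 0" "(\<Sum>v\<in>\<alpha> ` J. u v *s v) = 0" by blast
    have "(\<Sum>j\<in>J. u (\<alpha> j) *s \<alpha> j) = 0" using u(3) by (simp add: sum.reindex[OF inj])
    from ind[OF this] u(1,2) show False by auto
  qed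
  then obtain B where B: "\<alpha> ` J \<subseteq> B" "B \<subseteq> \<alpha> ` J \<union> cart_basis" "vec.independent B" "\<alpha> ` J \<union> cart_basis \<subseteq> vec.span B"
    using vec.maximal_independent_subset_extend[of "\<alpha> ` J" "\<alpha> ` J \<union> cart_basis"] by blast
  have span: "vec.span B = UNIV"
  proof -
    have "vec.span cart_basis \<subseteq> vec.span B" using B(4) by (intro vec.span_minimal vec.subspace_span) auto
    then show ?thesis using vec.span_Basis by auto
  qed
  have finB: "finite B" by (rule vec.finiteI_independent[OF B(3)])
  have card: "card B = CARD('m)"
    using vec.basis_card_eq_dim[of B UNIV] B(3) span by (simp add: vec.dim_UNIV card_cart_basis)
  obtain e0 where e0: "bij_betw e0 B {0..<CARD('m)}" using ex_bij_betw_finite_nat[OF finB] card by auto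
  define G where "G l = the_inv_into B e0 l" for l
  have G: "G l \<in> B" if "l < CARD('m)" for l
    using e0 that unfolding G_def bij_betw_def by (intro the_inv_into_into) auto
  have Ge: "G (e0 b) = b" if "b \<in> B" for b
    using e0 that unfolding G_def bij_betw_def by (simp add: the_inv_into_f_f)
  have "\<exists>c. axis \<mu> 1 = (\<Sum>b\<in>B. c b *s b)" for \<mu> :: 'm
  proof -
    have "(axis \<mu> 1 :: complex ^ 'm) \<in> vec.span B" using span by simp
    then show ?thesis unfolding vec.span_finite[OF finB] by auto
  qed
  then obtain c where c: "\<And>\<mu> :: 'm. axis \<mu> 1 = (\<Sum>b\<in>B. c \<mu> b *s b)" by metis
  have rep: "\<phi> \<mu> z = (\<Sum>l<CARD('m). c \<mu> (G l) * L (G l) z)" for \<mu> z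
  proof -
    have "\<phi> \<mu> z = L (\<Sum>b\<in>B. c \<mu> b *s b) z" using L_axis[of \<mu>] c[of \<mu>] by simp
    also have "\<dots> = (\<Sum>\<nu>\<in>UNIV. \<Sum>b\<in>B. c \<mu> b * (b $ \<nu> * \<phi> \<nu> z))"
      by (simp add: L_def sum_distrib_right mult.assoc)
    also have "\<dots> = (\<Sum>b\<in>B. c \<mu> b * L b z)"
      by (subst sum.swap) (simp add: L_def sum_distrib_left)
    also have "\<dots> = (\<Sum>l<CARD('m). c \<mu> (G l) * L (G l) z)"
    proof (rule sum.reindex_bij_betw[symmetric])
      show "bij_betw G {..<CARD('m)} B" unfolding G_def
        using bij_betw_the_inv_into[OF e0] by (simp add: lessThan_atLeast0)
    qed
    finally show ?thesis .
  qed
  show ?thesis unfolding completable_def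
  proof (intro exI[of _ "\<lambda>l. L (G l)"] exI[of _ "\<lambda>i l. c (h i) (G l)"] exI[of _ "\<lambda>j. e0 (\<alpha> j)"] conjI allI impI ballI)
    fix l assume "l < CARD('m)"
    then consider j where "j \<in> J" "G l = \<alpha> j" | \<mu> where "G l = axis \<mu> 1"
      using G B(2) by (fastforce simp: cart_basis_def)
    then show "L (G l) \<in> (\<lambda>j z. \<Sum>\<mu>\<in>UNIV. \<alpha> j $ \<mu> * \<phi> \<mu> z) ` I \<union> (\<lambda>i. \<phi> (h i)) ` {..<CARD('m)}"
    proof cases
      case 1
      then show ?thesis using J by (auto simp: L_def[abs_def])
    next
      case (2 \<mu>)
      obtain i where "i < CARD('m)" "h i = \<mu>" using h unfolding bij_betw_def by (metis UNIV_I imageE lessThan_iff)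
      then show ?thesis using 2 by (auto simp: L_axis)
    qed
  next
    show "inj_on (\<lambda>j. e0 (\<alpha> j)) J"
      using comp_inj_on[OF inj inj_on_subset[OF bij_betw_imp_inj_on[OF e0] B(1)]] by (simp add: o_def)
    show "(\<lambda>j. e0 (\<alpha> j)) ` J \<subseteq> {..<CARD('m)}" using B(1) bij_betw_apply[OF e0] by fastforce
    show "L (G (e0 (\<alpha> j))) = (\<lambda>z. \<Sum>\<mu>\<in>UNIV. \<alpha> j $ \<mu> * \<phi> \<mu> z)" if "j \<in> J" for j
      using Ge[of "\<alpha> j"] B(1) that by (auto simp: L_def[abs_def])
    show "\<phi> (h i) w = (\<Sum>l<CARD('m). c (h i) (G l) * L (G l) w)" for i w by (rule rep)
  qed
qed

lemma continuous_on_norm_vec: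
  fixes f :: "'a::topological_space \<Rightarrow> complex ^ 'n::finite"
  assumes "\<And>i. continuous_on A (\<lambda>z. f z $ i)" shows "continuous_on A (\<lambda>z. norm (f z))"
  using continuous_on_norm[OF continuous_on_vec_lambda[of A "\<lambda>i z. f z $ i", OF assms]] by simp

lemma continuous_on_ln_norm_vec:
  fixes f :: "'a::topological_space \<Rightarrow> complex ^ 'n::finite"
  assumes "\<And>i. continuous_on A (\<lambda>z. f z $ i)" "\<And>z. z \<in> A \<Longrightarrow> f z \<noteq> 0"
  shows "continuous_on A (\<lambda>z. ln (norm (f z)))"
  by (rule continuous_on_ln[OF continuous_on_norm_vec[OF assms(1)]]) (use assms(2) in auto)

text \<open>
  Cartan's inequality for \<open>v = d ln \<parallel>f\<parallel>\<close>, whose circle mean is \<open>d T_f\<close> up to a constant, combined with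
  the choice of the exceptional set. The hypothesis \<open>small\<close> is general position at the points where
  it matters.
\<close>

lemma second_main_theorem:
  fixes f :: "complex \<Rightarrow> complex ^ 'n::finite" and \<alpha> :: "'j \<Rightarrow> complex ^ 'm::finite" and \<phi> :: "'m \<Rightarrow> complex \<Rightarrow> complex"
  defines "g \<equiv> \<lambda>j z. \<Sum>\<mu>\<in>UNIV. \<alpha> j $ \<mu> * \<phi> \<mu> z"
  assumes R: "0 < R" and rep: "reduced_representation R f" and c: "0 \<le> c"
    and unbdd: "\<And>B. \<exists>r>0. ereal r < R \<and> B < char_fun f r"
    and \<phi>: "\<And>\<mu>. \<phi> \<mu> holomorphic_on disc R"
    and bound: "\<And>\<mu> z. z \<in> disc R \<Longrightarrow> cmod (\<phi> \<mu> z) \<le> K * norm (f z) ^ d"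
    and nondeg: "\<And>a. a \<noteq> 0 \<Longrightarrow> \<exists>z\<in>disc R. (\<Sum>\<mu>\<in>UNIV. a $ \<mu> * \<phi> \<mu> z) \<noteq> 0"
    and I: "finite I" "\<And>j. j \<in> I \<Longrightarrow> \<alpha> j \<noteq> 0"
    and c0: "0 < c0"
    and small: "\<And>z J a. z \<in> disc R \<Longrightarrow> J = {j\<in>I. cmod (g j z) < c0 * norm (f z) ^ d} \<Longrightarrow>
       (\<Sum>j\<in>J. a j *s \<alpha> j) = 0 \<Longrightarrow> \<forall>j\<in>J. a j = 0"
  shows "\<exists>C'. \<exists>E \<in> sets borel. E \<subseteq> {r. 0 < r \<and> ereal r < R} \<and>
     (\<integral>\<^sup>+ r \<in> E. ennreal (exp (c * char_fun f r)) \<partial>lborel) < \<infinity> \<and>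
     (\<forall>r. 0 < r \<and> ereal r < R \<and> r \<notin> E \<longrightarrow>
        (real (card I) - real CARD('m)) * (real d * char_fun f r)
          \<le> (\<Sum>j\<in>I. count_fun (min (CARD('m) - 1)) (g j) r)
            + C' * (log_plus (char_fun f r) + log_plus r) + real (CARD('m) * (CARD('m) - 1)) * c * char_fun f r)"
proof -
  define n where "n = CARD('m)"
  define b where "b = ln (norm (f 0))"
  define v where "v z = real d * ln (norm (f z))" for z
  have fn: "f z \<noteq> 0" if "z \<in> disc R" for z using rep that by (auto simp: reduced_representation_def)
  have ev: "exp (v z) = norm (f z) ^ d" if "z \<in> disc R" for z
    using fn[OF that] by (simp add: v_def exp_of_nat_mult)
  have T: "char_fun f r = circle_mean r (\<lambda>z. ln (norm (f z))) - b" if "0 < r" "ereal r < R" for r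
    using char_fun_power_eq_circle_mean[OF rep that, of 1] by (simp add: char_fun_def b_def)
  have Tmono: "char_fun f r \<le> char_fun f s" if "0 < r" "r \<le> s" "ereal s < R" for r s
  proof -
    have "ereal r \<le> ereal s" using that by simp
    also note that(3)
    finally show ?thesis using circle_mean_ln_norm_mono[OF rep that] that T[of r] T[of s] by simp
  qed
  have Tcont: "continuous_on {r. 0 < r \<and> ereal r < R} (char_fun f)"
  proof (rule continuous_on_eq[of _ "\<lambda>r. circle_mean r (\<lambda>z. ln (norm (f z))) - b"])
    show "continuous_on {r. 0 < r \<and> ereal r < R} (\<lambda>r. circle_mean r (\<lambda>z. ln (norm (f z))) - b)"
      by (intro continuous_intros continuous_on_circle_mean_ln_norm[OF rep])
  qed (use T in auto)
  have vm: "circle_mean r v = real d * (char_fun f r + b)" if "0 < r" "ereal r < R" for r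
    unfolding v_def[abs_def] circle_mean_cmult T[OF that] by simp
  have vmono: "circle_mean r v \<le> circle_mean s v" if "0 < r" "r \<le> s" "ereal s < R" for r s
    unfolding v_def[abs_def] circle_mean_cmult
    by (rule mult_left_mono[OF circle_mean_ln_norm_mono[OF rep that]]) simp
  have vcont: "continuous_on (disc R) v"
  proof -
    have "continuous_on (disc R) (\<lambda>z. f z $ i)" for i
      using rep by (auto simp: reduced_representation_def intro: holomorphic_on_imp_continuous_on)
    then show ?thesis unfolding v_def
      by (intro continuous_on_mult continuous_on_const continuous_on_ln_norm_vec fn)
  qed
  obtain h where h: "bij_betw h {..<CARD('m)} (UNIV :: 'm set)"
    using ex_bij_betw_nat_finite[of "UNIV :: 'm set"] by (auto simp: lessThan_atLeast0)
  define hi where "hi = the_inv_into {..<CARD('m)} h"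
  have hi: "hi (h i) = i" if "i < CARD('m)" for i
    using the_inv_into_f_f[OF bij_betw_imp_inj_on[OF h]] that by (simp add: hi_def)
  have indep: "\<forall>i<CARD('m). a i = 0" if z: "\<forall>z\<in>disc R. (\<Sum>i<CARD('m). a i * \<phi> (h i) z) = 0" for a
  proof -
    define a' :: "complex ^ 'm" where "a' = (\<chi> \<mu>. a (hi \<mu>))"
    have "(\<Sum>\<mu>\<in>UNIV. a' $ \<mu> * \<phi> \<mu> z) = (\<Sum>i<CARD('m). a i * \<phi> (h i) z)" for z
      unfolding sum.reindex_bij_betw[OF h, of "\<lambda>\<mu>. a' $ \<mu> * \<phi> \<mu> z", symmetric]
      by (intro sum.cong refl) (simp add: a'_def hi)
    then have "\<not> (\<exists>z\<in>disc R. (\<Sum>\<mu>\<in>UNIV. a' $ \<mu> * \<phi> \<mu> z) \<noteq> 0)" using z by simp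
    then have "a' = 0" using nondeg by blast
    then have a0: "a (hi (h i)) = 0" for i by (simp add: a'_def Finite_Cartesian_Product.vec_eq_iff)
    show ?thesis
    proof (intro allI impI)
      fix i assume "i < CARD('m)"
      then show "a i = 0" using a0[of i] hi by simp
    qed
  qed
  define A where "A j = (\<Sum>\<mu>\<in>UNIV. cmod (\<alpha> j $ \<mu>))" for j
  define C0 where "C0 = (\<bar>K\<bar> + 1) * (1 + (\<Sum>j\<in>I. A j))"
  have A0: "0 \<le> A j" for j by (simp add: A_def sum_nonneg)
  have SA: "0 \<le> (\<Sum>j\<in>I. A j)" by (intro sum_nonneg A0)
  have C0: "0 < C0" unfolding C0_def by (intro mult_pos_pos) (use SA in auto)
  have bound': "cmod (\<phi> \<mu> z) \<le> (\<bar>K\<bar> + 1) * exp (v z)" if "z \<in> disc R" for \<mu> z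
  proof -
    have "K * norm (f z) ^ d \<le> (\<bar>K\<bar> + 1) * norm (f z) ^ d" by (intro mult_right_mono) auto
    then show ?thesis using bound[OF that, of \<mu>] ev[OF that] by simp
  qed
  have Fb: "cmod (\<phi> \<mu> z) \<le> C0 * exp (v z)" if "z \<in> disc R" for \<mu> z
  proof -
    have "(\<bar>K\<bar> + 1) * 1 \<le> C0" unfolding C0_def by (intro mult_left_mono) (use SA in auto)
    then have "(\<bar>K\<bar> + 1) * exp (v z) \<le> C0 * exp (v z)" by (intro mult_right_mono) auto
    then show ?thesis using bound'[OF that, of \<mu>] by linarith
  qed
  have gb: "cmod (g j z) \<le> C0 * exp (v z)" if j: "j \<in> I" and z: "z \<in> disc R" for j z
  proof -
    have "cmod (g j z) \<le> (\<Sum>\<mu>\<in>UNIV. cmod (\<alpha> j $ \<mu>) * ((\<bar>K\<bar> + 1) * exp (v z)))"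
      unfolding g_def by (rule sum_norm_le) (auto simp: norm_mult intro!: mult_left_mono bound'[OF z])
    also have "\<dots> = A j * ((\<bar>K\<bar> + 1) * exp (v z))" by (simp add: A_def sum_distrib_right)
    also have "\<dots> \<le> (1 + (\<Sum>j\<in>I. A j)) * ((\<bar>K\<bar> + 1) * exp (v z))"
      using member_le_sum[OF j _ I(1), of A] A0 by (intro mult_right_mono) (auto intro!: add_increasing)
    finally show ?thesis by (simp add: C0_def mult_ac)
  qed
  have "\<exists>C r0 Bad. 0 < r0 \<and> ereal r0 < R \<and> countable Bad \<and>
     (\<forall>r \<rho>'. r0 \<le> r \<and> r < \<rho>' \<and> \<rho>' \<le> r + 1 \<and> ereal \<rho>' < R \<and> r \<notin> Bad \<longrightarrow>
        0 \<le> circle_mean \<rho>' v + C \<and>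
        (real (card I) - real CARD('m)) * circle_mean r v
          \<le> (\<Sum>j\<in>I. count_fun (min (CARD('m) - 1)) (g j) r)
            + real (CARD('m) * (CARD('m) - 1)) * (ln (1 / (\<rho>' - r)) + ln (1 + \<rho>') + ln (1 + (circle_mean \<rho>' v + C))) + C)"
  proof (rule cartan_inequality[where F = "\<lambda>i. \<phi> (h i)" and g = g, OF R _ vcont vmono _ indep I(1) _ _ C0 _ _ c0])
    show "g j holomorphic_on disc R" for j unfolding g_def by (intro holomorphic_intros \<phi>)
    show "\<exists>z\<in>disc R. g j z \<noteq> 0" if "j \<in> I" for j unfolding g_def by (rule nondeg[OF I(2)[OF that]])
    fix z assume z: "z \<in> disc R"
    define J where "J = {j\<in>I. cmod (g j z) < c0 * norm (f z) ^ d}"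
    have J: "finite J" "J \<subseteq> I" using I by (auto simp: J_def)
    have "completable (disc R) CARD('m) (\<lambda>i. \<phi> (h i)) g I J"
      unfolding g_def by (rule completable_of_independent[OF h J small[OF z J_def]])
    moreover have "\<forall>j\<in>I-J. c0 * exp (v z) \<le> cmod (g j z)" using ev[OF z] by (auto simp: J_def)
    ultimately show "\<exists>J\<subseteq>I. (\<forall>j\<in>I-J. c0 * exp (v z) \<le> cmod (g j z)) \<and> completable (disc R) CARD('m) (\<lambda>i. \<phi> (h i)) g I J"
      using J(2) by blast
  qed (auto intro!: \<phi> Fb gb)
  then obtain C r0 Bad where C: "0 < r0" "ereal r0 < R" "countable Bad"
    "\<And>r \<rho>'. r0 \<le> r \<Longrightarrow> r < \<rho>' \<Longrightarrow> \<rho>' \<le> r + 1 \<Longrightarrow> ereal \<rho>' < R \<Longrightarrow> r \<notin> Bad \<Longrightarrow>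
        0 \<le> circle_mean \<rho>' v + C \<and>
        (real (card I) - real CARD('m)) * circle_mean r v
          \<le> (\<Sum>j\<in>I. count_fun (min (CARD('m) - 1)) (g j) r)
            + real (CARD('m) * (CARD('m) - 1)) * (ln (1 / (\<rho>' - r)) + ln (1 + \<rho>') + ln (1 + (circle_mean \<rho>' v + C))) + C"
    by blast
  show ?thesis
  proof (rule exceptional_set_estimate[OF c _ _ Tmono Tcont unbdd C(1,2,3)])
    fix r \<rho> assume r: "r0 \<le> r" "r < \<rho>" "\<rho> \<le> r + 1" "ereal \<rho> < R" "r \<notin> Bad"
    have "ereal r \<le> ereal \<rho>" using r by simp
    also note r(4)
    finally have "ereal r < R" .
    then show "0 \<le> real d * (char_fun f \<rho> + b) + C \<and>
       (real (card I) - real CARD('m)) * (real d * (char_fun f r + b)) \<le> (\<Sum>j\<in>I. count_fun (min (CARD('m) - 1)) (g j) r)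
         + real (CARD('m) * (CARD('m) - 1)) * (ln (1 / (\<rho> - r)) + ln (1 + \<rho>) + ln (1 + (real d * (char_fun f \<rho> + b) + C))) + C"
      using C(4)[OF r] r C(1) vm[of r] vm[of \<rho>] by simp
  qed auto
qed

section \<open>Unboundedness of the characteristic function\<close>

lemma proj_scale: "u \<noteq> 0 \<Longrightarrow> proj (u *s x) = proj x"
proof -
  assume l: "u \<noteq> 0"
  have "c *s x \<in> proj (u *s x)" if "c \<noteq> 0" for c
    unfolding proj_def using that l by (intro CollectI exI[of _ "c / u"]) (simp add: vector_smult_assoc)
  moreover have "c *s (u *s x) \<in> proj x" if "c \<noteq> 0" for c
    unfolding proj_def using that l by (intro CollectI exI[of _ "c * u"]) (simp add: vector_smult_assoc)
  ultimately show ?thesis unfolding proj_def by blast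
qed

lemma proj_eq_of_minors:
  fixes x y :: "complex ^ 'n::finite"
  assumes x: "x \<noteq> 0" and y: "y \<noteq> 0" and m: "\<And>i j. x $ i * y $ j = x $ j * y $ i"
  shows "proj x = proj y"
proof -
  obtain i where i: "x $ i \<noteq> 0" using x by (auto simp: Finite_Cartesian_Product.vec_eq_iff)
  have e: "y = (y $ i / x $ i) *s x"
    using m[of i] i by (simp add: Finite_Cartesian_Product.vec_eq_iff field_simps)
  then have "y $ i \<noteq> 0" using y by auto
  then have "y $ i / x $ i \<noteq> 0" using i by simp
  from proj_scale[OF this, of x] show ?thesis using e by simp
qed

text \<open>
  If the radius is finite and \<open>T_f\<close> is bounded, then all integrals of \<open>exp (c T_f)\<close> are finite and the
  growth index is infinite. On the plane, a nonconstant \<open>f\<close> has a linear form \<open>h\<close> in its coordinates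
  that vanishes at some \<open>z1\<close> but not identically. By Jensen's formula the circle mean of \<open>ln |h|\<close>, which
  is at most \<open>T_f\<close> up to a constant, grows at least like \<open>ln r\<close>.
\<close>

lemma char_fun_unbounded:
  fixes f :: "complex \<Rightarrow> complex ^ 'n::finite"
  assumes R: "0 < R" and rep: "reduced_representation R f" and nc: "\<not> (\<lambda>z. proj (f z)) constant_on disc R"
    and growth: "growth_index R f < \<infinity>"
  shows "\<exists>r>0. ereal r < R \<and> B < char_fun f r"
proof (cases R)
  case (real R0)
  show ?thesis
  proof (rule ccontr)
    assume "\<not> ?thesis"
    then have B: "\<And>r. 0 < r \<Longrightarrow> ereal r < R \<Longrightarrow> char_fun f r \<le> B" by force
    have "(\<integral>\<^sup>+ r \<in> {r. 0 < r \<and> ereal r < R}. ennreal (exp (c * char_fun f r)) \<partial>lborel) < \<infinity>" if c: "c > 0" for c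
    proof -
      have "(\<integral>\<^sup>+ r \<in> {r. 0 < r \<and> ereal r < R}. ennreal (exp (c * char_fun f r)) \<partial>lborel)
         \<le> (\<integral>\<^sup>+ r. ennreal (exp (c * B)) * indicator {0..R0} r \<partial>lborel)"
      proof (rule nn_integral_mono)
        fix r
        show "ennreal (exp (c * char_fun f r)) * indicator {r. 0 < r \<and> ereal r < R} r \<le> ennreal (exp (c * B)) * indicator {0..R0} r"
          using B[of r] c by (cases "0 < r \<and> ereal r < R") (auto simp: real indicator_def intro!: ennreal_leI)
      qed
      also have "\<dots> = ennreal (exp (c * B)) * emeasure lborel {0..R0}" by (rule nn_integral_cmult_indicator) simp
      also have "\<dots> < \<infinity>" using R real by (simp add: ennreal_mult_less_top)
      finally show ?thesis .
    qed
    then have "{ereal c |c. 0 < c \<and> (\<integral>\<^sup>+ r \<in> {r. 0 < r \<and> ereal r < R}. ennreal (exp (c * char_fun f r)) \<partial>lborel) = \<infinity>} = {}"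
      by force
    then have "growth_index R f = Inf {}" by (simp only: growth_index_def)
    then show False using growth by (simp add: top_ereal_def)
  qed
next
  case MInf
  then show ?thesis using R by simp
next
  case PInf
  have disc: "disc R = UNIV" by (simp add: disc_def PInf)
  have fn: "f z \<noteq> 0" and fh: "(\<lambda>z. f z $ i) holomorphic_on disc R" for z i
    using rep by (auto simp: reduced_representation_def disc)
  have "\<exists>z1 z2 i j. f z1 $ i * f z2 $ j \<noteq> f z1 $ j * f z2 $ i"
  proof (rule ccontr)
    assume "\<not> ?thesis"
    then have e: "proj (f z) = proj (f 0)" for z by (intro proj_eq_of_minors fn) blast
    have "(\<lambda>z. proj (f z)) constant_on disc R"
      unfolding constant_on_def by (rule exI[of _ "proj (f 0)"], rule ballI, rule e)
    then show False using nc by blast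
  qed
  then obtain z1 z2 i j where z12: "f z1 $ i * f z2 $ j \<noteq> f z1 $ j * f z2 $ i" by blast
  \<comment> \<open>A minor of \<open>f z1\<close> and \<open>f w\<close>: it vanishes for \<open>w = z1\<close>.\<close>
  define h where "h w = f z1 $ i * f w $ j - f z1 $ j * f w $ i" for w
  have h: "h holomorphic_on disc R" unfolding h_def by (intro holomorphic_intros fh)
  have nz: "\<exists>z\<in>disc R. h z \<noteq> 0" using z12 by (auto simp: h_def disc)
  have h1: "h z1 = 0" by (simp add: h_def mult.commute)
  define K where "K = 2 * norm (f z1)"
  have K: "0 < K" using fn by (simp add: K_def)
  have hb: "cmod (h w) \<le> K * norm (f w)" for w
  proof -
    have "cmod (h w) \<le> cmod (f z1 $ i) * cmod (f w $ j) + cmod (f z1 $ j) * cmod (f w $ i)"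
      unfolding h_def by (rule order_trans[OF norm_triangle_ineq4]) (simp add: norm_mult)
    also have "\<dots> \<le> norm (f z1) * norm (f w) + norm (f z1) * norm (f w)"
      by (intro add_mono mult_mono Finite_Cartesian_Product.norm_nth_le) auto
    finally show ?thesis by (simp add: K_def mult_ac)
  qed
  define \<rho> where "\<rho> = cmod z1 + 1"
  define b where "b = ln (norm (f 0))"
  define C where "C = real (nat (zorder h 0)) * \<bar>ln 1\<bar> - ln (cmod (zor_poly h 0 0)) + ln K + b"
  \<comment> \<open>Beyond this radius \<open>ln (\<rho>' / \<rho>)\<close> exceeds \<open>B\<close> and all constants.\<close>
  define s where "s = \<rho> * exp (B + C + 1)"
  have \<rho>: "1 \<le> \<rho>" by (simp add: \<rho>_def)
  have "\<exists>\<rho>'. max \<rho> s < \<rho>' \<and> (\<forall>z. cmod z = \<rho>' \<longrightarrow> h z \<noteq> 0)"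
  proof -
    have "countable (cmod ` {z\<in>disc R. h z = 0})" by (intro countable_image countable_zeros_disc h nz)
    moreover have "uncountable {max \<rho> s<..<max \<rho> s + 1}" by (simp add: uncountable_open_interval)
    ultimately have "\<not> {max \<rho> s<..<max \<rho> s + 1} \<subseteq> cmod ` {z\<in>disc R. h z = 0}" using countable_subset by blast
    then show ?thesis by (auto simp: disc image_iff)
  qed
  then obtain \<rho>' where \<rho>': "\<rho> < \<rho>'" "s < \<rho>'" "\<And>z. cmod z = \<rho>' \<Longrightarrow> h z \<noteq> 0" by auto
  have \<rho>'0: "0 < \<rho>'" "ereal \<rho>' < R" using \<rho> \<rho>' by (auto simp: PInf)
  have reg: "regular_on_circle h \<rho>'" by (rule regular_on_circleI[OF h \<rho>'0 \<rho>'(3)])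
  have one: "1 \<le> (\<Sum>a | cmod a < \<rho> \<and> h a = 0. real (nat (zorder h a)))"
  proof -
    have fin: "finite {a. cmod a < \<rho> \<and> h a = 0}" by (rule finite_zeros_in_disc[OF h nz]) (simp add: PInf)
    have "0 < zorder h z1" by (rule zorder_pos_at_zero_disc[OF h nz _ h1]) (simp add: disc)
    then have "1 \<le> real (nat (zorder h z1))" by simp
    also have "\<dots> \<le> (\<Sum>a | cmod a < \<rho> \<and> h a = 0. real (nat (zorder h a)))"
      by (rule member_le_sum) (use fin h1 in \<open>auto simp: \<rho>_def\<close>)
    finally show ?thesis .
  qed
  have lnr: "B + C + 1 < ln (\<rho>' / \<rho>)"
  proof -
    have "exp (B + C + 1) < \<rho>' / \<rho>" using \<rho>'(2) \<rho> by (simp add: s_def field_simps)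
    then have "ln (exp (B + C + 1)) < ln (\<rho>' / \<rho>)" by (subst ln_less_cancel_iff) (use \<rho> \<rho>' in auto)
    then show ?thesis by simp
  qed
  have l0: "0 \<le> ln (\<rho>' / \<rho>)" using \<rho> \<rho>' by (intro ln_ge_zero) (simp add: field_simps)
  have lb: "(\<Sum>a | cmod a < \<rho> \<and> h a = 0. real (nat (zorder h a))) * ln (\<rho>' / \<rho>) - real (nat (zorder h 0)) * \<bar>ln 1\<bar>
     \<le> count_fun id h \<rho>'"
    by (rule count_fun_lower_bound[OF reg]) (use \<rho> \<rho>' in auto)
  have "ln (\<rho>' / \<rho>) - real (nat (zorder h 0)) * \<bar>ln 1\<bar> \<le> count_fun id h \<rho>'"
    using mult_right_mono[OF one l0] lb by linarith
  also have "count_fun id h \<rho>' = circle_mean \<rho>' (\<lambda>z. ln (cmod (h z))) - ln (cmod (zor_poly h 0 0))"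
    using jensen_formula[OF reg] by simp
  also have "circle_mean \<rho>' (\<lambda>z. ln (cmod (h z))) \<le> circle_mean \<rho>' (\<lambda>z. ln K + ln (norm (f z)))"
  proof (rule circle_mean_mono)
    have "continuous_on (sphere 0 \<rho>') (\<lambda>z. f z $ i)" for i
      by (rule continuous_on_subset[OF holomorphic_on_imp_continuous_on[OF fh]]) (simp add: disc)
    then show "continuous_on (sphere 0 \<rho>') (\<lambda>z. ln K + ln (norm (f z)))"
      by (intro continuous_on_add continuous_on_const continuous_on_ln_norm_vec fn)
    show "continuous_on (sphere 0 \<rho>') (\<lambda>z. ln (cmod (h z)))" by (rule regular_on_circleD(6)[OF reg])
    fix z assume "cmod z = \<rho>'"
    then have "0 < cmod (h z)" using \<rho>'(3) by simp
    then have "ln (cmod (h z)) \<le> ln (K * norm (f z))" using hb[of z] by (intro ln_mono) auto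
    then show "ln (cmod (h z)) \<le> ln K + ln (norm (f z))" using K fn by (simp add: ln_mult)
  qed (use \<rho>'0 in simp)
  also have "circle_mean \<rho>' (\<lambda>z. ln K + ln (norm (f z))) = ln K + (char_fun f \<rho>' + b)"
  proof -
    have "continuous_on (sphere 0 \<rho>') (\<lambda>z. f z $ i)" for i
      by (rule continuous_on_subset[OF holomorphic_on_imp_continuous_on[OF fh]]) (simp add: disc)
    then have "continuous_on (sphere 0 \<rho>') (\<lambda>z. ln (norm (f z)))" by (rule continuous_on_ln_norm_vec[OF _ fn])
    then have "circle_mean \<rho>' (\<lambda>z. ln K + ln (norm (f z))) = ln K + circle_mean \<rho>' (\<lambda>z. ln (norm (f z)))"
      using circle_mean_add[of \<rho>' "\<lambda>_. ln K" "\<lambda>z. ln (norm (f z))"] \<rho>'0 by simp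
    then show ?thesis using char_fun_power_eq_circle_mean[OF rep \<rho>'0, of 1] by (simp add: char_fun_def b_def)
  qed
  finally have "B < char_fun f \<rho>'" using lnr by (simp add: C_def)
  then show ?thesis using \<rho>'0 by blast
qed

section \<open>Linear systems and binary forms\<close>

lemma homogeneous_const_mult:
  assumes "homogeneous d p" shows "homogeneous d (const_poly c * p)"
  unfolding homogeneous_def
proof
  fix m assume "m \<in> Poly_Mapping.keys (const_poly c * p)"
  then have "m \<in> {a + b | a b. a \<in> Poly_Mapping.keys (const_poly c) \<and> b \<in> Poly_Mapping.keys p}"
    using keys_mult by blast
  then obtain a b where ab: "m = a + b" "a \<in> Poly_Mapping.keys (const_poly c)" "b \<in> Poly_Mapping.keys p" by blast
  have "a = 0" using ab(2) by (auto simp: const_poly_def split: if_splits)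
  then show "(\<Sum>i\<in>UNIV. Poly_Mapping.lookup m i) = d" using ab assms by (auto simp: homogeneous_def)
qed

lemma homogeneous_sum:
  assumes "\<And>i. i \<in> I \<Longrightarrow> homogeneous d (p i)" shows "homogeneous d (\<Sum>i\<in>I. p i)"
  unfolding homogeneous_def
proof
  fix m assume "m \<in> Poly_Mapping.keys (\<Sum>i\<in>I. p i)"
  then obtain i where "i \<in> I" "m \<in> Poly_Mapping.keys (p i)" using keys_sum[of p I] by blast
  then show "(\<Sum>i\<in>UNIV. Poly_Mapping.lookup m i) = d" using assms[of i] by (auto simp: homogeneous_def)
qed

lemma gradient_linear_combination:
  "gradient (\<Sum>\<mu>\<in>UNIV. const_poly (\<alpha> $ \<mu>) * S \<mu>) x = (\<Sum>\<mu>\<in>UNIV. (\<alpha> :: complex ^ 'm::finite) $ \<mu> *s gradient (S \<mu>) x)"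
proof (subst Finite_Cartesian_Product.vec_eq_iff, intro allI)
  fix i
  have "((\<lambda>t. \<Sum>\<mu>\<in>UNIV. \<alpha> $ \<mu> * eval_poly (S \<mu>) (x + t *s axis i 1)) has_field_derivative
      (\<Sum>\<mu>\<in>UNIV. \<alpha> $ \<mu> * eval_poly (pdiff i (S \<mu>)) x)) (at 0)"
    by (intro DERIV_sum DERIV_cmult eval_poly_partial_derivative)
  then have "((\<lambda>t. eval_poly (\<Sum>\<mu>\<in>UNIV. const_poly (\<alpha> $ \<mu>) * S \<mu>) (x + t *s axis i 1)) has_field_derivative
      (\<Sum>\<mu>\<in>UNIV. \<alpha> $ \<mu> * eval_poly (pdiff i (S \<mu>)) x)) (at 0)" by simp
  from DERIV_unique[OF eval_poly_partial_derivative this]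
  show "gradient (\<Sum>\<mu>\<in>UNIV. const_poly (\<alpha> $ \<mu>) * S \<mu>) x $ i = (\<Sum>\<mu>\<in>UNIV. \<alpha> $ \<mu> *s gradient (S \<mu>) x) $ i"
    by (simp add: gradient_def)
qed

lemma homogeneous_bound:
  fixes p :: "'n::finite cpoly"
  assumes "homogeneous d p"
  shows "cmod (eval_poly p x) \<le> (\<Sum>m\<in>Poly_Mapping.keys p. cmod (Poly_Mapping.lookup p m)) * norm x ^ d"
proof -
  have "cmod (Poly_Mapping.lookup p m * (\<Prod>i\<in>UNIV. (x $ i) ^ Poly_Mapping.lookup m i)) \<le> cmod (Poly_Mapping.lookup p m) * norm x ^ d"
    if m: "m \<in> Poly_Mapping.keys p" for m
  proof -
    have "(\<Prod>i\<in>UNIV. cmod (x $ i) ^ Poly_Mapping.lookup m i) \<le> (\<Prod>i\<in>UNIV. norm x ^ Poly_Mapping.lookup m i)"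
      by (intro prod_mono conjI power_mono Finite_Cartesian_Product.norm_nth_le zero_le_power norm_ge_zero)
    also have "\<dots> = norm x ^ d" using assms m by (auto simp: power_sum[symmetric] homogeneous_def)
    finally show ?thesis by (simp add: norm_mult prod_norm[symmetric] norm_power mult_left_mono)
  qed
  then show ?thesis unfolding eval_poly_def sum_distrib_right by (rule sum_norm_le)
qed

lemma eval_poly_prod [simp]: "eval_poly (\<Prod>i\<in>I. p i) x = (\<Prod>i\<in>I. eval_poly (p i) x)"
  by (induction I rule: infinite_finite_induct) auto

lemma eval_poly_variable [simp]:
  "eval_poly (Poly_Mapping.single (Poly_Mapping.single i 1) 1) x = (x :: complex ^ 'n::finite) $ i"
proof -
  have "(\<Prod>j\<in>UNIV. (x $ j) ^ Poly_Mapping.lookup (Poly_Mapping.single i (1::nat)) j) = (\<Prod>j\<in>UNIV. if j = i then x $ j else 1)"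
    by (intro prod.cong refl) (auto simp: lookup_single when_def)
  then show ?thesis by simp
qed

text \<open>
  Dehomogenize to a polynomial \<open>P\<close> in \<open>x_2 / x_1\<close> and split it into linear factors; if \<open>P\<close> has degree
  less than \<open>d\<close>, the missing factors are \<open>x_1\<close>. The identity extends from \<open>x_1 \<noteq> 0\<close> to all points.
\<close>

lemma binary_form_factorization:
  fixes \<sigma> :: "'n::finite cpoly"
  assumes card: "CARD('n) = 2" and hom: "homogeneous d \<sigma>" and nz: "eval_poly \<sigma> w \<noteq> 0"
  shows "\<exists>l e. l \<noteq> 0 \<and> (\<forall>m. e m \<noteq> 0) \<and> (\<forall>x. eval_poly \<sigma> x = l * (\<Prod>m<d. \<Sum>\<mu>\<in>UNIV. e m $ \<mu> * x $ \<mu>))"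
proof -
  obtain i1 i2 where i: "(UNIV :: 'n set) = {i1, i2}" "i1 \<noteq> i2" using card by (auto simp: card_2_iff)
  define X where "X = (Poly_Mapping.single (Poly_Mapping.single i1 1) 1 :: 'n cpoly)"
  have X: "eval_poly X y = y $ i1" for y unfolding X_def by (rule eval_poly_variable)
  have density: "eval_poly p x = 0" if "\<And>y. y $ i1 \<noteq> 0 \<Longrightarrow> eval_poly p y = 0" for p :: "'n cpoly" and x
  proof (rule eval_poly_zero_product)
    show "eval_poly p y * eval_poly X y = 0" for y using that[of y] by (cases "y $ i1 = 0") (auto simp: X)
    show "eval_poly X (axis i1 1) \<noteq> 0" by (simp add: X axis_def)
  qed
  define P where "P = (\<Sum>m\<in>Poly_Mapping.keys \<sigma>. monom (Poly_Mapping.lookup \<sigma> m) (Poly_Mapping.lookup m i2))"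
  have ev: "eval_poly \<sigma> x = (x $ i1) ^ d * poly P (x $ i2 / x $ i1)" if x: "x $ i1 \<noteq> 0" for x
  proof -
    define y :: "complex ^ 'n" where "y = (\<chi> i. if i = i1 then 1 else x $ i2 / x $ i1)"
    have "x $ j = (x $ i1 *s y) $ j" for j
    proof -
      have "j = i1 \<or> j = i2" using i(1) by blast
      then show ?thesis using i(2) x by (auto simp: y_def)
    qed
    then have xy: "x = x $ i1 *s y" unfolding Finite_Cartesian_Product.vec_eq_iff by blast
    have y: "y $ i1 = 1" "y $ i2 = x $ i2 / x $ i1" using i(2) by (simp_all add: y_def)
    have "(\<Prod>j\<in>UNIV. (y $ j) ^ Poly_Mapping.lookup m j) = (x $ i2 / x $ i1) ^ Poly_Mapping.lookup m i2" for m
      unfolding i(1) using i(2) by (simp add: y)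
    then have "eval_poly \<sigma> y = poly P (x $ i2 / x $ i1)"
      unfolding eval_poly_def P_def poly_sum poly_monom by simp
    then have "eval_poly \<sigma> (x $ i1 *s y) = (x $ i1) ^ d * poly P (x $ i2 / x $ i1)"
      by (simp only: eval_poly_homogeneous[OF hom])
    then show ?thesis by (simp only: xy[symmetric])
  qed
  have P0: "P \<noteq> 0"
  proof
    assume "P = 0"
    then have "eval_poly \<sigma> y = 0" if "y $ i1 \<noteq> 0" for y using ev[OF that] by simp
    then show False using density nz by blast
  qed
  have degP: "degree P \<le> d" unfolding P_def
  proof (rule degree_sum_le)
    fix m assume "m \<in> Poly_Mapping.keys \<sigma>"
    then have "(\<Sum>i\<in>UNIV. Poly_Mapping.lookup m i) = d" using hom by (auto simp: homogeneous_def)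
    then have "Poly_Mapping.lookup m i2 \<le> d" using member_le_sum[of i2 UNIV "Poly_Mapping.lookup m"] by simp
    then show "degree (monom (Poly_Mapping.lookup \<sigma> m) (Poly_Mapping.lookup m i2)) \<le> d"
      using degree_monom_le order_trans by blast
  qed simp
  obtain root where root: "Polynomial.smult (lead_coeff P) (\<Prod>i<degree P. [:-root i, 1:]) = P"
    by (rule complex_poly_decompose')
  define e :: "nat \<Rightarrow> complex ^ 'n" where
    "e m = (if m < degree P then axis i2 1 - root m *s axis i1 1 else axis i1 1)" for m
  have lin: "(\<Sum>\<mu>\<in>UNIV. e m $ \<mu> * x $ \<mu>) = (if m < degree P then x $ i2 - root m * x $ i1 else x $ i1)" for m x
    using i(2) by (simp add: i(1) e_def axis_def)
  have e0: "e m \<noteq> 0" for m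
  proof
    assume "e m = 0"
    then have "e m $ i1 = 0 \<and> e m $ i2 = 0" by simp
    then show False using i(2) by (auto simp: e_def axis_def split: if_splits)
  qed
  have prod: "eval_poly \<sigma> x = lead_coeff P * (\<Prod>m<d. \<Sum>\<mu>\<in>UNIV. e m $ \<mu> * x $ \<mu>)" if x: "x $ i1 \<noteq> 0" for x
  proof -
    have "poly P t = lead_coeff P * (\<Prod>m<degree P. t - root m)" for t
      using arg_cong[OF root, of "\<lambda>p. poly p t"] by (simp add: poly_prod)
    then have "eval_poly \<sigma> x = lead_coeff P * ((x $ i1) ^ d * (\<Prod>m<degree P. x $ i2 / x $ i1 - root m))"
      using ev[OF x] by simp
    also have "(x $ i1) ^ d * (\<Prod>m<degree P. x $ i2 / x $ i1 - root m)
       = (x $ i1) ^ (d - degree P) * (\<Prod>m<degree P. x $ i1 * (x $ i2 / x $ i1 - root m))"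
      using degP by (simp add: prod.distrib power_add[symmetric])
    also have "(\<Prod>m<degree P. x $ i1 * (x $ i2 / x $ i1 - root m)) = (\<Prod>m<degree P. \<Sum>\<mu>\<in>UNIV. e m $ \<mu> * x $ \<mu>)"
      unfolding lin by (intro prod.cong refl) (use x in \<open>simp add: field_simps\<close>)
    also have "(x $ i1) ^ (d - degree P) = (\<Prod>m\<in>{degree P..<d}. \<Sum>\<mu>\<in>UNIV. e m $ \<mu> * x $ \<mu>)"
      unfolding lin by simp
    also have "\<dots> * (\<Prod>m<degree P. \<Sum>\<mu>\<in>UNIV. e m $ \<mu> * x $ \<mu>) = (\<Prod>m<d. \<Sum>\<mu>\<in>UNIV. e m $ \<mu> * x $ \<mu>)"
      using prod.atLeastLessThan_concat[of 0 "degree P" d "\<lambda>m. \<Sum>\<mu>\<in>UNIV. e m $ \<mu> * x $ \<mu>"] degP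
      by (simp add: lessThan_atLeast0 mult.commute)
    finally show ?thesis .
  qed
  define Q where "Q = const_poly (lead_coeff P) * (\<Prod>m<d. \<Sum>\<mu>\<in>UNIV. const_poly (e m $ \<mu>) * Poly_Mapping.single (Poly_Mapping.single \<mu> 1) 1)"
  have Q: "eval_poly Q x = lead_coeff P * (\<Prod>m<d. \<Sum>\<mu>\<in>UNIV. e m $ \<mu> * x $ \<mu>)" for x
    unfolding Q_def eval_poly_mult eval_poly_prod eval_poly_sum eval_poly_const eval_poly_variable ..
  have "eval_poly (\<sigma> - Q) x = 0" for x
  proof (rule density)
    fix y :: "complex ^ 'n" assume "y $ i1 \<noteq> 0"
    from prod[OF this] show "eval_poly (\<sigma> - Q) y = 0" by (simp add: Q)
  qed
  then have "eval_poly \<sigma> x = lead_coeff P * (\<Prod>m<d. \<Sum>\<mu>\<in>UNIV. e m $ \<mu> * x $ \<mu>)" for x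
    by (simp add: Q)
  moreover have "lead_coeff P \<noteq> 0" using P0 by simp
  ultimately show ?thesis using e0 by blast
qed

text \<open>
  If two factors vanish at \<open>x\<close>, then the form vanishes to second order along every line through \<open>x\<close>.
\<close>

lemma smooth_factors_disjoint:
  fixes \<sigma> :: "'n::finite cpoly" and e :: "nat \<Rightarrow> complex ^ 'n" and x :: "complex ^ 'n"
  assumes smooth: "smooth_divisor \<sigma>"
    and fact: "\<And>x. eval_poly \<sigma> x = l * (\<Prod>m<d. \<Sum>\<mu>\<in>UNIV. e m $ \<mu> * x $ \<mu>)"
    and x: "x \<noteq> 0" and m: "m < d" "m' < d" "(\<Sum>\<mu>\<in>UNIV. e m $ \<mu> * x $ \<mu>) = 0" "(\<Sum>\<mu>\<in>UNIV. e m' $ \<mu> * x $ \<mu>) = 0"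
  shows "m = m'"
proof (rule ccontr)
  assume ne: "m \<noteq> m'"
  have shift: "(\<Sum>\<mu>\<in>UNIV. e k $ \<mu> * (x + t *s axis i 1) $ \<mu>) = (\<Sum>\<mu>\<in>UNIV. e k $ \<mu> * x $ \<mu>) + t * e k $ i" for k t i
  proof -
    have "(\<Sum>\<mu>\<in>UNIV. e k $ \<mu> * (x + t *s axis i 1) $ \<mu>) = (\<Sum>\<mu>\<in>UNIV. e k $ \<mu> * x $ \<mu> + (if \<mu> = i then t * e k $ i else 0))"
      by (intro sum.cong refl) (auto simp: axis_def algebra_simps)
    then show ?thesis by (simp add: sum.distrib)
  qed
  have split: "eval_poly \<sigma> y = l * ((\<Sum>\<mu>\<in>UNIV. e m $ \<mu> * y $ \<mu>) * ((\<Sum>\<mu>\<in>UNIV. e m' $ \<mu> * y $ \<mu>) *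
      (\<Prod>k\<in>{..<d}-{m}-{m'}. \<Sum>\<mu>\<in>UNIV. e k $ \<mu> * y $ \<mu>)))" for y
    unfolding fact using m ne by (subst prod.remove[of _ m], simp, simp, subst prod.remove[of _ m']) auto
  have "eval_poly (pdiff i \<sigma>) x = 0" for i
  proof -
    define h where "h t = l * (e m $ i * ((t * e m' $ i) * (\<Prod>k\<in>{..<d}-{m}-{m'}. (\<Sum>\<mu>\<in>UNIV. e k $ \<mu> * x $ \<mu>) + t * e k $ i)))" for t
    have "h holomorphic_on UNIV" unfolding h_def by (intro holomorphic_intros)
    then obtain h' where h': "(h has_field_derivative h') (at 0)"
      by (meson UNIV_I holomorphic_derivI open_UNIV)
    have "((\<lambda>t. t * h t) has_field_derivative 1 * h 0 + h' * 0) (at 0)" by (rule DERIV_mult[OF DERIV_ident h'])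
    moreover have "(\<lambda>t. t * h t) = (\<lambda>t. eval_poly \<sigma> (x + t *s axis i 1))"
      unfolding split shift m(3,4) h_def by (simp add: fun_eq_iff mult_ac)
    moreover have "h 0 = 0" by (simp add: h_def)
    ultimately have "((\<lambda>t. eval_poly \<sigma> (x + t *s axis i 1)) has_field_derivative 0) (at 0)" by simp
    from DERIV_unique[OF eval_poly_partial_derivative this] show ?thesis .
  qed
  then have "gradient \<sigma> x = 0" by (simp add: gradient_def Finite_Cartesian_Product.vec_eq_iff)
  moreover have "eval_poly \<sigma> x = 0" using split m by simp
  ultimately show False using smooth x by (auto simp: smooth_divisor_def)
qed

text \<open>
  In the plane, the vectors annihilated by a nonzero \<open>x\<close> form a line.
\<close>

lemma annihilators_dependent:
  fixes x a b :: "complex ^ 'n::finite"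
  assumes card: "CARD('n) = 2" and x: "x \<noteq> 0" and a: "(\<Sum>i\<in>UNIV. x $ i * a $ i) = 0" and b: "(\<Sum>i\<in>UNIV. x $ i * b $ i) = 0"
    and a0: "a \<noteq> 0"
  shows "\<exists>s t. t \<noteq> 0 \<and> s *s a + t *s b = 0"
proof -
  have "\<exists>p p'. (UNIV :: 'n set) = {p, p'} \<and> p \<noteq> p' \<and> x $ p \<noteq> 0"
  proof -
    obtain i1 i2 where i: "(UNIV :: 'n set) = {i1, i2}" "i1 \<noteq> i2" using card by (auto simp: card_2_iff)
    obtain p where p: "x $ p \<noteq> 0" using x by (auto simp: Finite_Cartesian_Product.vec_eq_iff)
    have "p = i1 \<or> p = i2" using i by blast
    then show ?thesis using i p by (metis insert_commute)
  qed
  then obtain p p' where p: "(UNIV :: 'n set) = {p, p'}" "p \<noteq> p'" "x $ p \<noteq> 0" by blast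
  have A: "x $ p * a $ p + x $ p' * a $ p' = 0" using a p(2) by (simp add: p(1))
  have B: "x $ p * b $ p + x $ p' * b $ p' = 0" using b p(2) by (simp add: p(1))
  have ap: "a $ p' \<noteq> 0"
  proof
    assume ap': "a $ p' = 0"
    then have "a $ p = 0" using A p(3) by simp
    then have "a $ i = 0" for i using ap' p(1) by (metis UNIV_I insert_iff singletonD)
    then show False using a0 by (simp add: Finite_Cartesian_Product.vec_eq_iff)
  qed
  have "x $ p * (b $ p' * a $ p - a $ p' * b $ p) = b $ p' * (x $ p * a $ p + x $ p' * a $ p') - a $ p' * (x $ p * b $ p + x $ p' * b $ p')"
    by (simp add: algebra_simps)
  then have "b $ p' * a $ p - a $ p' * b $ p = 0" using A B p(3) by simp
  then have "(b $ p' *s a + (- a $ p') *s b) $ i = 0" for i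
    using p(1) by (cases "i = p") (auto simp: mult.commute)
  then have "b $ p' *s a + (- a $ p') *s b = 0" by (simp only: Finite_Cartesian_Product.vec_eq_iff zero_index simp_thms)
  then show ?thesis using ap by (intro exI[of _ "b $ p'"] exI[of _ "- a $ p'"]) simp
qed

lemma count_fun_min_one:
  assumes "g holomorphic_on disc R" "\<exists>z\<in>disc R. g z \<noteq> 0" "ereal r < R"
  shows "count_fun (min 1) g r = (\<Sum>a | cmod a < r \<and> g a = 0. if a = 0 then ln r else ln (r / cmod a))"
  unfolding count_fun_def
proof (intro sum.cong refl)
  fix a assume a: "a \<in> {a. cmod a < r \<and> g a = 0}"
  then have "a \<in> disc R" using cball_subset_disc[OF assms(3)] by auto
  then have "0 < zorder g a" using zorder_pos_at_zero_disc[OF assms(1,2)] a by blast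
  then have "min 1 (nat (zorder g a)) = 1" by simp
  then show "real (min 1 (nat (zorder g a))) * (if a = 0 then ln r else ln (r / cmod a)) = (if a = 0 then ln r else ln (r / cmod a))"
    by simp
qed

text \<open>
  Counting without multiplicity is additive over disjoint sets of zeros.
\<close>

lemma count_fun_min_one_prod:
  assumes I: "finite I" and l: "l \<noteq> 0"
    and h: "\<And>m. m \<in> I \<Longrightarrow> h m holomorphic_on disc R" "\<And>m. m \<in> I \<Longrightarrow> \<exists>z\<in>disc R. h m z \<noteq> 0"
    and disj: "\<And>m m' z. m \<in> I \<Longrightarrow> m' \<in> I \<Longrightarrow> z \<in> disc R \<Longrightarrow> h m z = 0 \<Longrightarrow> h m' z = 0 \<Longrightarrow> m = m'"
    and g: "g holomorphic_on disc R" "\<exists>z\<in>disc R. g z \<noteq> 0" "\<And>z. g z = l * (\<Prod>m\<in>I. h m z)"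
    and r: "ereal r < R"
  shows "count_fun (min 1) g r = (\<Sum>m\<in>I. count_fun (min 1) (h m) r)"
proof -
  define w where "w a = (if a = 0 then ln r else ln (r / cmod a))" for a :: complex
  have "{a. cmod a < r \<and> g a = 0} = (\<Union>m\<in>I. {a. cmod a < r \<and> h m a = 0})" using l I by (auto simp: g(3))
  then have "count_fun (min 1) g r = (\<Sum>a\<in>(\<Union>m\<in>I. {a. cmod a < r \<and> h m a = 0}). w a)"
    unfolding count_fun_min_one[OF g(1,2) r] w_def by simp
  also have "\<dots> = (\<Sum>m\<in>I. \<Sum>a | cmod a < r \<and> h m a = 0. w a)"
  proof (rule sum.UNION_disjoint[OF I])
    show "\<forall>m\<in>I. finite {a. cmod a < r \<and> h m a = 0}" using finite_zeros_in_disc[OF h r] by blast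
    show "\<forall>m\<in>I. \<forall>m'\<in>I. m \<noteq> m' \<longrightarrow> {a. cmod a < r \<and> h m a = 0} \<inter> {a. cmod a < r \<and> h m' a = 0} = {}"
    proof (intro ballI impI)
      fix m m' assume m: "m \<in> I" "m' \<in> I" "m \<noteq> m'"
      have "cmod a < r \<Longrightarrow> a \<in> disc R" for a using cball_subset_disc[OF r] by auto
      then show "{a. cmod a < r \<and> h m a = 0} \<inter> {a. cmod a < r \<and> h m' a = 0} = {}" using disj[OF m(1,2)] m(3) by blast
    qed
  qed
  also have "\<dots> = (\<Sum>m\<in>I. count_fun (min 1) (h m) r)"
    unfolding w_def by (intro sum.cong refl count_fun_min_one[OF h r, symmetric])
  finally show ?thesis .
qed

section \<open>The second main theorem for the linear system\<close>

lemma char_fun_nonneg: "0 \<le> char_fun f r"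
proof -
  have "0 \<le> (LBINT z:cball 0 t. real 1 * fs_density f z) / t" if "0 < t" for t
    unfolding set_lebesgue_integral_def using that fs_density_nonneg[of f]
    by (intro divide_nonneg_nonneg Bochner_Integration.integral_nonneg) (auto simp: indicator_def)
  then show ?thesis
    unfolding char_fun_def char_fun_power_def set_lebesgue_integral_def[of _ "{0<..<r}"]
    by (intro Bochner_Integration.integral_nonneg) (auto simp: indicator_def)
qed

lemma exists_value_off_divisor:
  assumes "reduced_representation R f" "\<not> (\<lambda>z. proj (f z)) ` disc R \<subseteq> div_support s"
  shows "\<exists>z\<in>disc R. eval_poly s (f z) \<noteq> 0"
proof (rule ccontr)
  assume "\<not> ?thesis"
  then have "proj (f z) \<in> div_support s" if "z \<in> disc R" for z
    using assms(1) that unfolding div_support_def proj_zeros_def reduced_representation_def by blast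
  then show False using assms(2) by blast
qed

text \<open>
  After clearing denominators this is \<open>0 \<le> (k + 1) (d - 1) ((k - 1) k - 2)\<close>.
\<close>

lemma coefficient_le:
  assumes "k \<ge> 1" "d \<ge> 1" "k \<ge> 2 \<or> d = 1"
  shows "real q - (real k + 1) / real d - 1 / (2 * real d) * (real k - 1) * real k * (real k + 1) * (real d - 1)
     \<le> real q - (real k + 1)"
proof -
  define x y where "x = real k" and "y = real d"
  have y: "1 \<le> y" and x: "1 \<le> x" using assms by (auto simp: x_def y_def)
  have "0 \<le> (y - 1) * ((x - 1) * x - 2)"
  proof (cases "k \<ge> 2")
    case True
    then have "2 \<le> x" by (simp add: x_def)
    then have "1 * 2 \<le> (x - 1) * x" by (intro mult_mono) auto
    then show ?thesis using y by (intro mult_nonneg_nonneg) auto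
  next
    case False
    then show ?thesis using assms by (simp add: y_def)
  qed
  from mult_nonneg_nonneg[OF _ this, of "x + 1"] have "0 \<le> (x + 1) * ((y - 1) * ((x - 1) * x - 2))" using x by simp
  then have "2 * y * (x + 1) \<le> 2 * (x + 1) + (x - 1) * x * (x + 1) * (y - 1)" by (simp add: algebra_simps)
  moreover have "2 * y * ((x + 1) / y + 1 / (2 * y) * (x - 1) * x * (x + 1) * (y - 1)) = 2 * (x + 1) + (x - 1) * x * (x + 1) * (y - 1)"
    using y by (simp add: field_simps)
  ultimately have "2 * y * (x + 1) \<le> 2 * y * ((x + 1) / y + 1 / (2 * y) * (x - 1) * x * (x + 1) * (y - 1))" by simp
  then have "x + 1 \<le> (x + 1) / y + 1 / (2 * y) * (x - 1) * x * (x + 1) * (y - 1)" using y by (subst (asm) mult_le_cancel_left_pos) auto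
  then show ?thesis by (simp add: x_def y_def)
qed

lemma error_term_le:
  assumes "k \<ge> 1" "0 \<le> c" "0 \<le> (T :: real)" "0 < \<epsilon>"
  shows "real ((k + 1) * k) * c * T \<le> (real k)\<^sup>2 * (real k + 1)\<^sup>2 / 2 * (1 + \<epsilon>) * c * T"
proof -
  define P where "P = (real k + 1) * real k"
  have "2 * 1 \<le> P" unfolding P_def using assms(1) by (intro mult_mono) auto
  then have P: "2 \<le> P" by simp
  then have "P * 2 \<le> P * P" by (intro mult_left_mono) auto
  also have "P * P \<le> P * P * (1 + \<epsilon>)" using assms(4) P by simp
  finally have "P \<le> P * P / 2 * (1 + \<epsilon>)" by simp
  then have "P * (c * T) \<le> P * P / 2 * (1 + \<epsilon>) * (c * T)" using assms by (intro mult_right_mono) auto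
  moreover have "real ((k + 1) * k) = P" by (simp add: P_def algebra_simps)
  moreover have "(real k)\<^sup>2 * (real k + 1)\<^sup>2 = P * P" by (simp add: P_def power2_eq_square mult_ac)
  ultimately show ?thesis by (simp only: mult.assoc)
qed

text \<open>
  A linear relation between the coefficient vectors of those \<open>\<sigma> j\<close> that are small at a point gives the
  same relation between their gradients at a common zero, where normal crossings exclude it.
\<close>

theorem second_main_theorem_linear_system:
  fixes d :: nat and R :: ereal and S :: "'n::finite \<Rightarrow> 'n cpoly" and \<sigma> :: "nat \<Rightarrow> 'n cpoly"
    and f :: "complex \<Rightarrow> complex ^ 'n"
  assumes R: "0 < R" and hom: "\<And>\<mu>. homogeneous d (S \<mu>)"
    and I: "finite I" and \<sigma>: "\<And>j. j \<in> I \<Longrightarrow> \<sigma> j \<in> linear_system S"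
    and smooth: "\<And>j. j \<in> I \<Longrightarrow> smooth_divisor (\<sigma> j)"
    and snc: "snc_divisor (\<Prod>j\<in>I. \<sigma> j)"
    and rep: "reduced_representation R f" and unbdd: "\<And>B. \<exists>r>0. ereal r < R \<and> B < char_fun f r"
    and nondeg: "\<And>s. s \<in> linear_system S \<Longrightarrow> \<not> (\<lambda>z. proj (f z)) ` disc R \<subseteq> div_support s"
    and c: "0 \<le> c"
  shows "\<exists>C'. \<exists>E \<in> sets borel. E \<subseteq> {r. 0 < r \<and> ereal r < R} \<and>
     (\<integral>\<^sup>+ r \<in> E. ennreal (exp (c * char_fun f r)) \<partial>lborel) < \<infinity> \<and>
     (\<forall>r. 0 < r \<and> ereal r < R \<and> r \<notin> E \<longrightarrow>
        (real (card I) - real CARD('n)) * (real d * char_fun f r)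
          \<le> (\<Sum>j\<in>I. trunc_counting_fun (CARD('n) - 1) f (\<sigma> j) r)
            + C' * (log_plus (char_fun f r) + log_plus r) + real (CARD('n) * (CARD('n) - 1)) * c * char_fun f r)"
proof -
  have fh: "(\<lambda>z. f z $ i) holomorphic_on disc R" for i using rep by (auto simp: reduced_representation_def)
  have fn: "f z \<noteq> 0" if "z \<in> disc R" for z using rep that by (auto simp: reduced_representation_def)
  have "\<exists>\<alpha>. \<alpha> \<noteq> 0 \<and> \<sigma> j = (\<Sum>\<mu>\<in>UNIV. const_poly (\<alpha> $ \<mu>) * S \<mu>)" if "j \<in> I" for j
    using \<sigma>[OF that] by (auto simp: linear_system_def)
  then obtain \<alpha> :: "nat \<Rightarrow> complex ^ 'n" where \<alpha>: "\<And>j. j \<in> I \<Longrightarrow> \<alpha> j \<noteq> 0"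
    "\<And>j. j \<in> I \<Longrightarrow> \<sigma> j = (\<Sum>\<mu>\<in>UNIV. const_poly (\<alpha> j $ \<mu>) * S \<mu>)" by metis
  have ev: "(\<Sum>\<mu>\<in>UNIV. \<alpha> j $ \<mu> * eval_poly (S \<mu>) x) = eval_poly (\<sigma> j) x" if "j \<in> I" for j x
    unfolding \<alpha>(2)[OF that] by simp
  have hom\<sigma>: "homogeneous d (\<sigma> j)" if "j \<in> I" for j
    unfolding \<alpha>(2)[OF that] by (intro homogeneous_sum homogeneous_const_mult hom)
  have nz: "\<exists>z\<in>disc R. eval_poly (\<sigma> j) (f z) \<noteq> 0" if "j \<in> I" for j
    by (rule exists_value_off_divisor[OF rep nondeg[OF \<sigma>[OF that]]])
  obtain \<epsilon> where \<epsilon>: "0 < \<epsilon>" "\<And>x. x \<noteq> 0 \<Longrightarrow> \<exists>x0. x0 \<noteq> 0 \<and> (\<forall>j\<in>I. cmod (eval_poly (\<sigma> j) x) < \<epsilon> * norm x ^ d \<longrightarrow> eval_poly (\<sigma> j) x0 = 0)"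
    using common_zero_of_small_values[of I "\<lambda>j. eval_poly (\<sigma> j)" d, OF I continuous_on_eval_poly eval_poly_homogeneous[OF hom\<sigma>]] by blast
  define K where "K = (\<Sum>\<mu>\<in>UNIV. \<Sum>m\<in>Poly_Mapping.keys (S \<mu>). cmod (Poly_Mapping.lookup (S \<mu>) m))"
  have K: "cmod (eval_poly (S \<mu>) (f z)) \<le> K * norm (f z) ^ d" for \<mu> z
  proof -
    have "(\<Sum>m\<in>Poly_Mapping.keys (S \<mu>). cmod (Poly_Mapping.lookup (S \<mu>) m)) \<le> K"
      unfolding K_def by (rule member_le_sum[of \<mu> UNIV "\<lambda>\<mu>. \<Sum>m\<in>Poly_Mapping.keys (S \<mu>). cmod (Poly_Mapping.lookup (S \<mu>) m)"]) (auto intro: sum_nonneg)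
    then show ?thesis using homogeneous_bound[OF hom, of \<mu> "f z"] mult_right_mono[of _ K "norm (f z) ^ d"] by (meson order_trans norm_ge_zero zero_le_power)
  qed
  have "\<exists>C'. \<exists>E \<in> sets borel. E \<subseteq> {r. 0 < r \<and> ereal r < R} \<and>
     (\<integral>\<^sup>+ r \<in> E. ennreal (exp (c * char_fun f r)) \<partial>lborel) < \<infinity> \<and>
     (\<forall>r. 0 < r \<and> ereal r < R \<and> r \<notin> E \<longrightarrow>
        (real (card I) - real CARD('n)) * (real d * char_fun f r)
          \<le> (\<Sum>j\<in>I. count_fun (min (CARD('n) - 1)) (\<lambda>z. \<Sum>\<mu>\<in>UNIV. \<alpha> j $ \<mu> * eval_poly (S \<mu>) (f z)) r)
            + C' * (log_plus (char_fun f r) + log_plus r) + real (CARD('n) * (CARD('n) - 1)) * c * char_fun f r)"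
  proof (rule second_main_theorem[where \<phi> = "\<lambda>\<mu> z. eval_poly (S \<mu>) (f z)" and \<alpha> = \<alpha>, OF R rep c unbdd _ K _ I \<alpha>(1) \<epsilon>(1)])
    show "(\<lambda>z. eval_poly (S \<mu>) (f z)) holomorphic_on disc R" for \<mu> by (rule holomorphic_on_eval_poly[OF fh])
    show "\<exists>z\<in>disc R. (\<Sum>\<mu>\<in>UNIV. a $ \<mu> * eval_poly (S \<mu>) (f z)) \<noteq> 0" if "a \<noteq> 0" for a
    proof -
      have "(\<Sum>\<mu>\<in>UNIV. const_poly (a $ \<mu>) * S \<mu>) \<in> linear_system S" using that by (auto simp: linear_system_def)
      from exists_value_off_divisor[OF rep nondeg[OF this]] show ?thesis by simp
    qed
    fix z J a assume z: "z \<in> disc R" and J: "J = {j\<in>I. cmod (\<Sum>\<mu>\<in>UNIV. \<alpha> j $ \<mu> * eval_poly (S \<mu>) (f z)) < \<epsilon> * norm (f z) ^ d}"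
      and a: "(\<Sum>j\<in>J. a j *s \<alpha> j) = 0"
    have JI: "J \<subseteq> I" using J by blast
    obtain x where x: "x \<noteq> 0" "\<And>j. j \<in> I \<Longrightarrow> cmod (eval_poly (\<sigma> j) (f z)) < \<epsilon> * norm (f z) ^ d \<Longrightarrow> eval_poly (\<sigma> j) x = 0"
      using \<epsilon>(2)[OF fn[OF z]] by blast
    have xJ: "eval_poly (\<sigma> j) x = 0" if "j \<in> J" for j using that x(2)[of j] by (auto simp: J ev)
    have "(\<Sum>j\<in>J. a j *s gradient (\<sigma> j) x) = (\<Sum>j\<in>J. \<Sum>\<mu>\<in>UNIV. (a j * \<alpha> j $ \<mu>) *s gradient (S \<mu>) x)"
    proof (intro sum.cong refl)
      fix j assume "j \<in> J"
      then have "gradient (\<sigma> j) x = (\<Sum>\<mu>\<in>UNIV. \<alpha> j $ \<mu> *s gradient (S \<mu>) x)"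
        using \<alpha>(2)[of j] JI gradient_linear_combination[of "\<alpha> j" S x] by auto
      then show "a j *s gradient (\<sigma> j) x = (\<Sum>\<mu>\<in>UNIV. (a j * \<alpha> j $ \<mu>) *s gradient (S \<mu>) x)"
        by (simp add: vec.scale_sum_right vector_smult_assoc)
    qed
    also have "\<dots> = (\<Sum>\<mu>\<in>UNIV. (\<Sum>j\<in>J. a j *s \<alpha> j) $ \<mu> *s gradient (S \<mu>) x)"
      by (subst sum.swap) (simp add: vec.scale_sum_left)
    also have "\<dots> = 0" by (simp add: a)
    finally have g0: "(\<Sum>j\<in>J. a j *s gradient (\<sigma> j) x) = 0" .
    show "\<forall>j\<in>J. a j = 0"
      by (rule snc_gradients_independent[OF I hom\<sigma> _ smooth snc x(1) JI xJ g0]) (use nz in blast)+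
  qed
  moreover have "(\<Sum>j\<in>I. count_fun (min (CARD('n) - 1)) (\<lambda>z. \<Sum>\<mu>\<in>UNIV. \<alpha> j $ \<mu> * eval_poly (S \<mu>) (f z)) r)
      = (\<Sum>j\<in>I. trunc_counting_fun (CARD('n) - 1) f (\<sigma> j) r)" if "0 < r" "ereal r < R" for r
  proof (intro sum.cong refl)
    fix j assume j: "j \<in> I"
    have "trunc_counting_fun (CARD('n) - 1) f (\<sigma> j) r = count_fun (min (CARD('n) - 1)) (\<lambda>z. eval_poly (\<sigma> j) (f z)) r"
      by (rule trunc_counting_fun_eq_count_fun[OF holomorphic_on_eval_poly[OF fh] nz[OF j]]) (use that in auto)
    then show "count_fun (min (CARD('n) - 1)) (\<lambda>z. \<Sum>\<mu>\<in>UNIV. \<alpha> j $ \<mu> * eval_poly (S \<mu>) (f z)) r = trunc_counting_fun (CARD('n) - 1) f (\<sigma> j) r"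
      by (simp add: ev[OF j])
  qed
  ultimately show ?thesis by (simp cong: conj_cong imp_cong)
qed

text \<open>
  In dimension one the forms are replaced by their linear factors, no two of which have a common zero,
  so at each point at most one of them is small.
\<close>

theorem second_main_theorem_projective_line:
  fixes d :: nat and R :: ereal and \<sigma> :: "nat \<Rightarrow> 'n::finite cpoly" and f :: "complex \<Rightarrow> complex ^ 'n"
  assumes card: "CARD('n) = 2" and R: "0 < R"
    and I: "finite I" and hom: "\<And>j. j \<in> I \<Longrightarrow> homogeneous d (\<sigma> j)"
    and smooth: "\<And>j. j \<in> I \<Longrightarrow> smooth_divisor (\<sigma> j)"
    and snc: "snc_divisor (\<Prod>j\<in>I. \<sigma> j)"
    and rep: "reduced_representation R f" and unbdd: "\<And>B. \<exists>r>0. ereal r < R \<and> B < char_fun f r"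
    and nz: "\<And>j. j \<in> I \<Longrightarrow> \<exists>z\<in>disc R. eval_poly (\<sigma> j) (f z) \<noteq> 0"
    and nc: "\<not> (\<lambda>z. proj (f z)) constant_on disc R"
    and c: "0 \<le> c"
  shows "\<exists>C'. \<exists>E \<in> sets borel. E \<subseteq> {r. 0 < r \<and> ereal r < R} \<and>
     (\<integral>\<^sup>+ r \<in> E. ennreal (exp (c * char_fun f r)) \<partial>lborel) < \<infinity> \<and>
     (\<forall>r. 0 < r \<and> ereal r < R \<and> r \<notin> E \<longrightarrow>
        (real (card I) * real d - 2) * char_fun f r
          \<le> (\<Sum>j\<in>I. trunc_counting_fun 1 f (\<sigma> j) r)
            + C' * (log_plus (char_fun f r) + log_plus r) + 2 * c * char_fun f r)"
proof -
  have fh: "(\<lambda>z. f z $ i) holomorphic_on disc R" for i using rep by (auto simp: reduced_representation_def)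
  have fn: "f z \<noteq> 0" if "z \<in> disc R" for z using rep that by (auto simp: reduced_representation_def)
  define fact where "fact j l e \<longleftrightarrow> l \<noteq> 0 \<and> (\<forall>m. e m \<noteq> 0) \<and>
     (\<forall>x. eval_poly (\<sigma> j) x = l * (\<Prod>m<d. \<Sum>\<mu>\<in>UNIV. e m $ \<mu> * x $ \<mu>))" for j l and e :: "nat \<Rightarrow> complex ^ 'n"
  have ex: "\<exists>p. fact j (fst p) (snd p)" if j: "j \<in> I" for j
  proof -
    obtain z where z: "eval_poly (\<sigma> j) (f z) \<noteq> 0" using nz[OF j] by blast
    from binary_form_factorization[OF card hom[OF j] z] show ?thesis unfolding fact_def by simp
  qed
  define p where "p j = (SOME p. fact j (fst p) (snd p))" for j
  have p: "fact j (fst (p j)) (snd (p j))" if "j \<in> I" for j unfolding p_def by (rule someI_ex[OF ex[OF that]])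
  define l where "l j = fst (p j)" for j
  define e where "e j = snd (p j)" for j
  have le: "\<And>j. j \<in> I \<Longrightarrow> l j \<noteq> 0" "\<And>j m. j \<in> I \<Longrightarrow> e j m \<noteq> 0"
    "\<And>j x. j \<in> I \<Longrightarrow> eval_poly (\<sigma> j) x = l j * (\<Prod>m<d. \<Sum>\<mu>\<in>UNIV. e j m $ \<mu> * x $ \<mu>)"
    using p unfolding fact_def l_def e_def by blast+
  define L where "L p x = (\<Sum>\<mu>\<in>UNIV. e (fst p) (snd p) $ \<mu> * x $ \<mu>)" for p x
  define H where "H = I \<times> {..<d}"
  have H: "finite H" using I by (simp add: H_def)
  have cL: "continuous_on UNIV (L p)" for p unfolding L_def[abs_def] by (intro continuous_intros)
  have hL: "L p (t *s x) = t ^ 1 * L p x" for p t x by (simp add: L_def sum_distrib_left mult_ac)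
  have L\<sigma>: "eval_poly (\<sigma> j) x = l j * (\<Prod>m<d. L (j, m) x)" if "j \<in> I" for j x
    using le(3)[OF that] by (simp add: L_def)
  have uniq: "p = p'" if p: "p \<in> H" "p' \<in> H" "x \<noteq> 0" "L p x = 0" "L p' x = 0" for p p' x
  proof -
    obtain j m j' m' where pp: "p = (j, m)" "p' = (j', m')" "j \<in> I" "j' \<in> I" "m < d" "m' < d"
      using p(1,2) by (auto simp: H_def)
    have v: "eval_poly (\<sigma> j) x = 0" "eval_poly (\<sigma> j') x = 0"
      using L\<sigma>[of j x] L\<sigma>[of j' x] pp p(4,5) by auto
    have g: "gradient (\<sigma> j) x \<noteq> 0" using smooth[OF pp(3)] v p(3) by (auto simp: smooth_divisor_def)
    have jj: "j = j'"
    proof (rule ccontr)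
      assume ne: "j \<noteq> j'"
      have "(\<Sum>i\<in>UNIV. x $ i * gradient (\<sigma> j) x $ i) = 0" "(\<Sum>i\<in>UNIV. x $ i * gradient (\<sigma> j') x $ i) = 0"
        using euler_identity[OF hom] pp v by auto
      from annihilators_dependent[OF card p(3) this g]
      obtain s t where st: "t \<noteq> 0" "s *s gradient (\<sigma> j) x + t *s gradient (\<sigma> j') x = 0" by blast
      define a where "a i = (if i = j then s else t)" for i
      have "\<forall>i\<in>{j, j'}. a i = 0"
      proof (rule snc_gradients_independent[OF I hom _ smooth snc p(3)])
        show "(\<Sum>i\<in>{j, j'}. a i *s gradient (\<sigma> i) x) = 0" using ne st(2) by (simp add: a_def)
      qed (use nz pp v in blast)+
      then show False using ne st(1) by (simp add: a_def)
    qed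
    have "m = m'"
    proof (rule smooth_factors_disjoint[OF smooth[OF pp(3)] le(3)[OF pp(3)] p(3) pp(5,6)])
      show "(\<Sum>\<mu>\<in>UNIV. e j m $ \<mu> * x $ \<mu>) = 0" "(\<Sum>\<mu>\<in>UNIV. e j m' $ \<mu> * x $ \<mu>) = 0"
        using p(4,5) pp(1,2) jj by (simp_all add: L_def)
    qed
    then show ?thesis using pp jj by simp
  qed
  have nondeg: "\<exists>z\<in>disc R. (\<Sum>\<mu>\<in>UNIV. a $ \<mu> * f z $ \<mu>) \<noteq> 0" if a: "a \<noteq> 0" for a :: "complex ^ 'n"
  proof (rule ccontr)
    assume z: "\<not> ?thesis"
    define z0 :: complex where "z0 = 0"
    have z0: "z0 \<in> disc R" using R by (simp add: z0_def disc_def zero_ereal_def)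
    have e: "proj (f z) = proj (f z0)" if zd: "z \<in> disc R" for z
    proof -
      have "(\<Sum>i\<in>UNIV. a $ i * f z $ i) = 0" "(\<Sum>i\<in>UNIV. a $ i * f z0 $ i) = 0" using z zd z0 by auto
      from annihilators_dependent[OF card a this fn[OF zd]]
      obtain s t where st: "t \<noteq> 0" "s *s f z + t *s f z0 = 0" by blast
      have "f z0 = (1 / t) *s (t *s f z0)" using st(1) by (simp add: vector_smult_assoc)
      also have "t *s f z0 = (- s) *s f z" using st(2) by (simp add: add_eq_0_iff vec.scale_minus_left)
      finally have e: "f z0 = (- s / t) *s f z" by (simp add: vector_smult_assoc)
      then have "- s / t \<noteq> 0" using fn[OF z0] by auto
      from proj_scale[OF this, of "f z"] show ?thesis using e by simp
    qed
    have "(\<lambda>z. proj (f z)) constant_on disc R"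
      unfolding constant_on_def by (rule exI[of _ "proj (f z0)"], rule ballI, rule e)
    then show False using nc by blast
  qed
  obtain \<epsilon> where \<epsilon>: "0 < \<epsilon>" "\<And>x. x \<noteq> 0 \<Longrightarrow> \<exists>x0. x0 \<noteq> 0 \<and> (\<forall>p\<in>H. cmod (L p x) < \<epsilon> * norm x ^ 1 \<longrightarrow> L p x0 = 0)"
    using common_zero_of_small_values[of H L 1, OF H cL hL] by blast
  define \<alpha> where "\<alpha> p = e (fst p) (snd p)" for p
  have \<alpha>: "\<alpha> p \<noteq> 0" if "p \<in> H" for p using that le(2) by (auto simp: \<alpha>_def H_def)
  have \<alpha>L: "(\<Sum>\<mu>\<in>UNIV. \<alpha> p $ \<mu> * x $ \<mu>) = L p x" for p x by (simp add: \<alpha>_def L_def)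
  have "\<exists>C'. \<exists>E \<in> sets borel. E \<subseteq> {r. 0 < r \<and> ereal r < R} \<and>
     (\<integral>\<^sup>+ r \<in> E. ennreal (exp (c * char_fun f r)) \<partial>lborel) < \<infinity> \<and>
     (\<forall>r. 0 < r \<and> ereal r < R \<and> r \<notin> E \<longrightarrow>
        (real (card H) - real CARD('n)) * (real 1 * char_fun f r)
          \<le> (\<Sum>p\<in>H. count_fun (min (CARD('n) - 1)) (\<lambda>z. \<Sum>\<mu>\<in>UNIV. \<alpha> p $ \<mu> * f z $ \<mu>) r)
            + C' * (log_plus (char_fun f r) + log_plus r) + real (CARD('n) * (CARD('n) - 1)) * c * char_fun f r)"
  proof (rule second_main_theorem[where \<phi> = "\<lambda>\<mu> z. f z $ \<mu>" and \<alpha> = \<alpha> and K = 1, OF R rep c unbdd fh _ nondeg H \<alpha> \<epsilon>(1)])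
    show "cmod (f z $ \<mu>) \<le> 1 * norm (f z) ^ 1" for \<mu> z using Finite_Cartesian_Product.norm_nth_le[of "f z" \<mu>] by simp
    fix z J a assume z: "z \<in> disc R" and J: "J = {p\<in>H. cmod (\<Sum>\<mu>\<in>UNIV. \<alpha> p $ \<mu> * f z $ \<mu>) < \<epsilon> * norm (f z) ^ 1}"
      and a: "(\<Sum>p\<in>J. a p *s \<alpha> p) = 0"
    obtain x where x: "x \<noteq> 0" "\<And>p. p \<in> H \<Longrightarrow> cmod (L p (f z)) < \<epsilon> * norm (f z) ^ 1 \<Longrightarrow> L p x = 0"
      using \<epsilon>(2)[OF fn[OF z]] by blast
    have J0: "p \<in> H \<and> L p x = 0" if "p \<in> J" for p using that x(2)[of p] unfolding J \<alpha>L by blast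
    show "\<forall>p\<in>J. a p = 0"
    proof
      fix p assume p: "p \<in> J"
      have "J = {p}" using p J0 uniq[OF _ _ x(1)] by blast
      then have "a p *s \<alpha> p = 0" using a by simp
      then show "a p = 0" using \<alpha> J0[OF p] by simp
    qed
  qed
  moreover have "(\<Sum>p\<in>H. count_fun (min (CARD('n) - 1)) (\<lambda>z. \<Sum>\<mu>\<in>UNIV. \<alpha> p $ \<mu> * f z $ \<mu>) r)
      = (\<Sum>j\<in>I. trunc_counting_fun 1 f (\<sigma> j) r)" if r: "0 < r" "ereal r < R" for r
  proof -
    have "trunc_counting_fun 1 f (\<sigma> j) r = (\<Sum>m<d. count_fun (min 1) (\<lambda>z. L (j, m) (f z)) r)" if j: "j \<in> I" for j
    proof -
      have hol: "(\<lambda>z. eval_poly (\<sigma> j) (f z)) holomorphic_on disc R" by (rule holomorphic_on_eval_poly[OF fh])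
      have "trunc_counting_fun 1 f (\<sigma> j) r = count_fun (min 1) (\<lambda>z. eval_poly (\<sigma> j) (f z)) r"
        by (rule trunc_counting_fun_eq_count_fun[OF hol nz[OF j]]) (use r in auto)
      also have "\<dots> = (\<Sum>m<d. count_fun (min 1) (\<lambda>z. L (j, m) (f z)) r)"
      proof (rule count_fun_min_one_prod[OF _ le(1)[OF j] _ _ _ hol nz[OF j] L\<sigma>[OF j]])
        show "(\<lambda>z. L (j, m) (f z)) holomorphic_on disc R" for m unfolding L_def by (intro holomorphic_intros fh)
        show "\<exists>z\<in>disc R. L (j, m) (f z) \<noteq> 0" if "m \<in> {..<d}" for m
          using nondeg[OF le(2)[OF j], of m] by (simp add: L_def)
        show "m = m'" if "m \<in> {..<d}" "m' \<in> {..<d}" "z \<in> disc R" "L (j, m) (f z) = 0" "L (j, m') (f z) = 0" for m m' z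
          using uniq[of "(j, m)" "(j, m')" "f z"] that j fn by (auto simp: H_def)
      qed (use r in auto)
      finally show ?thesis .
    qed
    then have "(\<Sum>j\<in>I. trunc_counting_fun 1 f (\<sigma> j) r) = (\<Sum>j\<in>I. \<Sum>m<d. count_fun (min 1) (\<lambda>z. L (j, m) (f z)) r)" by simp
    also have "\<dots> = (\<Sum>p\<in>H. count_fun (min 1) (\<lambda>z. L p (f z)) r)"
      unfolding H_def sum.cartesian_product by (intro sum.cong refl) auto
    finally show ?thesis by (simp add: \<alpha>L card)
  qed
  moreover have "real (card H) = real (card I) * real d" by (simp add: H_def card_cartesian_product)
  ultimately show ?thesis by (simp add: card cong: conj_cong imp_cong)
qed

theorem theorem6:
  fixes k d q :: nat
    and R :: ereal
    and S :: "'n::finite \<Rightarrow> 'n cpoly"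
    and \<sigma> :: "nat \<Rightarrow> 'n cpoly"
    and f :: "complex \<Rightarrow> complex ^ 'n"
  assumes "CARD('n) = k + 1"
    and "k \<ge> 1" and "d \<ge> 1" and "q \<ge> 1"
    and "0 < R"
    and "\<And>\<mu>. homogeneous d (S \<mu>)"
    and "jacobian_det S \<noteq> 0"
    and "\<And>j. j \<in> {1..q} \<Longrightarrow> \<sigma> j \<in> linear_system S"
    and "\<And>j. j \<in> {1..q} \<Longrightarrow> smooth_divisor (\<sigma> j)"
    and "snc_divisor (\<Prod>j\<in>{1..q}. \<sigma> j)"
    and "reduced_representation R f"
    and "\<not> (\<lambda>z. proj (f z)) constant_on disc R"
    and "growth_index R f < \<infinity>"
    and "\<And>s. s \<in> linear_system S \<Longrightarrow> \<not> (\<lambda>z. proj (f z)) ` disc R \<subseteq> div_support s"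
    and "\<not> (\<lambda>z. proj (f z)) ` disc R \<subseteq> polar_locus S"
  shows "\<forall>\<epsilon>>0. \<exists>C. \<exists>E \<in> sets borel.
           E \<subseteq> {r. 0 < r \<and> ereal r < R} \<and>
           (\<integral>\<^sup>+ r \<in> E. ennreal (exp ((real_of_ereal (growth_index R f) + \<epsilon>) * char_fun f r)) \<partial>lborel) < \<infinity> \<and>
           (\<forall>r. 0 < r \<and> ereal r < R \<and> r \<notin> E \<longrightarrow>
              (real q - (real k + 1) / real d
                 - 1 / (2 * real d) * (real k - 1) * real k * (real k + 1) * (real d - 1))
                * char_fun_power f d r
              \<le> (\<Sum>j\<in>{1..q}. trunc_counting_fun k f (\<sigma> j) r)
                + C * (log_plus (char_fun f r) + log_plus r)
                + (real k)\<^sup>2 * (real k + 1)\<^sup>2 / 2 * (1 + \<epsilon>)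
                    * (real_of_ereal (growth_index R f) + \<epsilon>) * char_fun f r)"
  
proof (intro allI impI)
  fix \<epsilon> :: real assume \<epsilon>: "0 < \<epsilon>"
  define c where "c = real_of_ereal (growth_index R f) + \<epsilon>"
  have "0 \<le> growth_index R f" unfolding growth_index_def by (rule Inf_greatest) auto
  then have c: "0 \<le> c" using \<epsilon> by (simp add: c_def real_of_ereal_pos)
  have unbdd: "\<exists>r>0. ereal r < R \<and> B < char_fun f r" for B
    by (rule char_fun_unbounded) fact+
  have nz: "\<exists>z\<in>disc R. eval_poly (\<sigma> j) (f z) \<noteq> 0" if "j \<in> {1..q}" for j
    by (rule exists_value_off_divisor[OF assms(11) assms(14)[OF assms(8)[OF that]]])
  have hom\<sigma>: "homogeneous d (\<sigma> j)" if "j \<in> {1..q}" for j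
  proof -
    obtain \<alpha> where "\<sigma> j = (\<Sum>\<mu>\<in>UNIV. const_poly (\<alpha> $ \<mu>) * S \<mu>)" using assms(8)[OF \<open>j \<in> {1..q}\<close>] by (auto simp: linear_system_def)
    then show ?thesis using homogeneous_sum[of UNIV d "\<lambda>\<mu>. const_poly (\<alpha> $ \<mu>) * S \<mu>"] homogeneous_const_mult[OF assms(6)] by simp
  qed
  define A where "A = real q - (real k + 1) / real d
                 - 1 / (2 * real d) * (real k - 1) * real k * (real k + 1) * (real d - 1)"
  have power: "char_fun_power f d r = real d * char_fun f r" if "0 < r" "ereal r < R" for r
    using char_fun_power_eq_circle_mean[OF assms(11) that, of d] char_fun_power_eq_circle_mean[OF assms(11) that, of 1]
    by (simp add: char_fun_def)
  have "\<exists>C'. \<exists>E \<in> sets borel. E \<subseteq> {r. 0 < r \<and> ereal r < R} \<and>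
     (\<integral>\<^sup>+ r \<in> E. ennreal (exp (c * char_fun f r)) \<partial>lborel) < \<infinity> \<and>
     (\<forall>r. 0 < r \<and> ereal r < R \<and> r \<notin> E \<longrightarrow>
        A * (real d * char_fun f r) \<le> (\<Sum>j\<in>{1..q}. trunc_counting_fun k f (\<sigma> j) r)
            + C' * (log_plus (char_fun f r) + log_plus r) + real ((k + 1) * k) * c * char_fun f r)"
  proof (cases "k \<ge> 2 \<or> d = 1")
    case True
    have "A * (real d * char_fun f r) \<le> (real (card {1..q}) - real CARD('n)) * (real d * char_fun f r)" for r
      using coefficient_le[OF assms(2,3) True, of q] char_fun_nonneg[of f r] assms(1)
      by (intro mult_right_mono) (auto simp: A_def)
    note le = this
    have kn: "CARD('n) - 1 = k" "CARD('n) * k = (k + 1) * k" using assms(1) by simp_all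
    note smt = second_main_theorem_linear_system[OF assms(5,6) finite_atLeastAtMost assms(8,9,10,11) unbdd assms(14) c]
    have "\<exists>C'. \<exists>E \<in> sets borel. E \<subseteq> {r. 0 < r \<and> ereal r < R} \<and>
     (\<integral>\<^sup>+ r \<in> E. ennreal (exp (c * char_fun f r)) \<partial>lborel) < \<infinity> \<and>
     (\<forall>r. 0 < r \<and> ereal r < R \<and> r \<notin> E \<longrightarrow>
        (real (card {1..q}) - real CARD('n)) * (real d * char_fun f r)
          \<le> (\<Sum>j\<in>{1..q}. trunc_counting_fun k f (\<sigma> j) r)
            + C' * (log_plus (char_fun f r) + log_plus r) + real ((k + 1) * k) * c * char_fun f r)"
      by (rule smt[unfolded kn])
    then obtain C' E where E: "E \<in> sets borel" "E \<subseteq> {r. 0 < r \<and> ereal r < R}"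
       "(\<integral>\<^sup>+ r \<in> E. ennreal (exp (c * char_fun f r)) \<partial>lborel) < \<infinity>"
       "\<And>r. 0 < r \<and> ereal r < R \<and> r \<notin> E \<Longrightarrow> (real (card {1..q}) - real CARD('n)) * (real d * char_fun f r)
          \<le> (\<Sum>j\<in>{1..q}. trunc_counting_fun k f (\<sigma> j) r)
            + C' * (log_plus (char_fun f r) + log_plus r) + real ((k + 1) * k) * c * char_fun f r"
      by blast
    show ?thesis
    proof (intro exI[of _ C'] bexI[of _ E] conjI allI impI E(1,2,3))
      fix r assume r: "0 < r \<and> ereal r < R \<and> r \<notin> E"
      show "A * (real d * char_fun f r) \<le> (\<Sum>j\<in>{1..q}. trunc_counting_fun k f (\<sigma> j) r)
            + C' * (log_plus (char_fun f r) + log_plus r) + real ((k + 1) * k) * c * char_fun f r"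
        by (rule order_trans[OF le E(4)[OF r]])
    qed
  next
    case False
    then have k: "k = 1" using assms(2) by simp
    then have card: "CARD('n) = 2" using assms(1) by simp
    have A: "A * (real d * T) = (real (card {1..q}) * real d - 2) * T" for T
      using assms(3) by (simp add: A_def k field_simps)
    have "\<exists>C'. \<exists>E \<in> sets borel. E \<subseteq> {r. 0 < r \<and> ereal r < R} \<and>
     (\<integral>\<^sup>+ r \<in> E. ennreal (exp (c * char_fun f r)) \<partial>lborel) < \<infinity> \<and>
     (\<forall>r. 0 < r \<and> ereal r < R \<and> r \<notin> E \<longrightarrow>
        (real (card {1..q}) * real d - 2) * char_fun f r
          \<le> (\<Sum>j\<in>{1..q}. trunc_counting_fun 1 f (\<sigma> j) r)
            + C' * (log_plus (char_fun f r) + log_plus r) + 2 * c * char_fun f r)"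
      by (rule second_main_theorem_projective_line[OF card assms(5) _ hom\<sigma> assms(9,10,11) unbdd nz assms(12) c]) auto
    then show ?thesis unfolding A by (simp add: k)
  qed
  then obtain C' E where E: "E \<in> sets borel" "E \<subseteq> {r. 0 < r \<and> ereal r < R}"
     "(\<integral>\<^sup>+ r \<in> E. ennreal (exp (c * char_fun f r)) \<partial>lborel) < \<infinity>"
     "\<And>r. 0 < r \<and> ereal r < R \<and> r \<notin> E \<Longrightarrow>
        A * (real d * char_fun f r) \<le> (\<Sum>j\<in>{1..q}. trunc_counting_fun k f (\<sigma> j) r)
            + C' * (log_plus (char_fun f r) + log_plus r) + real ((k + 1) * k) * c * char_fun f r"
    by blast
  show "\<exists>C. \<exists>E \<in> sets borel.
           E \<subseteq> {r. 0 < r \<and> ereal r < R} \<and>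
           (\<integral>\<^sup>+ r \<in> E. ennreal (exp ((real_of_ereal (growth_index R f) + \<epsilon>) * char_fun f r)) \<partial>lborel) < \<infinity> \<and>
           (\<forall>r. 0 < r \<and> ereal r < R \<and> r \<notin> E \<longrightarrow>
              (real q - (real k + 1) / real d
                 - 1 / (2 * real d) * (real k - 1) * real k * (real k + 1) * (real d - 1))
                * char_fun_power f d r
              \<le> (\<Sum>j\<in>{1..q}. trunc_counting_fun k f (\<sigma> j) r)
                + C * (log_plus (char_fun f r) + log_plus r)
                + (real k)\<^sup>2 * (real k + 1)\<^sup>2 / 2 * (1 + \<epsilon>)
                    * (real_of_ereal (growth_index R f) + \<epsilon>) * char_fun f r)"
    unfolding c_def[symmetric] A_def[symmetric]
  proof (intro exI[of _ C'] bexI[of _ E] conjI allI impI E(1,2,3))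
    fix r assume r: "0 < r \<and> ereal r < R \<and> r \<notin> E"
    have p: "char_fun_power f d r = real d * char_fun f r" using power r by blast
    show "A * char_fun_power f d r \<le> (\<Sum>j\<in>{1..q}. trunc_counting_fun k f (\<sigma> j) r)
        + C' * (log_plus (char_fun f r) + log_plus r)
        + (real k)\<^sup>2 * (real k + 1)\<^sup>2 / 2 * (1 + \<epsilon>) * c * char_fun f r"
      unfolding p by (rule order_trans[OF E(4)[OF r] add_left_mono[OF error_term_le[OF assms(2) c char_fun_nonneg \<epsilon>]]])
  qed
qed

end
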